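(* Let $q\ge2$ and let $H$ be a periodic $C^2$ curve in $\mathbb{R}^3$ which is an embedding of $S^1$ and is a non-trivial knot. Let $G:\mathbb{R}^3\setminus\mathrm{Im}(H)\to\mathbb{R}$, $G(x)=\int_0^1\frac{1}{|x-H(t)|^{q-1}}\,dt$, and assume that $G$ is a Morse function. Then $G$ has at least $3$ critical points in $\mathbb{R}^3\setminus\mathrm{Im}(H)$.
   Context: $H:[0,1]\to\mathbb{R}^3$ satisfies $H(0)=H(1)$, $H'(0)=H'(1)$ and is regarded as a map $S^1\to\mathbb{R}^3$; embedding means this map is injective with nowhere vanishing derivative. A Morse function is one all of whose critical points are non-degenerate. *)

theory Defs
  imports "HOL-Analysis.Analysis"
begin

text \<open>
  At the end points of the parameter interval the derivatives are one-sided. Periodicity only asks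
  \<open>H\<close> and its first derivative to agree there, so the second derivative may jump.
\<close>

definition cderiv :: "(real \<Rightarrow> 'a::real_normed_vector) \<Rightarrow> real \<Rightarrow> 'a" where
  "cderiv H t = vector_derivative H (at t within {0..1})"

definition periodic_C2_curve :: "(real \<Rightarrow> 'a::real_normed_vector) \<Rightarrow> bool" where
  "periodic_C2_curve H \<longleftrightarrow>
     H differentiable_on {0..1} \<and>
     cderiv H differentiable_on {0..1} \<and>
     continuous_on {0..1} (cderiv (cderiv H)) \<and>
     H 0 = H 1 \<and> cderiv H 0 = cderiv H 1"

definition circle_embedding :: "(real \<Rightarrow> 'a::real_normed_vector) \<Rightarrow> bool" where
  "circle_embedding H \<longleftrightarrow> inj_on H {0..<1} \<and> (\<forall>t\<in>{0..1}. cderiv H t \<noteq> 0)"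

definition ambient_isotopic :: "'a::topological_space set \<Rightarrow> 'a set \<Rightarrow> bool" where
  "ambient_isotopic K L \<longleftrightarrow>
     (\<exists>\<phi>. homotopic_with_canon (\<lambda>f. \<exists>g. homeomorphism UNIV UNIV f g) UNIV UNIV id \<phi> \<and> \<phi> ` K = L)"

definition round_circle :: "(real ^ 3) set" where
  "round_circle = {x. norm x = 1 \<and> x $ 3 = 0}"

definition nontrivial_knot :: "(real ^ 3) set \<Rightarrow> bool" where
  "nontrivial_knot K \<longleftrightarrow> \<not> ambient_isotopic K round_circle"

definition critical_point :: "('a::real_inner \<Rightarrow> real) \<Rightarrow> 'a \<Rightarrow> bool" where
  "critical_point f x \<longleftrightarrow> (GDERIV f x :> 0)"

definition has_hessian :: "(real ^ 'n \<Rightarrow> real) \<Rightarrow> real ^ 'n ^ 'n \<Rightarrow> real ^ 'n \<Rightarrow> bool" where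
  "has_hessian f A x \<longleftrightarrow>
     (\<exists>g. (\<forall>\<^sub>F y in nhds x. GDERIV f y :> g y) \<and> (g has_derivative (\<lambda>v. A *v v)) (at x))"

definition nondegenerate_at :: "(real ^ 'n \<Rightarrow> real) \<Rightarrow> real ^ 'n \<Rightarrow> bool" where
  "nondegenerate_at f x \<longleftrightarrow> (\<exists>A. has_hessian f A x \<and> invertible A)"

definition morse_on :: "(real ^ 'n) set \<Rightarrow> (real ^ 'n \<Rightarrow> real) \<Rightarrow> bool" where
  "morse_on U f \<longleftrightarrow> (\<forall>x\<in>U. critical_point f x \<longrightarrow> nondegenerate_at f x)"

text \<open>Only the values off the curve matter; there the integrand is continuous.\<close>

definition potential :: "real \<Rightarrow> (real \<Rightarrow> 'a::real_normed_vector) \<Rightarrow> 'a \<Rightarrow> real" where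
  "potential q H x = integral {0..1} (\<lambda>t. 1 / norm (x - H t) powr (q - 1))"

end

theory Submission
  imports Defs
begin

text \<open>
  Suppose that there are at most two critical points. In a tube around the knot the gradient of \<open>G\<close> points towards the
  core, and \<open>G\<close> grows inwards near infinity, so \<open>grad G\<close> can be replaced by a Lipschitz field \<open>X\<close> with
  \<open>X \<bullet> grad G > 0\<close> off the critical points that is linear near them, radial in the tube and equal to \<open>- y\<close> far out.
  Adding a multiple of the tangent field in the tube removes the zeros on the knot, and the degree theorem shows that the
  signs of the Hessian determinants at the critical points add up to \<open>-1\<close>. So there is a single critical point \<open>p\<close>, and
  since \<open>q \<ge> 2\<close> makes the trace of the Hessian nonnegative, the Hessian at \<open>p\<close> has exactly one negative eigenvalue.

  Every orbit that starts above the level of \<open>p\<close> ends on the knot. So a small circle in the unstable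
  plane of \<open>p\<close> is carried by the flow into the tube, where it meets every ray from the core at most once.
  If it did not run around the knot exactly once, then the roots of the endpoint coordinate would form a covering over
  a set in which the flow contracts the knot to a point, but which is not trivial along the knot. Hence the circle is
  carried to a curve in the tube which an isotopy of the tube moves to the core, and the knot is trivial.
\<close>

section \<open>Ambient isotopies\<close>

text \<open>Invariant manifold theory is avoided because the field is chosen and not given. Near the
  saddle \<open>X\<close> is linear with eigenvalues -1, 1, 1, so that the unstable disc is flat and
  the circle in it is round; in the tube \<open>X\<close> contracts the normal discs, so that the
  coordinate along the knot is frozen once an orbit has entered. The flow is used only through its
  explicit form in these two regions and through the growth of \<open>G\<close> between them. Two
  such fields occur: for the index count the linear model at each zero is the Hessian itself, for
  the dynamics it is a reflection with the same negative direction. The value -1 is the index of the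
  field \<open>- y\<close> in dimension 3; the knot does not contribute because it carries a nowhere
  vanishing tangent field. A sum of two signs is even, so two critical points are as impossible as
  none. A negative determinant leaves one or three negative eigenvalues, and three would make the
  trace negative.\<close>

lemma ambient_isotopicI:
  fixes h :: "real \<Rightarrow> 'a::real_normed_vector \<Rightarrow> 'a"
  assumes cont: "continuous_on ({0..1} \<times> UNIV) (\<lambda>(t, x). h t x)"
    and h0: "\<And>x. h 0 x = x"
    and hom: "\<And>t. t \<in> {0..1} \<Longrightarrow> \<exists>g. homeomorphism UNIV UNIV (h t) g"
    and im: "h 1 ` K = L"
  shows "ambient_isotopic K L"
  unfolding ambient_isotopic_def
proof (intro exI conjI)
  show "homotopic_with_canon (\<lambda>f. \<exists>g. homeomorphism UNIV UNIV f g) UNIV UNIV id (h 1)"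
    unfolding homotopic_with_def
    using cont h0 hom
    by (intro exI [of _ "\<lambda>(t, x). h t x"])
       (auto simp: prod_topology_subtopology_eu simp del: subtopology_UNIV)
qed (rule im)

lemma ambient_isotopicE:
  fixes K L :: "'a::real_normed_vector set"
  assumes "ambient_isotopic K L"
  obtains h where "continuous_on ({0..1} \<times> UNIV) (\<lambda>(t, x). h t x)" "\<And>x. h 0 x = (x::'a)"
    "\<And>t. t \<in> {0..1::real} \<Longrightarrow> \<exists>g. homeomorphism UNIV UNIV (h t) g" "h 1 ` K = L"
proof -
  obtain \<phi> where *: "homotopic_with_canon (\<lambda>f. \<exists>g. homeomorphism UNIV UNIV f g) UNIV UNIV id \<phi>" "\<phi> ` K = L"
    using assms unfolding ambient_isotopic_def by blast
  have "\<exists>k. continuous_on ({0..1::real} \<times> UNIV) k \<and> (\<forall>x. k (0, x) = id x) \<and> (\<forall>x. k (1, x) = \<phi> x) \<and>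
      (\<forall>t\<in>{0..1}. \<exists>g. homeomorphism UNIV UNIV (\<lambda>x. k (t, x)) g)"
    using *(1) unfolding homotopic_with_def
    by (simp add: prod_topology_subtopology_eu image_subset_iff del: subtopology_UNIV)
  then obtain k where k: "continuous_on ({0..1::real} \<times> UNIV) k" "\<And>x. k (0, x) = id x" "\<And>x. k (1, x) = \<phi> x"
    "\<And>t. t \<in> {0..1} \<Longrightarrow> \<exists>g. homeomorphism UNIV UNIV (\<lambda>x. k (t, x)) g"
    by blast
  show thesis
    by (rule that [of "\<lambda>t x. k (t, x)"]) (use k *(2) in \<open>auto simp: image_iff\<close>)
qed

lemma ambient_isotopic_trans:
  fixes K L M :: "'a::real_normed_vector set"
  assumes "ambient_isotopic K L" "ambient_isotopic L M"
  shows "ambient_isotopic K M"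
proof -
  obtain h where h: "continuous_on ({0..1} \<times> UNIV) (\<lambda>(t, x). h t x)" "\<And>x. h 0 x = (x::'a)"
    "\<And>t. t \<in> {0..1::real} \<Longrightarrow> \<exists>g. homeomorphism UNIV UNIV (h t) g" "h 1 ` K = L"
    using ambient_isotopicE [OF assms(1)] by blast
  obtain k where k: "continuous_on ({0..1} \<times> UNIV) (\<lambda>(t, x). k t x)" "\<And>x. k 0 x = (x::'a)"
    "\<And>t. t \<in> {0..1::real} \<Longrightarrow> \<exists>g. homeomorphism UNIV UNIV (k t) g" "k 1 ` L = M"
    using ambient_isotopicE [OF assms(2)] by blast
  show ?thesis
  proof (rule ambient_isotopicI [of "\<lambda>t x. k t (h t x)"])
    have "continuous_on ({0..1} \<times> UNIV) (\<lambda>z. (\<lambda>(t, x). k t x) (fst z, (\<lambda>(t, x). h t x) z))"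
      by (rule continuous_on_compose2 [OF k(1)]) (auto intro!: continuous_intros h(1))
    then show "continuous_on ({0..1} \<times> UNIV) (\<lambda>(t, x). k t (h t x))"
      by (simp add: case_prod_unfold)
    show "\<exists>g. homeomorphism UNIV UNIV (\<lambda>x. k t (h t x)) g" if "t \<in> {0..1}" for t
      using h(3) [OF that] k(3) [OF that] homeomorphism_compose unfolding comp_def by blast
    show "(\<lambda>x. k 1 (h 1 x)) ` K = M"
      using h(4) k(4) by (metis image_image)
  qed (simp add: h k)
qed

text \<open>Running the isotopy backwards starts at \<open>h 1\<close>, so it is precomposed with
  the inverse \<open>g\<close> of \<open>h 1\<close>.\<close>

lemma ambient_isotopic_sym:
  fixes K L :: "'a::real_normed_vector set"
  assumes "ambient_isotopic K L"
  shows "ambient_isotopic L K"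
proof -
  obtain h where h: "continuous_on ({0..1} \<times> UNIV) (\<lambda>(t, x). h t x)" "\<And>x. h 0 x = (x::'a)"
    "\<And>t. t \<in> {0..1::real} \<Longrightarrow> \<exists>g. homeomorphism UNIV UNIV (h t) g" "h 1 ` K = L"
    using ambient_isotopicE [OF assms(1)] by blast
  obtain g where g: "homeomorphism UNIV UNIV (h 1) g"
    using h(3) [of 1] by auto
  have gg: "homeomorphism UNIV UNIV g (h 1)"
    using g homeomorphism_sym by blast
  show ?thesis
  proof (rule ambient_isotopicI [of "\<lambda>t x. h (1 - t) (g x)"])
    have "continuous_on ({0..1::real} \<times> UNIV) (\<lambda>z. (\<lambda>(t, x). h t x) (1 - fst z, g (snd z)))"
    proof (rule continuous_on_compose2 [OF h(1)])
      show "continuous_on ({0..1::real} \<times> UNIV) (\<lambda>z. (1 - fst z, g (snd z)))"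
        using g by (auto intro!: continuous_intros intro: continuous_on_compose2 [where g=g] continuous_on_subset simp: homeomorphism_def)
    qed auto
    then show "continuous_on ({0..1} \<times> UNIV) (\<lambda>(t, x). h (1 - t) (g x))"
      by (simp add: case_prod_unfold)
    show "\<exists>g'. homeomorphism UNIV UNIV (\<lambda>x. h (1 - t) (g x)) g'" if "t \<in> {0..1}" for t
      using h(3) [of "1 - t"] that gg homeomorphism_compose unfolding comp_def by fastforce
    show "(\<lambda>x. h (1 - 1) (g x)) ` L = K"
      using g h(4) by (auto simp: h(2) image_image homeomorphism_def)
    show "h (1 - 0) (g x) = x" for x
      using g by (simp add: homeomorphism_def)
  qed
qed

text \<open>Alexander's trick: conjugation with dilations shrinks the support of \<open>f\<close> to the origin.\<close>

lemma ambient_isotopic_compact_support: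
  fixes f :: "'a::euclidean_space \<Rightarrow> 'a"
  assumes hom: "homeomorphism UNIV UNIV f g"
    and out: "\<And>x. norm x \<ge> R \<Longrightarrow> f x = x" and "R > 0"
  shows "ambient_isotopic K (f ` K)"
proof (rule ambient_isotopicI [of "\<lambda>t x. if t = 0 then x else t *\<^sub>R f (x /\<^sub>R t)"])
  let ?h = "\<lambda>t x. if t = 0 then x else t *\<^sub>R f (x /\<^sub>R t)"
  have contf: "continuous_on UNIV f"
    using hom by (simp add: homeomorphism_def)
  have "bounded ((\<lambda>x. f x - x) ` cball 0 R)"
    by (intro compact_imp_bounded compact_continuous_image continuous_intros continuous_on_subset [OF contf])
       (auto simp: compact_cball)
  then obtain C' where C': "\<And>x. norm x \<le> R \<Longrightarrow> norm (f x - x) \<le> C'"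
    unfolding bounded_iff by force
  have C: "norm (f x - x) \<le> max C' 0" for x
    using out [of x] C' [of x] by (cases "norm x \<le> R") auto
  define C where "C = max C' 0"
  note C = C [folded C_def]
  \<comment> \<open>Conjugation with the dilation by \<open>t\<close> scales all displacements of
    \<open>f\<close> by \<open>t\<close>; this is what makes the family continuous at
    \<open>t = 0\<close>.\<close>
  have near: "norm (?h t x - x) \<le> C * \<bar>t\<bar>" for t x
  proof (cases "t = 0")
    case False
    then have "t *\<^sub>R f (x /\<^sub>R t) - x = t *\<^sub>R (f (x /\<^sub>R t) - x /\<^sub>R t)"
      by (simp add: algebra_simps)
    then show ?thesis
      using C [of "x /\<^sub>R t"] False by (simp add: mult.commute mult_right_mono)
  qed auto
  have "isCont (\<lambda>(t, x). ?h t x) (t, x)" for t x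
  proof (cases "t = 0")
    case True
    show ?thesis
      unfolding True continuous_at tendsto_iff dist_norm
    proof (intro allI impI)
      fix \<epsilon> :: real assume "\<epsilon> > 0"
      have "((\<lambda>z. C * \<bar>fst z\<bar> + norm (snd z - x)) \<longlongrightarrow> C * \<bar>fst (0::real, x)\<bar> + norm (snd (0::real, x) - x)) (at (0, x))"
        by (intro tendsto_intros)
      then have "\<forall>\<^sub>F z in at (0, x). C * \<bar>fst z\<bar> + norm (snd z - x) < \<epsilon>"
        using \<open>\<epsilon> > 0\<close> order_tendstoD(2) by fastforce
      then show "\<forall>\<^sub>F z in at (0, x). norm ((case z of (t, x) \<Rightarrow> ?h t x) - (case (0, x) of (t, x) \<Rightarrow> ?h t x)) < \<epsilon>"
      proof eventually_elim
        case (elim z)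
        have "norm (?h (fst z) (snd z) - x) \<le> norm (?h (fst z) (snd z) - snd z) + norm (snd z - x)"
          by (metis norm_triangle_sub diff_add_cancel add_diff_eq norm_triangle_ineq)
        with near [of "fst z" "snd z"] elim show ?case
          by (simp add: case_prod_unfold)
      qed
    qed
  next
    case False
    have "continuous_on ({z. fst z \<noteq> 0}) (\<lambda>z. fst z *\<^sub>R f (snd z /\<^sub>R fst z))"
      by (intro continuous_intros continuous_on_compose2 [OF contf]) auto
    then have "continuous_on ({z. fst z \<noteq> 0}) (\<lambda>(t, x). ?h t x)"
      by (rule continuous_on_eq) auto
    moreover have "open {z :: real \<times> 'a. fst z \<noteq> 0}"
      by (intro open_Collect_neq continuous_intros)
    ultimately show ?thesis
      using False continuous_on_eq_continuous_at by fastforce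
  qed
  then show "continuous_on ({0..1} \<times> UNIV) (\<lambda>(t, x). ?h t x)"
    by (auto intro!: continuous_at_imp_continuous_on)
  show "\<exists>g. homeomorphism UNIV UNIV (?h t) g" for t
  proof (cases "t = 0")
    case True then show ?thesis
      by (auto intro!: exI [of _ id] continuous_intros simp: case_prod_unfold homeomorphism_def)
  next
    case False
    have fg: "f (g x) = x" "g (f x) = x" for x using hom by (auto simp: homeomorphism_def)
    have contg: "continuous_on UNIV g" using hom by (simp add: homeomorphism_def)
    have "homeomorphism UNIV UNIV (\<lambda>x. t *\<^sub>R f (x /\<^sub>R t)) (\<lambda>x. t *\<^sub>R g (x /\<^sub>R t))"
      using False
      by (intro homeomorphismI continuous_intros continuous_on_compose2 [OF contf] continuous_on_compose2 [OF contg])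
         (auto simp: fg)
    with False show ?thesis by auto
  qed
qed auto

section \<open>Reflections and the isotopy class of round circles\<close>

definition refl_across :: "'a::real_inner \<Rightarrow> 'a \<Rightarrow> 'a" where
  "refl_across m x = x - (2 * (m \<bullet> x) / (m \<bullet> m)) *\<^sub>R m"

lemma refl_across_refl_across: "m \<noteq> 0 \<Longrightarrow> refl_across m (refl_across m x) = x"
  by (simp add: refl_across_def inner_diff_right field_simps flip: scaleR_add_left scaleR_diff_left)

text \<open>The case \<open>m = 0\<close> is included: division by zero turns the map into the
  identity.\<close>

lemma inner_refl_across: "refl_across m x \<bullet> refl_across m y = x \<bullet> y"
proof (cases "m = 0")
  case False
  then show ?thesis
    by (simp add: refl_across_def inner_diff_right inner_diff_left inner_commute field_simps)
qed (simp add: refl_across_def)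

lemma norm_refl_across: "norm (refl_across m x) = norm x"
  by (simp add: norm_eq_sqrt_inner inner_refl_across)

text \<open>Two reflections compose to a rotation. With mirrors orthogonal to \<open>e\<close> and
  to \<open>e + t b\<close> the rotation starts at the identity for \<open>t = 0\<close> and carries
  \<open>e\<close> to \<open>b\<close> for \<open>t = 1\<close>; scaling and translation are
  interpolated alongside.\<close>

lemma ambient_isotopic_circle:
  fixes a p :: "real ^ 3"
  assumes a: "norm a = 1" and r: "r > 0"
  shows "ambient_isotopic round_circle {p + v |v. v \<bullet> a = 0 \<and> norm v = r}"
proof -
  define e :: "real ^ 3" where "e = axis 3 1"
  have e: "e \<noteq> 0" "norm e = 1" "e \<bullet> e = 1" by (auto simp: e_def axis_eq_0_iff inner_axis_axis)
  have main: "ambient_isotopic round_circle {p + v |v. v \<bullet> b = 0 \<and> norm v = r}"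
    if b: "norm b = 1" "b \<bullet> e \<ge> 0" for b :: "real ^ 3"
  proof -
    define m where "m t = e + t *\<^sub>R b" for t
    define c where "c t = 1 - t + t * r" for t
    define h where "h t x = t *\<^sub>R p + c t *\<^sub>R refl_across (m t) (refl_across e x)" for t x
    define g where "g t y = refl_across e (refl_across (m t) ((y - t *\<^sub>R p) /\<^sub>R c t))" for t y
    have m0: "m t \<noteq> 0" if "t \<ge> 0" for t
    proof
      assume "m t = 0"
      then have "m t \<bullet> e = 0" by simp
      with b that e(3) show False by (simp add: m_def inner_add_left add_nonneg_eq_0_iff)
    qed
    have c0: "c t > 0" if "0 \<le> t" "t \<le> 1" for t
      using r that by (cases "t = 1") (auto simp: c_def add_pos_nonneg)
    have bb: "b \<bullet> b = 1" using b(1) by (simp add: dot_square_norm)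
    \<comment> \<open>For unit vectors \<open>e\<close> and \<open>b\<close> the reflection
      orthogonal to \<open>e + b\<close> exchanges \<open>- e\<close> and \<open>b\<close>.\<close>
    have mm: "m 1 \<bullet> m 1 = 2 * (m 1 \<bullet> e)"
      by (simp add: m_def inner_add_left inner_add_right bb e(3) inner_commute)
    have ee: "refl_across e e = - e"
      using e by (simp add: refl_across_def algebra_simps flip: scaleR_2)
    have "m 1 \<bullet> e \<noteq> 0"
      using m0 [of 1] mm by auto
    then have "refl_across (m 1) (- e) = - e + m 1"
      unfolding refl_across_def mm by simp
    then have Re: "refl_across (m 1) (refl_across e e) = b"
      by (simp add: ee m_def)
    show ?thesis
    proof (rule ambient_isotopicI [of h])
      show "continuous_on ({0..1} \<times> UNIV) (\<lambda>(t, x). h t x)"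
        unfolding h_def refl_across_def case_prod_unfold c_def
        by (intro continuous_intros) (use m0 e in \<open>auto simp: m_def intro!: continuous_intros\<close>)
      show "h 0 x = x" for x
        using e by (simp add: h_def m_def c_def refl_across_refl_across)
      show "\<exists>g. homeomorphism UNIV UNIV (h t) g" if t: "t \<in> {0..1}" for t
      proof (intro exI homeomorphismI)
        show "continuous_on UNIV (h t)" "continuous_on UNIV (g t)"
          using m0 [of t] c0 [of t] t e unfolding h_def g_def refl_across_def
          by (auto intro!: continuous_intros)
        show "g t (h t x) = x" "h t (g t x) = x" for x
          using m0 [of t] c0 [of t] t e by (simp_all add: h_def g_def refl_across_refl_across)
      qed auto
      have "x $ 3 = x \<bullet> e" for x :: "real ^ 3"
        by (simp add: e_def inner_axis)
      then have rc: "round_circle = {x. norm x = 1 \<and> x \<bullet> e = 0}"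
        by (simp add: round_circle_def)
      show "h 1 ` round_circle = {p + v |v. v \<bullet> b = 0 \<and> norm v = r}"
      proof (intro equalityI subsetI)
        fix y assume "y \<in> h 1 ` round_circle"
        then obtain x where x: "norm x = 1" "x \<bullet> e = 0" "y = h 1 x" unfolding rc by auto
        have "refl_across (m 1) (refl_across e x) \<bullet> b = 0"
          by (metis Re inner_refl_across x(2))
        with x r show "y \<in> {p + v |v. v \<bullet> b = 0 \<and> norm v = r}"
          by (auto simp: h_def c_def norm_refl_across)
      next
        fix y assume "y \<in> {p + v |v. v \<bullet> b = 0 \<and> norm v = r}"
        then obtain v where v: "y = p + v" "v \<bullet> b = 0" "norm v = r" by auto
        define x where "x = refl_across e (refl_across (m 1) (v /\<^sub>R r))"
        have hx: "h 1 x = y"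
          using m0 [of 1] e r v by (simp add: h_def x_def c_def refl_across_refl_across)
        have "x \<bullet> e = 0"
          by (metis Re inner_refl_across inner_scaleR_left mult_zero_right e(1) refl_across_refl_across m0 zero_le_one v(2) x_def)
        moreover have "norm x = 1"
          using r v by (simp add: x_def norm_refl_across)
        ultimately show "y \<in> h 1 ` round_circle"
          unfolding rc using hx by blast
      qed
    qed
  qed
  \<comment> \<open>The circle depends on \<open>a\<close> only up to sign, so the sign is chosen to
    put the normal into the half-space of \<open>e\<close>; then the second mirror normal never
    vanishes.\<close>
  show ?thesis
  proof (cases "a \<bullet> e \<ge> 0")
    case True then show ?thesis using main a by blast
  next
    case False
    then show ?thesis using main [of "- a"] a by simp
  qed
qed

section \<open>Flows of Lipschitz fields\<close>

text \<open>The weight \<open>exp (- 2 L t)\<close> turns the Picard operator into a contraction on the whole half line.\<close>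

lemma global_solution_exists:
  fixes X :: "'a::euclidean_space \<Rightarrow> 'a"
  assumes lip: "\<And>x y. norm (X x - X y) \<le> L * norm (x - y)" and L: "L > 0"
  obtains u where "u 0 = x" "\<And>t. t \<ge> 0 \<Longrightarrow> (u has_vector_derivative X (u t)) (at t within {0..})"
proof -
  \<comment> \<open>The unknown of the fixed point equation is \<open>w = (u - x) / E\<close>, which
    stays bounded although \<open>u\<close> may grow. Cutting \<open>t\<close> off at 0 extends
    everything to the whole line, so that the fixed point can be sought among the bounded continuous
    functions on \<open>real\<close>.\<close>
  define E where "E t = exp (2 * L * max t (0::real))" for t
  have contX: "continuous_on UNIV X"
    unfolding continuous_on_iff dist_norm
  proof (intro ballI allI impI)
    fix z and \<epsilon> :: real assume "\<epsilon> > 0"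
    then show "\<exists>d>0. \<forall>y\<in>UNIV. norm (y - z) < d \<longrightarrow> norm (X y - X z) < \<epsilon>"
      using L by (intro exI [of _ "\<epsilon> / L"]) (auto simp: field_simps intro: le_less_trans [OF lip])
  qed
  have Epos: "E t > 0" "E t \<ge> 1" for t using L by (auto simp: E_def)
  have contE: "continuous_on A E" for A
    unfolding E_def by (intro continuous_intros)
  define I where "I w t = integral {0..max t 0} (\<lambda>s. X (x + E s *\<^sub>R w s))" for w :: "real \<Rightarrow> 'a" and t
  have integ: "(\<lambda>s. X (x + E s *\<^sub>R w s)) integrable_on {0..t}" and
    contg: "continuous_on A (\<lambda>s. X (x + E s *\<^sub>R w s))"
    if "continuous_on UNIV w" for w t A
  proof -
    show "continuous_on A (\<lambda>s. X (x + E s *\<^sub>R w s))" for A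
      by (intro continuous_on_compose2 [OF contX] continuous_intros contE continuous_on_subset [OF that]) auto
    then show "(\<lambda>s. X (x + E s *\<^sub>R w s)) integrable_on {0..t}"
      by (rule integrable_continuous_interval)
  qed
  have expint: "((\<lambda>s. c * E s) has_integral c * (E t - 1) / (2 * L)) {0..max t 0}" for t c
  proof -
    have "((\<lambda>s. c * exp (2 * L * s)) has_integral c * exp (2 * L * max t 0) / (2 * L) - c * exp (2 * L * 0) / (2 * L)) {0..max t 0}"
      using L by (intro fundamental_theorem_of_calculus)
        (auto intro!: derivative_eq_intros simp: has_real_derivative_iff_has_vector_derivative[symmetric])
    then have "((\<lambda>s. c * exp (2 * L * s)) has_integral c * (E t - 1) / (2 * L)) {0..max t 0}"
      by (simp add: E_def right_diff_distrib diff_divide_distrib)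
    then show ?thesis
      by (rule has_integral_eq[rotated]) (auto simp: E_def)
  qed
  define P where "P w t = I w t /\<^sub>R E t" for w t
  have contP: "continuous_on UNIV (P w)" if "continuous_on UNIV w" for w
  proof -
    have "continuous_on {0..b} (\<lambda>t. integral {0..t} (\<lambda>s. X (x + E s *\<^sub>R w s)))" for b
      by (intro indefinite_integral_continuous_1 integ that)
    then have "continuous_on {..<b} (\<lambda>t. I w t)" for b
      unfolding I_def
      by (rule continuous_on_compose2 [of "{0..max b 0}"]) (auto intro!: continuous_intros)
    then have "isCont (I w) t" for t
      using continuous_on_eq_continuous_at [of "{..<t + 1}" "I w"] by (metis lessThan_iff less_add_one open_lessThan)
    then have "continuous_on UNIV (I w)"
      by (simp add: continuous_at_imp_continuous_on)
    then show ?thesis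
      unfolding P_def [abs_def] by (intro continuous_intros contE) (use Epos in \<open>auto simp: less_le\<close>)
  qed
  \<comment> \<open>The integral of \<open>L * E\<close> from 0 to \<open>t\<close> is at most
    \<open>E t / 2\<close>, which gives the contraction factor 1/2.\<close>
  have Idiff: "norm (P w t - P v t) \<le> C / 2"
    if w: "continuous_on UNIV w" and v: "continuous_on UNIV v" and C: "\<And>s. norm (w s - v s) \<le> C" for w v t C
  proof -
    have C0: "C \<ge> 0" using C [of 0] norm_ge_zero order_trans by blast
    have "norm (integral {0..max t 0} (\<lambda>s. X (x + E s *\<^sub>R w s) - X (x + E s *\<^sub>R v s)))
         \<le> integral {0..max t 0} (\<lambda>s. L * C * E s)"
    proof (rule integral_norm_bound_integral)
      show "norm (X (x + E s *\<^sub>R w s) - X (x + E s *\<^sub>R v s)) \<le> L * C * E s" for s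
      proof -
        have "norm (X (x + E s *\<^sub>R w s) - X (x + E s *\<^sub>R v s)) \<le> L * norm (E s *\<^sub>R (w s - v s))"
          using lip [of "x + E s *\<^sub>R w s" "x + E s *\<^sub>R v s"] by (simp add: algebra_simps)
        also have "\<dots> \<le> L * (E s * C)"
          using L Epos [of s] C [of s] by (simp add: mult_left_mono)
        finally show ?thesis by (simp add: mult_ac)
      qed
    qed (use integ w v expint in \<open>auto intro!: integrable_diff simp: has_integral_integrable_integral\<close>)
    also have "\<dots> = L * C * (E t - 1) / (2 * L)"
      using expint has_integral_integral by blast
    also have "\<dots> \<le> C / 2 * E t"
      using L C0 by (simp add: field_simps)
    finally have "norm (I w t - I v t) \<le> C / 2 * E t"
      by (simp add: I_def integral_diff integ w v)
    moreover have "P w t - P v t = (I w t - I v t) /\<^sub>R E t"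
      by (simp add: P_def algebra_simps)
    then have eq: "norm (P w t - P v t) = norm (I w t - I v t) / E t"
      using Epos(1) [of t] by (simp only: norm_scaleR abs_inverse abs_of_pos divide_inverse mult.commute)
    show ?thesis
      unfolding eq using calculation Epos(1) [of t] by (simp add: divide_le_eq)
  qed
  \<comment> \<open>Together with the contraction estimate, this bound at the zero function shows
    that \<open>P\<close> preserves boundedness.\<close>
  have P0: "norm (P (\<lambda>s. 0) t) \<le> norm (X x) / (2 * L)" for t
  proof -
    have "norm (I (\<lambda>s. 0) t) = norm (X x) * max t 0"
      by (simp add: I_def)
    also have "\<dots> \<le> norm (X x) * (E t / (2 * L))"
    proof (rule mult_left_mono)
      have "2 * L * max t 0 \<le> E t" unfolding E_def using exp_ge_add_one_self [of "2 * L * max t 0"] by linarith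
      then show "max t 0 \<le> E t / (2 * L)" using L by (simp add: le_divide_eq mult_ac)
    qed auto
    finally show ?thesis
      using Epos [of t] L by (simp add: P_def field_simps)
  qed
  have bP: "P (apply_bcontfun w) \<in> bcontfun" for w :: "real \<Rightarrow>\<^sub>C 'a"
  proof (rule bcontfun_normI)
    have cw: "continuous_on UNIV (apply_bcontfun w)" by simp
    show "continuous_on UNIV (P (apply_bcontfun w))" using contP cw by blast
    fix t
    have "norm (P (apply_bcontfun w) t - P (\<lambda>s. 0) t) \<le> norm w / 2"
      by (rule Idiff) (auto simp: norm_bounded)
    then show "norm (P (apply_bcontfun w) t) \<le> norm w / 2 + norm (X x) / (2 * L)"
      using P0 [of t] norm_triangle_sub [of "P (apply_bcontfun w) t" "P (\<lambda>s. 0) t"] by linarith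
  qed
  have "\<exists>!w. w \<in> UNIV \<and> Bcontfun (P (apply_bcontfun w)) = w"
  proof (rule Banach_fix [of UNIV "1/2"])
    show "dist (Bcontfun (P (apply_bcontfun w))) (Bcontfun (P (apply_bcontfun v))) \<le> 1 / 2 * dist w v"
      for w v :: "real \<Rightarrow>\<^sub>C 'a"
    proof (rule dist_bound)
      fix t
      have "norm (P (apply_bcontfun w) t - P (apply_bcontfun v) t) \<le> dist w v / 2"
        by (rule Idiff) (auto simp: dist_bounded simp flip: dist_norm)
      then show "dist (Bcontfun (P (apply_bcontfun w)) t) (Bcontfun (P (apply_bcontfun v)) t) \<le> 1 / 2 * dist w v"
        by (simp add: Bcontfun_inverse bP dist_norm)
    qed
  qed auto
  then obtain w where w: "Bcontfun (P (apply_bcontfun w)) = w" by blast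
  then have wP: "apply_bcontfun w t = P (apply_bcontfun w) t" for t
    by (metis Bcontfun_inverse bP)
  define u where "u t = x + E t *\<^sub>R apply_bcontfun w t" for t
  have ut: "u t = x + integral {0..t} (\<lambda>s. X (u s))" if "t \<ge> 0" for t
    using wP [of t] Epos [of t] that by (simp add: u_def P_def I_def)
  show thesis
  proof (rule that)
    show "u 0 = x" using ut [of 0] by simp
    fix t :: real assume t: "t \<ge> 0"
    have "((\<lambda>t. integral {0..t} (\<lambda>s. X (u s))) has_vector_derivative X (u t)) (at t within {0..t+1})"
      using t by (intro integral_has_vector_derivative) (auto simp: u_def intro!: contg)
    then have "((\<lambda>t. x + integral {0..t} (\<lambda>s. X (u s))) has_vector_derivative X (u t)) (at t within {0..t+1})"
      by (auto intro!: derivative_eq_intros)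
    then have "(u has_vector_derivative X (u t)) (at t within {0..t+1})"
      by (rule has_vector_derivative_transform [rotated -1]) (use t ut in auto)
    moreover have "at t within {0..t+1} = at t within {0..}"
      using t by (intro at_within_nhd [of _ "{t-1<..<t+1}"]) auto
    ultimately show "(u has_vector_derivative X (u t)) (at t within {0..})" by simp
  qed
qed

text \<open>Gronwall's estimate: the weighted square \<open>exp (- 2 L t) |u - v|^2\<close> has a
  nonpositive derivative.\<close>

lemma solution_dist_bound:
  fixes X :: "'a::euclidean_space \<Rightarrow> 'a"
  assumes lip: "\<And>x y. norm (X x - X y) \<le> L * norm (x - y)"
    and u: "\<And>t. t \<in> {0..b} \<Longrightarrow> (u has_vector_derivative X (u t)) (at t within {0..b})"
    and v: "\<And>t. t \<in> {0..b} \<Longrightarrow> (v has_vector_derivative X (v t)) (at t within {0..b})"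
    and t: "t \<in> {0..b}"
  shows "norm (u t - v t) \<le> exp (L * t) * norm (u 0 - v 0)"
proof -
  define w where "w t = u t - v t" for t
  define k where "k t = exp (- (2 * L * t)) * (w t \<bullet> w t)" for t
  define k' where "k' t = exp (- (2 * L * t)) * (2 * (w t \<bullet> (X (u t) - X (v t)))) - 2 * L * exp (- (2 * L * t)) * (w t \<bullet> w t)" for t
  have "k t \<le> k 0"
  proof (cases "t = 0")
    case False
    have "(k has_real_derivative k' s) (at s within {0..b})" if "s \<in> {0..b}" for s
    proof -
      have "(w has_vector_derivative (X (u s) - X (v s))) (at s within {0..b})"
        unfolding w_def [abs_def] by (intro has_vector_derivative_diff u v that)
      then have "(w has_derivative (\<lambda>h. h *\<^sub>R (X (u s) - X (v s)))) (at s within {0..b})"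
        by (simp add: has_vector_derivative_def)
      from has_derivative_inner [OF this this]
      have "((\<lambda>s. w s \<bullet> w s) has_real_derivative 2 * (w s \<bullet> (X (u s) - X (v s)))) (at s within {0..b})"
        unfolding has_field_derivative_def
        by (rule has_derivative_eq_rhs) (auto simp: inner_commute algebra_simps)
      then show ?thesis
        unfolding k_def [abs_def] k'_def
        by (auto intro!: derivative_eq_intros)
    qed
    note dk = this
    have "k' s \<le> 0" for s
    proof -
      have "w s \<bullet> (X (u s) - X (v s)) \<le> norm (w s) * norm (X (u s) - X (v s))"
        by (rule norm_cauchy_schwarz)
      also have "\<dots> \<le> norm (w s) * (L * norm (w s))"
        unfolding w_def by (intro mult_left_mono lip) auto
      finally have "w s \<bullet> (X (u s) - X (v s)) \<le> L * (w s \<bullet> w s)"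
        by (simp add: dot_square_norm power2_eq_square mult_ac)
      then have "exp (- (2 * L * s)) * (2 * (w s \<bullet> (X (u s) - X (v s)))) \<le> exp (- (2 * L * s)) * (2 * (L * (w s \<bullet> w s)))"
        by (intro mult_left_mono) auto
      then show ?thesis
        unfolding k'_def by (simp add: mult_ac)
    qed
    note k'0 = this
    show ?thesis
    proof (rule DERIV_nonpos_imp_decreasing_open [where f = k and a = 0 and b = t])
      have "continuous_on {0..b} k"
        using dk by (rule DERIV_continuous_on)
      then show "continuous_on {0..t} k"
        by (rule continuous_on_subset) (use t in auto)
      show "\<exists>y. (k has_real_derivative y) (at s) \<and> y \<le> 0" if "0 < s" "s < t" for s
      proof (intro exI conjI)
        have "at s within {0..b} = at s"
          using that t by (intro at_within_interior) auto
        then show "(k has_real_derivative k' s) (at s)"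
          using dk [of s] that t by auto
      qed (rule k'0)
    qed (use t in auto)
  qed auto
  then have "(norm (w t))\<^sup>2 \<le> (exp (L * t) * norm (w 0))\<^sup>2"
    by (simp add: k_def power_mult_distrib dot_square_norm exp_minus field_simps flip: exp_double)
  then show ?thesis
    unfolding w_def by (rule power2_le_imp_le) auto
qed

text \<open>Only forward time is recorded; the inverse maps come from the flow of the negated field.
  Uniqueness is stated for solutions on compact intervals, the form in which explicit orbits are
  recognised later.\<close>

locale flow =
  fixes X :: "'a::euclidean_space \<Rightarrow> 'a" and L :: real and \<phi> :: "real \<Rightarrow> 'a \<Rightarrow> 'a"
  assumes lip: "\<And>x y. norm (X x - X y) \<le> L * norm (x - y)" and L: "L > 0"
    and flow_0: "\<And>x. \<phi> 0 x = x"
    and flow_deriv: "\<And>t x. t \<ge> 0 \<Longrightarrow> ((\<lambda>t. \<phi> t x) has_vector_derivative X (\<phi> t x)) (at t within {0..})"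
    and flow_unique: "\<And>u b. (\<And>t. t \<in> {0..b} \<Longrightarrow> (u has_vector_derivative X (u t)) (at t within {0..b})) \<Longrightarrow> b \<ge> 0 \<Longrightarrow> \<phi> b (u 0) = u b"
    and flow_add: "\<And>s t x. s \<ge> 0 \<Longrightarrow> t \<ge> 0 \<Longrightarrow> \<phi> (s + t) x = \<phi> s (\<phi> t x)"
    and flow_dist: "\<And>t x y. t \<ge> 0 \<Longrightarrow> norm (\<phi> t x - \<phi> t y) \<le> exp (L * t) * norm (x - y)"

lemma flow_exists:
  fixes X :: "'a::euclidean_space \<Rightarrow> 'a"
  assumes lip: "\<And>x y. norm (X x - X y) \<le> L * norm (x - y)" and L: "L > 0"
  shows "\<exists>\<phi>. flow X L \<phi>"
proof -
  have "\<forall>x. \<exists>u. u 0 = x \<and> (\<forall>t\<ge>0. (u has_vector_derivative X (u t)) (at t within {0..}))"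
    using global_solution_exists [OF lip L] by metis
  then obtain f where f: "\<And>x. f x 0 = x"
    "\<And>x t. t \<ge> 0 \<Longrightarrow> (f x has_vector_derivative X (f x t)) (at t within {0..})"
    by metis
  define \<phi> where "\<phi> t x = f x t" for t x
  have \<phi>0: "\<phi> 0 x = x" for x by (simp add: \<phi>_def f)
  have d\<phi>: "((\<lambda>t. \<phi> t x) has_vector_derivative X (\<phi> t x)) (at t within {0..})" if "t \<ge> 0" for t x
    using f(2) [OF that] by (simp add: \<phi>_def)
  have d\<phi>': "((\<lambda>t. \<phi> t x) has_vector_derivative X (\<phi> t x)) (at t within {0..b})" if "t \<in> {0..b}" for t x b
    by (rule has_vector_derivative_within_subset [OF d\<phi>]) (use that in auto)
  have uniq: "\<phi> b (u 0) = u b"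
    if u: "\<And>t. t \<in> {0..b} \<Longrightarrow> (u has_vector_derivative X (u t)) (at t within {0..b})" and b: "b \<ge> 0" for u b
    using solution_dist_bound [where b=b and t=b, OF lip d\<phi>' u, of "u 0"] b by (simp add: \<phi>0)
  have add: "\<phi> (s + t) x = \<phi> s (\<phi> t x)" if "s \<ge> 0" "t \<ge> 0" for s t x
  proof -
    have "((\<lambda>r. \<phi> (r + t) x) has_vector_derivative X (\<phi> (r + t) x)) (at r within {0..s})" if r: "r \<in> {0..s}" for r
    proof -
      have "((\<lambda>t. \<phi> t x) \<circ> (\<lambda>r. r + t) has_vector_derivative 1 *\<^sub>R X (\<phi> (r + t) x)) (at r within {0..s})"
        by (rule vector_diff_chain_within)
           (use r \<open>t \<ge> 0\<close> in \<open>auto intro!: derivative_eq_intros has_vector_derivative_within_subset [OF d\<phi>]\<close>)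
      then show ?thesis by (simp add: comp_def)
    qed
    from uniq [OF this] that show ?thesis by simp
  qed
  have dist: "norm (\<phi> t x - \<phi> t y) \<le> exp (L * t) * norm (x - y)" if "t \<ge> 0" for t x y
    using solution_dist_bound [where b=t and t=t, OF lip d\<phi>' d\<phi>', of x y] that by (simp add: \<phi>0)
  have "flow X L \<phi>"
  proof
    show "\<phi> b (u 0) = u b"
      if "\<And>t. t \<in> {0..b} \<Longrightarrow> (u has_vector_derivative X (u t)) (at t within {0..b})" "b \<ge> 0" for u b
      using uniq that by blast
  qed (use lip L \<phi>0 d\<phi> add dist in auto)
  then show ?thesis by blast
qed

context flow
begin

lemma continuous_on_time: "continuous_on {0..} (\<lambda>t. \<phi> t x)"
  using flow_deriv has_vector_derivative_continuous
  unfolding continuous_on_eq_continuous_within by blast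

text \<open>Joint continuity splits into the continuity of a single orbit in time and the
  exponential Lipschitz bound in space.\<close>

lemma continuous_on_flow: "continuous_on ({0..} \<times> UNIV) (\<lambda>(t, x). \<phi> t x)"
  unfolding continuous_on_def
proof (rule ballI)
  fix z :: "real \<times> 'a" assume z: "z \<in> {0..} \<times> UNIV"
  obtain t x where tx: "z = (t, x)" by fastforce
  let ?F = "at (t, x) within {0..} \<times> UNIV"
  have "((\<lambda>w. \<phi> (fst w) x) \<longlongrightarrow> \<phi> t x) ?F"
  proof -
    have "continuous_on ({0..} \<times> UNIV) (\<lambda>w. \<phi> (fst w) x)"
      by (rule continuous_on_compose2 [OF continuous_on_time]) (auto intro!: continuous_intros)
    then show ?thesis using z tx unfolding continuous_on_def by force
  qed
  moreover have "((\<lambda>w. \<phi> (fst w) (snd w) - \<phi> (fst w) x) \<longlongrightarrow> 0) ?F"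
  proof (rule Lim_null_comparison)
    show "\<forall>\<^sub>F w in ?F. norm (\<phi> (fst w) (snd w) - \<phi> (fst w) x) \<le> exp (L * fst w) * norm (snd w - x)"
      unfolding eventually_at_filter by (intro always_eventually) (auto intro: flow_dist)
    have "((\<lambda>w. exp (L * fst w) * norm (snd w - x)) \<longlongrightarrow> exp (L * fst (t, x)) * norm (snd (t, x) - x)) ?F"
      by (intro tendsto_intros)
    then show "((\<lambda>w. exp (L * fst w) * norm (snd w - x)) \<longlongrightarrow> 0) ?F" by simp
  qed
  ultimately have "((\<lambda>w. \<phi> (fst w) x + (\<phi> (fst w) (snd w) - \<phi> (fst w) x)) \<longlongrightarrow> \<phi> t x + 0) ?F"
    by (intro tendsto_intros)
  then show "((\<lambda>(t, x). \<phi> t x) \<longlongrightarrow> (case z of (t, x) \<Rightarrow> \<phi> t x)) (at z within {0..} \<times> UNIV)"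
    by (simp add: tx case_prod_unfold)
qed

lemma continuous_on_space:
  assumes "t \<ge> 0" shows "continuous_on A (\<phi> t)"
proof -
  have "continuous_on A (\<lambda>x. (\<lambda>(t, x). \<phi> t x) (t, x))"
    by (rule continuous_on_compose2 [OF continuous_on_flow]) (use assms in \<open>auto intro!: continuous_intros\<close>)
  then show ?thesis by simp
qed

text \<open>The inverse is the flow of \<open>- X\<close>: an orbit traversed backwards solves the
  negated equation, and uniqueness identifies it.\<close>

lemma homeomorphism_flow:
  assumes "t \<ge> 0" shows "\<exists>g. homeomorphism UNIV UNIV (\<phi> t) g"
proof -
  have nlip: "norm (- X x - - X y) \<le> L * norm (x - y)" for x y
    using lip [of x y] by (simp add: norm_minus_commute)
  obtain \<psi> where \<psi>: "flow (\<lambda>x. - X x) L \<psi>"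
    using flow_exists [of "\<lambda>x. - X x", OF nlip L] by blast
  interpret b: flow "\<lambda>x. - X x" L \<psi> by fact
  have "\<psi> t (\<phi> t x) = x" for x
  proof -
    have "((\<lambda>r. \<phi> (t - r) x) has_vector_derivative - X (\<phi> (t - r) x)) (at r within {0..t})" if r: "r \<in> {0..t}" for r
    proof -
      have "((\<lambda>t. \<phi> t x) \<circ> (\<lambda>r. t - r) has_vector_derivative (- 1) *\<^sub>R X (\<phi> (t - r) x)) (at r within {0..t})"
        by (rule vector_diff_chain_within)
           (use r \<open>t \<ge> 0\<close> in \<open>auto intro!: derivative_eq_intros has_vector_derivative_within_subset [OF flow_deriv]\<close>)
      then show ?thesis by (simp add: comp_def)
    qed
    from b.flow_unique [OF this] assms show ?thesis by (simp add: flow_0)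
  qed
  moreover have "\<phi> t (\<psi> t x) = x" for x
  proof -
    have "((\<lambda>r. \<psi> (t - r) x) has_vector_derivative X (\<psi> (t - r) x)) (at r within {0..t})" if r: "r \<in> {0..t}" for r
    proof -
      have "((\<lambda>t. \<psi> t x) \<circ> (\<lambda>r. t - r) has_vector_derivative (- 1) *\<^sub>R (- X (\<psi> (t - r) x))) (at r within {0..t})"
        by (rule vector_diff_chain_within)
           (use r \<open>t \<ge> 0\<close> in \<open>auto intro!: derivative_eq_intros has_vector_derivative_within_subset [OF b.flow_deriv]\<close>)
      then show ?thesis by (simp add: comp_def)
    qed
    from flow_unique [OF this] assms show ?thesis by (simp add: b.flow_0)
  qed
  ultimately have "homeomorphism UNIV UNIV (\<phi> t) (\<psi> t)"
    using assms by (intro homeomorphismI continuous_on_space b.continuous_on_space) auto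
  then show ?thesis by blast
qed

lemma flow_inj: "t \<ge> 0 \<Longrightarrow> \<phi> t x = \<phi> t y \<Longrightarrow> x = y"
  using homeomorphism_flow [of t] by (metis UNIV_I homeomorphism_apply1)

end

section \<open>The degree of a vector field\<close>

definition C1 :: "('a::real_normed_vector \<Rightarrow> 'b::real_normed_vector) \<Rightarrow> bool" where
  "C1 f \<longleftrightarrow> (\<exists>f'. (\<forall>x. (f has_derivative blinfun_apply (f' x)) (at x)) \<and> continuous_on UNIV f')"

lemma C1E:
  assumes "C1 f"
  obtains f' where "\<And>x. (f has_derivative blinfun_apply (f' x)) (at x)" "continuous_on UNIV f'"
  using assms unfolding C1_def by blast

lemma C1_continuous_on: "C1 f \<Longrightarrow> continuous_on A f"
  by (erule C1E, rule has_derivative_continuous_on, rule has_derivative_at_withinI) assumption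

lemma C1_bounded_linear: "bounded_linear f \<Longrightarrow> C1 f"
  unfolding C1_def
  by (intro exI [of _ "\<lambda>_. Blinfun f"])
     (auto simp: bounded_linear_Blinfun_apply intro: bounded_linear.has_derivative has_derivative_ident bounded_linear_imp_has_derivative)

lemma C1_const: "C1 (\<lambda>x. c)"
  unfolding C1_def by (intro exI [of _ "\<lambda>_. 0"]) (auto intro!: derivative_eq_intros)

lemma C1_compose:
  assumes "C1 f" "C1 g" shows "C1 (\<lambda>x. f (g x))"
proof -
  obtain f' where f: "\<And>x. (f has_derivative blinfun_apply (f' x)) (at x)" "continuous_on UNIV f'"
    using C1E [OF assms(1)] by blast
  obtain g' where g: "\<And>x. (g has_derivative blinfun_apply (g' x)) (at x)" "continuous_on UNIV g'"
    using C1E [OF assms(2)] by blast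
  have contg: "continuous_on UNIV g"
    by (intro C1_continuous_on assms)
  show ?thesis
    unfolding C1_def
  proof (intro exI conjI allI)
    show "((\<lambda>x. f (g x)) has_derivative blinfun_apply (f' (g x) o\<^sub>L g' x)) (at x)" for x
      using has_derivative_compose [OF g(1) f(1)] by (simp add: blinfun_compose.rep_eq comp_def)
    show "continuous_on UNIV (\<lambda>x. f' (g x) o\<^sub>L g' x)"
      by (intro continuous_intros g(2) continuous_on_compose2 [OF f(2) contg]) auto
  qed
qed

lemma C1_add:
  assumes "C1 f" "C1 g" shows "C1 (\<lambda>x. f x + g x)"
proof -
  obtain f' where f: "\<And>x. (f has_derivative blinfun_apply (f' x)) (at x)" "continuous_on UNIV f'"
    using C1E [OF assms(1)] by blast
  obtain g' where g: "\<And>x. (g has_derivative blinfun_apply (g' x)) (at x)" "continuous_on UNIV g'"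
    using C1E [OF assms(2)] by blast
  show ?thesis
    unfolding C1_def
  proof (intro exI conjI allI)
    show "((\<lambda>x. f x + g x) has_derivative blinfun_apply (f' x + g' x)) (at x)" for x
      unfolding plus_blinfun.rep_eq by (intro has_derivative_add f g)
    show "continuous_on UNIV (\<lambda>x. f' x + g' x)"
      by (intro continuous_on_add f g)
  qed
qed

lemma C1_scaleR:
  fixes f :: "'a::real_normed_vector \<Rightarrow> real"
  assumes "C1 f" "C1 g" shows "C1 (\<lambda>x. f x *\<^sub>R g x)"
proof -
  obtain f' where f: "\<And>x. (f has_derivative blinfun_apply (f' x)) (at x)" "continuous_on UNIV f'"
    using C1E [OF assms(1)] by blast
  obtain g' where g: "\<And>x. (g has_derivative blinfun_apply (g' x)) (at x)" "continuous_on UNIV g'"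
    using C1E [OF assms(2)] by blast
  have cont: "continuous_on UNIV f" "continuous_on UNIV g"
    by (intro C1_continuous_on assms)+
  show ?thesis
    unfolding C1_def
  proof (intro exI conjI allI)
    show "((\<lambda>x. f x *\<^sub>R g x) has_derivative blinfun_apply
       ((blinfun_scaleR_right (f x) o\<^sub>L g' x) + (blinfun_scaleR_left (g x) o\<^sub>L f' x))) (at x)" for x
      using has_derivative_scaleR [OF f(1) g(1)]
      by (rule has_derivative_eq_rhs) (auto simp: plus_blinfun.rep_eq blinfun_scaleR_right.rep_eq)
    show "continuous_on UNIV (\<lambda>x. (blinfun_scaleR_right (f x) o\<^sub>L g' x) + (blinfun_scaleR_left (g x) o\<^sub>L f' x))"
      by (intro continuous_intros f g cont bounded_linear.continuous_on [OF bounded_linear_blinfun_scaleR_right]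
            bounded_linear.continuous_on [OF bounded_linear_blinfun_scaleR_left])
  qed
qed

lemma C1_diff: "C1 f \<Longrightarrow> C1 g \<Longrightarrow> C1 (\<lambda>x. f x - g x)"
  using C1_add [of f "\<lambda>x. (- 1) *\<^sub>R g x"] C1_scaleR [OF C1_const, of g "- 1"] by simp

lemma C1_sum: "(\<And>i. i \<in> A \<Longrightarrow> C1 (f i)) \<Longrightarrow> C1 (\<lambda>x. \<Sum>i\<in>A. f i x)"
  by (induction A rule: infinite_finite_induct) (auto intro: C1_const C1_add)

lemma C1_euclidean:
  fixes f :: "'a::real_normed_vector \<Rightarrow> 'b::euclidean_space"
  assumes "\<And>b. b \<in> Basis \<Longrightarrow> C1 (\<lambda>x. f x \<bullet> b)"
  shows "C1 f"
proof -
  have "C1 (\<lambda>x. \<Sum>b\<in>Basis. (f x \<bullet> b) *\<^sub>R b)"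
    by (intro C1_sum C1_scaleR C1_const assms)
  then show ?thesis by (simp add: euclidean_representation)
qed

lemma C1_inner_self:
  fixes f :: "'a::real_normed_vector \<Rightarrow> 'b::euclidean_space"
  assumes "C1 f"
  shows "C1 (\<lambda>x. f x \<bullet> f x)"
proof -
  have c: "C1 (\<lambda>x. f x \<bullet> b)" for b
    by (rule C1_compose [where f = "\<lambda>y. y \<bullet> b", OF C1_bounded_linear [OF bounded_linear_inner_left] assms])
  have "C1 (\<lambda>x. \<Sum>b\<in>Basis. (f x \<bullet> b) *\<^sub>R (f x \<bullet> b))"
    by (rule C1_sum [where f = "\<lambda>b x. (f x \<bullet> b) *\<^sub>R (f x \<bullet> b)", OF C1_scaleR [OF c c]])
  moreover have "f x \<bullet> f x = (\<Sum>b\<in>Basis. (f x \<bullet> b) *\<^sub>R (f x \<bullet> b))" for x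
    by (subst euclidean_inner) simp
  ultimately show ?thesis by simp
qed

lemma C1_polynomial_function:
  fixes f :: "'a::real_normed_vector \<Rightarrow> 'b::euclidean_space"
  assumes "polynomial_function f" shows "C1 f"
proof -
  have "C1 g" if "real_polynomial_function g" for g :: "'a \<Rightarrow> real"
    using that
  proof (induction)
    case (mult f g) then show ?case using C1_scaleR [of f g] by simp
  qed (auto intro: C1_bounded_linear C1_const C1_add)
  moreover have "real_polynomial_function (\<lambda>x. f x \<bullet> b)" for b
    using assms [unfolded polynomial_function_def, THEN spec, THEN mp, OF bounded_linear_inner_left [of b]]
    by (simp add: comp_def)
  ultimately show ?thesis
    using C1_euclidean [of f] by simp
qed

lemma C1_real:
  fixes f :: "real \<Rightarrow> real"
  assumes "\<And>t. (f has_real_derivative f' t) (at t)" "continuous_on UNIV f'"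
  shows "C1 f"
  unfolding C1_def
proof (intro exI conjI allI)
  show "(f has_derivative blinfun_apply (blinfun_scaleR_right (f' t))) (at t)" for t
    using assms(1) [of t] by (simp add: has_field_derivative_def blinfun_scaleR_right.rep_eq real_scaleR_def [abs_def])
  show "continuous_on UNIV (\<lambda>t. blinfun_scaleR_right (f' t) :: real \<Rightarrow>\<^sub>L real)"
    by (intro bounded_linear.continuous_on [OF bounded_linear_blinfun_scaleR_right] assms)
qed

section \<open>Cutoff functions\<close>

lemma sqpos_deriv: "((\<lambda>t::real. (max 0 t)\<^sup>2) has_real_derivative 2 * max 0 t) (at t)"
proof -
  consider "t < 0" | "t > 0" | "t = 0" by linarith
  then show ?thesis
  proof cases
    case 1
    have "((\<lambda>t::real. 0) has_real_derivative 0) (at t)" by simp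
    then have "((\<lambda>t::real. (max 0 t)\<^sup>2) has_real_derivative 0) (at t)"
      by (rule has_field_derivative_transform_within_open [where S = "{..<0}"]) (use 1 in auto)
    with 1 show ?thesis by simp
  next
    case 2
    have "((\<lambda>t::real. t\<^sup>2) has_real_derivative 2 * t) (at t)" by (auto intro!: derivative_eq_intros)
    then have "((\<lambda>t::real. (max 0 t)\<^sup>2) has_real_derivative 2 * t) (at t)"
      by (rule has_field_derivative_transform_within_open [where S = "{0<..}"]) (use 2 in auto)
    with 2 show ?thesis by simp
  next
    case 3
    have "((\<lambda>h. (max 0 h)\<^sup>2 / h) \<longlongrightarrow> 0) (at (0::real))"
    proof (rule Lim_null_comparison)
      show "\<forall>\<^sub>F h in at (0::real). norm ((max 0 h)\<^sup>2 / h) \<le> \<bar>h\<bar>"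
        unfolding eventually_at_filter by (intro always_eventually) (auto simp: max_def power2_eq_square)
      show "(abs \<longlongrightarrow> 0) (at (0::real))" by (intro tendsto_rabs_zero) auto
    qed
    then show ?thesis unfolding 3 by (simp add: DERIV_def)
  qed
qed

text \<open>A descent from 1 at \<open>a\<close> to 0 at \<open>b\<close>, strict in between. Both
  kinks sit inside squared positive parts, which makes the function continuously
  differentiable.\<close>

definition cutoff :: "real \<Rightarrow> real \<Rightarrow> real \<Rightarrow> real" where
  "cutoff a b t = (max 0 (1 - (max 0 ((t - a) / (b - a)))\<^sup>2))\<^sup>2"

definition cutoff' :: "real \<Rightarrow> real \<Rightarrow> real \<Rightarrow> real" where
  "cutoff' a b t = - 4 * max 0 (1 - (max 0 ((t - a) / (b - a)))\<^sup>2) * max 0 ((t - a) / (b - a)) / (b - a)"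

lemma cutoff_deriv:
  assumes "a < b" shows "(cutoff a b has_real_derivative cutoff' a b t) (at t)"
proof -
  have 1: "((\<lambda>t. (t - a) / (b - a)) has_real_derivative 1 / (b - a)) (at t)"
    using assms by (auto intro!: derivative_eq_intros)
  have 2: "((\<lambda>t. 1 - (max 0 ((t - a) / (b - a)))\<^sup>2) has_real_derivative
      0 - 2 * max 0 ((t - a) / (b - a)) * (1 / (b - a))) (at t)"
    by (intro DERIV_diff DERIV_const DERIV_chain2 [OF sqpos_deriv 1])
  show ?thesis
    unfolding cutoff_def [abs_def] cutoff'_def
    by (rule DERIV_cong [OF DERIV_chain2 [OF sqpos_deriv 2]]) simp
qed

lemma continuous_cutoff': "a < b \<Longrightarrow> continuous_on A (cutoff' a b)"
  unfolding cutoff'_def [abs_def] by (intro continuous_intros) auto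

lemma C1_cutoff: "a < b \<Longrightarrow> C1 (cutoff a b)"
  by (rule C1_real [OF cutoff_deriv continuous_cutoff'])

lemma cutoff_eq_1: "a < b \<Longrightarrow> t \<le> a \<Longrightarrow> cutoff a b t = 1"
proof -
  assume "a < b" "t \<le> a"
  then have "max 0 ((t - a) / (b - a)) = 0" by (simp add: divide_nonpos_pos)
  then show ?thesis by (simp add: cutoff_def)
qed

lemma one_le_cutoff_arg:
  assumes "a < b" "t \<ge> b"
  shows "max 0 (1 - (max 0 ((t - a) / (b - a)))\<^sup>2) = (0::real)"
proof -
  have "1 \<le> max 0 ((t - a) / (b - a))" using assms by (simp add: le_max_iff_disj)
  then have "1 \<le> (max 0 ((t - a) / (b - a)))\<^sup>2" by (rule one_le_power)
  then show ?thesis by simp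
qed

lemma cutoff_eq_0: "a < b \<Longrightarrow> t \<ge> b \<Longrightarrow> cutoff a b t = 0"
  by (simp add: cutoff_def one_le_cutoff_arg)

lemma cutoff_bounds: "0 \<le> cutoff a b t" "cutoff a b t \<le> 1"
  by (auto simp: cutoff_def max_def power_le_one)

lemma cutoff'_neg:
  assumes t: "a < t" "t < b" shows "cutoff' a b t < 0"
proof -
  define s where "s = (t - a) / (b - a)"
  have s: "0 < s" "s < 1" using t by (auto simp: s_def)
  then have "s\<^sup>2 < 1" by (simp add: power_less_one_iff)
  with s have "0 < (1 - s\<^sup>2) * s" by simp
  moreover have "cutoff' a b t = - 4 * ((1 - s\<^sup>2) * s) / (b - a)"
    using s \<open>s\<^sup>2 < 1\<close> unfolding cutoff'_def s_def [symmetric] by (simp add: algebra_simps)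
  moreover have "0 < 4 * ((1 - s\<^sup>2) * s) / (b - a)"
    using calculation t by (intro divide_pos_pos) auto
  ultimately show ?thesis by linarith
qed

lemma cutoff'_zero: "a < b \<Longrightarrow> t \<le> a \<or> t \<ge> b \<Longrightarrow> cutoff' a b t = 0"
  using one_le_cutoff_arg [of a b t] by (auto simp: cutoff'_def divide_nonpos_pos)

lemma cutoff_strict:
  assumes "a \<le> s" "s < t" "t \<le> b" shows "cutoff a b t < cutoff a b s"
proof (rule DERIV_neg_imp_decreasing_open [OF \<open>s < t\<close>])
  show "\<exists>y. (cutoff a b has_real_derivative y) (at x) \<and> y < 0" if "s < x" "x < t" for x
    using cutoff_deriv [of a b x] cutoff'_neg [of a x b] that assms by auto
  show "continuous_on {s..t} (cutoff a b)"
    by (rule DERIV_continuous_on, rule has_field_derivative_at_within, rule cutoff_deriv) (use assms in auto)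
qed

section \<open>Jacobian determinants and the volume argument\<close>

abbreviation jac :: "(real^3 \<Rightarrow> real^3) \<Rightarrow> real^3 \<Rightarrow> real^3^3" where
  "jac f x \<equiv> matrix (frechet_derivative f (at x))"

lemma C1_jac:
  fixes f :: "real^3 \<Rightarrow> real^3"
  assumes "C1 f"
  shows "(f has_derivative frechet_derivative f (at x)) (at x)"
    and "continuous_on A (\<lambda>x. jac f x $ i $ j)"
proof -
  obtain f' where f: "\<And>x. (f has_derivative blinfun_apply (f' x)) (at x)" "continuous_on UNIV f'"
    using C1E [OF assms] by blast
  have eq: "frechet_derivative f (at x) = blinfun_apply (f' x)" for x
    using f(1) frechet_derivative_at by metis
  show "(f has_derivative frechet_derivative f (at x)) (at x)"
    unfolding eq by (rule f)
  have "continuous_on A (\<lambda>x. blinfun_apply (f' x) (axis j 1))"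
    by (intro continuous_intros continuous_on_subset [OF f(2)]) auto
  then show "continuous_on A (\<lambda>x. jac f x $ i $ j)"
    unfolding eq matrix_def by (auto intro!: continuous_intros)
qed

lemma continuous_on_det_jac: "C1 f \<Longrightarrow> continuous_on A (\<lambda>x. det (jac f x))"
  unfolding det_3 by (intro continuous_on_add continuous_on_diff continuous_on_mult C1_jac(2))

definition mat_tr :: "real^3^3 \<Rightarrow> real" where
  "mat_tr M = M$1$1 + M$2$2 + M$3$3"
text \<open>The sum of the principal 2 by 2 minors, which is the coefficient of \<open>t^2\<close>
  in \<open>det (I + t M)\<close>.\<close>

definition mat_minors :: "real^3^3 \<Rightarrow> real" where
  "mat_minors M = M$1$1*M$2$2 - M$1$2*M$2$1 + M$1$1*M$3$3 - M$1$3*M$3$1 + M$2$2*M$3$3 - M$2$3*M$3$2"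

lemma det_id_plus: "det (mat 1 + t *\<^sub>R M) = 1 + t * mat_tr M + t\<^sup>2 * mat_minors M + t^3 * det (M::real^3^3)"
  unfolding det_3 mat_tr_def mat_minors_def mat_def
  by (simp add: power2_eq_square power3_eq_cube algebra_simps)

text \<open>For surjectivity the equation \<open>x = y - F x\<close> is solved by the contraction
  principle.\<close>

lemma id_plus_lipschitz_bij:
  fixes F :: "'a::euclidean_space \<Rightarrow> 'a"
  assumes lip: "\<And>x y. norm (F x - F y) \<le> c * norm (x - y)" and c: "0 \<le> c" "c < 1"
  shows "bij (\<lambda>x. x + F x)"
proof (rule bijI)
  show "inj (\<lambda>x. x + F x)"
  proof (rule injI)
    fix x y assume "x + F x = y + F y"
    then have "x - y = F y - F x" by (simp add: algebra_simps)
    then have "norm (x - y) \<le> c * norm (x - y)"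
      using lip [of y x] by (simp add: norm_minus_commute)
    then have "(1 - c) * norm (x - y) \<le> 0" by (simp add: algebra_simps)
    then show "x = y" using c by (simp add: mult_le_0_iff)
  qed
  show "surj (\<lambda>x. x + F x)"
    unfolding surj_def
  proof
    fix y
    have "\<exists>!x. x \<in> UNIV \<and> y - F x = x"
    proof (rule Banach_fix [OF _ _ c])
      show "dist (y - F x) (y - F z) \<le> c * dist x z" for x z
        using lip [of z x] by (simp add: dist_norm norm_minus_commute)
    qed (auto simp: complete_UNIV)
    then obtain x where "y - F x = x" by blast
    then show "\<exists>x. y = x + F x" by (metis diff_add_cancel add.commute)
  qed
qed

text \<open>Milnor's volume argument: for small \<open>t\<close> the maps \<open>id + t F\<close> and \<open>id + t F0\<close> are bijections agreeing off the
  ball, so the cubic polynomials \<open>t \<mapsto> \<integral> det (I + t DF)\<close> and \<open>t \<mapsto> \<integral> det (I + t DF0)\<close> coincide.\<close>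

lemma integral_det_eq:
  fixes F F0 :: "real^3 \<Rightarrow> real^3"
  assumes F: "C1 F" "\<And>x y. norm (F x - F y) \<le> \<Lambda> * norm (x - y)"
    and F0: "C1 F0" "\<And>x y. norm (F0 x - F0 y) \<le> \<Lambda> * norm (x - y)"
    and eq: "\<And>x. x \<notin> cbox l u \<Longrightarrow> F x = F0 x"
  shows "integral (cbox l u) (\<lambda>x. det (jac F x)) = integral (cbox l u) (\<lambda>x. det (jac F0 x))"
proof -
  define \<Lambda>' where "\<Lambda>' = max \<Lambda> 1"
  have \<Lambda>': "\<Lambda>' \<ge> 1" "norm (F x - F y) \<le> \<Lambda>' * norm (x - y)" "norm (F0 x - F0 y) \<le> \<Lambda>' * norm (x - y)" for x y
  proof -
    show "\<Lambda>' \<ge> 1" by (simp add: \<Lambda>'_def)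
    have "\<Lambda> * norm (x - y) \<le> \<Lambda>' * norm (x - y)"
      by (intro mult_right_mono) (auto simp: \<Lambda>'_def)
    then show "norm (F x - F y) \<le> \<Lambda>' * norm (x - y)" "norm (F0 x - F0 y) \<le> \<Lambda>' * norm (x - y)"
      using F(2) [of x y] F0(2) [of x y] by linarith+
  qed
  \<comment> \<open>For small \<open>t\<close> the determinant of \<open>I + t Df\<close> is
    positive, so the volume formula for the image holds without absolute value and yields a cubic
    polynomial in \<open>t\<close>.\<close>
  have poly: "\<exists>\<epsilon>>0. \<forall>t. 0 < t \<and> t < \<epsilon> \<longrightarrow> measure lebesgue ((\<lambda>x. x + t *\<^sub>R f x) ` cbox l u) =
      integral (cbox l u) (\<lambda>x. 1) + t * integral (cbox l u) (\<lambda>x. mat_tr (jac f x))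
      + t\<^sup>2 * integral (cbox l u) (\<lambda>x. mat_minors (jac f x)) + t^3 * integral (cbox l u) (\<lambda>x. det (jac f x))"
    if f: "C1 f" and inj: "\<And>t. 0 < t \<Longrightarrow> t < 1 / (2 * \<Lambda>') \<Longrightarrow> bij (\<lambda>x. x + t *\<^sub>R f x)" for f :: "real^3 \<Rightarrow> real^3"
  proof -
    have c1: "continuous_on (cbox l u) (\<lambda>x. mat_tr (jac f x))"
      and c2: "continuous_on (cbox l u) (\<lambda>x. mat_minors (jac f x))"
      and c3: "continuous_on (cbox l u) (\<lambda>x. det (jac f x))"
      by (auto simp: mat_tr_def mat_minors_def intro!: continuous_on_add continuous_on_diff continuous_on_mult C1_jac(2) continuous_on_det_jac f)
    have i: "g integrable_on (cbox l u)" if "continuous_on (cbox l u) g" for g :: "real^3 \<Rightarrow> real"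
      using that by (rule integrable_continuous)
    have bd: "\<exists>B\<ge>0. \<forall>x\<in>cbox l u. \<bar>g x\<bar> \<le> B" if "continuous_on (cbox l u) g" for g :: "real^3 \<Rightarrow> real"
    proof -
      have "bounded (g ` cbox l u)" using that compact_continuous_image compact_imp_bounded compact_cbox by blast
      then obtain B where "\<forall>x\<in>cbox l u. \<bar>g x\<bar> \<le> B" unfolding bounded_iff by auto
      then show ?thesis by (intro exI [of _ "max B 0"]) (auto intro: max.coboundedI1)
    qed
    obtain B1 B2 B3 where B: "B1 \<ge> 0" "B2 \<ge> 0" "B3 \<ge> 0" "\<And>x. x \<in> cbox l u \<Longrightarrow> \<bar>mat_tr (jac f x)\<bar> \<le> B1"
      "\<And>x. x \<in> cbox l u \<Longrightarrow> \<bar>mat_minors (jac f x)\<bar> \<le> B2" "\<And>x. x \<in> cbox l u \<Longrightarrow> \<bar>det (jac f x)\<bar> \<le> B3"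
      using bd [OF c1] bd [OF c2] bd [OF c3] by metis
    \<comment> \<open>The three bounds serve the bijectivity of \<open>id + t f\<close>, the
      comparison of \<open>t^2\<close> and \<open>t^3\<close> with \<open>t\<close>, and the
      positivity of the determinant.\<close>
    define \<epsilon> where "\<epsilon> = min (1 / (2 * \<Lambda>')) (min 1 (1 / (1 + B1 + B2 + B3)))"
    have "\<Lambda>' > 0" "1 + B1 + B2 + B3 > 0" using \<Lambda>'(1) B(1-3) by linarith+
    then have \<epsilon>: "\<epsilon> > 0" by (simp add: \<epsilon>_def)
    show ?thesis
    proof (intro exI conjI allI impI)
      show "\<epsilon> > 0" by (rule \<epsilon>)
      fix t :: real assume t: "0 < t \<and> t < \<epsilon>"
      then have t1: "0 < t" "t < 1 / (2 * \<Lambda>')" "t < 1" "t < 1 / (1 + B1 + B2 + B3)"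
        by (auto simp: \<epsilon>_def)
      then have t2: "t * (1 + B1 + B2 + B3) < 1"
        using B(1-3) by (simp add: less_divide_eq)
      let ?h = "\<lambda>x. x + t *\<^sub>R f x"
      have der: "(?h has_derivative (\<lambda>v. v + t *\<^sub>R frechet_derivative f (at x) v)) (at x within cbox l u)" for x
        by (auto intro!: derivative_eq_intros has_derivative_at_withinI [OF C1_jac(1) [OF f]])
      have mx: "matrix (\<lambda>v. v + t *\<^sub>R frechet_derivative f (at x) v) = mat 1 + t *\<^sub>R jac f x" for x
        by (simp add: matrix_def mat_def vec_eq_iff axis_def)
      have pos: "det (mat 1 + t *\<^sub>R jac f x) > 0" if x: "x \<in> cbox l u" for x
      proof -
        have tt: "t\<^sup>2 \<le> t" "t^3 \<le> t"
          using t1 power_decreasing [of 1 2 t] power_decreasing [of 1 3 t] by auto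
        have "\<bar>t * mat_tr (jac f x)\<bar> \<le> t * B1"
          using t1 B(4) [OF x] by (simp add: abs_mult)
        moreover have "\<bar>t\<^sup>2 * mat_minors (jac f x)\<bar> \<le> t * B2"
          using mult_mono [OF tt(1) B(5) [OF x]] t1 by (simp add: abs_mult)
        moreover have "\<bar>t^3 * det (jac f x)\<bar> \<le> t * B3"
          using mult_mono [OF tt(2) B(6) [OF x]] t1 by (simp add: abs_mult)
        moreover have "t * B1 + t * B2 + t * B3 < 1"
          using t1 t2 by (simp add: algebra_simps)
        ultimately show ?thesis unfolding det_id_plus by linarith
      qed
      have "measure lebesgue (?h ` cbox l u) = integral (cbox l u) (\<lambda>x. \<bar>det (matrix (\<lambda>v. v + t *\<^sub>R frechet_derivative f (at x) v))\<bar>)"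
      proof (rule measure_differentiable_image_eq [OF _ der])
        show "inj_on ?h (cbox l u)" using inj t1 by (meson bij_is_inj inj_on_subset subset_UNIV)
        show "(\<lambda>x. \<bar>det (matrix (\<lambda>v. v + t *\<^sub>R frechet_derivative f (at x) v))\<bar>) integrable_on cbox l u"
          unfolding mx det_id_plus by (intro i continuous_intros c1 c2 c3)
      qed auto
      also have "\<dots> = integral (cbox l u) (\<lambda>x. 1 + t * mat_tr (jac f x) + t\<^sup>2 * mat_minors (jac f x) + t^3 * det (jac f x))"
      proof (rule integral_cong)
        show "\<bar>det (matrix (\<lambda>v. v + t *\<^sub>R frechet_derivative f (at x) v))\<bar> =
            1 + t * mat_tr (jac f x) + t\<^sup>2 * mat_minors (jac f x) + t^3 * det (jac f x)" if "x \<in> cbox l u" for x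
          using pos [OF that] unfolding mx det_id_plus by linarith
      qed
      also have "\<dots> = integral (cbox l u) (\<lambda>x. 1) + t * integral (cbox l u) (\<lambda>x. mat_tr (jac f x))
      + t\<^sup>2 * integral (cbox l u) (\<lambda>x. mat_minors (jac f x)) + t^3 * integral (cbox l u) (\<lambda>x. det (jac f x))"
        by (intro integral_unique has_integral_add has_integral_mult_right integrable_integral i c1 c2 c3 continuous_on_const)
      finally show "measure lebesgue (?h ` cbox l u) = integral (cbox l u) (\<lambda>x. 1) + t * integral (cbox l u) (\<lambda>x. mat_tr (jac f x))
      + t\<^sup>2 * integral (cbox l u) (\<lambda>x. mat_minors (jac f x)) + t^3 * integral (cbox l u) (\<lambda>x. det (jac f x))" .
    qed
  qed
  have bij: "bij (\<lambda>x. x + t *\<^sub>R f x)" if "0 < t" "t < 1 / (2 * \<Lambda>')" "\<And>x y. norm (f x - f y) \<le> \<Lambda>' * norm (x - y)"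
    for f :: "real^3 \<Rightarrow> real^3" and t
  proof (rule id_plus_lipschitz_bij [of _ "1/2"])
    fix x y
    have "norm (t *\<^sub>R f x - t *\<^sub>R f y) = t * norm (f x - f y)"
    proof -
      have "t *\<^sub>R f x - t *\<^sub>R f y = t *\<^sub>R (f x - f y)" by (simp only: scaleR_diff_right)
      then show ?thesis using that(1) by (simp only: norm_scaleR abs_of_pos)
    qed
    also have "\<dots> \<le> t * (\<Lambda>' * norm (x - y))"
      by (rule mult_left_mono [OF that(3)]) (rule less_imp_le [OF that(1)])
    also have "\<dots> = (t * \<Lambda>') * norm (x - y)" by simp
    also have "\<dots> \<le> 1/2 * norm (x - y)"
    proof (rule mult_right_mono)
      have "\<Lambda>' > 0" using \<Lambda>'(1) by linarith
      then show "t * \<Lambda>' \<le> 1/2" using that(2) by (simp add: less_divide_eq)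
    qed auto
    finally show "norm (t *\<^sub>R f x - t *\<^sub>R f y) \<le> 1/2 * norm (x - y)" .
  qed auto
  \<comment> \<open>Both maps are bijections and agree outside the box, so they have the same image
    of the complement and hence of the box.\<close>
  have im: "(\<lambda>x. x + t *\<^sub>R F x) ` cbox l u = (\<lambda>x. x + t *\<^sub>R F0 x) ` cbox l u" if t: "0 < t" "t < 1 / (2 * \<Lambda>')" for t
  proof -
    have *: "f ` cbox l u = - (f ` (- cbox l u))" if "bij f" for f :: "real^3 \<Rightarrow> real^3"
      using bij_image_Compl_eq [OF that, of "cbox l u"] by (metis double_complement)
    have "(\<lambda>x. x + t *\<^sub>R F x) ` (- cbox l u) = (\<lambda>x. x + t *\<^sub>R F0 x) ` (- cbox l u)"
      by (rule image_cong) (auto simp: eq)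
    then show ?thesis
      by (simp only: * [OF bij [OF t \<Lambda>'(2)]] * [OF bij [OF t \<Lambda>'(3)]])
  qed
  obtain \<epsilon>1 where e1: "\<epsilon>1 > 0" "\<forall>t. 0 < t \<and> t < \<epsilon>1 \<longrightarrow> measure lebesgue ((\<lambda>x. x + t *\<^sub>R F x) ` cbox l u) =
      integral (cbox l u) (\<lambda>x. 1) + t * integral (cbox l u) (\<lambda>x. mat_tr (jac F x))
      + t\<^sup>2 * integral (cbox l u) (\<lambda>x. mat_minors (jac F x)) + t^3 * integral (cbox l u) (\<lambda>x. det (jac F x))"
    using poly [OF F(1) bij [OF _ _ \<Lambda>'(2)]] by blast
  obtain \<epsilon>2 where e2: "\<epsilon>2 > 0" "\<forall>t. 0 < t \<and> t < \<epsilon>2 \<longrightarrow> measure lebesgue ((\<lambda>x. x + t *\<^sub>R F0 x) ` cbox l u) =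
      integral (cbox l u) (\<lambda>x. 1) + t * integral (cbox l u) (\<lambda>x. mat_tr (jac F0 x))
      + t\<^sup>2 * integral (cbox l u) (\<lambda>x. mat_minors (jac F0 x)) + t^3 * integral (cbox l u) (\<lambda>x. det (jac F0 x))"
    using poly [OF F0(1) bij [OF _ _ \<Lambda>'(3)]] by blast
  define \<alpha> where "\<alpha> = integral (cbox l u) (\<lambda>x. mat_tr (jac F x)) - integral (cbox l u) (\<lambda>x. mat_tr (jac F0 x))"
  define \<beta> where "\<beta> = integral (cbox l u) (\<lambda>x. mat_minors (jac F x)) - integral (cbox l u) (\<lambda>x. mat_minors (jac F0 x))"
  define \<gamma> where "\<gamma> = integral (cbox l u) (\<lambda>x. det (jac F x)) - integral (cbox l u) (\<lambda>x. det (jac F0 x))"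
  \<comment> \<open>A cubic polynomial without constant term that vanishes at \<open>s\<close>,
    \<open>2 s\<close> and \<open>3 s\<close> is zero; the division by 4 keeps all three points
    below the bounds.\<close>
  define s where "s = min (min \<epsilon>1 \<epsilon>2) (1 / (2 * \<Lambda>')) / 4"
  have "\<Lambda>' > 0" using \<Lambda>'(1) by linarith
  then have s: "s > 0" using e1(1) e2(1) by (simp add: s_def)
  have s4: "4 * s \<le> \<epsilon>1" "4 * s \<le> \<epsilon>2" "4 * s \<le> 1 / (2 * \<Lambda>')" by (auto simp: s_def)
  have z: "t * \<alpha> + t\<^sup>2 * \<beta> + t^3 * \<gamma> = 0" if "t \<in> {s, 2 * s, 3 * s}" for t
  proof -
    have t: "0 < t" "t < \<epsilon>1" "t < \<epsilon>2" "t < 1 / (2 * \<Lambda>')"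
      using that s s4 by (elim insertE emptyE; linarith)+
    show ?thesis
      using e1(2) [rule_format, of t] e2(2) [rule_format, of t] im [of t] t unfolding \<alpha>_def \<beta>_def \<gamma>_def
      by (simp add: algebra_simps)
  qed
  have "s * \<alpha> + s\<^sup>2 * \<beta> + s^3 * \<gamma> = 0" "2 * (s * \<alpha>) + 4 * (s\<^sup>2 * \<beta>) + 8 * (s^3 * \<gamma>) = 0"
    "3 * (s * \<alpha>) + 9 * (s\<^sup>2 * \<beta>) + 27 * (s^3 * \<gamma>) = 0"
    using z [of s] z [of "2 * s"] z [of "3 * s"] by (simp_all add: power_mult_distrib)
  then have "s^3 * \<gamma> = 0" by linarith
  then show ?thesis using s by (simp add: \<gamma>_def)
qed

section \<open>Counting zeros by an integral\<close>

definition squash :: "real \<Rightarrow> real^3 \<Rightarrow> real^3" where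
  "squash \<eta> w = (\<chi> i. cutoff (- \<eta>) \<eta> (w $ i))"

lemma squash_deriv:
  assumes "\<eta> > 0"
  shows "(squash \<eta> has_derivative (\<lambda>v. \<chi> i. cutoff' (- \<eta>) \<eta> (w $ i) * v $ i)) (at w)"
  unfolding has_derivative_componentwise_within [of "squash \<eta>"]
proof
  fix b :: "real^3" assume "b \<in> Basis"
  then obtain i where b: "b = axis i 1" by (auto simp: Basis_vec_def)
  have "((\<lambda>x. x $ i) has_derivative (\<lambda>v. v $ i)) (at w)"
    by (intro bounded_linear_imp_has_derivative bounded_linear_vec_nth)
  moreover have "(cutoff (- \<eta>) \<eta> has_derivative (\<lambda>h. cutoff' (- \<eta>) \<eta> (w $ i) * h)) (at (w $ i))"
    using cutoff_deriv [of "- \<eta>" \<eta>] assms by (simp add: has_field_derivative_def)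
  ultimately have "((\<lambda>x. cutoff (- \<eta>) \<eta> (x $ i)) has_derivative (\<lambda>v. cutoff' (- \<eta>) \<eta> (w $ i) * v $ i)) (at w)"
    by (rule has_derivative_compose)
  then show "((\<lambda>x. squash \<eta> x \<bullet> b) has_derivative (\<lambda>x. (\<chi> i. cutoff' (- \<eta>) \<eta> (w $ i) * x $ i) \<bullet> b)) (at w)"
    by (simp add: b inner_axis squash_def)
qed

lemma C1_squash:
  assumes "\<eta> > 0" shows "C1 (squash \<eta>)"
proof (rule C1_euclidean)
  fix b :: "real^3" assume "b \<in> Basis"
  then obtain i where b: "b = axis i 1" by (auto simp: Basis_vec_def)
  have "C1 (\<lambda>x :: real^3. cutoff (- \<eta>) \<eta> (x $ i))"
    by (rule C1_compose [OF C1_cutoff C1_bounded_linear [OF bounded_linear_vec_nth]]) (use assms in simp)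
  then show "C1 (\<lambda>x. squash \<eta> x \<bullet> b)"
    by (simp add: b inner_axis squash_def)
qed

lemma inj_on_squash: "inj_on (squash \<eta>) {w. \<forall>i. \<bar>w $ i\<bar> < \<eta>}"
proof (rule inj_onI)
  fix v w assume *: "v \<in> {w. \<forall>i. \<bar>w $ i\<bar> < \<eta>}" "w \<in> {w. \<forall>i. \<bar>w $ i\<bar> < \<eta>}" "squash \<eta> v = squash \<eta> w"
  have "v $ i = w $ i" for i
  proof (rule ccontr)
    have b: "- \<eta> \<le> v $ i" "v $ i \<le> \<eta>" "- \<eta> \<le> w $ i" "w $ i \<le> \<eta>"
      using *(1,2) by (auto simp: abs_less_iff less_imp_le minus_less_iff)
    have "cutoff (- \<eta>) \<eta> (v $ i) = cutoff (- \<eta>) \<eta> (w $ i)"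
      using *(3) by (simp add: squash_def vec_eq_iff)
    moreover assume "v $ i \<noteq> w $ i"
    then have "v $ i < w $ i \<or> w $ i < v $ i" by linarith
    ultimately show False
      using cutoff_strict [of "- \<eta>" "v $ i" "w $ i" \<eta>] cutoff_strict [of "- \<eta>" "w $ i" "v $ i" \<eta>] b by auto
  qed
  then show "v = w" by (simp add: vec_eq_iff)
qed

lemma open_cube: "open {w :: real^3. \<forall>i. \<bar>w $ i\<bar> < \<eta>}"
proof -
  have "{w :: real^3. \<forall>i. \<bar>w $ i\<bar> < \<eta>} = (\<Inter>i. {w. \<bar>w $ i\<bar> < \<eta>})" by auto
  then show ?thesis
    by (auto intro!: open_INT open_Collect_less continuous_intros)
qed

text \<open>The squashed cube is open by invariance of domain. Its volume is the unit in which zeros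
  are counted.\<close>

lemma measure_squash_pos:
  assumes "\<eta> > 0"
  shows "measure lebesgue (squash \<eta> ` {w. \<forall>i. \<bar>w $ i\<bar> < \<eta>}) > 0"
proof -
  let ?Q = "{w :: real^3. \<forall>i. \<bar>w $ i\<bar> < \<eta>}"
  have op: "open (squash \<eta> ` ?Q)"
    by (rule invariance_of_domain [OF C1_continuous_on [OF C1_squash [OF assms]] open_cube inj_on_squash])
  have "(0 :: real^3) \<in> ?Q" using assms by auto
  then have ne: "squash \<eta> ` ?Q \<noteq> {}" by blast
  have "squash \<eta> ` ?Q \<subseteq> cbox 0 1"
    using cutoff_bounds by (auto simp: squash_def mem_box_cart)
  then have "bounded (squash \<eta> ` ?Q)" by (rule bounded_subset [OF bounded_cbox])
  then have "squash \<eta> ` ?Q \<in> lmeasurable"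
    using op by (rule lmeasurable_open)
  moreover have "\<not> negligible (squash \<eta> ` ?Q)"
    using open_not_negligible [OF op ne] .
  ultimately show ?thesis
    by (simp add: negligible_iff_measure zero_less_measure_iff)
qed

text \<open>The derivative of \<open>squash\<close> is diagonal and degenerates as soon as one
  component of the value leaves the open interval from \<open>- \<eta>\<close> to
  \<open>\<eta>\<close>. So the determinant of a squashed field lives only where the field is small,
  that is, near its zeros.\<close>

lemma det_jac_squash:
  assumes g: "C1 g" and \<eta>: "\<eta> > 0"
  shows "det (jac (\<lambda>x. squash \<eta> (g x)) x) = (\<Prod>i\<in>UNIV. cutoff' (- \<eta>) \<eta> (g x $ i)) * det (jac g x)"
proof -
  let ?D = "\<lambda>v :: real^3. \<chi> i. cutoff' (- \<eta>) \<eta> (g x $ i) * v $ i"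
  have "((\<lambda>x. squash \<eta> (g x)) has_derivative (\<lambda>v. ?D (frechet_derivative g (at x) v))) (at x)"
    by (rule has_derivative_compose [OF C1_jac(1) [OF g] squash_deriv [OF \<eta>]])
  then have eq: "frechet_derivative (\<lambda>x. squash \<eta> (g x)) (at x) = (\<lambda>v. ?D (frechet_derivative g (at x) v))"
    by (rule frechet_derivative_at [symmetric])
  have "jac (\<lambda>x. squash \<eta> (g x)) x = (\<chi> i. cutoff' (- \<eta>) \<eta> (g x $ i) *s (jac g x $ i))"
    unfolding eq by (simp add: matrix_def vec_eq_iff)
  then show ?thesis
    by (simp only: det_rows_mul vec_lambda_eta)
qed

text \<open>Near a zero the field is a linear isomorphism, so its squashed version maps a
  neighbourhood bijectively onto the squashed cube. By change of variables each zero contributes the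
  volume of that set, with the sign of \<open>det (B p)\<close> reversed.\<close>

lemma integral_det_squash:
  fixes g :: "real^3 \<Rightarrow> real^3" and B :: "real^3 \<Rightarrow> real^3^3"
  assumes g: "C1 g" and \<eta>: "\<eta> > 0" and P: "finite P"
    and sub: "\<And>p. p \<in> P \<Longrightarrow> ball p r \<subseteq> cbox l u"
    and disj: "\<And>p q. p \<in> P \<Longrightarrow> q \<in> P \<Longrightarrow> p \<noteq> q \<Longrightarrow> ball p r \<inter> ball q r = {}"
    and lin: "\<And>p y. p \<in> P \<Longrightarrow> y \<in> ball p r \<Longrightarrow> g y = B p *v (y - p)"
    and small: "\<And>y. (\<And>i. \<bar>g y $ i\<bar> < \<eta>) \<Longrightarrow> \<exists>p\<in>P. y \<in> ball p r"
    and small': "\<And>p v. p \<in> P \<Longrightarrow> (\<And>i. \<bar>(B p *v v) $ i\<bar> < \<eta>) \<Longrightarrow> norm v < r"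
    and det: "\<And>p. p \<in> P \<Longrightarrow> det (B p) \<noteq> 0"
  shows "integral (cbox l u) (\<lambda>x. det (jac (\<lambda>x. squash \<eta> (g x)) x)) =
     - (\<Sum>p\<in>P. sgn (det (B p))) * measure lebesgue (squash \<eta> ` {w. \<forall>i. \<bar>w $ i\<bar> < \<eta>})"
proof -
  define Q where "Q = {w :: real^3. \<forall>i. \<bar>w $ i\<bar> < \<eta>}"
  define V where "V = measure lebesgue (squash \<eta> ` Q)"
  define h where "h x = squash \<eta> (g x)" for x
  have Ch: "C1 h"
    unfolding h_def [abs_def] by (rule C1_compose [OF C1_squash [OF \<eta>] g])
  define D where "D x = det (jac h x)" for x
  have D: "D x = (\<Prod>i\<in>UNIV. cutoff' (- \<eta>) \<eta> (g x $ i)) * det (jac g x)" for x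
    using det_jac_squash [OF g \<eta>] unfolding D_def h_def [abs_def] .
  have contD: "continuous_on A D" for A
    unfolding D_def [abs_def] by (rule continuous_on_det_jac [OF Ch])
  have jacg: "jac g y = B p" if "p \<in> P" "y \<in> ball p r" for p y
  proof -
    have "((\<lambda>y. B p *v (y - p)) has_derivative (\<lambda>v. B p *v v)) (at y)"
      by (rule has_derivative_eq_rhs, rule bounded_linear.has_derivative [OF matrix_vector_mul_bounded_linear])
         (auto intro!: derivative_eq_intros)
    then have "(g has_derivative (\<lambda>v. B p *v v)) (at y)"
      by (rule has_derivative_transform_within_open [where s = "ball p r"]) (use that lin in auto)
    then have "frechet_derivative g (at y) = (\<lambda>v. B p *v v)"
      by (rule frechet_derivative_at [symmetric])
    then show ?thesis by simp
  qed
  define Z where "Z p = {x \<in> ball p r. g x \<in> Q}" for p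
  have openZ: "open (Z p)" for p
  proof -
    have "open (ball p r \<inter> g -` Q)"
      by (rule continuous_open_preimage) (auto simp: Q_def open_cube C1_continuous_on [OF g])
    then show ?thesis by (simp add: Z_def vimage_def Int_def)
  qed
  have Zsub: "Z p \<subseteq> cbox l u" if "p \<in> P" for p
    using sub [OF that] by (auto simp: Z_def)
  have D0: "D x = 0" if "x \<notin> (\<Union>p\<in>P. Z p)" for x
  proof -
    have "\<not> (\<forall>i. \<bar>g x $ i\<bar> < \<eta>)"
      using small [of x] that by (auto simp: Z_def Q_def)
    then obtain i where i: "\<not> \<bar>g x $ i\<bar> < \<eta>" by blast
    then have "cutoff' (- \<eta>) \<eta> (g x $ i) = 0"
      using \<eta> by (intro cutoff'_zero) auto
    then show ?thesis unfolding D by (auto simp: prod_zero_iff)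
  qed
  \<comment> \<open>The three diagonal factors are negative inside the cube, so their product
    reverses the sign of the determinant.\<close>
  have Dneg: "D x = - sgn (det (B p)) * \<bar>D x\<bar>" if "p \<in> P" "x \<in> Z p" for p x
  proof -
    have neg: "cutoff' (- \<eta>) \<eta> (g x $ i) < 0" for i
    proof (rule cutoff'_neg)
      have "\<bar>g x $ i\<bar> < \<eta>" using that by (auto simp: Z_def Q_def)
      then show "- \<eta> < g x $ i" "g x $ i < \<eta>" by auto
    qed
    have p3: "(\<Prod>i\<in>UNIV. cutoff' (- \<eta>) \<eta> (g x $ i)) < 0"
      unfolding UNIV_3 using mult_neg_pos [OF neg [of 1] mult_neg_neg [OF neg [of 2] neg [of 3]]] by simp
    have "det (jac g x) = det (B p)"
      using jacg that by (simp add: Z_def)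
    moreover have "c * d = - sgn d * \<bar>c * d\<bar>" if "c < 0" for c d :: real
      using that by (cases d "0 :: real" rule: linorder_cases) (auto simp: abs_mult)
    ultimately show ?thesis
      unfolding D using p3 by simp
  qed
  have Zint: "((\<lambda>x. D x) has_integral (- sgn (det (B p)) * V)) (Z p)" if p: "p \<in> P" for p
  proof -
    obtain C where C: "B p ** C = mat 1" "C ** B p = mat 1"
      using det [OF p] invertible_det_nz unfolding invertible_def by blast
    have inj: "inj_on h (Z p)"
    proof (rule inj_onI)
      fix x y assume *: "x \<in> Z p" "y \<in> Z p" "h x = h y"
      then have "g x = g y"
        using inj_on_squash [of \<eta>] unfolding h_def inj_on_def by (auto simp: Z_def Q_def)
      then have "B p *v x = B p *v y"
        using lin [OF p] * by (auto simp: Z_def matrix_vector_mult_diff_distrib)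
      then have "C ** B p *v x = C ** B p *v y"
        by (simp flip: matrix_vector_mul_assoc)
      then show "x = y"
        by (simp add: C)
    qed
    have img: "h ` Z p = squash \<eta> ` Q"
    proof -
      have "g ` Z p = Q"
      proof (intro equalityI subsetI)
        fix w assume w: "w \<in> Q"
        define v where "v = C *v w"
        have Bv: "B p *v v = w"
          by (simp add: v_def matrix_vector_mul_assoc C)
        have "norm v < r"
          using small' [OF p, of v] w Bv by (auto simp: Q_def)
        then have "p + v \<in> ball p r" by (simp add: dist_norm)
        moreover from this have "g (p + v) = w"
          using lin [OF p] Bv by simp
        ultimately show "w \<in> g ` Z p"
          using w by (force simp: Z_def)
      qed (auto simp: Z_def)
      then show ?thesis unfolding h_def by (metis image_image)
    qed
    have ab: "(\<lambda>x. \<bar>D x\<bar>) integrable_on Z p"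
    proof -
      have "(\<lambda>x. \<bar>D x\<bar>) absolutely_integrable_on cbox l u"
        by (intro absolutely_integrable_continuous continuous_intros contD)
      then have "(\<lambda>x. \<bar>D x\<bar>) absolutely_integrable_on Z p"
        by (rule set_integrable_subset) (use openZ Zsub [OF p] in auto)
      then show ?thesis by (rule set_lebesgue_integral_eq_integral)
    qed
    have der: "(h has_derivative frechet_derivative h (at x)) (at x within Z p)" for x
      by (rule has_derivative_at_withinI [OF C1_jac(1) [OF Ch]])
    have "measure lebesgue (h ` Z p) = integral (Z p) (\<lambda>x. \<bar>det (jac h x)\<bar>)"
      by (rule measure_differentiable_image_eq [OF _ der inj])
         (use openZ ab in \<open>auto simp: D_def\<close>)
    then have "((\<lambda>x. \<bar>D x\<bar>) has_integral V) (Z p)"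
      using ab unfolding V_def img D_def by (metis integrable_integral)
    then have "((\<lambda>x. - sgn (det (B p)) * \<bar>D x\<bar>) has_integral (- sgn (det (B p)) * V)) (Z p)"
      by (rule has_integral_mult_right)
    then show ?thesis
      by (rule has_integral_eq [rotated]) (use Dneg [OF p] in simp)
  qed
  have disjZ: "x \<notin> Z q" if "p \<in> P" "q \<in> P" "p \<noteq> q" "x \<in> Z p" for p q x
    using disj [OF that(1-3)] that(4) by (auto simp: Z_def)
  have "((\<lambda>x. \<Sum>p\<in>P. if x \<in> Z p then D x else 0) has_integral (\<Sum>p\<in>P. - sgn (det (B p)) * V)) (cbox l u)"
    by (intro has_integral_sum P, subst has_integral_restrict [OF Zsub]) (rule Zint | assumption)+
  moreover have "(\<Sum>p\<in>P. if x \<in> Z p then D x else 0) = D x" for x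
  proof (cases "x \<in> (\<Union>p\<in>P. Z p)")
    case True
    then obtain p where p: "p \<in> P" "x \<in> Z p" by blast
    have "(\<Sum>q\<in>P. if x \<in> Z q then D x else 0) = (\<Sum>q\<in>P. if q = p then D x else 0)"
      by (rule sum.cong) (use p disjZ in auto)
    then show ?thesis using p P by simp
  next
    case False
    then have "(\<Sum>p\<in>P. if x \<in> Z p then D x else 0) = 0"
      by (intro sum.neutral) auto
    then show ?thesis using D0 [OF False] by simp
  qed
  ultimately have "(D has_integral (\<Sum>p\<in>P. - sgn (det (B p)) * V)) (cbox l u)"
    by simp
  then show ?thesis
    unfolding D_def [abs_def] h_def [abs_def] V_def Q_def
    by (simp add: integral_unique sum_distrib_right sum_negf)
qed

text \<open>The derivative vanishes outside the box and is bounded inside, so the mean value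
  inequality applies globally.\<close>

lemma C1_locally_const_imp_lipschitz:
  fixes w :: "'a::euclidean_space \<Rightarrow> 'b::real_normed_vector"
  assumes w: "C1 w" and c: "\<And>x. x \<notin> cbox l u \<Longrightarrow> w x = c"
  shows "\<exists>\<Lambda>\<ge>0. \<forall>x y. norm (w x - w y) \<le> \<Lambda> * norm (x - y)"
proof -
  obtain w' where w': "\<And>x. (w has_derivative blinfun_apply (w' x)) (at x)" "continuous_on UNIV w'"
    using C1E [OF w] by blast
  have "bounded (w' ` cbox l u)"
    by (intro compact_imp_bounded compact_continuous_image continuous_on_subset [OF w'(2)]) (auto simp: compact_cbox)
  then obtain \<Lambda> where \<Lambda>: "\<And>x. x \<in> cbox l u \<Longrightarrow> norm (w' x) \<le> \<Lambda>"
    unfolding bounded_iff by blast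
  have bound: "onorm (blinfun_apply (w' x)) \<le> max \<Lambda> 0" for x
  proof (cases "x \<in> cbox l u")
    case True
    then show ?thesis using \<Lambda> [OF True] by (simp add: norm_blinfun.rep_eq)
  next
    case False
    have "(w has_derivative (\<lambda>h. 0)) (at x)"
      by (rule has_derivative_transform_within_open [OF has_derivative_const, where s = "- cbox l u"])
         (use False c in \<open>auto simp: closed_cbox\<close>)
    then have "blinfun_apply (w' x) = (\<lambda>h. 0)"
      using has_derivative_unique [OF w'(1)] by blast
    then show ?thesis by (simp add: onorm_zero)
  qed
  have "norm (w x - w y) \<le> max \<Lambda> 0 * norm (x - y)" for x y
    by (rule differentiable_bound [of UNIV w "\<lambda>x. blinfun_apply (w' x)"])
       (use w'(1) bound in auto)
  then show ?thesis by (intro exI [of _ "max \<Lambda> 0"]) auto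
qed

lemma squash_lipschitz:
  assumes "\<eta> > 0"
  shows "\<exists>\<Lambda>\<ge>0. \<forall>v w. norm (squash \<eta> v - squash \<eta> w) \<le> \<Lambda> * norm (v - w)"
proof -
  have "C1 (\<lambda>t. cutoff (- \<eta>) \<eta> t - 1)"
    by (intro C1_diff C1_const C1_cutoff) (use assms in auto)
  have "\<bar>cutoff' (- \<eta>) \<eta> t\<bar> \<le> 4 / (2 * \<eta>)" for t
  proof (cases "- \<eta> < t \<and> t < \<eta>")
    case True
    define s where "s = (t + \<eta>) / (2 * \<eta>)"
    have s: "0 < s" "s < 1" using True by (auto simp: s_def)
    then have s2: "s\<^sup>2 < 1" by (simp add: power_less_one_iff)
    have "(1 - s\<^sup>2) * s \<le> 1 * 1"
      by (rule mult_mono) (use s s2 in auto)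
    moreover have "0 \<le> (1 - s\<^sup>2) * s" using s s2 by simp
    moreover have "cutoff' (- \<eta>) \<eta> t = - 4 * ((1 - s\<^sup>2) * s) / (2 * \<eta>)"
    proof -
      have "max 0 ((t - - \<eta>) / (\<eta> - - \<eta>)) = s" "\<eta> - - \<eta> = 2 * \<eta>"
        using s by (auto simp: s_def)
      moreover have "max 0 (1 - s\<^sup>2) = 1 - s\<^sup>2" using s2 by simp
      ultimately show ?thesis
        unfolding cutoff'_def by (simp only: mult.assoc)
    qed
    ultimately have "- cutoff' (- \<eta>) \<eta> t \<le> 4 * 1 / (2 * \<eta>)"
      using assms divide_right_mono [of "4 * ((1 - s\<^sup>2) * s)" "4 * 1" "2 * \<eta>"] by simp
    moreover have "cutoff' (- \<eta>) \<eta> t < 0" using True by (intro cutoff'_neg) auto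
    ultimately show ?thesis by linarith
  next
    case False
    then have "cutoff' (- \<eta>) \<eta> t = 0" using assms by (intro cutoff'_zero) auto
    then show ?thesis using assms by simp
  qed
  note bd = this
  have cl: "\<bar>cutoff (- \<eta>) \<eta> s - cutoff (- \<eta>) \<eta> t\<bar> \<le> 4 / (2 * \<eta>) * \<bar>s - t\<bar>" for s t
  proof -
    have "norm (cutoff (- \<eta>) \<eta> s - cutoff (- \<eta>) \<eta> t) \<le> 4 / (2 * \<eta>) * norm (s - t)"
      by (rule field_differentiable_bound [of UNIV _ "cutoff' (- \<eta>) \<eta>"])
         (use bd cutoff_deriv [of "- \<eta>" \<eta>] assms in auto)
    then show ?thesis by simp
  qed
  have "norm (squash \<eta> v - squash \<eta> w) \<le> 3 * (4 / (2 * \<eta>)) * norm (v - w)" for v w :: "real^3"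
  proof -
    have "norm (squash \<eta> v - squash \<eta> w) \<le> (\<Sum>i\<in>UNIV. \<bar>(squash \<eta> v - squash \<eta> w) $ i\<bar>)"
      by (rule norm_le_l1_cart)
    also have "\<dots> \<le> (\<Sum>i\<in>(UNIV :: 3 set). 4 / (2 * \<eta>) * norm (v - w))"
    proof (rule sum_mono)
      fix i :: 3
      have "\<bar>(squash \<eta> v - squash \<eta> w) $ i\<bar> \<le> 4 / (2 * \<eta>) * \<bar>(v - w) $ i\<bar>"
        using cl by (simp add: squash_def)
      also have "\<dots> \<le> 4 / (2 * \<eta>) * norm (v - w)"
        by (rule mult_left_mono [OF component_le_norm_cart]) (use assms in auto)
      finally show "\<bar>(squash \<eta> v - squash \<eta> w) $ i\<bar> \<le> 4 / (2 * \<eta>) * norm (v - w)" .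
    qed
    also have "\<dots> = 3 * (4 / (2 * \<eta>)) * norm (v - w)"
      by (simp add: sum_3)
    finally show ?thesis .
  qed
  then show ?thesis
    by (intro exI [of _ "3 * (4 / (2 * \<eta>))"]) (use assms in auto)
qed

text \<open>The Poincare-Hopf count for a field that equals \<open>- y\<close> far out. A smooth
  replacement with the same zeros is squashed and compared with the squashed field
  \<open>- y\<close>, whose only zero has sign -1.\<close>

theorem zero_index_sum:
  fixes f :: "real^3 \<Rightarrow> real^3" and B :: "real^3 \<Rightarrow> real^3^3"
  assumes contf: "continuous_on UNIV f" and P: "finite P" and R: "R > 0"
    and out: "\<And>y. norm y \<ge> R \<Longrightarrow> f y = - y"
    and r0: "r0 > 0" and lin: "\<And>p y. p \<in> P \<Longrightarrow> dist p y < r0 \<Longrightarrow> f y = B p *v (y - p)"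
    and zeros: "\<And>y. f y = 0 \<longleftrightarrow> y \<in> P"
    and det: "\<And>p. p \<in> P \<Longrightarrow> det (B p) \<noteq> 0"
  shows "(\<Sum>p\<in>P. sgn (det (B p))) = -1"
proof -
  have PR: "norm p < R" if "p \<in> P" for p
  proof (rule ccontr)
    assume "\<not> norm p < R"
    then have "f p = - p" "p \<noteq> 0" using out [of p] R by auto
    then show False using zeros [of p] that by simp
  qed
  obtain d where d: "d > 0" "\<And>p q. p \<in> P \<Longrightarrow> q \<in> P \<Longrightarrow> p \<noteq> q \<Longrightarrow> d \<le> dist p q"
  proof -
    have "\<exists>d>0. \<forall>q\<in>P. q \<noteq> p \<longrightarrow> d \<le> dist p q" for p
      using finite_set_avoid [OF P, of p] by blast
    then obtain D where D: "\<And>p. D p > 0" "\<And>p q. q \<in> P \<Longrightarrow> q \<noteq> p \<Longrightarrow> D p \<le> dist p q" by metis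
    show thesis
    proof (rule that [of "Min (insert 1 (D ` P))"])
      show "0 < Min (insert 1 (D ` P))" using P D by auto
      show "Min (insert 1 (D ` P)) \<le> dist p q" if "p \<in> P" "q \<in> P" "p \<noteq> q" for p q
        using D(2) [of q p] that P by (metis Min_le finite.insertI finite_imageI image_eqI insertI2 order_trans)
    qed
  qed
  define r where "r = min (min r0 1) (d / 2)"
  have r: "r > 0" "r \<le> r0" "r \<le> 1" "r \<le> d / 2" using r0 d by (auto simp: r_def)
  have disj: "ball p r \<inter> ball q r = {}" if "p \<in> P" "q \<in> P" "p \<noteq> q" for p q
  proof -
    have "2 * r \<le> dist p q" using d(2) [OF that] r by linarith
    then show ?thesis by (intro disjoint_ballI) auto
  qed
  have bR: "norm y < R + 1" if "p \<in> P" "y \<in> ball p r" for p y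
  proof -
    have "norm y \<le> norm p + dist p y" by (metis dist_norm dist_commute norm_triangle_sub)
    then show ?thesis using PR [OF that(1)] that(2) r by auto
  qed
  obtain \<beta> where \<beta>: "\<beta> > 0" "\<And>p v. p \<in> P \<Longrightarrow> \<beta> * norm v \<le> norm (B p *v v)"
  proof -
    have "\<exists>b>0. \<forall>v. b * norm v \<le> norm (B p *v v)" if "p \<in> P" for p
    proof -
      have "inj ((*v) (B p))"
        using det [OF that] by (simp add: inj_matrix_vector_mult invertible_det_nz)
      then show ?thesis
        using linear_inj_bounded_below_pos [OF matrix_vector_mul_linear] by metis
    qed
    then obtain D where D: "\<And>p. p \<in> P \<Longrightarrow> D p > 0" "\<And>p v. p \<in> P \<Longrightarrow> D p * norm v \<le> norm (B p *v v)" by metis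
    show thesis
    proof (rule that [of "Min (insert 1 (D ` P))"])
      show "0 < Min (insert 1 (D ` P))" using P D by auto
      fix p :: "real^3" and v :: "real^3" assume p: "p \<in> P"
      have "Min (insert 1 (D ` P)) * norm v \<le> D p * norm v"
        using P p by (intro mult_right_mono Min_le) auto
      then show "Min (insert 1 (D ` P)) * norm v \<le> norm (B p *v v)"
        using D(2) [OF p, of v] by linarith
    qed
  qed
  \<comment> \<open>Away from the half balls around the zeros \<open>f\<close> is bounded below;
    half of this bound is the error allowed in smoothing.\<close>
  define K where "K = cball 0 (R + 2) - (\<Union>p\<in>P. ball p (r / 2))"
  have "compact K"
    unfolding K_def by (intro compact_diff compact_cball open_UN) auto
  obtain m where m: "m > 0" "\<And>y. y \<in> K \<Longrightarrow> m \<le> norm (f y)"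
  proof (cases "K = {}")
    case False
    have "continuous_on K (\<lambda>y. norm (f y))" by (intro continuous_intros continuous_on_subset [OF contf]) auto
    then obtain y0 where y0: "y0 \<in> K" "\<And>y. y \<in> K \<Longrightarrow> norm (f y0) \<le> norm (f y)"
      using continuous_attains_inf [OF \<open>compact K\<close> False] by blast
    have "y0 \<notin> P" using y0(1) r(1) by (auto simp: K_def)
    then show thesis using that [of "norm (f y0)"] zeros y0 by auto
  qed (auto intro: that [of 1])
  define m1 where "m1 = min m 1"
  have m1: "m1 > 0" "m1 \<le> m" "m1 \<le> 1" using m by (auto simp: m1_def)
  have fbig: "m1 \<le> norm (f y)" if "\<And>p. p \<in> P \<Longrightarrow> y \<notin> ball p (r / 2)" for y
  proof (cases "y \<in> cball 0 (R + 2)")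
    case True
    then have "y \<in> K" using that by (auto simp: K_def)
    then show ?thesis using m m1 by fastforce
  next
    case False
    then have "norm y > R + 2" by simp
    then show ?thesis using out [of y] R m1 by simp
  qed
  obtain pl where pl: "polynomial_function pl" "\<And>y. y \<in> cball 0 (R + 2) \<Longrightarrow> norm (f y - pl y) < m1 / 2"
    using Stone_Weierstrass_polynomial_function [OF compact_cball continuous_on_subset [OF contf], of 0 "R + 2" "m1 / 2"] m1
    by auto
  have sq: "(R + 1)\<^sup>2 < (R + 2)\<^sup>2" "(r / 2)\<^sup>2 < r\<^sup>2" using R r by (auto intro!: power_strict_mono)
  define c0 where "c0 y = 1 - cutoff ((R + 1)\<^sup>2) ((R + 2)\<^sup>2) (y \<bullet> y)" for y :: "real^3"
  define c where "c p y = cutoff ((r / 2)\<^sup>2) (r\<^sup>2) ((y - p) \<bullet> (y - p))" for p y :: "real^3"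
  have c0: "c0 y = 0" if "norm y \<le> R + 1" for y
    using that sq cutoff_eq_1 by (simp add: c0_def power2_norm_eq_inner [symmetric] power_mono)
  have c0': "c0 y = 1" if "norm y \<ge> R + 2" for y
    using that sq cutoff_eq_0 R by (simp add: c0_def power2_norm_eq_inner [symmetric] power_mono)
  have cp: "c p y = 0" if "y \<notin> ball p r" for p y
    using that sq(2) r by (simp add: c_def dist_norm norm_minus_commute power2_norm_eq_inner [symmetric] cutoff_eq_0 power_mono)
  have cp': "c p y = 1" if "y \<in> ball p (r / 2)" for p y
    using that sq(2) r by (simp add: c_def dist_norm norm_minus_commute power2_norm_eq_inner [symmetric] cutoff_eq_1 power_mono del: power_divide)
  have cb: "0 \<le> c0 y" "c0 y \<le> 1" "0 \<le> c p y" "c p y \<le> 1" for p y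
    using cutoff_bounds by (auto simp: c0_def c_def)
  \<comment> \<open>The polynomial is replaced by the linear models near the zeros and by
    \<open>- y\<close> far out. The supports of the cutoffs are disjoint, so at most one correction
    is active at any point.\<close>
  define g where "g y = pl y + c0 y *\<^sub>R (- y - pl y) + (\<Sum>p\<in>P. c p y *\<^sub>R (B p *v (y - p) - pl y))" for y
  have gC1: "C1 g"
  proof -
    have C1id: "C1 (\<lambda>y. y - p)" for p :: "real^3"
      by (rule C1_diff [OF C1_bounded_linear [OF bounded_linear_ident] C1_const])
    have pC: "C1 pl" by (rule C1_polynomial_function [OF pl(1)])
    have "C1 c0"
      unfolding c0_def [abs_def]
      by (rule C1_diff [OF C1_const C1_compose [OF C1_cutoff [OF sq(1)] C1_inner_self [OF C1_bounded_linear [OF bounded_linear_ident]]]])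
    moreover have "C1 (c p)" for p
      unfolding c_def [abs_def]
      by (rule C1_compose [OF C1_cutoff [OF sq(2)] C1_inner_self [OF C1id]])
    moreover have "C1 (\<lambda>y :: real^3. - y - pl y)"
      by (rule C1_diff [OF C1_bounded_linear [OF bounded_linear_minus [OF bounded_linear_ident]] pC])
    moreover have "C1 (\<lambda>y. B p *v (y - p) - pl y)" for p
      by (rule C1_diff [OF C1_compose [OF C1_bounded_linear [OF matrix_vector_mul_bounded_linear] C1id] pC])
    ultimately show ?thesis
      unfolding g_def [abs_def]
      by (intro C1_add [OF C1_add [OF pC C1_scaleR] C1_sum [OF C1_scaleR]])
  qed
  have g1: "g y = B p *v (y - p)" if p: "p \<in> P" "y \<in> ball p (r / 2)" for p y
  proof -
    have yr: "y \<in> ball p r" using p(2) r by auto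
    have "c q y = 0" if "q \<in> P - {p}" for q
      using disj [of p q] that p(1) yr cp by blast
    then have "(\<Sum>q\<in>P. c q y *\<^sub>R (B q *v (y - q) - pl y)) = c p y *\<^sub>R (B p *v (y - p) - pl y)"
      using P p(1) by (simp add: sum.remove [of P p])
    then show ?thesis
      using cp' [OF p(2)] c0 [of y] bR [OF p(1) yr] by (simp add: g_def)
  qed
  have g2: "m1 / 2 \<le> norm (g y)" if ny: "\<And>p. p \<in> P \<Longrightarrow> y \<notin> ball p (r / 2)" for y
  proof -
    have "norm (g y - f y) \<le> m1 / 2"
    proof (cases "\<exists>p\<in>P. y \<in> ball p r")
      case True
      then obtain p where p: "p \<in> P" "y \<in> ball p r" by blast
      have "c q y = 0" if "q \<in> P - {p}" for q
        using disj [of p q] that p cp by blast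
      then have "(\<Sum>q\<in>P. c q y *\<^sub>R (B q *v (y - q) - pl y)) = c p y *\<^sub>R (B p *v (y - p) - pl y)"
        using P p(1) by (simp add: sum.remove [of P p])
      moreover have "f y = B p *v (y - p)" using lin [OF p(1)] p(2) r by auto
      moreover have "c0 y = 0" using c0 [of y] bR [OF p] by simp
      ultimately have "g y = pl y + c p y *\<^sub>R (f y - pl y)"
        unfolding g_def by simp
      then have "g y - f y = (1 - c p y) *\<^sub>R (pl y - f y)"
        by (simp add: algebra_simps)
      then have "norm (g y - f y) = (1 - c p y) * norm (pl y - f y)"
        using cb by simp
      also have "\<dots> \<le> 1 * norm (pl y - f y)"
        using cb by (intro mult_right_mono) auto
      also have "\<dots> \<le> m1 / 2"
        using pl(2) [of y] bR [OF p] by (simp add: norm_minus_commute)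
      finally show ?thesis .
    next
      case False
      then have "(\<Sum>q\<in>P. c q y *\<^sub>R (B q *v (y - q) - pl y)) = 0"
        using cp by (intro sum.neutral) auto
      then have "g y = pl y + c0 y *\<^sub>R (- y - pl y)"
        unfolding g_def by simp
      then have gy: "g y - f y = (1 - c0 y) *\<^sub>R (pl y - f y) + c0 y *\<^sub>R (- y - f y)"
        by (simp add: algebra_simps)
      show ?thesis
      proof (cases "norm y \<le> R + 2")
        case True
        have z: "c0 y *\<^sub>R (- y - f y) = 0"
        proof (cases "norm y \<le> R + 1")
          case True then show ?thesis using c0 by simp
        next
          case False then show ?thesis using out [of y] by simp
        qed
        have "norm (g y - f y) = (1 - c0 y) * norm (pl y - f y)"
          unfolding gy z using cb(2) [of y] by simp
        also have "\<dots> \<le> 1 * norm (pl y - f y)"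
          using cb by (intro mult_right_mono) auto
        also have "\<dots> \<le> m1 / 2"
          using pl(2) [of y] True by (simp add: norm_minus_commute)
        finally show ?thesis .
      next
        case False
        then have "c0 y = 1" "f y = - y" using c0' [of y] out [of y] by auto
        then show ?thesis unfolding gy using m1 by simp
      qed
    qed
    then show ?thesis
      using fbig [OF ny] norm_triangle_ineq2 [of "f y" "g y"] by (simp add: norm_minus_commute)
  qed
  have gout: "g y = - y" if "norm y \<ge> R + 2" for y
  proof -
    have "c p y = 0" if "p \<in> P" for p
      using bR [OF that, of y] \<open>norm y \<ge> R + 2\<close> cp by fastforce
    then have "(\<Sum>q\<in>P. c q y *\<^sub>R (B q *v (y - q) - pl y)) = 0" by (intro sum.neutral) auto
    then show ?thesis using c0' [OF that] by (simp add: g_def)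
  qed
  \<comment> \<open>A cube of half side \<open>\<eta>\<close> lies in the ball of radius
    \<open>3 \<eta>\<close>. The first bound excludes points away from the zeros, the second keeps
    preimages under \<open>B p\<close> in the half ball.\<close>
  define \<eta> where "\<eta> = min (m1 / 6) (\<beta> * r / 6)"
  have \<eta>: "\<eta> > 0" "3 * \<eta> \<le> m1 / 2" "3 * \<eta> \<le> \<beta> * (r / 2)"
    using m1 \<beta> r by (auto simp: \<eta>_def)
  have cube: "norm w < 3 * \<eta>" if "\<And>i. \<bar>w $ i\<bar> < \<eta>" for w :: "real^3"
    using norm_le_l1_cart [of w] that [of 1] that [of 2] that [of 3] by (simp add: sum_3)
  define l u :: "real^3" where "l = (\<chi> i. - (R + 2))" and "u = (\<chi> i. R + 2)"
  have inbox: "y \<in> cbox l u" if "norm y \<le> R + 2" for y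
    unfolding mem_box_cart l_def u_def
  proof
    show "(\<chi> i. - (R + 2)) $ i \<le> y $ i \<and> y $ i \<le> (\<chi> i. R + 2) $ i" for i
      using that component_le_norm_cart [of y i] by (simp add: abs_le_iff)
  qed
  have V: "measure lebesgue (squash \<eta> ` {w. \<forall>i. \<bar>w $ i\<bar> < \<eta>}) > 0"
    by (rule measure_squash_pos [OF \<eta>(1)])
  define V where "V = measure lebesgue (squash \<eta> ` {w. \<forall>i. \<bar>w $ i\<bar> < \<eta>})"
  have I1: "integral (cbox l u) (\<lambda>x. det (jac (\<lambda>x. squash \<eta> (g x)) x)) = - (\<Sum>p\<in>P. sgn (det (B p))) * V"
    unfolding V_def
  proof (rule integral_det_squash [OF gC1 \<eta>(1) P, where r = "r / 2"])
    fix p assume p: "p \<in> P"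
    show "ball p (r / 2) \<subseteq> cbox l u"
    proof
      fix y assume "y \<in> ball p (r / 2)"
      then have "y \<in> ball p r" using r by auto
      then show "y \<in> cbox l u" using bR [OF p, of y] inbox by auto
    qed
    show "ball p (r / 2) \<inter> ball q (r / 2) = {}" if "q \<in> P" "p \<noteq> q" for q
      using disj [OF p that] subset_ball [of "r / 2" r p] subset_ball [of "r / 2" r q] r(1) by auto
    show "g y = B p *v (y - p)" if "y \<in> ball p (r / 2)" for y by (rule g1 [OF p that])
    show "norm v < r / 2" if "\<And>i. \<bar>(B p *v v) $ i\<bar> < \<eta>" for v
    proof -
      have "\<beta> * norm v < \<beta> * (r / 2)"
        using \<beta>(2) [OF p, of v] cube [OF that] \<eta>(3) by linarith
      then show ?thesis using \<beta>(1) by simp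
    qed
    show "det (B p) \<noteq> 0" by (rule det [OF p])
  next
    fix y assume "\<And>i. \<bar>g y $ i\<bar> < \<eta>"
    from cube [of "g y", OF this] have "norm (g y) < m1 / 2" using \<eta> by linarith
    then show "\<exists>p\<in>P. y \<in> ball p (r / 2)" using g2 [of y] by force
  qed
  have neg: "- mat 1 *v y = - y" for y :: "real^3"
    by (simp add: vec_eq_iff matrix_vector_mult_def mat_def sum_3 forall_3)
  have dm: "det (- mat 1 :: real^3^3) = - 1"
    by (simp add: det_3 mat_def)
  have I2: "integral (cbox l u) (\<lambda>x. det (jac (\<lambda>x. squash \<eta> (- x)) x)) = - (\<Sum>p\<in>{0::real^3}. sgn (det (- mat 1 :: real^3^3))) * V"
    unfolding V_def
  proof (rule integral_det_squash [where r = 1 and B = "\<lambda>_. - mat 1"])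
    have lt: "norm w < 1" if "\<And>i. \<bar>w $ i\<bar> < \<eta>" for w :: "real^3"
      using cube [OF that] \<eta> m1 by linarith
    show "C1 (uminus :: real^3 \<Rightarrow> real^3)" by (rule C1_bounded_linear [OF bounded_linear_minus [OF bounded_linear_ident]])
    show "ball p 1 \<subseteq> cbox l u" if "p \<in> {0}" for p using that R inbox by auto
    show "- y = - mat 1 *v (y - p)" if "p \<in> {0}" for p y :: "real^3"
      using that neg by simp
    show "\<exists>p\<in>{0}. y \<in> ball p 1" if "\<And>i. \<bar>(- y) $ i\<bar> < \<eta>" for y :: "real^3"
      using lt [OF that] by simp
    show "norm v < 1" if "\<And>i. \<bar>(- mat 1 *v v) $ i\<bar> < \<eta>" for v :: "real^3"
      using lt [OF that] neg by simp
  qed (use dm \<eta> in auto)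
  have F0: "C1 (\<lambda>x. squash \<eta> (- x))"
    by (rule C1_compose [OF C1_squash [OF \<eta>(1)] C1_bounded_linear [OF bounded_linear_minus [OF bounded_linear_ident]]])
  have F: "C1 (\<lambda>x. squash \<eta> (g x))"
    by (rule C1_compose [OF C1_squash [OF \<eta>(1)] gC1])
  have eqout: "squash \<eta> (g x) = squash \<eta> (- x)" if "x \<notin> cbox l u" for x
    using gout [of x] inbox [of x] that by (cases "norm x \<le> R + 2") auto
  obtain \<Lambda> where \<Lambda>: "\<Lambda> \<ge> 0" "\<And>x y. norm (squash \<eta> x - squash \<eta> y) \<le> \<Lambda> * norm (x - y)"
    using squash_lipschitz [OF \<eta>(1)] by blast
  \<comment> \<open>The two squashed fields differ only inside the box, so a global Lipschitz bound
    for one of them passes to the other.\<close>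
  obtain \<Lambda>' where \<Lambda>': "\<Lambda>' \<ge> 0" "\<And>x y. norm ((squash \<eta> (g x) - squash \<eta> (- x)) - (squash \<eta> (g y) - squash \<eta> (- y))) \<le> \<Lambda>' * norm (x - y)"
    using C1_locally_const_imp_lipschitz [OF C1_diff [OF F F0], of l u 0] eqout by auto
  have "integral (cbox l u) (\<lambda>x. det (jac (\<lambda>x. squash \<eta> (g x)) x)) = integral (cbox l u) (\<lambda>x. det (jac (\<lambda>x. squash \<eta> (- x)) x))"
  proof (rule integral_det_eq [where \<Lambda> = "\<Lambda> + \<Lambda>'"])
    show n: "norm (squash \<eta> (- x) - squash \<eta> (- y)) \<le> (\<Lambda> + \<Lambda>') * norm (x - y)" for x y
    proof -
      have "norm (squash \<eta> (- x) - squash \<eta> (- y)) \<le> \<Lambda> * norm (x - y)"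
        using \<Lambda>(2) [of "- x" "- y"] by (simp add: norm_minus_commute)
      also have "\<dots> \<le> (\<Lambda> + \<Lambda>') * norm (x - y)" using \<Lambda>' by (intro mult_right_mono) auto
      finally show ?thesis .
    qed
    show "norm (squash \<eta> (g x) - squash \<eta> (g y)) \<le> (\<Lambda> + \<Lambda>') * norm (x - y)" for x y
    proof -
      have "squash \<eta> (g x) - squash \<eta> (g y) = (squash \<eta> (- x) - squash \<eta> (- y)) +
          ((squash \<eta> (g x) - squash \<eta> (- x)) - (squash \<eta> (g y) - squash \<eta> (- y)))" by simp
      then have "norm (squash \<eta> (g x) - squash \<eta> (g y)) \<le> norm (squash \<eta> (- x) - squash \<eta> (- y)) +
          norm ((squash \<eta> (g x) - squash \<eta> (- x)) - (squash \<eta> (g y) - squash \<eta> (- y)))"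
        by (metis norm_triangle_ineq)
      also have "\<dots> \<le> \<Lambda> * norm (x - y) + \<Lambda>' * norm (x - y)"
        using \<Lambda>(2) [of "- x" "- y"] \<Lambda>'(2) [of x y] by (simp add: norm_minus_commute)
      finally show ?thesis by (simp add: algebra_simps)
    qed
  qed (use F F0 eqout in auto)
  then have "- (\<Sum>p\<in>P. sgn (det (B p))) * V = 1 * V"
    unfolding I1 I2 by (simp add: dm)
  then have "((\<Sum>p\<in>P. sgn (det (B p))) + 1) * V = 0"
    by (simp add: algebra_simps)
  then show ?thesis
    using V unfolding V_def [symmetric] by simp
qed

section \<open>Symmetric matrices with one negative direction\<close>

lemma quadratic_min_imp_zero:
  fixes c k :: real
  assumes "\<And>t. 0 \<le> c * t + k * t\<^sup>2"
  shows "c = 0"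
proof (rule ccontr)
  assume c: "c \<noteq> 0"
  define K where "K = \<bar>k\<bar> + 1"
  \<comment> \<open>The minimiser of \<open>c t + K t^2\<close>, where \<open>K\<close> is a
    positive bound for \<open>k\<close>; the minimum \<open>- c^2 / (4 K)\<close> is negative unless
    \<open>c = 0\<close>.\<close>
  define t where "t = - c / (2 * K)"
  have K: "K > 0" by (simp add: K_def)
  have "c * t = - 2 * (c\<^sup>2 / (4 * K))" "K * t\<^sup>2 = c\<^sup>2 / (4 * K)"
    using K by (simp_all add: t_def power2_eq_square)
  moreover have "c * t + k * t\<^sup>2 \<le> c * t + K * t\<^sup>2"
    by (intro add_left_mono mult_right_mono) (auto simp: K_def)
  moreover have "c\<^sup>2 / (4 * K) > 0" using c K by simp
  ultimately show False using assms [of t] by linarith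
qed

text \<open>The minimum of the Rayleigh quotient on the unit sphere of an invariant subspace is an
  eigenvalue: at a minimiser \<open>a\<close> the first variation in the direction
  \<open>w = A a - \<mu> a\<close> is \<open>2 |w|^2\<close> and has to vanish.\<close>

lemma rayleigh_min:
  fixes A :: "real^'n^'n" and S :: "(real^'n) set"
  assumes sym: "\<And>x y. (A *v x) \<bullet> y = x \<bullet> (A *v y)" and S: "subspace S"
    and inv: "\<And>x. x \<in> S \<Longrightarrow> A *v x \<in> S" and ne: "z \<in> S" "z \<noteq> 0"
  obtains a \<mu> where "a \<in> S" "norm a = 1" "A *v a = \<mu> *\<^sub>R a" "\<And>x. x \<in> S \<Longrightarrow> \<mu> * (norm x)\<^sup>2 \<le> x \<bullet> (A *v x)"
proof -
  have "compact (S \<inter> sphere 0 1)"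
    using closed_subspace [OF S] by (intro closed_Int_compact) auto
  moreover have "(1 / norm z) *\<^sub>R z \<in> S \<inter> sphere 0 1"
    using S ne by (simp add: subspace_mul)
  then have "S \<inter> sphere 0 1 \<noteq> {}" by blast
  moreover have "continuous_on (S \<inter> sphere 0 1) (\<lambda>x. x \<bullet> (A *v x))"
    by (intro continuous_intros linear_continuous_on matrix_vector_mul_bounded_linear)
  ultimately obtain a where a0: "a \<in> S \<inter> sphere 0 1" "\<forall>x\<in>S \<inter> sphere 0 1. a \<bullet> (A *v a) \<le> x \<bullet> (A *v x)"
    using continuous_attains_inf [of "S \<inter> sphere 0 1" "\<lambda>x. x \<bullet> (A *v x)"] by blast
  then have a: "a \<in> S" "norm a = 1" "\<And>x. x \<in> S \<Longrightarrow> norm x = 1 \<Longrightarrow> a \<bullet> (A *v a) \<le> x \<bullet> (A *v x)"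
    by auto
  define \<mu> where "\<mu> = a \<bullet> (A *v a)"
  have min: "\<mu> * (norm x)\<^sup>2 \<le> x \<bullet> (A *v x)" if "x \<in> S" for x
  proof (cases "x = 0")
    case False
    then have "\<mu> \<le> ((1 / norm x) *\<^sub>R x) \<bullet> (A *v ((1 / norm x) *\<^sub>R x))"
      unfolding \<mu>_def using that S by (intro a(3)) (auto simp: subspace_mul)
    also have "\<dots> = (x \<bullet> (A *v x)) / (norm x)\<^sup>2"
      by (simp add: matrix_vector_mult_scaleR power2_eq_square)
    finally show ?thesis using False by (simp add: le_divide_eq)
  qed auto
  have "A *v a = \<mu> *\<^sub>R a"
  proof -
    define w where "w = A *v a - \<mu> *\<^sub>R a"
    have wS: "w \<in> S" unfolding w_def using a(1) inv S by (intro subspace_diff subspace_mul) auto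
    have aa: "a \<bullet> a = 1" using a(2) by (simp add: norm_eq_1)
    have aw: "a \<bullet> w = 0" by (simp add: w_def inner_diff_right aa \<mu>_def)
    have "0 \<le> (2 * (w \<bullet> w)) * t + (w \<bullet> (A *v w) - \<mu> * (w \<bullet> w)) * t\<^sup>2" for t
    proof -
      have "\<mu> * (norm (a + t *\<^sub>R w))\<^sup>2 \<le> (a + t *\<^sub>R w) \<bullet> (A *v (a + t *\<^sub>R w))"
        using a(1) wS S by (intro min subspace_add subspace_mul)
      moreover have "(norm (a + t *\<^sub>R w))\<^sup>2 = 1 + t\<^sup>2 * (w \<bullet> w)"
        unfolding power2_norm_eq_inner by (simp add: inner_add_left inner_add_right aa aw inner_commute [of w a] power2_eq_square)
      moreover have "w \<bullet> (A *v a) = w \<bullet> w"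
        using aw by (simp add: w_def inner_diff_right inner_diff_left inner_commute)
      moreover have "(a + t *\<^sub>R w) \<bullet> (A *v (a + t *\<^sub>R w)) = \<mu> + 2 * t * (w \<bullet> (A *v a)) + t\<^sup>2 * (w \<bullet> (A *v w))"
        using sym [of a w] by (simp add: inner_add_left inner_add_right matrix_vector_right_distrib matrix_vector_mult_scaleR \<mu>_def power2_eq_square inner_commute algebra_simps)
      ultimately show ?thesis by (simp add: algebra_simps)
    qed
    then have "2 * (w \<bullet> w) = 0" by (rule quadratic_min_imp_zero)
    then show ?thesis by (simp add: w_def)
  qed
  then show thesis using that a min by blast
qed

text \<open>The determinant is the product of the eigenvalues, so one or three of them are negative;
  three would make the trace negative.\<close>

theorem saddle_direction:
  fixes A :: "real^3^3"
  assumes sym: "\<And>x y. (A *v x) \<bullet> y = x \<bullet> (A *v y)" and det: "det A < 0"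
    and tr: "0 \<le> trace A"
  obtains a l where "norm a = 1" "A *v a = l *\<^sub>R a" "l < 0" "\<And>v. v \<bullet> a = 0 \<Longrightarrow> v \<noteq> 0 \<Longrightarrow> 0 < v \<bullet> (A *v v)"
proof -
  obtain a l where a: "norm a = 1" "A *v a = l *\<^sub>R a" "\<And>x. l * (norm x)\<^sup>2 \<le> x \<bullet> (A *v x)"
    using rayleigh_min [OF sym subspace_UNIV, of "axis 1 1"] by (auto simp: axis_eq_0_iff)
  define S where "S = {x. a \<bullet> x = 0}"
  have S: "subspace S" unfolding S_def by (rule subspace_hyperplane)
  have inv: "A *v x \<in> S" if "x \<in> S" for x
    using that sym [of a x] by (simp add: S_def a(2))
  obtain z where z: "z \<in> S" "z \<noteq> 0"
    using orthogonal_to_vector_exists [of a] unfolding S_def orthogonal_def by auto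
  obtain b m where b: "b \<in> S" "norm b = 1" "A *v b = m *\<^sub>R b" "\<And>x. x \<in> S \<Longrightarrow> m * (norm x)\<^sup>2 \<le> x \<bullet> (A *v x)"
    using rayleigh_min [OF sym S inv z] by blast
  define e where "e = cross3 a b"
  have ab: "a \<bullet> b = 0" "a \<bullet> a = 1" "b \<bullet> b = 1" using a b by (auto simp: S_def norm_eq_1)
  have e: "a \<bullet> e = 0" "b \<bullet> e = 0" by (simp_all add: e_def dot_cross_self)
  have ne: "norm e = 1"
    using norm_cross_dot [of a b] a(1) b(2) ab(1) norm_ge_zero [of e] unfolding e_def
    by (simp add: power2_eq_1_iff)
  then have ee: "e \<bullet> e = 1" by (simp add: norm_eq_1)
  have expand: "x = (x \<bullet> a) *\<^sub>R a + (x \<bullet> b) *\<^sub>R b + (x \<bullet> e) *\<^sub>R e" for x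
  proof -
    define y where "y = x - ((x \<bullet> a) *\<^sub>R a + (x \<bullet> b) *\<^sub>R b + (x \<bullet> e) *\<^sub>R e)"
    have y: "y \<bullet> a = 0" "y \<bullet> b = 0" "y \<bullet> e = 0"
      using ab e ee by (simp_all add: y_def inner_diff_left inner_add_left inner_diff_right inner_add_right inner_commute)
    have "cross3 y e = (y \<bullet> b) *\<^sub>R a - (y \<bullet> a) *\<^sub>R b"
      unfolding e_def by (simp add: cross3_simps forall_3)
    then have "cross3 y e = 0" using y by simp
    with y(3) ne have "y = 0"
      using norm_and_cross_eq_0 [of y e] by auto
    then show ?thesis by (simp add: y_def)
  qed
  define n where "n = e \<bullet> (A *v e)"
  have Ae: "A *v e = n *\<^sub>R e"
  proof -
    have "(A *v e) \<bullet> a = 0" "(A *v e) \<bullet> b = 0"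
      using sym [of e a] sym [of e b] a(2) b(3) e by (simp_all add: inner_commute)
    then show ?thesis using expand [of "A *v e"] by (simp add: n_def inner_commute)
  qed
  have mn: "m \<le> n"
    using b(4) [of e] e ne by (simp add: n_def S_def)
  have Ax: "A *v x = ((x \<bullet> a) * l) *\<^sub>R a + ((x \<bullet> b) * m) *\<^sub>R b + ((x \<bullet> e) * n) *\<^sub>R e" for x
    by (subst expand [of x]) (simp add: matrix_vector_right_distrib matrix_vector_mult_scaleR a b Ae)
  have entry: "A $ i $ j = (A *v axis j 1) $ i" for i j
    by (simp add: matrix_vector_mult_basis column_def)
  have "A $ i $ i = l * (a $ i)\<^sup>2 + m * (b $ i)\<^sup>2 + n * (e $ i)\<^sup>2" for i
    by (simp add: entry Ax inner_axis inner_axis' power2_eq_square)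
  then have "trace A = l * (\<Sum>i\<in>UNIV. (a $ i)\<^sup>2) + m * (\<Sum>i\<in>UNIV. (b $ i)\<^sup>2) + n * (\<Sum>i\<in>UNIV. (e $ i)\<^sup>2)"
    by (simp add: trace_def sum.distrib sum_distrib_left)
  moreover have "(\<Sum>i\<in>UNIV. (x $ i)\<^sup>2) = x \<bullet> x" for x :: "real^3"
    by (simp add: inner_vec_def power2_eq_square)
  ultimately have trace: "l + m + n \<ge> 0" using tr ab ee by simp
  \<comment> \<open>By the cofactor identity, \<open>transpose A\<close> maps the cross product of
    \<open>A a\<close> and \<open>A b\<close> to \<open>det A\<close> times that of \<open>a\<close>
    and \<open>b\<close>.\<close>
  have dets: "det A = l * m * n"
  proof -
    have "transpose A *v (cross3 (A *v a) (A *v b)) = det A *\<^sub>R e"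
      unfolding e_def by (rule cross_matrix_mult)
    moreover have "cross3 (A *v a) (A *v b) = (l * m) *\<^sub>R e"
      by (simp add: a b cross_mult_left cross_mult_right mult.commute flip: e_def)
    ultimately have "(l * m) *\<^sub>R (transpose A *v e) = det A *\<^sub>R e"
      by (simp only: matrix_vector_mult_scaleR)
    then have "(l * m) * ((transpose A *v e) \<bullet> e) = det A"
      by (metis ee inner_scaleR_left mult.right_neutral)
    moreover have "(transpose A *v e) \<bullet> e = n"
      using dot_lmul_matrix [of e A e] by (simp add: n_def)
    ultimately show ?thesis by simp
  qed
  \<comment> \<open>The minima were taken in succession, so \<open>l \<le> m \<le> n\<close>. A
    negative product then forces \<open>l < 0\<close>, and \<open>m\<close>, \<open>n\<close> have
    equal signs.\<close>
  have sgn: "l < 0" "m > 0" "n > 0"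
  proof -
    have lm: "l \<le> m" using a(3) [of b] b ab by simp
    have "l * (m * n) < 0" using det dets by (simp add: mult.assoc)
    then have "l < 0 \<and> m * n > 0 \<or> l > 0 \<and> m * n < 0" using mult_less_0_iff [of l "m * n"] by blast
    then show "l < 0" using lm mn by (auto simp: mult_less_0_iff)
    then have "m * n > 0" using \<open>l * (m * n) < 0\<close> by (simp add: mult_less_0_iff)
    then show "m > 0" "n > 0" using \<open>l < 0\<close> trace by (auto simp: zero_less_mult_iff)
  qed
  show thesis
  proof (rule that [OF a(1) a(2) sgn(1)])
    fix v assume v: "v \<bullet> a = 0" "v \<noteq> 0"
    have "v = (v \<bullet> b) *\<^sub>R b + (v \<bullet> e) *\<^sub>R e" using expand [of v] v by simp
    then have nz: "v \<bullet> b \<noteq> 0 \<or> v \<bullet> e \<noteq> 0" using v by (metis add_0 scaleR_zero_left)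
    have "v \<bullet> (A *v v) = m * (v \<bullet> b)\<^sup>2 + n * (v \<bullet> e)\<^sup>2"
      using v by (simp add: Ax inner_add_right power2_eq_square)
    moreover have "0 < m * (v \<bullet> b)\<^sup>2 + n * (v \<bullet> e)\<^sup>2"
      using nz sgn by (auto intro: add_pos_nonneg add_nonneg_pos)
    ultimately show "0 < v \<bullet> (A *v v)" by simp
  qed
qed

section \<open>Framed curves and tubes\<close>

text \<open>The knot is extended to a curve of period 1 on the line, with an orthonormal frame of
  its normal planes. Lipschitz conditions take the place of second derivatives, which may jump at
  the integers.\<close>

locale framed_curve =
  fixes c c' n1 n2 :: "real \<Rightarrow> real^3" and L m :: real
  assumes m: "m > 0" "\<And>t. m \<le> norm (c' t)"
    and c_per: "\<And>t. c (t + 1) = c t" and c'_per: "\<And>t. c' (t + 1) = c' t"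
    and n1_per: "\<And>t. n1 (t + 1) = n1 t" and n2_per: "\<And>t. n2 (t + 1) = n2 t"
    and c_deriv: "\<And>t. (c has_vector_derivative c' t) (at t)"
    and c_inj: "\<And>s t. c s = c t \<Longrightarrow> s - t \<in> \<int>"
    and L: "L > 0"
    and c'_lip: "\<And>s t. norm (c' s - c' t) \<le> L * \<bar>s - t\<bar>"
    and n1_lip: "\<And>s t. norm (n1 s - n1 t) \<le> L * \<bar>s - t\<bar>"
    and n2_lip: "\<And>s t. norm (n2 s - n2 t) \<le> L * \<bar>s - t\<bar>"
    and orth: "\<And>t. n1 t \<bullet> n1 t = 1" "\<And>t. n2 t \<bullet> n2 t = 1" "\<And>t. n1 t \<bullet> n2 t = 0"
      "\<And>t. n1 t \<bullet> c' t = 0" "\<And>t. n2 t \<bullet> c' t = 0"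

text \<open>For joining the two one-sided derivatives at an integer.\<close>

lemma has_derivative_within_Un:
  assumes "(f has_derivative f') (at x within S)" "(f has_derivative f') (at x within T)"
  shows "(f has_derivative f') (at x within S \<union> T)"
  using assms unfolding has_derivative_within by (auto intro: Lim_Un)

lemma lipschitz_normalize:
  fixes x y :: "'a::real_inner"
  assumes "r > 0" "r \<le> norm x" "r \<le> norm y"
  shows "norm (x /\<^sub>R norm x - y /\<^sub>R norm y) \<le> 2 / r * norm (x - y)"
proof -
  have pos: "norm x > 0" "norm y > 0" using assms by linarith+
  have "x /\<^sub>R norm x - y /\<^sub>R norm y = (x - y) /\<^sub>R norm x + (inverse (norm x) - inverse (norm y)) *\<^sub>R y"
    by (simp add: algebra_simps)
  then have "norm (x /\<^sub>R norm x - y /\<^sub>R norm y) \<le> norm ((x - y) /\<^sub>R norm x) + norm ((inverse (norm x) - inverse (norm y)) *\<^sub>R y)"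
    by (metis norm_triangle_ineq)
  also have "norm ((inverse (norm x) - inverse (norm y)) *\<^sub>R y) = \<bar>norm y - norm x\<bar> / norm x"
  proof -
    have "inverse (norm x) - inverse (norm y) = (norm y - norm x) / (norm x * norm y)"
      using pos by (simp add: field_simps)
    then show ?thesis using pos by (simp add: abs_mult)
  qed
  also have "norm ((x - y) /\<^sub>R norm x) + \<bar>norm y - norm x\<bar> / norm x \<le> 2 * norm (x - y) / norm x"
  proof -
    have "\<bar>norm y - norm x\<bar> / norm x \<le> norm (x - y) / norm x"
      using norm_triangle_ineq3 [of y x] pos by (intro divide_right_mono) (auto simp: norm_minus_commute)
    moreover have "norm ((x - y) /\<^sub>R norm x) = norm (x - y) / norm x"
      by (simp add: divide_inverse mult.commute)
    moreover have "2 * norm (x - y) / norm x = norm (x - y) / norm x + norm (x - y) / norm x" by simp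
    ultimately show ?thesis by linarith
  qed
  also have "\<dots> \<le> 2 * norm (x - y) / r"
    using assms pos by (intro divide_left_mono) auto
  finally show ?thesis by simp
qed

lemma norm_cross3_le: "norm (cross3 x y) \<le> norm x * norm y"
proof -
  have "(norm (cross3 x y))\<^sup>2 \<le> (norm x * norm y)\<^sup>2"
    using norm_cross_dot [of x y] zero_le_power2 [of "x \<bullet> y"] by linarith
  then show ?thesis by (rule power2_le_imp_le) simp
qed

lemma periodic_shift_int:
  fixes f :: "real \<Rightarrow> 'a"
  assumes "\<And>t. f (t + 1) = f t"
  shows "f (t + of_int k) = f t"
proof -
  have *: "f (s + of_nat n) = f s" for s and n :: nat
    by (induction n) (use assms in \<open>auto simp: add.assoc [symmetric] add.commute [of 1]\<close>)
  show ?thesis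
  proof (cases k rule: int_cases2)
    case (nonneg n) then show ?thesis using * by simp
  next
    case (nonpos n) then show ?thesis using * [of "t + of_int k" n] by simp
  qed
qed

text \<open>The Frenet frame breaks down where the curvature vanishes. The frame is built from a
  fixed vector \<open>v\<close> that is nowhere tangent: its normal component is normalised and
  completed by a cross product.\<close>

lemma framed_curve_exists:
  fixes H :: "real \<Rightarrow> real^3"
  assumes H: "periodic_C2_curve H" and emb: "circle_embedding H"
  shows "\<exists>c c' n1 n2 L m. framed_curve c c' n1 n2 L m \<and> (\<forall>t\<in>{0..1}. c t = H t)"
proof -
  define D where "D = cderiv H"
  have Hd: "(H has_vector_derivative D t) (at t within {0..1})" if "t \<in> {0..1}" for t
    using H that unfolding periodic_C2_curve_def differentiable_on_def D_def cderiv_def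
    by (simp add: vector_derivative_works)
  have Dd: "(D has_vector_derivative cderiv D t) (at t within {0..1})" if "t \<in> {0..1}" for t
    using H that unfolding periodic_C2_curve_def differentiable_on_def D_def [symmetric]
    unfolding cderiv_def [of D] by (simp add: vector_derivative_works)
  have "continuous_on {0..1} (cderiv D)"
    using H unfolding periodic_C2_curve_def D_def by blast
  then have "bounded (cderiv D ` {0..1})"
    by (intro compact_imp_bounded compact_continuous_image) auto
  then obtain K where K: "K > 0" "\<And>t. t \<in> {0..1} \<Longrightarrow> norm (cderiv D t) \<le> K"
    unfolding bounded_pos by auto
  have Dlip: "K-lipschitz_on {0..1} D"
  proof (rule lipschitz_onI)
    show "dist (D s) (D t) \<le> K * dist s t" if "s \<in> {0..1}" "t \<in> {0..1}" for s t
      unfolding dist_norm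
    proof (rule differentiable_bound [of "{0..1}" D "\<lambda>x h. h *\<^sub>R cderiv D x"])
      show "(D has_derivative (\<lambda>h. h *\<^sub>R cderiv D x)) (at x within {0..1})" if "x \<in> {0..1}" for x
        using Dd [OF that] by (simp add: has_vector_derivative_def)
      show "onorm (\<lambda>h. h *\<^sub>R cderiv D x) \<le> K" if "x \<in> {0..1}" for x
      proof (rule onorm_le)
        fix h :: real
        show "norm (h *\<^sub>R cderiv D x) \<le> K * norm h"
          using mult_right_mono [OF K(2) [OF that] abs_ge_zero [of h]] by (simp add: mult.commute)
      qed
    qed (use that in auto)
  qed (use K in auto)
  have H01: "H 0 = H 1" "D 0 = D 1"
    using H unfolding periodic_C2_curve_def D_def by auto
  define c where "c t = H (frac t)" for t
  define c' where "c' t = D (frac t)" for t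
  have cH: "c t = H (t - of_int n)" "c' t = D (t - of_int n)" if "t \<in> {of_int n..of_int n + 1}" for t n
  proof -
    have "c t = H (t - of_int n) \<and> c' t = D (t - of_int n)"
    proof (cases "t = of_int n + 1")
      case True
      then have "frac t = 0" by simp
      then show ?thesis using True H01 by (simp add: c_def c'_def)
    next
      case False
      then have "\<lfloor>t\<rfloor> = n" using that by (intro floor_unique) auto
      then show ?thesis by (simp add: c_def c'_def frac_def)
    qed
    then show "c t = H (t - of_int n)" "c' t = D (t - of_int n)" by auto
  qed
  have cper: "c (t + 1) = c t" "c' (t + 1) = c' t" for t
    by (simp_all add: c_def c'_def frac_1_eq)
  have cd: "(c has_vector_derivative c' t) (at t within {of_int n..of_int n + 1})" if "t \<in> {of_int n..of_int n + 1}" for t n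
  proof -
    have "((\<lambda>s. s - of_int n) has_vector_derivative 1) (at t within {of_int n..of_int n + 1})"
      by (auto intro!: derivative_eq_intros)
    moreover have "(H has_vector_derivative D (t - of_int n)) (at (t - of_int n) within (\<lambda>s. s - of_int n) ` {of_int n..of_int n + 1})"
      by (rule has_vector_derivative_within_subset [OF Hd]) (use that in auto)
    ultimately have "(H \<circ> (\<lambda>s. s - of_int n) has_vector_derivative 1 *\<^sub>R D (t - of_int n)) (at t within {of_int n..of_int n + 1})"
      by (rule vector_diff_chain_within)
    then have "(H \<circ> (\<lambda>s. s - of_int n) has_vector_derivative c' t) (at t within {of_int n..of_int n + 1})"
      using cH(2) [OF that] by simp
    then show ?thesis
      by (rule has_vector_derivative_transform [OF that, rotated]) (use cH(1) in auto)
  qed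
  have c_deriv: "(c has_vector_derivative c' t) (at t)" for t
  proof -
    define n where "n = \<lfloor>t\<rfloor>"
    have t: "of_int n \<le> t" "t < of_int n + 1" by (auto simp: n_def)
    have 1: "(c has_vector_derivative c' t) (at t within {of_int n..of_int n + 1})"
      using t by (intro cd) auto
    show ?thesis
    proof (cases "t = of_int n")
      case True
      have "(c has_vector_derivative c' t) (at t within {of_int (n - 1)..of_int (n - 1) + 1})"
        using True by (intro cd) auto
      then have "(c has_vector_derivative c' t) (at t within {of_int (n - 1)..of_int (n - 1) + 1} \<union> {of_int n..of_int n + 1})"
        using 1 unfolding has_vector_derivative_def by (rule has_derivative_within_Un)
      moreover have "at t within ({of_int (n - 1)..of_int (n - 1) + 1} \<union> {of_int n..of_int n + 1}) = at t"
        using True by (intro at_within_open_subset [of _ "{of_int n - 1<..<of_int n + 1}"]) auto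
      ultimately show ?thesis by simp
    next
      case False
      then have "at t within {of_int n..of_int n + 1} = at t"
        using t by (intro at_within_open_subset [of _ "{of_int n<..<of_int n + 1}"]) auto
      with 1 show ?thesis by simp
    qed
  qed
  \<comment> \<open>The bound holds on each unit interval and survives the concatenation of
    intervals.\<close>
  have c'lip: "norm (c' s - c' t) \<le> K * \<bar>s - t\<bar>" for s t
  proof -
    have unit: "K-lipschitz_on {of_int n..of_int n + 1} c'" for n
    proof (rule lipschitz_onI)
      show "dist (c' s) (c' t) \<le> K * dist s t" if "s \<in> {of_int n..of_int n + 1}" "t \<in> {of_int n..of_int n + 1}" for s t
        using lipschitz_onD [OF Dlip, of "s - of_int n" "t - of_int n"] that cH(2) [OF that(1)] cH(2) [OF that(2)]
        by (simp add: dist_norm)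
    qed (use K in auto)
    have big: "K-lipschitz_on {of_int (- int k)..of_int (int k)} c'" for k
    proof (induction k)
      case (Suc k)
      have "K-lipschitz_on {of_int (- int (Suc k))..of_int (- int k)} c'"
        using unit [of "- int (Suc k)"] by simp
      from lipschitz_on_concat [OF this Suc.IH]
      have "K-lipschitz_on {of_int (- int (Suc k))..of_int (int k)} c'" by simp
      moreover have "K-lipschitz_on {of_int (int k)..of_int (int (Suc k))} c'"
        using unit [of "int k"] by (simp add: add.commute)
      ultimately have "K-lipschitz_on {of_int (- int (Suc k))..of_int (int (Suc k))} (\<lambda>x. if x \<le> of_int (int k) then c' x else c' x)"
        by (rule lipschitz_on_concat) simp
      then show ?case by simp
    qed (use K in \<open>auto intro!: lipschitz_onI\<close>)
    obtain k :: nat where "max \<bar>s\<bar> \<bar>t\<bar> \<le> of_nat k" using real_arch_simple by blast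
    then have "s \<in> {of_int (- int k)..of_int (int k)}" "t \<in> {of_int (- int k)..of_int (int k)}" by auto
    from lipschitz_onD [OF big this] show ?thesis by (simp add: dist_norm)
  qed
  have contD: "continuous_on {0..1} D" using Dlip lipschitz_on_continuous_on by blast
  obtain m where m: "m > 0" "\<And>t. t \<in> {0..1} \<Longrightarrow> m \<le> norm (D t)"
  proof -
    have "\<exists>s\<in>{0..1}. \<forall>t\<in>{0..1}. norm (D s) \<le> norm (D t)"
      by (rule continuous_attains_inf) (auto intro!: continuous_on_norm contD)
    then obtain t0 where t0: "t0 \<in> {0..1}" "\<forall>t\<in>{0..1}. norm (D t0) \<le> norm (D t)"
      by blast
    have "D t0 \<noteq> 0" using emb t0 unfolding circle_embedding_def D_def by blast
    then show thesis using that [of "norm (D t0)"] t0 by auto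
  qed
  have fr: "frac t \<in> {0..1}" for t :: real
    using frac_ge_0 [of t] frac_lt_1 [of t] by auto
  have mc: "m \<le> norm (c' t)" for t using m(2) [OF fr] by (simp add: c'_def)
  have cinj: "s - t \<in> \<int>" if "c s = c t" for s t
  proof -
    have "inj_on H {0..<1}" using emb unfolding circle_embedding_def by blast
    then have "frac s = frac t"
      using that frac_ge_0 [of s] frac_ge_0 [of t] frac_lt_1 [of s] frac_lt_1 [of t] unfolding c_def inj_on_def by auto
    then have "s - t = of_int (\<lfloor>s\<rfloor> - \<lfloor>t\<rfloor>)" by (simp add: frac_def algebra_simps)
    then show ?thesis by (metis Ints_of_int)
  qed
  text \<open>The cone over the tangent indicatrix is the image of a plane, so some direction misses it.\<close>
  obtain v where v: "\<And>t k. v \<noteq> k *\<^sub>R c' t"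
  proof -
    \<comment> \<open>The idle third coordinate makes the parameter plane a negligible subset of a
      space of dimension 3, so that its locally Lipschitz image is negligible too.\<close>
    define f :: "real \<times> real \<times> real \<Rightarrow> real^3" where "f z = fst z *\<^sub>R c' (fst (snd z))" for z
    define S where "S = {z :: real \<times> real \<times> real. (0, 0, 1) \<bullet> z = 0}"
    have "negligible (f ` S)"
    proof (rule negligible_locally_Lipschitz_image)
      show "DIM(real \<times> real \<times> real) \<le> DIM(real^3)" by simp
      show "negligible S" unfolding S_def by (rule negligible_hyperplane) (simp add: zero_prod_def)
      fix z :: "real \<times> real \<times> real"
      define B where "B = \<bar>fst z\<bar> * K + norm (c' (fst (snd z))) + K + 1"
      show "\<exists>T B. open T \<and> z \<in> T \<and> (\<forall>y\<in>S \<inter> T. norm (f y - f z) \<le> B * norm (y - z))"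
      proof (intro exI conjI ballI)
        show "open (ball z 1)" "z \<in> ball z 1" by auto
        fix y assume y: "y \<in> S \<inter> ball z 1"
        have n: "\<bar>fst y - fst z\<bar> \<le> norm (y - z)" "\<bar>fst (snd y) - fst (snd z)\<bar> \<le> norm (y - z)"
          using dist_fst_le [of y z] order_trans [OF dist_fst_le dist_snd_le [of y z]]
          by (simp_all add: dist_norm)
        have y1: "norm (y - z) < 1" using y by (simp add: dist_norm norm_minus_commute)
        have "f y - f z = fst y *\<^sub>R (c' (fst (snd y)) - c' (fst (snd z))) + (fst y - fst z) *\<^sub>R c' (fst (snd z))"
          by (simp add: f_def algebra_simps)
        then have "norm (f y - f z) \<le> \<bar>fst y\<bar> * norm (c' (fst (snd y)) - c' (fst (snd z))) + \<bar>fst y - fst z\<bar> * norm (c' (fst (snd z)))"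
          by (metis norm_triangle_ineq norm_scaleR)
        also have "\<dots> \<le> (\<bar>fst z\<bar> + 1) * (K * norm (y - z)) + norm (y - z) * norm (c' (fst (snd z)))"
        proof (intro add_mono mult_mono)
          show "\<bar>fst y\<bar> \<le> \<bar>fst z\<bar> + 1" using n y1 by linarith
          have "K * \<bar>fst (snd y) - fst (snd z)\<bar> \<le> K * norm (y - z)" using n K by (intro mult_left_mono) auto
          then show "norm (c' (fst (snd y)) - c' (fst (snd z))) \<le> K * norm (y - z)"
            using c'lip [of "fst (snd y)" "fst (snd z)"] by linarith
        qed (use n in auto)
        also have "\<dots> \<le> B * norm (y - z)" by (simp add: B_def algebra_simps)
        finally show "norm (f y - f z) \<le> B * norm (y - z)" .
      qed
    qed
    then have "f ` S \<noteq> UNIV" using non_negligible_UNIV by metis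
    then obtain v where v: "v \<notin> f ` S" by blast
    have "v \<noteq> k *\<^sub>R c' t" for t k
    proof
      assume "v = k *\<^sub>R c' t"
      then have "v = f (k, t, 0)" "(k, t, 0) \<in> S" by (simp_all add: f_def S_def)
      with v show False by blast
    qed
    then show thesis using that by blast
  qed
  define T where "T t = c' t /\<^sub>R norm (c' t)" for t
  have c'0: "c' t \<noteq> 0" for t using mc [of t] m by auto
  have TT: "T t \<bullet> T t = 1" for t using c'0 by (simp add: T_def norm_eq_1 flip: power2_norm_eq_inner)
  then have nT: "norm (T t) = 1" for t by (simp add: norm_eq_1)
  have Tlip: "norm (T s - T t) \<le> 2 / m * K * \<bar>s - t\<bar>" for s t
  proof -
    have "norm (T s - T t) \<le> 2 / m * norm (c' s - c' t)"
      unfolding T_def by (rule lipschitz_normalize [OF m(1) mc mc])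
    also have "\<dots> \<le> 2 / m * (K * \<bar>s - t\<bar>)" using m by (intro mult_left_mono c'lip) auto
    finally show ?thesis by simp
  qed
  define LT where "LT = 2 / m * K"
  define N where "N t = v - (v \<bullet> T t) *\<^sub>R T t" for t
  have N0: "N t \<noteq> 0" for t
  proof
    assume "N t = 0"
    then have "v = ((v \<bullet> T t) * inverse (norm (c' t))) *\<^sub>R c' t" by (simp add: N_def T_def)
    with v show False by blast
  qed
  have NT: "N t \<bullet> T t = 0" for t by (simp add: N_def inner_diff_left TT)
  have Nlip: "norm (N s - N t) \<le> 2 * norm v * LT * \<bar>s - t\<bar>" for s t
  proof -
    have "N s - N t = - ((v \<bullet> (T s - T t)) *\<^sub>R T s + (v \<bullet> T t) *\<^sub>R (T s - T t))"
      by (simp add: N_def algebra_simps inner_diff_right)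
    then have "norm (N s - N t) \<le> norm ((v \<bullet> (T s - T t)) *\<^sub>R T s) + norm ((v \<bullet> T t) *\<^sub>R (T s - T t))"
      by (metis norm_minus_cancel norm_triangle_ineq)
    also have "\<dots> \<le> norm v * norm (T s - T t) + norm v * norm (T s - T t)"
      using Cauchy_Schwarz_ineq2 [of v "T s - T t"] Cauchy_Schwarz_ineq2 [of v "T t"] nT
      by (intro add_mono) (auto intro!: mult_right_mono)
    also have "\<dots> = 2 * norm v * norm (T s - T t)" by simp
    also have "\<dots> \<le> 2 * norm v * (LT * \<bar>s - t\<bar>)"
      using Tlip [of s t] by (intro mult_left_mono) (auto simp: LT_def)
    finally show ?thesis by (simp add: mult.assoc)
  qed
  have Tper: "T (t + 1) = T t" "N (t + 1) = N t" for t by (simp_all add: T_def N_def cper)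
  have contN: "continuous_on {0..1} N"
  proof -
    have "(2 * norm v * LT)-lipschitz_on {0..1} N"
      using Nlip K m by (intro lipschitz_onI) (auto simp: dist_norm LT_def)
    then show ?thesis by (rule lipschitz_on_continuous_on)
  qed
  \<comment> \<open>Periodicity reduces the lower bound on \<open>|N t|\<close> to one period, where
    compactness applies.\<close>
  obtain r where r: "r > 0" "\<And>t. r \<le> norm (N t)"
  proof -
    have "\<exists>s\<in>{0..1}. \<forall>t\<in>{0..1}. norm (N s) \<le> norm (N t)"
      by (rule continuous_attains_inf) (auto intro!: continuous_on_norm contN)
    then obtain t0 where t0: "t0 \<in> {0..1}" "\<forall>t\<in>{0..1}. norm (N t0) \<le> norm (N t)"
      by blast
    have "norm (N t0) \<le> norm (N t)" for t
    proof -
      have "N t = N (frac t)" using periodic_shift_int [of N "frac t" "\<lfloor>t\<rfloor>"] Tper by (simp add: frac_def)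
      then show ?thesis using t0 fr [of t] by simp
    qed
    then show thesis using that [of "norm (N t0)"] N0 by auto
  qed
  define n1 where "n1 t = N t /\<^sub>R norm (N t)" for t
  define n2 where "n2 t = cross3 (T t) (n1 t)" for t
  define L1 where "L1 = 2 / r * (2 * norm v * LT)"
  have n1lip: "norm (n1 s - n1 t) \<le> L1 * \<bar>s - t\<bar>" for s t
  proof -
    have "norm (n1 s - n1 t) \<le> 2 / r * norm (N s - N t)"
      unfolding n1_def by (rule lipschitz_normalize [OF r(1) r(2) r(2)])
    also have "\<dots> \<le> 2 / r * (2 * norm v * LT * \<bar>s - t\<bar>)" using r by (intro mult_left_mono Nlip) auto
    finally show ?thesis by (simp add: L1_def)
  qed
  have n11: "n1 t \<bullet> n1 t = 1" for t using N0 by (simp add: n1_def norm_eq_1 flip: power2_norm_eq_inner)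
  then have nn1: "norm (n1 t) = 1" for t by (simp add: norm_eq_1)
  have n1T: "n1 t \<bullet> T t = 0" for t by (simp add: n1_def NT)
  have n2lip: "norm (n2 s - n2 t) \<le> (LT + L1) * \<bar>s - t\<bar>" for s t
  proof -
    have "n2 s - n2 t = cross3 (T s - T t) (n1 s) + cross3 (T t) (n1 s - n1 t)"
      by (simp add: n2_def Cross3.left_diff_distrib Cross3.right_diff_distrib)
    then have "norm (n2 s - n2 t) \<le> norm (cross3 (T s - T t) (n1 s)) + norm (cross3 (T t) (n1 s - n1 t))"
      by (metis norm_triangle_ineq)
    also have "\<dots> \<le> norm (T s - T t) + norm (n1 s - n1 t)"
      using norm_cross3_le [of "T s - T t" "n1 s"] norm_cross3_le [of "T t" "n1 s - n1 t"] by (simp add: nn1 nT)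
    also have "\<dots> \<le> (LT + L1) * \<bar>s - t\<bar>"
      using Tlip [of s t] n1lip [of s t] by (simp add: LT_def algebra_simps)
    finally show ?thesis .
  qed
  have n22: "n2 t \<bullet> n2 t = 1" for t
    using norm_cross_dot [of "T t" "n1 t"] n1T [of t] by (simp add: n2_def nn1 nT inner_commute power2_norm_eq_inner)
  have c'T: "c' t = norm (c' t) *\<^sub>R T t" for t using c'0 by (simp add: T_def)
  define L where "L = K + LT + L1"
  have pos: "LT > 0" "L1 \<ge> 0" using K m r by (auto simp: LT_def L1_def)
  have le: "a * \<bar>s - t\<bar> \<le> L * \<bar>s - t\<bar>" if "a \<le> L" for a s t :: real
    using that by (intro mult_right_mono) auto
  have "framed_curve c c' n1 n2 L m"
  proof
    show "norm (c' s - c' t) \<le> L * \<bar>s - t\<bar>" for s t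
      using c'lip [of s t] le [of K s t] pos by (simp add: L_def)
    show "norm (n1 s - n1 t) \<le> L * \<bar>s - t\<bar>" for s t
      using n1lip [of s t] le [of L1 s t] pos K by (simp add: L_def)
    show "norm (n2 s - n2 t) \<le> L * \<bar>s - t\<bar>" for s t
      using n2lip [of s t] le [of "LT + L1" s t] pos K by (simp add: L_def)
    show "n1 t \<bullet> n2 t = 0" for t by (simp add: n2_def dot_cross_self)
    show "n1 t \<bullet> c' t = 0" "n2 t \<bullet> c' t = 0" for t
      by (subst c'T, simp add: n1T n2_def dot_cross_self)+
    show "n1 (t + 1) = n1 t" "n2 (t + 1) = n2 t" for t by (simp_all add: n1_def n2_def Tper)
  qed (use m mc cper c_deriv cinj n11 n22 pos K in \<open>auto simp: L_def\<close>)
  moreover have "c t = H t" if "t \<in> {0..1}" for t using cH(1) [of t 0] that by simp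
  ultimately show ?thesis by blast
qed

section \<open>Tubular coordinates\<close>

context framed_curve
begin

text \<open>The normal plane at parameter \<open>x\<close> is identified with the complex numbers,
  which makes modulus and direction in that plane directly available.\<close>

definition N :: "real \<Rightarrow> complex \<Rightarrow> real^3" where
  "N x z = Re z *\<^sub>R n1 x + Im z *\<^sub>R n2 x"

definition \<tau> :: "real \<Rightarrow> complex \<Rightarrow> real^3" where
  "\<tau> x z = c x + N x z"

lemma N_simps: "N x 0 = 0" "N x (z + w) = N x z + N x w" "N x (z - w) = N x z - N x w" "N x (r *\<^sub>R z) = r *\<^sub>R N x z"
  by (simp_all add: N_def algebra_simps)

lemma inner_N: "N x z \<bullet> N x w = Re z * Re w + Im z * Im w"
  using orth(3) [of x] by (simp add: N_def inner_add_left inner_add_right orth inner_commute)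

lemma norm_N: "norm (N x z) = cmod z"
  unfolding norm_eq_sqrt_inner [of "N x z"] inner_N cmod_def by (simp add: power2_eq_square)

lemma N_orth: "N x z \<bullet> c' x = 0"
  by (simp add: N_def inner_add_left orth)

lemma N_lip: "norm (N s z - N t z) \<le> 2 * L * \<bar>s - t\<bar> * cmod z"
proof -
  have "N s z - N t z = Re z *\<^sub>R (n1 s - n1 t) + Im z *\<^sub>R (n2 s - n2 t)"
    by (simp add: N_def algebra_simps)
  then have "norm (N s z - N t z) \<le> \<bar>Re z\<bar> * norm (n1 s - n1 t) + \<bar>Im z\<bar> * norm (n2 s - n2 t)"
    by (metis norm_triangle_ineq norm_scaleR)
  also have "\<dots> \<le> cmod z * (L * \<bar>s - t\<bar>) + cmod z * (L * \<bar>s - t\<bar>)"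
    by (intro add_mono mult_mono n1_lip n2_lip abs_Re_le_cmod abs_Im_le_cmod) auto
  finally show ?thesis by (simp add: mult_ac)
qed

lemma N_per: "N (x + 1) z = N x z" by (simp add: N_def n1_per n2_per)

lemma \<tau>_per: "\<tau> (x + of_int k) z = \<tau> x z"
  using periodic_shift_int [of "\<lambda>x. \<tau> x z"] by (simp add: \<tau>_def N_per c_per)

lemma c_per_int: "c (x + of_int k) = c x" and c'_per_int: "c' (x + of_int k) = c' x"
  using periodic_shift_int [of c] periodic_shift_int [of c'] by (auto simp: c_per c'_per)

lemma c'_bound: "norm (c' t) \<le> norm (c' 0) + L"
proof -
  have "c' t = c' (frac t)" using c'_per_int [of "frac t" "\<lfloor>t\<rfloor>"] by (simp add: frac_def)
  then have "norm (c' t) \<le> norm (c' 0) + norm (c' (frac t) - c' 0)"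
    by (metis norm_triangle_sub)
  also have "norm (c' (frac t) - c' 0) \<le> L * \<bar>frac t - 0\<bar>" by (rule c'_lip)
  also have "\<dots> \<le> L" using L frac_ge_0 [of t] frac_lt_1 [of t] by (simp add: mult_left_le)
  finally show ?thesis by simp
qed

lemma c_lip: "norm (c s - c t) \<le> (norm (c' 0) + L) * \<bar>s - t\<bar>"
proof -
  have "norm (c s - c t) \<le> (norm (c' 0) + L) * norm (s - t)"
  proof (rule differentiable_bound [of UNIV c "\<lambda>x h. h *\<^sub>R c' x"])
    show "(c has_derivative (\<lambda>h. h *\<^sub>R c' x)) (at x within UNIV)" for x
      using c_deriv [of x] by (simp add: has_vector_derivative_def)
    show "onorm (\<lambda>h. h *\<^sub>R c' x) \<le> norm (c' 0) + L" for x
    proof (rule onorm_le)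
      show "norm (h *\<^sub>R c' x) \<le> (norm (c' 0) + L) * norm h" for h :: real
        using mult_right_mono [OF c'_bound abs_ge_zero [of h]] by (simp add: mult.commute)
    qed
  qed auto
  then show ?thesis by simp
qed

text \<open>A Lipschitz derivative suffices for a quadratic error: the mean value inequality is
  applied to \<open>c (x + s) - s c' x\<close>.\<close>

lemma c_taylor: "norm (c (x + u) - c x - u *\<^sub>R c' x) \<le> L * u\<^sup>2"
proof -
  define f where "f s = c (x + s) - s *\<^sub>R c' x" for s
  have "norm (f u - f 0) \<le> L * \<bar>u\<bar> * norm (u - 0)"
  proof (rule differentiable_bound [of "cball 0 \<bar>u\<bar>" f "\<lambda>s h. h *\<^sub>R (c' (x + s) - c' x)"])
    fix s :: real assume s: "s \<in> cball 0 \<bar>u\<bar>"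
    have "((\<lambda>s. x + s) has_vector_derivative 1) (at s within cball 0 \<bar>u\<bar>)"
      by (auto intro!: derivative_eq_intros)
    moreover have "(c has_vector_derivative c' (x + s)) (at (x + s) within (\<lambda>s. x + s) ` cball 0 \<bar>u\<bar>)"
      by (rule has_vector_derivative_at_within [OF c_deriv])
    ultimately have "(c \<circ> (\<lambda>s. x + s) has_vector_derivative 1 *\<^sub>R c' (x + s)) (at s within cball 0 \<bar>u\<bar>)"
      by (rule vector_diff_chain_within)
    then have "((\<lambda>s. c (x + s)) has_vector_derivative c' (x + s)) (at s within cball 0 \<bar>u\<bar>)"
      by (simp add: comp_def)
    then have "(f has_vector_derivative c' (x + s) - c' x) (at s within cball 0 \<bar>u\<bar>)"
      unfolding f_def by (auto intro!: derivative_eq_intros)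
    then show "(f has_derivative (\<lambda>h. h *\<^sub>R (c' (x + s) - c' x))) (at s within cball 0 \<bar>u\<bar>)"
      by (simp add: has_vector_derivative_def)
    have n: "norm (c' (x + s) - c' x) \<le> L * \<bar>u\<bar>"
      using c'_lip [of "x + s" x] s L by (auto intro: order_trans mult_left_mono)
    show "onorm (\<lambda>h. h *\<^sub>R (c' (x + s) - c' x)) \<le> L * \<bar>u\<bar>"
    proof (rule onorm_le)
      show "norm (h *\<^sub>R (c' (x + s) - c' x)) \<le> L * \<bar>u\<bar> * norm h" for h :: real
        using mult_right_mono [OF n abs_ge_zero [of h]] by (simp add: mult.commute)
    qed
  qed auto
  then show ?thesis by (simp add: f_def power2_eq_square algebra_simps)
qed

lemma continuous_c: "continuous_on A c"
  using c_deriv by (meson continuous_at_imp_continuous_on has_vector_derivative_continuous)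

lemma continuous_n: "continuous_on A n1" "continuous_on A n2" "continuous_on A c'"
proof -
  have "L-lipschitz_on A n1" "L-lipschitz_on A n2" "L-lipschitz_on A c'"
    using n1_lip n2_lip c'_lip L by (auto intro!: lipschitz_onI simp: dist_norm)
  then show "continuous_on A n1" "continuous_on A n2" "continuous_on A c'"
    by (auto dest: lipschitz_on_continuous_on)
qed

lemma continuous_\<tau>: "continuous_on A (\<lambda>(x, z). \<tau> x z)"
  unfolding \<tau>_def N_def case_prod_unfold
  by (intro continuous_intros continuous_on_compose2 [OF continuous_n(1)] continuous_on_compose2 [OF continuous_n(2)]
      continuous_on_compose2 [OF continuous_c]) auto

text \<open>Short chords are controlled by the Taylor estimate. The other pairs form a compact set
  modulo the period, on which injectivity keeps the chords away from 0. The bound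
  \<open>\<bar>u\<bar> \<le> 1/2\<close> singles out the shorter arc.\<close>

lemma chord_arc: "\<exists>\<kappa>>0. \<forall>x u. \<bar>u\<bar> \<le> 1/2 \<longrightarrow> \<kappa> * \<bar>u\<bar> \<le> norm (c (x + u) - c x)"
proof -
  define u1 where "u1 = min (1/2) (m / (2 * L))"
  have u1: "u1 > 0" "u1 \<le> 1/2" "u1 \<le> m / (2 * L)" using m L by (auto simp: u1_def)
  have near: "m / 2 * \<bar>u\<bar> \<le> norm (c (x + u) - c x)" if "\<bar>u\<bar> \<le> u1" for x u
  proof -
    have "L * u\<^sup>2 \<le> m / 2 * \<bar>u\<bar>"
    proof -
      have "L * \<bar>u\<bar> \<le> L * u1" using that L by (intro mult_left_mono) auto
      also have "\<dots> \<le> m / 2" using u1 L by (simp add: field_simps)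
      finally have "L * \<bar>u\<bar> \<le> m / 2" .
      then have "L * \<bar>u\<bar> * \<bar>u\<bar> \<le> m / 2 * \<bar>u\<bar>" by (intro mult_right_mono) auto
      then show ?thesis by (simp add: power2_eq_square)
    qed
    moreover have "m * \<bar>u\<bar> \<le> norm (u *\<^sub>R c' x)"
      using mult_left_mono [OF m(2) [of x], of "\<bar>u\<bar>"] by (simp add: mult.commute)
    moreover have "norm (u *\<^sub>R c' x) \<le> norm (c (x + u) - c x) + norm (c (x + u) - c x - u *\<^sub>R c' x)"
      by (metis norm_triangle_sub norm_minus_commute)
    ultimately show ?thesis using c_taylor [of x u] by linarith
  qed
  define S where "S = {0..1::real} \<times> ({-1/2..-u1} \<union> {u1..1/2})"
  have "compact S" unfolding S_def by (intro compact_Times compact_Un) auto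
  moreover have "(0, u1) \<in> S" using u1 by (auto simp: S_def)
  moreover have "continuous_on S (\<lambda>(x, u). norm (c (x + u) - c x))"
    unfolding case_prod_unfold
    by (intro continuous_intros continuous_on_compose2 [OF continuous_c]) auto
  ultimately obtain p where p: "p \<in> S" "\<forall>q\<in>S. (\<lambda>(x, u). norm (c (x + u) - c x)) p \<le> (\<lambda>(x, u). norm (c (x + u) - c x)) q"
    using continuous_attains_inf [of S] by blast
  define b where "b = (\<lambda>(x, u). norm (c (x + u) - c x)) p"
  have "b > 0"
  proof -
    obtain x u where pu: "p = (x, u)" by fastforce
    have "u \<notin> \<int>"
    proof
      assume "u \<in> \<int>"
      then obtain k :: int where "u = of_int k" by (auto elim: Ints_cases)
      moreover have "\<bar>u\<bar> < 1" "u \<noteq> 0" using p(1) u1 unfolding pu S_def by auto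
      ultimately have "\<bar>k\<bar> < 1" "k \<noteq> 0" by auto
      then show False by linarith
    qed
    then have "c (x + u) \<noteq> c x" using c_inj [of "x + u" x] by auto
    then show ?thesis by (simp add: b_def pu)
  qed
  show ?thesis
  proof (intro exI conjI allI impI)
    show "0 < min (m / 2) b" using m \<open>b > 0\<close> by simp
    fix x u :: real assume u: "\<bar>u\<bar> \<le> 1/2"
    show "min (m / 2) b * \<bar>u\<bar> \<le> norm (c (x + u) - c x)"
    proof (cases "\<bar>u\<bar> \<le> u1")
      case True
      have "min (m / 2) b * \<bar>u\<bar> \<le> m / 2 * \<bar>u\<bar>" by (intro mult_right_mono) auto
      with near [OF True, of x] show ?thesis by linarith
    next
      case False
      then have "(frac x, u) \<in> S" using u frac_ge_0 [of x] frac_lt_1 [of x] by (auto simp: S_def)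
      then have "b \<le> norm (c (frac x + u) - c (frac x))" using p(2) b_def by fastforce
      also have "c (frac x + u) = c (x + u)" using c_per_int [of "frac x + u" "\<lfloor>x\<rfloor>"] by (simp add: frac_def)
      also have "c (frac x) = c x" using c_per_int [of "frac x" "\<lfloor>x\<rfloor>"] by (simp add: frac_def)
      finally have "b \<le> norm (c (x + u) - c x)" .
      moreover have "min (m / 2) b * \<bar>u\<bar> \<le> b * 1" using u \<open>b > 0\<close> m by (intro mult_mono) auto
      ultimately show ?thesis by linarith
    qed
  qed
qed

text \<open>For nearby parameters the displacement is \<open>u c' x + N x (w - z)\<close>, a sum of
  orthogonal vectors, up to errors with small constants. For distant parameters the chord of the
  core is too long to be compensated within the normal discs.\<close>

lemma tube_bilipschitz:
  "\<exists>\<delta>>0. \<exists>\<kappa>>0. \<forall>x u z w. \<bar>u\<bar> \<le> 1/2 \<longrightarrow> cmod z \<le> \<delta> \<longrightarrow> cmod w \<le> \<delta> \<longrightarrow>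
     \<kappa> * (\<bar>u\<bar> + cmod (w - z)) \<le> norm (\<tau> (x + u) w - \<tau> x z)"
proof -
  obtain \<kappa> where \<kappa>: "\<kappa> > 0" "\<And>x u. \<bar>u\<bar> \<le> 1/2 \<Longrightarrow> \<kappa> * \<bar>u\<bar> \<le> norm (c (x + u) - c x)"
    using chord_arc by blast
  \<comment> \<open>Each of the two errors may cost \<open>m / 8 * \<bar>u\<bar>\<close> of the main
    term \<open>m / 2 * \<bar>u\<bar>\<close>, which leaves \<open>m / 4\<close>. Beyond
    \<open>u0\<close> the chord is at least \<open>\<kappa> * u0\<close>, and the two discs of
    radius \<open>\<delta>\<close> use up at most half of it.\<close>
  define u0 where "u0 = min (1/2) (m / (8 * L))"
  define \<delta> where "\<delta> = min (1/2) (min (m / (16 * L)) (\<kappa> * u0 / 4))"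
  define \<kappa>' where "\<kappa>' = min (min (m / 4) (1/2)) (\<kappa> * u0 / 4)"
  have u0: "u0 > 0" "L * u0 \<le> m / 8" using m L by (auto simp: u0_def min_def field_simps)
  have \<delta>: "\<delta> > 0" "\<delta> \<le> 1/2" "L * \<delta> \<le> m / 16" "\<delta> \<le> \<kappa> * u0 / 4"
  proof -
    show "\<delta> > 0" "\<delta> \<le> 1/2" "\<delta> \<le> \<kappa> * u0 / 4" using m L \<kappa> u0 by (auto simp: \<delta>_def)
    have "\<delta> \<le> m / (16 * L)" by (simp add: \<delta>_def)
    then show "L * \<delta> \<le> m / 16" using L by (simp add: field_simps)
  qed
  have \<kappa>': "\<kappa>' > 0" "\<kappa>' \<le> m / 4" "\<kappa>' \<le> 1/2" "\<kappa>' \<le> \<kappa> * u0 / 4" using m \<kappa> u0 by (auto simp: \<kappa>'_def)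
  have "\<kappa>' * (\<bar>u\<bar> + cmod (w - z)) \<le> norm (\<tau> (x + u) w - \<tau> x z)"
    if u: "\<bar>u\<bar> \<le> 1/2" and z: "cmod z \<le> \<delta>" and w: "cmod w \<le> \<delta>" for x u z w
  proof (cases "\<bar>u\<bar> \<le> u0")
    case True
    define P where "P = u *\<^sub>R c' x + N x (w - z)"
    define e1 where "e1 = c (x + u) - c x - u *\<^sub>R c' x"
    define e2 where "e2 = N (x + u) w - N x w"
    have D: "\<tau> (x + u) w - \<tau> x z = P + (e1 + e2)"
      by (simp add: \<tau>_def P_def e1_def e2_def N_simps)
    have "norm e1 \<le> m / 8 * \<bar>u\<bar>"
    proof -
      have "L * \<bar>u\<bar> \<le> L * u0" using True L by (intro mult_left_mono) auto
      then have "L * \<bar>u\<bar> * \<bar>u\<bar> \<le> m / 8 * \<bar>u\<bar>"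
        using u0(2) by (intro mult_right_mono) linarith+
      then show ?thesis using c_taylor [of x u] by (simp add: e1_def power2_eq_square)
    qed
    moreover have "norm e2 \<le> m / 8 * \<bar>u\<bar>"
    proof -
      have "norm e2 \<le> 2 * L * \<bar>u\<bar> * cmod w" using N_lip [of "x + u" w x] by (simp add: e2_def)
      also have "\<dots> \<le> 2 * L * \<bar>u\<bar> * \<delta>" using w L by (intro mult_left_mono) auto
      also have "\<dots> = 2 * (L * \<delta>) * \<bar>u\<bar>" by simp
      also have "\<dots> \<le> 2 * (m / 16) * \<bar>u\<bar>" using \<delta> by (intro mult_right_mono mult_left_mono) auto
      finally show ?thesis by simp
    qed
    moreover have "m / 2 * \<bar>u\<bar> + cmod (w - z) / 2 \<le> norm P"
    proof -
      have PP: "P \<bullet> P = u\<^sup>2 * (c' x \<bullet> c' x) + (cmod (w - z))\<^sup>2"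
      proof -
        have "N x (w - z) \<bullet> N x (w - z) = (cmod (w - z))\<^sup>2"
          by (metis norm_N power2_norm_eq_inner)
        then show ?thesis
          using N_orth [of x "w - z"]
          by (simp add: P_def inner_add_left inner_add_right inner_commute power2_eq_square)
      qed
      have "\<bar>u\<bar> * norm (c' x) \<le> norm P"
        by (rule power2_le_imp_le) (auto simp: power_mult_distrib power2_norm_eq_inner PP)
      moreover have "\<bar>u\<bar> * m \<le> \<bar>u\<bar> * norm (c' x)" using m by (intro mult_left_mono) auto
      moreover have "cmod (w - z) \<le> norm P"
        by (rule power2_le_imp_le) (auto simp: power2_norm_eq_inner [of P] PP)
      ultimately show ?thesis by (simp add: field_simps)
    qed
    moreover have "norm P \<le> norm (\<tau> (x + u) w - \<tau> x z) + (norm e1 + norm e2)"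
      unfolding D using norm_triangle_ineq2 [of P "- (e1 + e2)"] norm_triangle_ineq [of e1 e2] norm_minus_cancel [of "e1 + e2"]
      by (simp del: minus_add_distrib norm_minus_cancel)
    moreover have "\<kappa>' * \<bar>u\<bar> \<le> m / 4 * \<bar>u\<bar>" "\<kappa>' * cmod (w - z) \<le> 1/2 * cmod (w - z)"
      using mult_right_mono [OF \<kappa>'(2) abs_ge_zero [of u]] mult_right_mono [OF \<kappa>'(3) norm_ge_zero [of "w - z"]] by simp_all
    moreover have "m / 2 * \<bar>u\<bar> = m / 8 * \<bar>u\<bar> + m / 8 * \<bar>u\<bar> + m / 4 * \<bar>u\<bar>" by (simp add: field_simps)
    ultimately show ?thesis by (simp only: distrib_left)
  next
    case False
    have "\<kappa> * u0 \<le> \<kappa> * \<bar>u\<bar>" using False \<kappa> by (intro mult_left_mono) auto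
    then have "\<kappa> * u0 \<le> norm (c (x + u) - c x)" using \<kappa>(2) [OF u, of x] by linarith
    moreover have "norm (c (x + u) - c x) \<le> norm (\<tau> (x + u) w - \<tau> x z) + (norm (N (x + u) w) + norm (N x z))"
    proof -
      have "c (x + u) - c x = (\<tau> (x + u) w - \<tau> x z) + (N x z - N (x + u) w)" by (simp add: \<tau>_def)
      then have "norm (c (x + u) - c x) \<le> norm (\<tau> (x + u) w - \<tau> x z) + norm (N x z - N (x + u) w)"
        by (simp only: norm_triangle_ineq)
      then show ?thesis
        using norm_triangle_ineq4 [of "N x z" "N (x + u) w"] by linarith
    qed
    moreover have "\<kappa>' * (\<bar>u\<bar> + cmod (w - z)) \<le> (\<kappa> * u0 / 4) * 2"
    proof (rule mult_mono)
      have "cmod (w - z) \<le> cmod w + cmod z" by (rule norm_triangle_ineq4)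
      then show "\<bar>u\<bar> + cmod (w - z) \<le> 2" using u w z \<delta> by linarith
    qed (use \<kappa>' \<kappa> u0 in auto)
    ultimately show ?thesis using w z \<delta> norm_N [of "x + u" w] norm_N [of x z] by linarith
  qed
  then show ?thesis using \<delta>(1) \<kappa>'(1) by blast
qed

end

text \<open>A continuous map from a compact set to a Hausdorff space is a quotient map onto its
  image. So continuity on the tube can be tested in tube coordinates, although these are determined
  only modulo the period.\<close>

lemma continuous_on_compact_surjection:
  fixes f :: "'a::heine_borel \<Rightarrow> 'b::t2_space" and g :: "'b \<Rightarrow> 'c::topological_space"
  assumes S: "compact S" and f: "continuous_on S f" and gf: "continuous_on S (\<lambda>x. g (f x))"
  shows "continuous_on (f ` S) g"
  unfolding continuous_on_closed_invariant
proof (intro allI impI)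
  fix B :: "'c set" assume B: "closed B"
  obtain A where A: "closed A" "A \<inter> S = (\<lambda>x. g (f x)) -` B \<inter> S"
    using gf B unfolding continuous_on_closed_invariant by blast
  have "compact (A \<inter> S)" using S A(1) by (simp add: closed_Int_compact)
  then have "compact (f ` (A \<inter> S))" by (intro compact_continuous_image continuous_on_subset [OF f]) auto
  then have "closed (f ` (A \<inter> S))" by (rule compact_imp_closed)
  moreover have "f ` (A \<inter> S) \<inter> f ` S = g -` B \<inter> f ` S"
    unfolding A(2) by auto
  ultimately show "\<exists>A. closed A \<and> A \<inter> f ` S = g -` B \<inter> f ` S" by blast
qed

section \<open>The embedded tube\<close>

locale tube = framed_curve +
  fixes \<delta> \<kappa> :: real
  assumes \<delta>: "\<delta> > 0" and \<kappa>: "\<kappa> > 0"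
    and bilip: "\<And>x u z w. \<bar>u\<bar> \<le> 1/2 \<Longrightarrow> cmod z \<le> \<delta> \<Longrightarrow> cmod w \<le> \<delta> \<Longrightarrow>
       \<kappa> * (\<bar>u\<bar> + cmod (w - z)) \<le> norm (\<tau> (x + u) w - \<tau> x z)"
begin

definition V :: "real \<Rightarrow> (real^3) set" where
  "V r = {\<tau> x z |x z. cmod z \<le> r}"

definition V' :: "real \<Rightarrow> (real^3) set" where
  "V' r = {\<tau> x z |x z. cmod z < r}"

definition K :: "(real^3) set" where "K = range c"

lemma K_eq: "K = V 0"
  by (auto simp: K_def V_def \<tau>_def N_simps)

lemma K_sub: "r > 0 \<Longrightarrow> K \<subseteq> V' r"
  by (auto simp: K_eq V_def V'_def) (metis norm_zero)

lemma near_rep: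
  fixes x y :: real
  obtains k :: int where "\<bar>y - x - of_int k\<bar> \<le> 1/2"
  using that [of "round (y - x)"] of_int_round_abs_le [of "y - x"] by (metis abs_minus_commute)

text \<open>Any two parameters come within distance 1/2 after an integer shift, so the local
  estimate governs all pairs.\<close>

lemma bilip_mod:
  assumes "cmod z \<le> \<delta>" "cmod w \<le> \<delta>"
  obtains k :: int where "\<kappa> * (\<bar>y - x - of_int k\<bar> + cmod (w - z)) \<le> norm (\<tau> y w - \<tau> x z)"
proof -
  obtain k :: int where k: "\<bar>y - x - of_int k\<bar> \<le> 1/2" by (rule near_rep)
  have "\<kappa> * (\<bar>y - x - of_int k\<bar> + cmod (w - z)) \<le> norm (\<tau> (x + (y - x - of_int k)) w - \<tau> x z)"
    by (rule bilip [OF k assms])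
  moreover have "\<tau> (x + (y - x - of_int k)) w = \<tau> y w"
    using \<tau>_per [of "y" "- k" w] by simp
  ultimately show thesis using that by simp
qed

lemma \<tau>_inj:
  assumes "\<tau> x z = \<tau> y w" "cmod z \<le> \<delta>" "cmod w \<le> \<delta>"
  shows "w = z" "y - x \<in> \<int>"
proof -
  obtain k :: int where "\<kappa> * (\<bar>y - x - of_int k\<bar> + cmod (w - z)) \<le> norm (\<tau> y w - \<tau> x z)"
    using bilip_mod [OF assms(2,3)] by blast
  then have "\<kappa> * (\<bar>y - x - of_int k\<bar> + cmod (w - z)) \<le> 0" using assms(1) by simp
  then have *: "\<bar>y - x - of_int k\<bar> + cmod (w - z) \<le> 0" using \<kappa> by (simp add: mult_le_0_iff)
  then have "\<bar>y - x - of_int k\<bar> = 0" "cmod (w - z) = 0"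
    using abs_ge_zero [of "y - x - of_int k"] norm_ge_zero [of "w - z"] by linarith+
  then show "w = z" "y - x \<in> \<int>" by auto
qed

text \<open>The coordinate \<open>tx\<close> is determined only modulo 1.\<close>

definition tx :: "real^3 \<Rightarrow> real" where "tx y = (SOME x. \<exists>z. cmod z \<le> \<delta> \<and> y = \<tau> x z)"
definition tz :: "real^3 \<Rightarrow> complex" where "tz y = (SOME z. cmod z \<le> \<delta> \<and> y = \<tau> (tx y) z)"

lemma txz: assumes "y \<in> V \<delta>" shows "y = \<tau> (tx y) (tz y)" "cmod (tz y) \<le> \<delta>"
proof -
  have "\<exists>x z. cmod z \<le> \<delta> \<and> y = \<tau> x z" using assms by (auto simp: V_def)
  then have "\<exists>z. cmod z \<le> \<delta> \<and> y = \<tau> (tx y) z" unfolding tx_def by (rule someI_ex)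
  then have "cmod (tz y) \<le> \<delta> \<and> y = \<tau> (tx y) (tz y)" unfolding tz_def by (rule someI_ex)
  then show "y = \<tau> (tx y) (tz y)" "cmod (tz y) \<le> \<delta>" by auto
qed

lemma tz_\<tau>: "cmod z \<le> \<delta> \<Longrightarrow> tz (\<tau> x z) = z"
  and tx_\<tau>: "cmod z \<le> \<delta> \<Longrightarrow> tx (\<tau> x z) - x \<in> \<int>"
proof -
  assume z: "cmod z \<le> \<delta>"
  then have "\<tau> x z \<in> V \<delta>" by (auto simp: V_def)
  from txz [OF this] \<tau>_inj [of x z "tx (\<tau> x z)" "tz (\<tau> x z)"] z
  show "tz (\<tau> x z) = z" "tx (\<tau> x z) - x \<in> \<int>" by auto
qed

lemma periodic_tx:
  fixes f :: "real \<Rightarrow> 'b"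
  assumes "\<And>x. f (x + 1) = f x" "cmod z \<le> \<delta>"
  shows "f (tx (\<tau> x z)) = f x"
proof -
  obtain k :: int where "tx (\<tau> x z) - x = of_int k" using tx_\<tau> [OF assms(2)] by (auto elim: Ints_cases)
  then have "tx (\<tau> x z) = x + of_int k" by simp
  then show ?thesis using periodic_shift_int [of f x k] assms(1) by simp
qed

lemma V_image: "V r = (\<lambda>(x, z). \<tau> x z) ` ({0..1} \<times> cball 0 r)"
proof (intro equalityI subsetI)
  fix y assume "y \<in> V r"
  then obtain x z where "y = \<tau> x z" "cmod z \<le> r" by (auto simp: V_def)
  moreover have "\<tau> x z = \<tau> (frac x) z" using \<tau>_per [of "frac x" "\<lfloor>x\<rfloor>"] by (simp add: frac_def)
  ultimately show "y \<in> (\<lambda>(x, z). \<tau> x z) ` ({0..1} \<times> cball 0 r)"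
    using frac_ge_0 [of x] frac_lt_1 [of x] by (auto intro!: image_eqI [of _ _ "(frac x, z)"])
qed (fastforce simp: V_def)

lemma compact_V: "compact (V r)"
  unfolding V_image by (intro compact_continuous_image continuous_\<tau> compact_Times) auto

lemma continuous_on_V:
  fixes f :: "real^3 \<Rightarrow> 'b::topological_space"
  assumes "continuous_on ({0..1} \<times> cball 0 r) (\<lambda>(x, z). f (\<tau> x z))"
  shows "continuous_on (V r) f"
  unfolding V_image
  by (rule continuous_on_compact_surjection [OF _ continuous_\<tau>])
     (use assms in \<open>auto intro!: compact_Times simp: case_prod_unfold\<close>)

lemma V'_sub: "V' r \<subseteq> V r" by (auto simp: V_def V'_def intro: less_imp_le)

lemma V_mono: "r \<le> s \<Longrightarrow> V r \<subseteq> V s" by (auto simp: V_def intro: order_trans)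

lemma in_V_iff: "y \<in> V \<delta> \<Longrightarrow> r \<le> \<delta> \<Longrightarrow> y \<in> V r \<longleftrightarrow> cmod (tz y) \<le> r"
  using txz tz_\<tau> by (auto simp: V_def) (metis order_trans)

lemma in_V'_iff: "y \<in> V \<delta> \<Longrightarrow> r \<le> \<delta> \<Longrightarrow> y \<in> V' r \<longleftrightarrow> cmod (tz y) < r"
  using txz tz_\<tau> by (auto simp: V'_def)

lemma open_V':
  assumes "r \<le> \<delta>" shows "open (V' r)"
proof -
  \<comment> \<open>Windows of length 1/2 are shorter than the period, so \<open>\<tau>\<close> is
    injective over each of them and invariance of domain applies.\<close>
  have "V' r = (\<Union>x0. (\<lambda>(x, z). \<tau> x z) ` ({x0 - 1/4<..<x0 + 1/4} \<times> ball 0 r))"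
  proof (intro equalityI subsetI)
    fix y assume "y \<in> V' r"
    then obtain x z where "y = \<tau> x z" "cmod z < r" by (auto simp: V'_def)
    then show "y \<in> (\<Union>x0. (\<lambda>(x, z). \<tau> x z) ` ({x0 - 1/4<..<x0 + 1/4} \<times> ball 0 r))"
      by (auto intro!: exI [of _ x] image_eqI [of _ _ "(x, z)"])
  qed (fastforce simp: V'_def)
  moreover have "open ((\<lambda>(x, z). \<tau> x z) ` ({x0 - 1/4<..<x0 + 1/4} \<times> ball 0 r))" for x0
  proof (rule invariance_of_domain_gen)
    show "open ({x0 - 1/4<..<x0 + 1/4} \<times> ball (0::complex) r)" by (intro open_Times) auto
    show "inj_on (\<lambda>(x, z). \<tau> x z) ({x0 - 1/4<..<x0 + 1/4} \<times> ball 0 r)"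
    proof (rule inj_onI, clarsimp)
      fix x z y w assume *: "\<tau> x z = \<tau> y w" "x0 - 1/4 < x" "x < x0 + 1/4" "y < x0 + 1/4" "x0 - 1/4 < y" "cmod z < r" "cmod w < r"
      then have "w = z" "y - x \<in> \<int>" using \<tau>_inj [of x z y w] assms by auto
      moreover have "\<bar>y - x\<bar> < 1" using * by linarith
      ultimately show "x = y \<and> z = w" using Ints_nonzero_abs_less1 [of "y - x"] by auto
    qed
  qed (auto intro: continuous_\<tau>)
  ultimately show ?thesis by auto
qed

text \<open>Although \<open>tx\<close> may jump, the normal component equals
  \<open>y - c (tx y)\<close>, in which an integer shift of \<open>tx y\<close> is
  invisible.\<close>

lemma tz_lip:
  assumes "y \<in> V \<delta>" "w \<in> V \<delta>"
  shows "\<bar>cmod (tz y) - cmod (tz w)\<bar> \<le> norm (y - w) / \<kappa>"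
    and "norm (N (tx y) (tz y) - N (tx w) (tz w)) \<le> (1 + (norm (c' 0) + L) / \<kappa>) * norm (y - w)"
proof -
  obtain k :: int where k: "\<kappa> * (\<bar>tx y - tx w - of_int k\<bar> + cmod (tz y - tz w)) \<le> norm (y - w)"
    using bilip_mod [of "tz w" "tz y" "tx y" "tx w"] txz [OF assms(1)] txz [OF assms(2)] by metis
  then have "\<bar>tx y - tx w - of_int k\<bar> + cmod (tz y - tz w) \<le> norm (y - w) / \<kappa>"
    using \<kappa> by (simp add: field_simps)
  moreover have "\<bar>cmod (tz y) - cmod (tz w)\<bar> \<le> cmod (tz y - tz w)" by (rule norm_triangle_ineq3)
  ultimately show "\<bar>cmod (tz y) - cmod (tz w)\<bar> \<le> norm (y - w) / \<kappa>" by linarith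
  have b: "\<bar>tx y - (tx w + of_int k)\<bar> \<le> norm (y - w) / \<kappa>"
    using \<open>\<bar>tx y - tx w - of_int k\<bar> + cmod (tz y - tz w) \<le> norm (y - w) / \<kappa>\<close> norm_ge_zero [of "tz y - tz w"]
    by (simp only: diff_diff_eq [symmetric])
  have "N (tx y) (tz y) - N (tx w) (tz w) = (y - w) - (c (tx y) - c (tx w + of_int k))"
  proof -
    have "N (tx v) (tz v) = v - c (tx v)" if "v \<in> V \<delta>" for v
      using txz(1) [OF that] by (metis \<tau>_def add_diff_cancel_left')
    then show ?thesis using assms by (simp add: c_per_int)
  qed
  then have "norm (N (tx y) (tz y) - N (tx w) (tz w)) \<le> norm (y - w) + norm (c (tx y) - c (tx w + of_int k))"
    by (metis norm_triangle_ineq4)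
  also have "\<dots> \<le> norm (y - w) + (norm (c' 0) + L) * (norm (y - w) / \<kappa>)"
    using c_lip [of "tx y" "tx w + of_int k"] mult_left_mono [OF b, of "norm (c' 0) + L"] L by simp
  finally show "norm (N (tx y) (tz y) - N (tx w) (tz w)) \<le> (1 + (norm (c' 0) + L) / \<kappa>) * norm (y - w)"
    by (simp add: algebra_simps)
qed

end

section \<open>The potential and its gradient\<close>

text \<open>Differentiation under the integral sign, with derivatives represented by
  gradients.\<close>

lemma gradient_integral:
  fixes f :: "'a::euclidean_space \<Rightarrow> real \<Rightarrow> real" and k :: "'a \<Rightarrow> real \<Rightarrow> 'a"
  assumes U: "open U" and y: "y \<in> U"
    and d: "\<And>y t. y \<in> U \<Longrightarrow> t \<in> {0..1} \<Longrightarrow> ((\<lambda>y. f y t) has_derivative (\<lambda>v. k y t \<bullet> v)) (at y)"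
    and f: "\<And>y. y \<in> U \<Longrightarrow> continuous_on {0..1} (f y)"
    and k: "continuous_on (U \<times> {0..1}) (\<lambda>(y, t). k y t)"
  shows "((\<lambda>y. integral {0..1} (f y)) has_derivative (\<lambda>v. integral {0..1} (k y) \<bullet> v)) (at y)"
proof -
  obtain r where r: "r > 0" "ball y r \<subseteq> U" using U y openE by blast
  have ky: "continuous_on {0..1} (k y)"
  proof -
    have "continuous_on {0..1} (\<lambda>t. (\<lambda>(y, t). k y t) (y, t))"
      by (rule continuous_on_compose2 [OF k]) (use y in \<open>auto intro!: continuous_intros\<close>)
    then show ?thesis by simp
  qed
  have "((\<lambda>y. integral (cbox 0 1) (f y)) has_derivative blinfun_apply (integral (cbox 0 1) (\<lambda>t. blinfun_inner_right (k y t)))) (at y within ball y r)"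
  proof (rule leibniz_rule)
    show "((\<lambda>y. f y t) has_derivative blinfun_apply (blinfun_inner_right (k x t))) (at x within ball y r)"
      if "x \<in> ball y r" "t \<in> cbox 0 1" for x t
      using has_derivative_at_withinI [OF d [of x t]] that r by (auto simp: blinfun_inner_right.rep_eq)
    show "f x integrable_on cbox 0 1" if "x \<in> ball y r" for x
      using f [of x] that r by (auto intro!: integrable_continuous_interval)
    have "continuous_on (ball y r \<times> cbox 0 1) (\<lambda>z. blinfun_inner_right ((\<lambda>(y, t). k y t) z))"
      by (intro bounded_linear.continuous_on [OF bounded_linear_blinfun_inner_right] continuous_on_subset [OF k])
         (use r in auto)
    then show "continuous_on (ball y r \<times> cbox 0 1) (\<lambda>(x, t). blinfun_inner_right (k x t))"
      by (simp add: case_prod_unfold)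
  qed (use r in auto)
  moreover have "integral (cbox 0 1) (\<lambda>t. blinfun_inner_right (k y t)) = blinfun_inner_right (integral {0..1} (k y))"
    using integral_linear [OF integrable_continuous_interval [OF ky] bounded_linear_blinfun_inner_right]
    by (simp add: comp_def)
  moreover have "at y within ball y r = at y"
    using r by (intro at_within_open) auto
  ultimately show ?thesis by (simp add: blinfun_inner_right.rep_eq)
qed

lemma integral_unit_pos:
  fixes f :: "real \<Rightarrow> real"
  assumes "continuous_on {0..1} f" "\<And>t. t \<in> {0..1} \<Longrightarrow> f t > 0"
  shows "integral {0..1} f > 0"
proof -
  have "\<exists>s\<in>{0..1}. \<forall>t\<in>{0..1}. f s \<le> f t"
    by (rule continuous_attains_inf) (auto intro!: assms)
  then obtain s where s: "s \<in> {0..1}" "\<And>t. t \<in> {0..1} \<Longrightarrow> f s \<le> f t" by blast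
  have "integral {0..1::real} (\<lambda>_. f s) \<le> integral {0..1} f"
    by (intro integral_le integrable_continuous_interval assms s) auto
  then show ?thesis using assms(2) [OF s(1)] by simp
qed

lemma powr_inner_deriv:
  fixes a y :: "'a::euclidean_space"
  assumes "y \<noteq> a"
  shows "((\<lambda>y. ((y - a) \<bullet> (y - a)) powr r) has_derivative (\<lambda>v. (2 * r * ((y - a) \<bullet> (y - a)) powr (r - 1)) * ((y - a) \<bullet> v))) (at y)"
proof -
  have pos: "(y - a) \<bullet> (y - a) > 0" using assms by simp
  have 1: "((\<lambda>y. (y - a) \<bullet> (y - a)) has_derivative (\<lambda>v. 2 * ((y - a) \<bullet> v))) (at y)"
    by (rule has_derivative_eq_rhs, rule has_derivative_inner) (auto intro!: derivative_eq_intros simp: inner_commute)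
  have 2: "((\<lambda>z. z powr r) has_derivative (\<lambda>h. (r * ((y - a) \<bullet> (y - a)) powr (r - 1)) * h)) (at ((y - a) \<bullet> (y - a)))"
    using has_real_derivative_powr [OF pos, of r] by (simp add: has_field_derivative_def)
  show ?thesis
    by (rule has_derivative_eq_rhs [OF has_derivative_compose [OF 1 2]]) (auto simp: algebra_simps)
qed

text \<open>The potential with exponent \<open>s = q - 1\<close>. A power of the inner product
  replaces the power of the norm because it is easier to differentiate.\<close>

definition coulomb :: "real \<Rightarrow> (real \<Rightarrow> 'a::euclidean_space) \<Rightarrow> 'a \<Rightarrow> real" where
  "coulomb s c y = integral {0..1} (\<lambda>t. ((y - c t) \<bullet> (y - c t)) powr (- s / 2))"

definition field :: "real \<Rightarrow> (real \<Rightarrow> 'a::euclidean_space) \<Rightarrow> 'a \<Rightarrow> 'a" where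
  "field s c y = integral {0..1} (\<lambda>t. (- s * ((y - c t) \<bullet> (y - c t)) powr (- s / 2 - 1)) *\<^sub>R (y - c t))"

lemma potential_eq_coulomb:
  assumes "\<And>t. t \<in> {0..1} \<Longrightarrow> H t = c t" "y \<notin> c ` {0..1}"
  shows "potential q H y = coulomb (q - 1) c y"
  unfolding potential_def coulomb_def
proof (rule integral_cong)
  fix t :: real assume t: "t \<in> {0..1}"
  then have pos: "norm (y - c t) > 0" using assms(2) by auto
  have "((y - c t) \<bullet> (y - c t)) powr (- (q - 1) / 2) = (norm (y - c t) powr 2) powr (- (q - 1) / 2)"
    using pos by (simp add: dot_square_norm)
  also have "\<dots> = 1 / norm (y - c t) powr (q - 1)"
  proof -
    have "2 * (- (q - 1) / 2) = - (q - 1)" by simp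
    then show ?thesis by (simp only: powr_powr powr_minus_divide)
  qed
  finally show "1 / norm (y - H t) powr (q - 1) = ((y - c t) \<bullet> (y - c t)) powr (- (q - 1) / 2)"
    using assms(1) [OF t] by simp
qed

context
  fixes s :: real and c :: "real \<Rightarrow> 'a::euclidean_space"
  assumes c: "continuous_on UNIV c"
begin

lemma curve_closed: "closed (c ` {0..1})"
  by (intro compact_imp_closed compact_continuous_image continuous_on_subset [OF c]) auto

lemma kernel_continuous:
  "continuous_on ((- c ` {0..1}) \<times> {0..1}) (\<lambda>z. ((fst z - c (snd z)) \<bullet> (fst z - c (snd z))) powr r)"
  by (intro continuous_on_powr continuous_intros continuous_on_compose2 [OF c]) auto

lemma kernel_continuous_t:
  assumes "y \<notin> c ` {0..1}"
  shows "continuous_on {0..1} (\<lambda>t. ((y - c t) \<bullet> (y - c t)) powr r)"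
  by (intro continuous_on_powr continuous_intros continuous_on_subset [OF c]) (use assms in auto)

lemma coulomb_deriv:
  assumes "y \<notin> c ` {0..1}"
  shows "(coulomb s c has_derivative (\<lambda>v. field s c y \<bullet> v)) (at y)"
  unfolding coulomb_def [abs_def] field_def
proof (rule gradient_integral [where U = "- c ` {0..1}"])
  show "open (- c ` {0..1})" using curve_closed by auto
  show "((\<lambda>y. ((y - c t) \<bullet> (y - c t)) powr (- s / 2)) has_derivative
      (\<lambda>v. ((- s * ((x - c t) \<bullet> (x - c t)) powr (- s / 2 - 1)) *\<^sub>R (x - c t)) \<bullet> v)) (at x)"
    if "x \<in> - c ` {0..1}" "t \<in> {0..1}" for x t
    by (rule has_derivative_eq_rhs [OF powr_inner_deriv]) (use that in \<open>auto simp: algebra_simps\<close>)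
  show "continuous_on {0..1} (\<lambda>t. ((x - c t) \<bullet> (x - c t)) powr (- s / 2))" if "x \<in> - c ` {0..1}" for x
    using kernel_continuous_t that by auto
  show "continuous_on ((- c ` {0..1}) \<times> {0..1}) (\<lambda>(y, t). (- s * ((y - c t) \<bullet> (y - c t)) powr (- s / 2 - 1)) *\<^sub>R (y - c t))"
    unfolding case_prod_unfold
    by (intro continuous_intros kernel_continuous continuous_on_compose2 [OF c]) auto
qed (use assms in auto)

text \<open>The row in direction \<open>e\<close> of the Hessian of the kernel
  \<open>|y - c t| powr (- s)\<close>.\<close>

definition hess_row :: "'a \<Rightarrow> 'a \<Rightarrow> real \<Rightarrow> 'a" where
  "hess_row e y t = (s * (s + 2) * ((y - c t) \<bullet> (y - c t)) powr (- s / 2 - 2) * ((y - c t) \<bullet> e)) *\<^sub>R (y - c t)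
     - (s * ((y - c t) \<bullet> (y - c t)) powr (- s / 2 - 1)) *\<^sub>R e"

lemma hess_row_inner: "hess_row e y t \<bullet> v =
    s * (s + 2) * ((y - c t) \<bullet> (y - c t)) powr (- s / 2 - 2) * ((y - c t) \<bullet> e) * ((y - c t) \<bullet> v)
     - s * ((y - c t) \<bullet> (y - c t)) powr (- s / 2 - 1) * (e \<bullet> v)"
proof -
  define w where "w = y - c t"
  show ?thesis unfolding hess_row_def w_def [symmetric] by (simp add: inner_diff_left)
qed

lemma hess_row_continuous: "continuous_on ((- c ` {0..1}) \<times> {0..1}) (\<lambda>(y, t). hess_row e y t)"
  unfolding hess_row_def case_prod_unfold
  by (intro continuous_intros kernel_continuous continuous_on_compose2 [OF c]) auto

lemma hess_row_continuous_t:
  assumes "y \<notin> c ` {0..1}" shows "continuous_on {0..1} (hess_row e y)"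
  unfolding hess_row_def [abs_def]
  by (intro continuous_intros kernel_continuous_t assms continuous_on_subset [OF c]) auto

lemma field_kernel_continuous_t:
  assumes "y \<notin> c ` {0..1}"
  shows "continuous_on {0..1} (\<lambda>t. (- s * ((y - c t) \<bullet> (y - c t)) powr (- s / 2 - 1)) *\<^sub>R (y - c t))"
  by (intro continuous_intros kernel_continuous_t assms continuous_on_subset [OF c]) auto

lemma field_inner:
  assumes "y \<notin> c ` {0..1}"
  shows "field s c y \<bullet> e = integral {0..1} (\<lambda>t. - s * ((y - c t) \<bullet> (y - c t)) powr (- s / 2 - 1) * ((y - c t) \<bullet> e))"
  using integral_linear [OF integrable_continuous_interval [OF field_kernel_continuous_t [OF assms]] bounded_linear_inner_left [of e]]
  by (simp add: field_def comp_def)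

lemma field_deriv:
  assumes "y \<notin> c ` {0..1}"
  shows "((\<lambda>y. field s c y \<bullet> e) has_derivative (\<lambda>v. integral {0..1} (hess_row e y) \<bullet> v)) (at y)"
proof -
  have "((\<lambda>y. integral {0..1} (\<lambda>t. - s * ((y - c t) \<bullet> (y - c t)) powr (- s / 2 - 1) * ((y - c t) \<bullet> e)))
      has_derivative (\<lambda>v. integral {0..1} (hess_row e y) \<bullet> v)) (at y)"
  proof (rule gradient_integral [where U = "- c ` {0..1}"])
    show "open (- c ` {0..1})" using curve_closed by auto
    show "((\<lambda>y. - s * ((y - c t) \<bullet> (y - c t)) powr (- s / 2 - 1) * ((y - c t) \<bullet> e)) has_derivative
        (\<lambda>v. hess_row e x t \<bullet> v)) (at x)"
      if "x \<in> - c ` {0..1}" "t \<in> {0..1}" for x t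
    proof -
      have x: "x \<noteq> c t" using that by auto
      have d2: "((\<lambda>y. (y - c t) \<bullet> e) has_derivative (\<lambda>v. v \<bullet> e)) (at x)"
        by (auto intro!: derivative_eq_intros)
      have "((\<lambda>y. ((y - c t) \<bullet> (y - c t)) powr (- s / 2 - 1) * ((y - c t) \<bullet> e)) has_derivative
         (\<lambda>v. ((x - c t) \<bullet> (x - c t)) powr (- s / 2 - 1) * (v \<bullet> e) +
           (2 * (- s / 2 - 1) * ((x - c t) \<bullet> (x - c t)) powr (- s / 2 - 1 - 1)) * ((x - c t) \<bullet> v) * ((x - c t) \<bullet> e))) (at x)"
        by (rule has_derivative_mult [OF powr_inner_deriv [OF x] d2])
      from has_derivative_mult_right [OF this, of "- s"]
      have "((\<lambda>y. - s * (((y - c t) \<bullet> (y - c t)) powr (- s / 2 - 1) * ((y - c t) \<bullet> e))) has_derivative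
         (\<lambda>v. hess_row e x t \<bullet> v)) (at x)"
        by (rule has_derivative_eq_rhs)
           (auto simp: hess_row_def inner_diff_left inner_commute algebra_simps)
      then show ?thesis by (simp add: mult.assoc)
    qed
    show "continuous_on {0..1} (\<lambda>t. - s * ((x - c t) \<bullet> (x - c t)) powr (- s / 2 - 1) * ((x - c t) \<bullet> e))" if "x \<in> - c ` {0..1}" for x
      by (intro continuous_intros kernel_continuous_t continuous_on_subset [OF c]) (use that in auto)
  qed (use assms hess_row_continuous in auto)
  then show ?thesis
    by (rule has_derivative_transform_within_open [where s = "- c ` {0..1}"])
       (use curve_closed assms field_inner in auto)
qed

lemma continuous_on_field: "continuous_on (- c ` {0..1}) (field s c)"
proof -
  have "continuous_on (- c ` {0..1}) (\<lambda>y. field s c y \<bullet> b)" for b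
    using field_deriv by (intro has_derivative_continuous_on [where f' = "\<lambda>y v. integral {0..1} (hess_row b y) \<bullet> v"])
       (auto intro: has_derivative_at_withinI)
  then show ?thesis using continuous_on_componentwise [of _ "field s c"] by blast
qed

lemma hess_row_symmetric:
  assumes "y \<notin> c ` {0..1}"
  shows "integral {0..1} (hess_row e y) \<bullet> v = integral {0..1} (hess_row v y) \<bullet> e"
proof -
  have *: "integral {0..1} (hess_row e y) \<bullet> v = integral {0..1} (\<lambda>t. hess_row e y t \<bullet> v)" for e v
    using integral_linear [OF integrable_continuous_interval [OF hess_row_continuous_t [OF assms]] bounded_linear_inner_left [of v]]
    by (simp add: comp_def)
  show ?thesis
    unfolding * by (rule integral_cong) (simp only: hess_row_inner inner_commute [of e v] mult_ac)
qed

text \<open>In dimension 3 the Laplacian of \<open>|w| powr (- s)\<close> is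
  \<open>s (s - 1) |w| powr (- s - 2)\<close>, which is nonnegative for \<open>s \<ge> 1\<close>,
  that is, for \<open>q \<ge> 2\<close>.\<close>

lemma hess_row_trace:
  assumes "y \<notin> c ` {0..1}" "1 \<le> s" "DIM('a) = 3"
  shows "0 \<le> (\<Sum>b\<in>Basis. integral {0..1} (hess_row b y) \<bullet> b)"
proof -
  have *: "integral {0..1} (hess_row e y) \<bullet> v = integral {0..1} (\<lambda>t. hess_row e y t \<bullet> v)" for e v
    using integral_linear [OF integrable_continuous_interval [OF hess_row_continuous_t [OF assms(1)]] bounded_linear_inner_left [of v]]
    by (simp add: comp_def)
  have "(\<Sum>b\<in>Basis. integral {0..1} (hess_row b y) \<bullet> b) = integral {0..1} (\<lambda>t. \<Sum>b\<in>Basis. hess_row b y t \<bullet> b)"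
    unfolding * by (rule integral_sum [symmetric])
      (auto intro!: integrable_continuous_interval continuous_on_inner hess_row_continuous_t assms continuous_on_const)
  also have "\<dots> \<ge> 0"
  proof (rule integral_nonneg)
    show "(\<lambda>t. \<Sum>b\<in>Basis. hess_row b y t \<bullet> b) integrable_on {0..1}"
      by (intro integrable_continuous_interval continuous_on_sum continuous_on_inner hess_row_continuous_t assms continuous_on_const)
    fix t :: real assume t: "t \<in> {0..1}"
    define w where "w = y - c t"
    have w: "w \<bullet> w > 0" using assms(1) t by (auto simp: w_def)
    have "(\<Sum>b\<in>Basis. hess_row b y t \<bullet> b) = (\<Sum>b\<in>Basis. s * (s + 2) * (w \<bullet> w) powr (- s / 2 - 2) * ((w \<bullet> b) * (w \<bullet> b)) - s * (w \<bullet> w) powr (- s / 2 - 1))"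
      by (rule sum.cong) (auto simp: hess_row_inner w_def [symmetric])
    also have "\<dots> = s * (s + 2) * (w \<bullet> w) powr (- s / 2 - 2) * (\<Sum>b\<in>Basis. (w \<bullet> b) * (w \<bullet> b)) - 3 * (s * (w \<bullet> w) powr (- s / 2 - 1))"
      using assms(3) by (simp add: sum_subtractf sum_distrib_left)
    also have "(\<Sum>b\<in>Basis. (w \<bullet> b) * (w \<bullet> b)) = w \<bullet> w"
      by (rule euclidean_inner [symmetric])
    also have "s * (s + 2) * (w \<bullet> w) powr (- s / 2 - 2) * (w \<bullet> w) = s * (s + 2) * (w \<bullet> w) powr (- s / 2 - 1)"
    proof -
      have "(w \<bullet> w) powr (- s / 2 - 2) * (w \<bullet> w) powr 1 = (w \<bullet> w) powr (- s / 2 - 1)"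
      proof -
        have "(- s / 2 - 2) + 1 = - s / 2 - 1" by simp
        then show ?thesis by (metis powr_add)
      qed
      then show ?thesis using w by (simp add: mult.assoc)
    qed
    also have "s * (s + 2) * (w \<bullet> w) powr (- s / 2 - 1) - 3 * (s * (w \<bullet> w) powr (- s / 2 - 1)) = s * (s - 1) * (w \<bullet> w) powr (- s / 2 - 1)"
      by (simp add: algebra_simps)
    also have "\<dots> \<ge> 0" using assms(2) by simp
    finally show "0 \<le> (\<Sum>b\<in>Basis. hess_row b y t \<bullet> b)" .
  qed
  finally show ?thesis .
qed

text \<open>Outside a ball that contains the curve, \<open>y - c t\<close> has a positive inner
  product with \<open>y\<close> for every \<open>t\<close>, so every piece of the curve contributes
  with the same sign.\<close>

lemma field_inward:
  assumes "\<And>t. norm (c t) \<le> R" "norm y > R" "s > 0"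
  shows "field s c y \<bullet> y < 0"
proof -
  have y: "y \<notin> c ` {0..1}" using assms by (metis image_iff not_less)
  have "integral {0..1} (\<lambda>t. s * ((y - c t) \<bullet> (y - c t)) powr (- s / 2 - 1) * ((y - c t) \<bullet> y)) > 0"
  proof (rule integral_unit_pos)
    show "continuous_on {0..1} (\<lambda>t. s * ((y - c t) \<bullet> (y - c t)) powr (- s / 2 - 1) * ((y - c t) \<bullet> y))"
      by (intro continuous_intros kernel_continuous_t y continuous_on_subset [OF c]) auto
    fix t :: real assume "t \<in> {0..1}"
    then have w: "(y - c t) \<bullet> (y - c t) > 0" using y by auto
    have "c t \<bullet> y \<le> norm (c t) * norm y" by (rule norm_cauchy_schwarz)
    also have "\<dots> < norm y * norm y"
    proof (rule mult_strict_right_mono)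
      show "norm (c t) < norm y" using assms(1) [of t] assms(2) by linarith
      then show "0 < norm y" using norm_ge_zero [of "c t"] by linarith
    qed
    finally have "(y - c t) \<bullet> y > 0" by (simp add: inner_diff_left dot_square_norm power2_eq_square)
    then show "s * ((y - c t) \<bullet> (y - c t)) powr (- s / 2 - 1) * ((y - c t) \<bullet> y) > 0"
      using assms(3) w by (intro mult_pos_pos) auto
  qed
  then show ?thesis unfolding field_inner [OF y] by simp
qed

lemma coulomb_pos:
  assumes "y \<notin> c ` {0..1}" shows "coulomb s c y > 0"
  unfolding coulomb_def
  by (rule integral_unit_pos) (use assms kernel_continuous_t in auto)

lemma coulomb_bounded_superlevel:
  assumes "\<And>t. norm (c t) \<le> R" "s > 0" "\<epsilon> > 0"
  shows "\<exists>B. \<forall>y. \<epsilon> \<le> coulomb s c y \<longrightarrow> norm y \<le> B"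
proof (intro exI allI impI)
  fix y assume \<epsilon>: "\<epsilon> \<le> coulomb s c y"
  \<comment> \<open>At distance more than \<open>\<epsilon> powr (- 1 / s)\<close> from the curve
    the kernel is below \<open>\<epsilon>\<close>; the term \<open>R + 1\<close> keeps
    \<open>y\<close> off the curve.\<close>
  show "norm y \<le> max (R + 1) (R + \<epsilon> powr (- 1 / s))"
  proof (rule ccontr)
    assume "\<not> norm y \<le> max (R + 1) (R + \<epsilon> powr (- 1 / s))"
    then have ny: "norm y > R + 1" "norm y > R + \<epsilon> powr (- 1 / s)" by auto
    have d: "norm y - R \<le> norm (y - c t)" for t
      using assms(1) [of t] norm_triangle_ineq2 [of y "c t"] by linarith
    have y: "y \<notin> c ` {0..1}"
    proof
      assume "y \<in> c ` {0..1}"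
      then obtain t where "y = c t" by blast
      with d [of t] ny(1) show False by simp
    qed
    have "coulomb s c y \<le> integral {0..1::real} (\<lambda>_. (norm y - R) powr (- s))"
      unfolding coulomb_def
    proof (rule integral_le)
      show "((y - c t) \<bullet> (y - c t)) powr (- s / 2) \<le> (norm y - R) powr (- s)" if "t \<in> {0..1}" for t
      proof -
        have pos: "norm (y - c t) > 0" using d [of t] ny by linarith
        have "((y - c t) \<bullet> (y - c t)) powr (- s / 2) = (norm (y - c t) powr 2) powr (- s / 2)"
          using pos by (simp add: dot_square_norm)
        also have "\<dots> = norm (y - c t) powr (2 * (- s / 2))" by (rule powr_powr)
        also have "2 * (- s / 2) = - s" by simp
        also have "norm (y - c t) powr (- s) \<le> (norm y - R) powr (- s)"
          using d [of t] ny assms(2) by (intro powr_mono2') auto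
        finally show ?thesis .
      qed
    qed (auto intro!: integrable_continuous_interval kernel_continuous_t y)
    also have "\<dots> = (norm y - R) powr (- s)" by simp
    also have "\<dots> < (\<epsilon> powr (- 1 / s)) powr (- s)"
      using ny assms by (intro powr_less_mono2_neg) auto
    also have "\<dots> = \<epsilon>" using assms by (simp add: powr_powr)
    finally show False using \<epsilon> by simp
  qed
qed

end

section \<open>The gradient near the knot\<close>

context tube
begin

text \<open>Near the curve the part of the integral over \<open>\<bar>t - x\<bar> \<le> \<rho>\<close>, with \<open>\<rho> = \<bar>z\<bar>\<close>, is at least of order \<open>\<rho> powr (1 - s)\<close>,
  while the negative part of the integrand is everywhere at most of order \<open>\<rho> powr (1 - s / 2)\<close>.\<close>

lemma field_towards_core:
  assumes s: "s \<ge> 1"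
  shows "\<exists>r>0. r \<le> \<delta> \<and> (\<forall>x z. z \<noteq> 0 \<longrightarrow> cmod z \<le> r \<longrightarrow> field s c (\<tau> x z) \<bullet> N x z < 0)"
proof -
  define M where "M = norm (c' 0) + L"
  have M: "M > 0" using L by (simp add: M_def add_nonneg_pos)
  \<comment> \<open>\<open>C1\<close> belongs to the short arc, where the distance is at most
    \<open>(1 + M) * \<rho>\<close> and the inner product with the normal vector at least
    \<open>\<rho>^2 / 2\<close>. \<open>C2\<close> belongs to the places where that inner product is
    negative.\<close>
  define C1 where "C1 = (1 + M) powr (- (s + 2)) / 2"
  define C2 where "C2 = \<kappa> powr (- (s + 2)) * L * L powr (s / 2)"
  have C: "C1 > 0" "C2 > 0" using M \<kappa> L by (auto simp: C1_def C2_def)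
  \<comment> \<open>The last bound keeps \<open>C2 * \<rho> powr (s / 2)\<close> below
    \<open>C1\<close>, which is what the final comparison of the two contributions requires.\<close>
  define r where "r = min (min \<delta> (1/2)) (min (1 / (2 * L)) ((C1 / C2 / 2) powr (2 / s)))"
  have r: "r > 0" "r \<le> \<delta>" "r \<le> 1/2" "r \<le> 1 / (2 * L)" "r \<le> (C1 / C2 / 2) powr (2 / s)"
    using \<delta> L C by (auto simp: r_def)
  have main: "field s c (\<tau> x z) \<bullet> N x z < 0" if z: "z \<noteq> 0" "cmod z \<le> r" and x: "0 \<le> x" "x \<le> 1" for x z
  proof -
    define \<rho> where "\<rho> = cmod z"
    have \<rho>: "\<rho> > 0" "\<rho> \<le> r" using z by (auto simp: \<rho>_def)
    have \<rho>': "\<rho> \<le> 1/2" "\<rho> \<le> \<delta>" "L * \<rho> \<le> 1/2"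
    proof -
      show "\<rho> \<le> 1/2" "\<rho> \<le> \<delta>" using \<rho> r by linarith+
      have "\<rho> \<le> 1 / (2 * L)" using \<rho> r by linarith
      then show "L * \<rho> \<le> 1/2" using L by (simp add: field_simps)
    qed
    define n where "n = N x z"
    define y where "y = \<tau> x z"
    have nn: "n \<bullet> n = \<rho>\<^sup>2" by (metis n_def norm_N \<rho>_def power2_norm_eq_inner)
    have nrm: "norm n = \<rho>" by (simp add: n_def norm_N \<rho>_def)
    have w1: "\<kappa> * (\<bar>u\<bar> + \<rho>) \<le> norm (y - c (x + u))" if "\<bar>u\<bar> \<le> 1/2" for u
    proof -
      have "\<kappa> * (\<bar>u\<bar> + cmod (0 - z)) \<le> norm (\<tau> (x + u) 0 - \<tau> x z)"
        by (rule bilip [OF that]) (use \<rho>' \<delta> in \<open>auto simp: \<rho>_def\<close>)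
      then show ?thesis by (simp add: \<tau>_def [of "x + u"] N_simps y_def \<rho>_def norm_minus_commute)
    qed
    have w2: "norm (y - c (x + u)) \<le> \<rho> + M * \<bar>u\<bar>" for u
    proof -
      have "y - c (x + u) = n - (c (x + u) - c x)" by (simp add: y_def \<tau>_def n_def)
      then have "norm (y - c (x + u)) \<le> norm n + norm (c (x + u) - c x)" by (metis norm_triangle_ineq4)
      then show ?thesis using c_lip [of "x + u" x] nrm by (simp add: M_def)
    qed
    have wn: "\<rho>\<^sup>2 - L * u\<^sup>2 * \<rho> \<le> (y - c (x + u)) \<bullet> n" for u
    proof -
      have "(y - c (x + u)) \<bullet> n = \<rho>\<^sup>2 - (c (x + u) - c x - u *\<^sub>R c' x) \<bullet> n"
      proof -
        have "c' x \<bullet> n = 0" using N_orth [of x z] by (simp add: n_def inner_commute)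
        moreover have "y = c x + n" by (simp add: y_def \<tau>_def n_def)
        ultimately show ?thesis by (simp add: inner_diff_left inner_add_left nn)
      qed
      moreover have "(c (x + u) - c x - u *\<^sub>R c' x) \<bullet> n \<le> norm (c (x + u) - c x - u *\<^sub>R c' x) * norm n"
        by (rule norm_cauchy_schwarz)
      moreover have "norm (c (x + u) - c x - u *\<^sub>R c' x) * norm n \<le> L * u\<^sup>2 * \<rho>"
        unfolding nrm by (rule mult_right_mono [OF c_taylor]) (use \<rho> in auto)
      ultimately show ?thesis by linarith
    qed
    have yK: "y \<notin> c ` {0..1}"
    proof
      assume "y \<in> c ` {0..1}"
      then obtain t where "\<tau> x z = \<tau> t 0" by (auto simp: y_def \<tau>_def N_simps)
      then have "0 = z" by (rule \<tau>_inj) (use \<rho>' \<delta> in \<open>auto simp: \<rho>_def\<close>)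
      with z show False by simp
    qed
    define J where "J t = ((y - c t) \<bullet> (y - c t)) powr (- s / 2 - 1) * ((y - c t) \<bullet> n)" for t
    have J: "J t = norm (y - c t) powr (- (s + 2)) * ((y - c t) \<bullet> n)" if "y \<noteq> c t" for t
    proof -
      have "((y - c t) \<bullet> (y - c t)) powr (- s / 2 - 1) = (norm (y - c t) powr 2) powr (- s / 2 - 1)"
        using that by (simp add: dot_square_norm)
      also have "\<dots> = norm (y - c t) powr (2 * (- s / 2 - 1))" by (rule powr_powr)
      also have "2 * (- s / 2 - 1) = - (s + 2)" by simp
      finally show ?thesis by (simp only: J_def)
    qed
    define A where "A = C1 * \<rho> powr (- s)"
    define B where "B = C2 * \<rho> powr (1 - s / 2)"
    have AB: "A > 0" "B > 0" using C \<rho> by (auto simp: A_def B_def)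
    have JA: "A \<le> J (x + u)" if u: "\<bar>u\<bar> \<le> \<rho>" for u
    proof -
      have u': "\<bar>u\<bar> \<le> 1/2" using u \<rho>' by linarith
      have "0 < \<kappa> * (\<bar>u\<bar> + \<rho>)" using \<kappa> \<rho> by (intro mult_pos_pos) auto
      then have pos: "norm (y - c (x + u)) > 0" using w1 [OF u'] by linarith
      have "L * u\<^sup>2 * \<rho> \<le> 1/2 * \<rho>\<^sup>2"
      proof -
        have "u\<^sup>2 \<le> \<rho>\<^sup>2" using u by (metis abs_ge_zero power2_abs power_mono)
        then have "L * u\<^sup>2 * \<rho> \<le> L * \<rho>\<^sup>2 * \<rho>" using L \<rho> by (intro mult_right_mono mult_left_mono) auto
        also have "\<dots> = (L * \<rho>) * \<rho>\<^sup>2" by simp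
        also have "\<dots> \<le> 1/2 * \<rho>\<^sup>2" using \<rho>' by (intro mult_right_mono) auto
        finally show ?thesis .
      qed
      then have 1: "\<rho>\<^sup>2 / 2 \<le> (y - c (x + u)) \<bullet> n" using wn [of u] by linarith
      have "norm (y - c (x + u)) \<le> (1 + M) * \<rho>"
      proof -
        have "M * \<bar>u\<bar> \<le> M * \<rho>" using u M by (intro mult_left_mono) auto
        moreover have "(1 + M) * \<rho> = \<rho> + M * \<rho>" by (simp add: algebra_simps)
        ultimately show ?thesis using w2 [of u] by linarith
      qed
      then have 2: "((1 + M) * \<rho>) powr (- (s + 2)) \<le> norm (y - c (x + u)) powr (- (s + 2))"
        using s pos by (intro powr_mono2') auto
      have "A = ((1 + M) * \<rho>) powr (- (s + 2)) * (\<rho>\<^sup>2 / 2)"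
      proof -
        have "\<rho> powr (- (s + 2)) * \<rho>\<^sup>2 = \<rho> powr (- s)"
        proof -
          have "\<rho> powr (- (s + 2)) * \<rho> powr 2 = \<rho> powr (- (s + 2) + 2)" by (simp only: powr_add)
          then show ?thesis using \<rho> by simp
        qed
        then show ?thesis using M \<rho> by (simp add: A_def C1_def powr_mult)
      qed
      also have "\<dots> \<le> J (x + u)"
      proof -
        have "y \<noteq> c (x + u)" using pos by auto
        show ?thesis unfolding J [OF \<open>y \<noteq> c (x + u)\<close>] by (intro mult_mono 1 2) auto
      qed
      finally show ?thesis .
    qed
    have JB: "- B \<le> J t" for t
    proof -
      obtain k :: int where k: "\<bar>t - x - of_int k\<bar> \<le> 1/2" by (rule near_rep)
      define u where "u = t - x - of_int k"
      have ct: "c t = c (x + u)" using c_per_int [of "x + u" k] by (simp add: u_def)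
      have u': "\<bar>u\<bar> \<le> 1/2" using k by (simp add: u_def)
      have "0 < \<kappa> * (\<bar>u\<bar> + \<rho>)" using \<kappa> \<rho> by (intro mult_pos_pos) auto
      then have pos: "norm (y - c t) > 0" unfolding ct using w1 [OF u'] by linarith
      show ?thesis
      proof (cases "(y - c t) \<bullet> n \<ge> 0")
        case True
        then have "J t \<ge> 0" by (simp add: J_def)
        then show ?thesis using AB by linarith
      next
        \<comment> \<open>A negative inner product forces \<open>L * u^2 > \<rho>\<close>: the
          distance to the curve is there of the order of the square root of \<open>\<rho>\<close> at
          least, and not merely of the order of \<open>\<rho>\<close>.\<close>
        case False
        have lower: "- (L * u\<^sup>2 * \<rho>) \<le> (y - c t) \<bullet> n"
          using wn [of u] zero_le_power2 [of \<rho>] unfolding ct by linarith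
        have "\<rho>\<^sup>2 < L * u\<^sup>2 * \<rho>" using wn [of u] False unfolding ct by linarith
        then have "\<rho> * \<rho> < (L * u\<^sup>2) * \<rho>" by (simp add: power2_eq_square)
        then have lu: "\<rho> < L * u\<^sup>2" using \<rho> by (simp add: mult_less_cancel_right_pos)
        then have u0: "u \<noteq> 0" using \<rho> by auto
        have "norm (y - c t) powr (- (s + 2)) \<le> (\<kappa> * \<bar>u\<bar>) powr (- (s + 2))"
        proof (rule powr_mono2')
          have "\<kappa> * \<bar>u\<bar> \<le> \<kappa> * (\<bar>u\<bar> + \<rho>)" using \<kappa> \<rho> by (intro mult_left_mono) auto
          then show "\<kappa> * \<bar>u\<bar> \<le> norm (y - c t)" using w1 [OF u'] unfolding ct by linarith
        qed (use s \<kappa> u0 in auto)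
        then have "norm (y - c t) powr (- (s + 2)) * (L * u\<^sup>2 * \<rho>) \<le> (\<kappa> * \<bar>u\<bar>) powr (- (s + 2)) * (L * u\<^sup>2 * \<rho>)"
          using L \<rho> by (intro mult_right_mono) auto
        also have "\<dots> = \<kappa> powr (- (s + 2)) * L * \<rho> * (\<bar>u\<bar> powr (- (s + 2)) * \<bar>u\<bar> powr 2)"
          using \<kappa> u0 by (simp add: powr_mult)
        also have "\<bar>u\<bar> powr (- (s + 2)) * \<bar>u\<bar> powr 2 = \<bar>u\<bar> powr (- s)"
        proof -
          have "\<bar>u\<bar> powr (- (s + 2)) * \<bar>u\<bar> powr 2 = \<bar>u\<bar> powr (- (s + 2) + 2)" by (simp only: powr_add)
          then show ?thesis by simp
        qed
        also have "\<kappa> powr (- (s + 2)) * L * \<rho> * \<bar>u\<bar> powr (- s) \<le> \<kappa> powr (- (s + 2)) * L * \<rho> * (\<rho> / L) powr (- s / 2)"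
        proof (rule mult_left_mono)
          have "\<bar>u\<bar> powr (- s) = \<bar>u\<bar> powr (2 * (- s / 2))" by simp
          also have "\<dots> = (\<bar>u\<bar> powr 2) powr (- s / 2)" by (rule powr_powr [symmetric])
          also have "\<dots> = (u\<^sup>2) powr (- s / 2)" using u0 by simp
          also have "\<dots> \<le> (\<rho> / L) powr (- s / 2)"
            using s lu L \<rho> by (intro powr_mono2') (auto simp: field_simps)
          finally show "\<bar>u\<bar> powr (- s) \<le> (\<rho> / L) powr (- s / 2)" .
        qed (use \<kappa> L \<rho> in auto)
        also have "\<dots> = B"
        proof -
          have "(\<rho> / L) powr (- s / 2) = \<rho> powr (- s / 2) * L powr (s / 2)"
            using \<rho> L by (simp add: powr_divide powr_minus_divide)
          moreover have "\<rho> * \<rho> powr (- s / 2) = \<rho> powr (1 - s / 2)"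
          proof -
            have "\<rho> powr 1 * \<rho> powr (- s / 2) = \<rho> powr (1 + - s / 2)" by (simp only: powr_add)
            then show ?thesis using \<rho> by simp
          qed
          ultimately show ?thesis by (simp add: B_def C2_def mult_ac)
        qed
        finally have "norm (y - c t) powr (- (s + 2)) * (L * u\<^sup>2 * \<rho>) \<le> B" .
        moreover have "norm (y - c t) powr (- (s + 2)) * (- (L * u\<^sup>2 * \<rho>)) \<le> norm (y - c t) powr (- (s + 2)) * ((y - c t) \<bullet> n)"
          by (intro mult_left_mono lower) auto
        moreover have "y \<noteq> c t" using pos by auto
        ultimately show ?thesis using J [of t] by simp
      qed
    qed
    \<comment> \<open>An arc of length \<open>\<rho>\<close> on the side of \<open>x\<close> that
      stays inside the unit interval.\<close>
    define I where "I = (if x \<le> 1/2 then {x..x + \<rho>} else {x - \<rho>..x})"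
    have I: "I \<subseteq> {0..1}" "\<And>t. t \<in> I \<Longrightarrow> \<bar>t - x\<bar> \<le> \<rho>" using x \<rho> \<rho>' by (auto simp: I_def split: if_splits)
    have Iint: "((\<lambda>t. if t \<in> I then A else 0) has_integral A * \<rho>) {0..1}"
    proof -
      have "((\<lambda>t. A) has_integral A * \<rho>) I"
        using has_integral_const_real [of A x "x + \<rho>"] has_integral_const_real [of A "x - \<rho>" x] \<rho>
        by (auto simp: I_def mult.commute)
      then show ?thesis using has_integral_restrict [OF I(1), of "\<lambda>t. A"] by simp
    qed
    have contJ: "continuous_on {0..1} J"
      unfolding J_def [abs_def]
      by (intro continuous_intros kernel_continuous_t continuous_on_subset [OF continuous_c] yK) (auto intro: continuous_c)
    have "((\<lambda>t. (if t \<in> I then A else 0) - B) has_integral (A * \<rho> - B * 1)) {0..1}"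
      using has_integral_diff [OF Iint has_integral_const_real [of B 0 1]] by simp
    moreover have "(if t \<in> I then A else 0) - B \<le> J t" if "t \<in> {0..1}" for t
    proof (cases "t \<in> I")
      case True
      then show ?thesis using JA [of "t - x"] I(2) AB by auto
    next
      case False then show ?thesis using JB [of t] by auto
    qed
    ultimately have "A * \<rho> - B * 1 \<le> integral {0..1} J"
      by (rule has_integral_le [OF _ integrable_integral [OF integrable_continuous_interval [OF contJ]]]) auto
    moreover have "B < A * \<rho>"
    proof -
      have "\<rho> powr (s / 2) \<le> ((C1 / C2 / 2) powr (2 / s)) powr (s / 2)"
        using \<rho> r s by (intro powr_mono2) auto
      also have "\<dots> = C1 / C2 / 2" using s C by (simp add: powr_powr)
      also have "\<dots> < C1 / C2"
      proof -
        have "x / 2 < x" if "x > 0" for x :: real using that by simp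
        from this [OF divide_pos_pos [OF C]] show ?thesis .
      qed
      finally have "C2 * \<rho> powr (s / 2) < C1" using C by (simp add: field_simps)
      then have "C2 * \<rho> powr (s / 2) * \<rho> powr (1 - s) < C1 * \<rho> powr (1 - s)"
        using \<rho> by (intro mult_strict_right_mono) auto
      moreover have "\<rho> powr (s / 2) * \<rho> powr (1 - s) = \<rho> powr (1 - s / 2)"
        by (subst powr_add [symmetric]) (simp add: field_simps)
      moreover have "\<rho> powr (1 - s) = \<rho> powr (- s) * \<rho>"
      proof -
        have "\<rho> powr (- s) * \<rho> powr 1 = \<rho> powr (- s + 1)" by (simp only: powr_add)
        then show ?thesis using \<rho> by (simp add: algebra_simps)
      qed
      ultimately show ?thesis by (simp add: A_def B_def mult.assoc)
    qed
    ultimately have "integral {0..1} J > 0" by linarith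
    moreover have "field s c y \<bullet> n = - s * integral {0..1} J"
      unfolding field_inner [OF continuous_c yK] J_def mult.assoc by (rule integral_mult_right)
    ultimately show ?thesis using s by (simp add: n_def y_def)
  qed
  have "field s c (\<tau> x z) \<bullet> N x z < 0" if z: "z \<noteq> 0" "cmod z \<le> r" for x z
  proof -
    have "\<tau> x z = \<tau> (frac x) z" "N x z = N (frac x) z"
      using \<tau>_per [of "frac x" "\<lfloor>x\<rfloor>" z] periodic_shift_int [of "\<lambda>x. N x z" "frac x" "\<lfloor>x\<rfloor>"] N_per
      by (auto simp: frac_def)
    then show ?thesis using main [OF z, of "frac x"] frac_ge_0 [of x] frac_lt_1 [of x] by simp
  qed
  then show ?thesis using r by blast
qed

end

section \<open>Gradient-like fields and the single saddle\<close>

lemma C1_lipschitz_on_compact: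
  fixes f :: "'a::euclidean_space \<Rightarrow> 'b::real_normed_vector"
  assumes f: "C1 f" and S: "compact S"
  shows "\<exists>\<Lambda>\<ge>0. \<forall>x\<in>S. \<forall>y\<in>S. norm (f x - f y) \<le> \<Lambda> * norm (x - y)"
proof -
  obtain r where "\<forall>x\<in>S. norm x \<le> r"
    using compact_imp_bounded [OF S] unfolding bounded_iff by (elim exE)
  then have r: "S \<subseteq> cball 0 r" by auto
  obtain f' where f': "\<And>x. (f has_derivative blinfun_apply (f' x)) (at x)" "continuous_on UNIV f'"
    using C1E [OF f] by blast
  have "bounded (f' ` cball 0 r)"
    by (intro compact_imp_bounded compact_continuous_image continuous_on_subset [OF f'(2)]) (auto simp: compact_cball)
  then obtain \<Lambda> where \<Lambda>: "\<And>x. x \<in> cball 0 r \<Longrightarrow> norm (f' x) \<le> \<Lambda>"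
    unfolding bounded_iff by blast
  have "norm (f x - f y) \<le> max \<Lambda> 0 * norm (x - y)" if "x \<in> S" "y \<in> S" for x y
  proof (rule differentiable_bound [of "cball 0 r" f "\<lambda>x. blinfun_apply (f' x)"])
    show "(f has_derivative blinfun_apply (f' x)) (at x within cball 0 r)" for x
      by (rule has_derivative_at_withinI [OF f'(1)])
    show "onorm (blinfun_apply (f' x)) \<le> max \<Lambda> 0" if "x \<in> cball 0 r" for x
      using \<Lambda> [OF that] by (simp add: norm_blinfun.rep_eq)
  qed (use that r in auto)
  then show ?thesis by (intro exI [of _ "max \<Lambda> 0"]) auto
qed

text \<open>By compactness of the sphere the quadratic form \<open>(B v) \<bullet> (A v)\<close> is
  at least \<open>\<beta> |v|^2\<close>, and the remainder of \<open>g\<close> at \<open>p\<close>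
  is of smaller order.\<close>

lemma positive_pairing_near_zero:
  fixes g :: "real^'n \<Rightarrow> real^'n" and B :: "real^'n^'n"
  assumes gp: "g p = 0" and d: "(g has_derivative A) (at p)"
    and pos: "\<And>v. v \<noteq> 0 \<Longrightarrow> 0 < (B *v v) \<bullet> A v"
  shows "\<exists>\<rho>>0. \<forall>y. y \<noteq> p \<longrightarrow> dist p y \<le> \<rho> \<longrightarrow> 0 < (B *v (y - p)) \<bullet> g y"
proof -
  have A: "bounded_linear A" using d has_derivative_bounded_linear by blast
  have "continuous_on (sphere 0 1) (\<lambda>v. (B *v v) \<bullet> A v)"
    by (intro continuous_intros linear_continuous_on A matrix_vector_mul_bounded_linear)
  moreover have "sphere (0::real^'n) 1 \<noteq> {}" by simp
  ultimately have "\<exists>v\<in>sphere 0 1. \<forall>w\<in>sphere 0 1. (B *v v) \<bullet> A v \<le> (B *v w) \<bullet> A w"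
    by (intro continuous_attains_inf) auto
  then obtain v0 where v0: "norm v0 = 1" "\<And>w. norm w = 1 \<Longrightarrow> (B *v v0) \<bullet> A v0 \<le> (B *v w) \<bullet> A w" by auto
  define \<beta> where "\<beta> = (B *v v0) \<bullet> A v0"
  have "v0 \<noteq> 0" using v0(1) by auto
  then have \<beta>: "\<beta> > 0" using pos unfolding \<beta>_def by blast
  have quad: "\<beta> * (norm v)\<^sup>2 \<le> (B *v v) \<bullet> A v" for v
  proof (cases "v = 0")
    case False
    have "\<beta> \<le> (B *v ((1 / norm v) *\<^sub>R v)) \<bullet> A ((1 / norm v) *\<^sub>R v)"
      unfolding \<beta>_def using False by (intro v0) auto
    also have "\<dots> = ((B *v v) \<bullet> A v) / (norm v)\<^sup>2"
      by (simp add: matrix_vector_mult_scaleR linear_cmul [OF bounded_linear.linear [OF A]] power2_eq_square)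
    finally show ?thesis using False by (simp add: le_divide_eq)
  qed (use linear_0 [OF bounded_linear.linear [OF A]] in simp)
  obtain b where b: "b > 0" "\<And>v. norm (B *v v) \<le> norm v * b"
    using bounded_linear.pos_bounded [OF matrix_vector_mul_bounded_linear [of B]] by blast
  \<comment> \<open>The tolerance \<open>\<beta> / (2 b)\<close> costs at most half of the quadratic
    form because \<open>|B v| \<le> b |v|\<close>.\<close>
  have "\<forall>e>0. \<exists>d>0. \<forall>y. norm (y - p) < d \<longrightarrow> norm (g y - g p - A (y - p)) \<le> e * norm (y - p)"
    using d unfolding has_derivative_at_alt by blast
  then obtain r where r: "r > 0" "\<And>y. norm (y - p) < r \<Longrightarrow> norm (g y - g p - A (y - p)) \<le> \<beta> / (2 * b) * norm (y - p)"
    using \<beta> b by (metis divide_pos_pos mult_pos_pos zero_less_numeral)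
  show ?thesis
  proof (intro exI conjI allI impI)
    show "r / 2 > 0" using r by simp
    fix y assume y: "y \<noteq> p" "dist p y \<le> r / 2"
    define v where "v = y - p"
    have v: "v \<noteq> 0" "norm v < r" using y r by (auto simp: v_def dist_norm norm_minus_commute)
    have e: "norm (g y - A v) \<le> \<beta> / (2 * b) * norm v" using r(2) [of y] v gp by (simp add: v_def)
    have "\<bar>(B *v v) \<bullet> (g y - A v)\<bar> \<le> norm (B *v v) * norm (g y - A v)" by (rule Cauchy_Schwarz_ineq2)
    also have "\<dots> \<le> (norm v * b) * (\<beta> / (2 * b) * norm v)"
      by (intro mult_mono b(2) e) (use b in auto)
    also have "\<dots> = \<beta> / 2 * (norm v)\<^sup>2" using b by (simp add: power2_eq_square)
    finally have "\<bar>(B *v v) \<bullet> (g y - A v)\<bar> \<le> \<beta> / 2 * (norm v)\<^sup>2" .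
    moreover have "\<beta> / 2 * (norm v)\<^sup>2 < \<beta> * (norm v)\<^sup>2" using \<beta> v by simp
    moreover have "(B *v v) \<bullet> g y = (B *v v) \<bullet> A v + (B *v v) \<bullet> (g y - A v)" by (simp add: inner_diff_right)
    ultimately have "0 < (B *v v) \<bullet> g y" using quad [of v] by linarith
    then show "0 < (B *v (y - p)) \<bullet> g y" by (simp add: v_def)
  qed
qed

locale charged_tube = tube +
  fixes s :: real
  assumes s: "s \<ge> 1" and core: "\<And>x z. z \<noteq> 0 \<Longrightarrow> cmod z \<le> \<delta> \<Longrightarrow> field s c (\<tau> x z) \<bullet> N x z < 0"
begin

abbreviation "g \<equiv> field s c"
abbreviation "G \<equiv> coulomb s c"

lemma K_image: "c ` {0..1} = K"
proof -
  have "c t \<in> c ` {0..1}" for t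
  proof (rule image_eqI)
    show "c t = c (frac t)" using c_per_int [of "frac t" "\<lfloor>t\<rfloor>"] by (simp add: frac_def)
    show "frac t \<in> {0..1}" using frac_ge_0 [of t] frac_lt_1 [of t] by simp
  qed
  then show ?thesis unfolding K_def by blast
qed

lemma c_bounded: "\<exists>R>0. \<forall>t. norm (c t) \<le> R"
proof -
  have "compact K" unfolding K_eq by (rule compact_V)
  then show ?thesis using compact_imp_bounded [of K] unfolding bounded_pos K_def by auto
qed

lemma continuous_g: "continuous_on (- K) g"
  using continuous_on_field [OF continuous_c, of s] by (simp add: K_image)

lemma \<tau>_in_K: "cmod z \<le> \<delta> \<Longrightarrow> \<tau> x z \<in> K \<longleftrightarrow> z = 0"
proof
  assume z: "cmod z \<le> \<delta>" and "\<tau> x z \<in> K"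
  then obtain t where "\<tau> x z = \<tau> t 0" unfolding K_def by (auto simp: \<tau>_def N_simps)
  from \<tau>_inj(1) [OF this z] show "z = 0" using \<delta> by simp
qed (auto simp: K_def \<tau>_def N_simps)

lemma g_nz_V: "y \<in> V \<delta> \<Longrightarrow> y \<notin> K \<Longrightarrow> g y \<noteq> 0"
proof -
  assume y: "y \<in> V \<delta>" "y \<notin> K"
  then have "tz y \<noteq> 0" using txz [OF y(1)] \<tau>_in_K [of "tz y" "tx y"] by auto
  then have "g (\<tau> (tx y) (tz y)) \<bullet> N (tx y) (tz y) < 0"
    using core txz [OF y(1)] by blast
  then show ?thesis using txz(1) [OF y(1)] by auto
qed

text \<open>A segment that leaves the tube crosses its boundary, where \<open>f\<close> vanishes, so
  the Lipschitz bound inside the tube carries over to the whole space.\<close>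

lemma lipschitz_extend_tube:
  fixes f :: "real^3 \<Rightarrow> 'b::real_normed_vector"
  assumes lip: "\<And>x y. x \<in> V \<delta> \<Longrightarrow> y \<in> V \<delta> \<Longrightarrow> norm (f x - f y) \<le> \<Lambda> * norm (x - y)" and \<Lambda>: "\<Lambda> \<ge> 0"
    and zero: "\<And>x. x \<notin> V' \<delta> \<Longrightarrow> f x = 0"
  shows "norm (f x - f y) \<le> \<Lambda> * norm (x - y)"
proof -
  have key: "norm (f x - f y) \<le> \<Lambda> * norm (x - y)" if x: "x \<in> V' \<delta>" and y: "y \<notin> V \<delta>" for x y
  proof -
    have "closed_segment x y \<inter> frontier (V' \<delta>) \<noteq> {}"
    proof (rule connected_Int_frontier)
      show "closed_segment x y \<inter> V' \<delta> \<noteq> {}" using x by auto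
      show "closed_segment x y - V' \<delta> \<noteq> {}" using y V'_sub by auto
    qed auto
    then obtain w where w: "w \<in> closed_segment x y" "w \<in> frontier (V' \<delta>)" by blast
    have "w \<notin> V' \<delta>" using w(2) open_V' [of \<delta>] by (simp add: frontier_def interior_open)
    then have fw: "f w = 0" "f y = 0" using zero y V'_sub by blast+
    have "closure (V' \<delta>) \<subseteq> V \<delta>"
      using V'_sub compact_V compact_imp_closed closure_minimal by blast
    then have wV: "w \<in> V \<delta>" using w(2) by (auto simp: frontier_def)
    have "norm (f x - f w) \<le> \<Lambda> * norm (x - w)" using lip x wV V'_sub by blast
    also have "\<dots> \<le> \<Lambda> * norm (x - y)"
      using segment_bound1 [OF w(1)] \<Lambda> by (intro mult_left_mono) (auto simp: norm_minus_commute)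
    finally show ?thesis using fw by simp
  qed
  consider "x \<in> V \<delta>" "y \<in> V \<delta>" | "x \<in> V' \<delta>" "y \<notin> V \<delta>" | "y \<in> V' \<delta>" "x \<notin> V \<delta>" | "x \<notin> V' \<delta>" "y \<notin> V' \<delta>"
    using V'_sub by blast
  then show ?thesis
  proof cases
    case 3 then show ?thesis using key [of y x] by (simp add: norm_minus_commute)
  qed (use lip key zero \<Lambda> in auto)
qed

text \<open>Only the sign of \<open>X \<bullet> g\<close> ties \<open>X\<close> to the gradient; the
  prescribed normal forms make the flow explicit around the knot, around the zeros and far out. The
  matrices \<open>B p\<close> are parameters because two different choices are made.\<close>

definition gradient_like :: "(real^3) set \<Rightarrow> (real^3 \<Rightarrow> real^3^3) \<Rightarrow> (real^3 \<Rightarrow> real^3) \<Rightarrow> real \<Rightarrow> real \<Rightarrow> real \<Rightarrow> bool" where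
  "gradient_like P B X \<Lambda> \<rho> R \<longleftrightarrow> 0 < \<Lambda> \<and> 0 < \<rho> \<and> 0 < R \<and> (\<forall>x y. norm (X x - X y) \<le> \<Lambda> * norm (x - y)) \<and>
     (\<forall>x z. cmod z \<le> \<delta> / 2 \<longrightarrow> X (\<tau> x z) = - N x z) \<and>
     (\<forall>p\<in>P. \<forall>y. dist p y \<le> \<rho> \<longrightarrow> X y = B p *v (y - p)) \<and>
     (\<forall>y. y \<notin> K \<longrightarrow> y \<notin> P \<longrightarrow> 0 < X y \<bullet> g y) \<and>
     (\<forall>y. norm y \<ge> R \<longrightarrow> X y = - y)"

text \<open>Positivity of \<open>X \<bullet> g\<close> at a point is a convex condition on
  \<open>X\<close>, so fields that satisfy it may be blended by cutoff functions. Where no normal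
  form is prescribed, a polynomial approximation of \<open>g\<close> serves.\<close>

lemma gradient_like_field:
  fixes B :: "real^3 \<Rightarrow> real^3^3"
  assumes P: "finite P" "P \<subseteq> - K" "\<And>y. y \<notin> K \<Longrightarrow> g y = 0 \<longleftrightarrow> y \<in> P"
    and B: "\<And>p. p \<in> P \<Longrightarrow> \<exists>A. (g has_derivative A) (at p) \<and> (\<forall>v. v \<noteq> 0 \<longrightarrow> 0 < (B p *v v) \<bullet> A v)"
  shows "\<exists>X \<Lambda> \<rho> R. gradient_like P B X \<Lambda> \<rho> R"

proof -
  have PV: "p \<notin> V \<delta>" if "p \<in> P" for p
    using g_nz_V [of p] P that by auto
  have finmin: "\<exists>d>0. \<forall>p\<in>P. d \<le> D p" if "\<And>p. p \<in> P \<Longrightarrow> D p > 0" for D :: "real^3 \<Rightarrow> real"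
  proof (intro exI conjI ballI)
    show "0 < Min (insert 1 (D ` P))" using P(1) that by auto
    show "Min (insert 1 (D ` P)) \<le> D p" if "p \<in> P" for p using P(1) that by auto
  qed
  have "\<exists>r>0. \<forall>y. y \<noteq> p \<longrightarrow> dist p y \<le> r \<longrightarrow> 0 < (B p *v (y - p)) \<bullet> g y" if pP: "p \<in> P" for p
  proof -
    obtain A where A: "(g has_derivative A) (at p)" "\<And>v. v \<noteq> 0 \<Longrightarrow> 0 < (B p *v v) \<bullet> A v"
      using B [OF pP] by blast
    have "g p = 0" using P pP by blast
    then show ?thesis by (rule positive_pairing_near_zero [OF _ A])
  qed
  then obtain r1 where r1: "\<And>p. p \<in> P \<Longrightarrow> r1 p > 0" "\<And>p y. p \<in> P \<Longrightarrow> y \<noteq> p \<Longrightarrow> dist p y \<le> r1 p \<Longrightarrow> 0 < (B p *v (y - p)) \<bullet> g y"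
    by metis
  obtain d1 where d1: "d1 > 0" "\<And>p. p \<in> P \<Longrightarrow> d1 \<le> r1 p" using finmin [of r1, OF r1(1)] by blast
  have "\<exists>r>0. ball p r \<inter> V \<delta> = {}" if pP: "p \<in> P" for p
  proof -
    have "open (- V \<delta>)" using compact_V [of \<delta>] compact_imp_closed by blast
    then obtain r where "r > 0" "ball p r \<subseteq> - V \<delta>" using PV [OF pP] openE by blast
    then show ?thesis by blast
  qed
  then obtain r2 where r2: "\<And>p. p \<in> P \<Longrightarrow> r2 p > 0" "\<And>p. p \<in> P \<Longrightarrow> ball p (r2 p) \<inter> V \<delta> = {}" by metis
  obtain d2 where d2: "d2 > 0" "\<And>p. p \<in> P \<Longrightarrow> d2 \<le> r2 p" using finmin [of r2, OF r2(1)] by blast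
  have "\<exists>d>0. \<forall>q\<in>P. q \<noteq> p \<longrightarrow> d \<le> dist p q" for p
    using finite_set_avoid [OF P(1), of p] by blast
  then obtain r3 where r3: "\<And>p. r3 p > 0" "\<And>p q. q \<in> P \<Longrightarrow> q \<noteq> p \<Longrightarrow> r3 p \<le> dist p q" by metis
  obtain d3 where d3: "d3 > 0" "\<And>p. p \<in> P \<Longrightarrow> d3 \<le> r3 p" using finmin [of r3, OF r3(1)] by blast
  \<comment> \<open>Within distance \<open>2 * \<rho>\<close> of a zero the linear model pairs
    positively with \<open>g\<close>, the tube is not met, and balls around different zeros are
    disjoint.\<close>
  define \<rho> where "\<rho> = min (min (d1 / 2) (d2 / 4)) (d3 / 8)"
  have \<rho>: "\<rho> > 0" "2 * \<rho> \<le> d1" "2 * \<rho> < d2" "4 * \<rho> < d3" using d1 d2 d3 by (auto simp: \<rho>_def)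
  have near: "0 < (B p *v (y - p)) \<bullet> g y" if "p \<in> P" "y \<noteq> p" "dist p y \<le> 2 * \<rho>" for p y
    using r1(2) [OF that(1,2)] d1(2) [OF that(1)] that(3) \<rho> by linarith
  have farV: "y \<notin> V \<delta>" if "p \<in> P" "dist p y \<le> 2 * \<rho>" for p y
    using r2(2) [OF that(1)] d2(2) [OF that(1)] that(2) \<rho> by (auto simp: disjoint_iff)
  have uniqp: "p = q" if "p \<in> P" "q \<in> P" "dist p y \<le> 2 * \<rho>" "dist q y \<le> 2 * \<rho>" for p q y
  proof (rule ccontr)
    assume "p \<noteq> q"
    then have "d3 \<le> dist p q" using r3(2) [OF that(2), of p] d3(2) [OF that(1)] by auto
    moreover have "dist p q \<le> dist p y + dist q y" by (rule dist_triangle2)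
    ultimately show False using that \<rho> by linarith
  qed
  obtain Rc where Rc: "Rc > 0" "\<And>t. norm (c t) \<le> Rc" using c_bounded by blast
  have "bounded (V \<delta> \<union> (\<Union>p\<in>P. cball p (2 * \<rho>)))"
    using compact_imp_bounded [OF compact_V] P(1) by (auto intro!: bounded_Union)
  then obtain R1 where R1: "R1 > 0" "\<And>y. y \<in> V \<delta> \<union> (\<Union>p\<in>P. cball p (2 * \<rho>)) \<Longrightarrow> norm y \<le> R1"
    unfolding bounded_pos by auto
  define R0 where "R0 = max Rc R1"
  have R0: "R0 > 0" "\<And>t. norm (c t) \<le> R0" "\<And>y. y \<in> V \<delta> \<Longrightarrow> norm y \<le> R0"
    "\<And>p y. p \<in> P \<Longrightarrow> dist p y \<le> 2 * \<rho> \<Longrightarrow> norm y \<le> R0"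
    using Rc R1 unfolding R0_def by (auto simp: max.coboundedI1 intro: order_trans [OF Rc(2)] order_trans [OF R1(2)])
  have outward: "0 < (- y) \<bullet> g y" if "norm y > R0" for y
    using field_inward [OF continuous_c R0(2) that, of s] s by (simp add: inner_commute)
  \<comment> \<open>The region in which the polynomial may enter: off the inner tube, off the small
    balls, inside a large ball. There \<open>|g|\<close> has a positive minimum, which sets the
    precision of the approximation.\<close>
  define D where "D = cball 0 (R0 + 1) - V' (\<delta> / 2) - (\<Union>p\<in>P. ball p \<rho>)"
  have oV: "open (V' (\<delta> / 2))" using \<delta> by (intro open_V') auto
  have "compact D"
    unfolding D_def by (intro compact_diff compact_cball oV open_UN) auto
  have DK: "D \<subseteq> - K" using K_sub [of "\<delta> / 2"] \<delta> by (auto simp: D_def)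
  have Dg: "g y \<noteq> 0" if "y \<in> D" for y
  proof -
    have "y \<notin> K" using that DK by blast
    moreover have "y \<notin> P" using that \<rho>(1) by (auto simp: D_def)
    ultimately show ?thesis using P(3) by blast
  qed
  obtain m0 where m0: "m0 > 0" "\<And>y. y \<in> D \<Longrightarrow> m0 \<le> norm (g y)"
  proof (cases "D = {}")
    case False
    have "\<exists>y\<in>D. \<forall>w\<in>D. norm (g y) \<le> norm (g w)"
      by (rule continuous_attains_inf [OF \<open>compact D\<close> False])
         (intro continuous_on_norm continuous_on_subset [OF continuous_g DK])
    then obtain y where "y \<in> D" "\<And>w. w \<in> D \<Longrightarrow> norm (g y) \<le> norm (g w)" by blast
    then show thesis using that [of "norm (g y)"] Dg by simp
  qed (use that [of 1] in auto)
  obtain pl where pl: "polynomial_function pl" "\<And>y. y \<in> D \<Longrightarrow> norm (g y - pl y) < m0"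
    using Stone_Weierstrass_polynomial_function [OF \<open>compact D\<close> continuous_on_subset [OF continuous_g DK] m0(1)] by blast
  have plg: "0 < pl y \<bullet> g y" if "y \<in> D" for y
  proof -
    have "\<bar>(g y - pl y) \<bullet> g y\<bar> \<le> norm (g y - pl y) * norm (g y)" by (rule Cauchy_Schwarz_ineq2)
    also have "\<dots> < norm (g y) * norm (g y)"
      using pl(2) [OF that] m0(2) [OF that] m0(1) by (intro mult_strict_right_mono) auto
    finally show ?thesis by (simp add: inner_diff_left dot_square_norm power2_eq_square)
  qed
  have plC: "C1 pl" by (rule C1_polynomial_function [OF pl(1)])
  have sq: "\<rho>\<^sup>2 < (2 * \<rho>)\<^sup>2" "R0\<^sup>2 < (R0 + 1)\<^sup>2" using \<rho> R0 by (auto intro!: power_strict_mono)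
  define a where "a p y = cutoff (\<rho>\<^sup>2) ((2 * \<rho>)\<^sup>2) ((y - p) \<bullet> (y - p))" for p y :: "real^3"
  define e where "e y = 1 - cutoff (R0\<^sup>2) ((R0 + 1)\<^sup>2) (y \<bullet> y)" for y :: "real^3"
  have a1: "a p y = 1" if "dist p y \<le> \<rho>" for p y
    unfolding a_def power2_norm_eq_inner [symmetric]
    by (rule cutoff_eq_1 [OF sq(1)], rule power_mono) (use that in \<open>auto simp: dist_norm norm_minus_commute\<close>)
  have a0: "a p y = 0" if "\<not> dist p y \<le> 2 * \<rho>" for p y
    unfolding a_def power2_norm_eq_inner [symmetric]
    by (rule cutoff_eq_0 [OF sq(1)], rule power_mono) (use that \<rho> in \<open>auto simp: dist_norm norm_minus_commute\<close>)
  have e0: "e y = 0" if "norm y \<le> R0" for y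
    unfolding e_def power2_norm_eq_inner [symmetric]
    using cutoff_eq_1 [OF sq(2) power_mono [OF that norm_ge_zero]] by simp
  have e1: "e y = 1" if "norm y \<ge> R0 + 1" for y
    unfolding e_def power2_norm_eq_inner [symmetric]
    using cutoff_eq_0 [OF sq(2) power_mono [OF that]] R0 by simp
  have ab: "0 \<le> a p y" "a p y \<le> 1" "0 \<le> e y" "e y \<le> 1" for p y
    using cutoff_bounds by (auto simp: a_def e_def)
  \<comment> \<open>Equal to 1 on the inner half of the tube, then linear in the distance to the
    core down to 0 at the boundary. Only a Lipschitz bound is available for functions of tube
    coordinates.\<close>
  define b where "b y = (if y \<in> V \<delta> then min 1 (2 - 2 * cmod (tz y) / \<delta>) else 0)" for y
  have b1: "b y = 1" if "y \<in> V (\<delta> / 2)" for y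
  proof -
    have "y \<in> V \<delta>" using V_mono [of "\<delta> / 2" \<delta>] that \<delta> by auto
    moreover from this have "cmod (tz y) \<le> \<delta> / 2" using in_V_iff [of y "\<delta> / 2"] that \<delta> by auto
    then have "2 * cmod (tz y) / \<delta> \<le> 1" using \<delta> by simp
    ultimately show ?thesis by (simp add: b_def)
  qed
  have b0: "b y = 0" if "y \<notin> V' \<delta>" for y
  proof (cases "y \<in> V \<delta>")
    case True
    then have "cmod (tz y) = \<delta>" using txz(2) [OF True] in_V'_iff [OF True, of \<delta>] that by auto
    then show ?thesis using True \<delta> by (simp add: b_def)
  qed (simp add: b_def)
  have bb: "0 \<le> b y" "b y \<le> 1" for y
    using txz(2) [of y] \<delta> by (auto simp: b_def divide_le_eq)
  \<comment> \<open>\<open>W\<close> collects the continuously differentiable parts and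
    \<open>S\<close> the part in tube coordinates, because their Lipschitz bounds have different
    origins.\<close>
  define W where "W y = (\<Sum>p\<in>P. a p y *\<^sub>R (B p *v (y - p) - pl y)) + e y *\<^sub>R (- y - pl y) + pl y" for y
  define S where "S y = b y *\<^sub>R (- N (tx y) (tz y) - pl y)" for y
  define X where "X y = W y + S y" for y
  have suma: "(\<Sum>q\<in>P. a q y *\<^sub>R (B q *v (y - q) - pl y)) = a p y *\<^sub>R (B p *v (y - p) - pl y)"
    if "p \<in> P" "dist p y \<le> 2 * \<rho>" for p y
  proof -
    have "a q y = 0" if "q \<in> P - {p}" for q
      using uniqp [of p q y] a0 [of q y] that \<open>p \<in> P\<close> \<open>dist p y \<le> 2 * \<rho>\<close> by blast
    then show ?thesis using P(1) that(1) by (simp add: sum.remove [of P p])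
  qed
  have suma0: "(\<Sum>q\<in>P. a q y *\<^sub>R (B q *v (y - q) - pl y)) = 0"
    if "\<And>p. p \<in> P \<Longrightarrow> \<not> dist p y \<le> 2 * \<rho>" for y
    by (rule sum.neutral) (use a0 that in auto)
  text \<open>The four supports are disjoint, so at each point \<open>X\<close> is a convex combination of at most two fields.\<close>
  have Xp: "X y = a p y *\<^sub>R (B p *v (y - p)) + (1 - a p y) *\<^sub>R pl y" if "p \<in> P" "dist p y \<le> 2 * \<rho>" for p y
  proof -
    have "e y = 0" "b y = 0" using e0 R0(4) [OF that] farV [OF that] by (auto simp: b_def)
    then show ?thesis using suma [OF that] by (simp add: X_def W_def S_def algebra_simps)
  qed
  have XV: "X y = b y *\<^sub>R (- N (tx y) (tz y)) + (1 - b y) *\<^sub>R pl y" if "y \<in> V \<delta>" for y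
  proof -
    have "(\<Sum>q\<in>P. a q y *\<^sub>R (B q *v (y - q) - pl y)) = 0" by (rule suma0) (use farV that in blast)
    moreover have "e y = 0" using e0 R0(3) [OF that] by auto
    ultimately show ?thesis by (simp add: X_def W_def S_def algebra_simps)
  qed
  have Xo: "X y = e y *\<^sub>R (- y) + (1 - e y) *\<^sub>R pl y" if "y \<notin> V \<delta>" "\<forall>p\<in>P. \<not> dist p y \<le> 2 * \<rho>" for y
    using suma0 [of y] that by (simp add: X_def W_def S_def b_def algebra_simps)
  have conv: "0 < (t *\<^sub>R v + (1 - t) *\<^sub>R w) \<bullet> u" if "0 \<le> t" "t \<le> 1" "t \<noteq> 0 \<Longrightarrow> 0 < v \<bullet> u" "t \<noteq> 1 \<Longrightarrow> 0 < w \<bullet> u" for t and u v w :: "real^3"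
    using that by (cases "t = 0"; cases "t = 1") (auto simp: inner_add_left add_pos_pos)
  have Xg: "0 < X y \<bullet> g y" if y: "y \<notin> K" "y \<notin> P" for y
  proof (cases "\<exists>p\<in>P. dist p y \<le> 2 * \<rho>")
    case True
    then obtain p where p: "p \<in> P" "dist p y \<le> 2 * \<rho>" by blast
    show ?thesis
      unfolding Xp [OF p]
    proof (rule conv [OF ab(1,2)])
      show "0 < (B p *v (y - p)) \<bullet> g y" using near [OF p(1) _ p(2)] y p by auto
      assume "a p y \<noteq> 1"
      then have "\<not> dist p y \<le> \<rho>" using a1 by blast
      then have "\<not> dist q y < \<rho>" if "q \<in> P" for q
        using uniqp [OF p(1) that p(2)] \<rho> by (cases "q = p") force+
      then have "y \<notin> (\<Union>p\<in>P. ball p \<rho>)" by auto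
      moreover have "y \<notin> V' (\<delta> / 2)" using farV [OF p] V'_sub V_mono [of "\<delta> / 2" \<delta>] \<delta> by fastforce
      ultimately have "y \<in> D" using R0(4) [OF p] by (auto simp: D_def)
      then show "0 < pl y \<bullet> g y" by (rule plg)
    qed
  next
    case False
    then have np: "\<And>p. p \<in> P \<Longrightarrow> \<not> dist p y \<le> 2 * \<rho>" by blast
    then have nb: "y \<notin> (\<Union>p\<in>P. ball p \<rho>)" using \<rho>(1) by force
    show ?thesis
    proof (cases "y \<in> V \<delta>")
      case True
      have "tz y \<noteq> 0" using y(1) txz [OF True] \<tau>_in_K [of "tz y" "tx y"] by auto
      then have "g (\<tau> (tx y) (tz y)) \<bullet> N (tx y) (tz y) < 0" using core txz(2) [OF True] by blast
      then have c: "0 < (- N (tx y) (tz y)) \<bullet> g y" using txz(1) [OF True] by (simp add: inner_commute)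
      show ?thesis
        unfolding XV [OF True]
      proof (rule conv [OF bb])
        show "0 < (- N (tx y) (tz y)) \<bullet> g y" by (rule c)
        assume "b y \<noteq> 1"
        then have "y \<notin> V (\<delta> / 2)" using b1 by blast
        then have "y \<in> D" using nb V'_sub R0(3) [OF True] by (auto simp: D_def)
        then show "0 < pl y \<bullet> g y" by (rule plg)
      qed
    next
      case nV: False
      have np': "\<forall>p\<in>P. \<not> dist p y \<le> 2 * \<rho>" using np by blast
      show ?thesis
        unfolding Xo [OF nV np']
      proof (rule conv [OF ab(3,4)])
        show "0 < (- y) \<bullet> g y" if "e y \<noteq> 0" using outward e0 that by force
        assume "e y \<noteq> 1"
        then have "norm y \<le> R0 + 1" using e1 by force
        moreover have "y \<notin> V' (\<delta> / 2)" using nV V'_sub V_mono [of "\<delta> / 2" \<delta>] \<delta> by fastforce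
        ultimately have "y \<in> D" using nb by (auto simp: D_def)
        then show "0 < pl y \<bullet> g y" by (rule plg)
      qed
    qed
  qed
  \<comment> \<open>\<open>W + id\<close> is continuously differentiable and vanishes outside a box;
    \<open>S\<close> is Lipschitz in the tube and vanishes at its boundary.\<close>
  have Xlip: "\<exists>\<Lambda>>0. \<forall>x y. norm (X x - X y) \<le> \<Lambda> * norm (x - y)"
  proof -
    have C1id: "C1 (\<lambda>y. y - p)" for p :: "real^3"
      by (rule C1_diff [OF C1_bounded_linear [OF bounded_linear_ident] C1_const])
    have "C1 e"
      unfolding e_def [abs_def]
      by (rule C1_diff [OF C1_const C1_compose [OF C1_cutoff [OF sq(2)] C1_inner_self [OF C1_bounded_linear [OF bounded_linear_ident]]]])
    moreover have "C1 (a p)" for p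
      unfolding a_def [abs_def]
      by (rule C1_compose [OF C1_cutoff [OF sq(1)] C1_inner_self [OF C1id]])
    moreover have "C1 (\<lambda>y :: real^3. - y - pl y)"
      by (rule C1_diff [OF C1_bounded_linear [OF bounded_linear_minus [OF bounded_linear_ident]] plC])
    moreover have "C1 (\<lambda>y. B p *v (y - p) - pl y)" for p
      by (rule C1_diff [OF C1_compose [OF C1_bounded_linear [OF matrix_vector_mul_bounded_linear] C1id] plC])
    ultimately have "C1 W"
      unfolding W_def [abs_def]
      by (intro C1_add [OF C1_add [OF C1_sum [OF C1_scaleR] C1_scaleR] plC])
    from C1_add [OF this C1_bounded_linear [OF bounded_linear_ident]]
    have W1: "C1 (\<lambda>y. W y + y)" .
    define l u :: "real^3" where "l = (\<chi> i. - (R0 + 1))" and "u = (\<chi> i. R0 + 1)"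
    have inbox: "y \<in> cbox l u" if "norm y \<le> R0 + 1" for y
      unfolding mem_box_cart l_def u_def
    proof (intro allI conjI)
      fix i show "(\<chi> i. - (R0 + 1)) $ i \<le> y $ i" "y $ i \<le> (\<chi> i. R0 + 1) $ i"
        using component_le_norm_cart [of y i] that by (auto simp: abs_le_iff)
    qed
    have "W y + y = 0" if "y \<notin> cbox l u" for y
    proof -
      have ny: "norm y > R0 + 1" using inbox that by force
      have "(\<Sum>q\<in>P. a q y *\<^sub>R (B q *v (y - q) - pl y)) = 0" by (rule suma0) (use R0(4) ny in force)
      then show ?thesis using e1 [of y] ny by (simp add: W_def)
    qed
    then obtain \<Lambda>1 where \<Lambda>1: "\<Lambda>1 \<ge> 0" "\<And>x y. norm ((W x + x) - (W y + y)) \<le> \<Lambda>1 * norm (x - y)"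
      using C1_locally_const_imp_lipschitz [OF W1, of l u 0] by blast
    obtain \<Lambda>2 where \<Lambda>2: "\<Lambda>2 \<ge> 0" "\<And>x y. x \<in> V \<delta> \<Longrightarrow> y \<in> V \<delta> \<Longrightarrow> norm (pl x - pl y) \<le> \<Lambda>2 * norm (x - y)"
      using C1_lipschitz_on_compact [OF plC compact_V] by blast
    have "bounded (pl ` V \<delta>)"
      by (intro compact_imp_bounded compact_continuous_image C1_continuous_on plC compact_V)
    then obtain Q where Q: "Q > 0" "\<And>y. y \<in> V \<delta> \<Longrightarrow> norm (pl y) \<le> Q" unfolding bounded_pos by auto
    define \<Lambda>3 where "\<Lambda>3 = 1 + (norm (c' 0) + L) / \<kappa>"
    have \<Lambda>3: "\<Lambda>3 \<ge> 1" using L \<kappa> by (simp add: \<Lambda>3_def)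
    define \<Lambda>4 where "\<Lambda>4 = (\<Lambda>3 + \<Lambda>2) + 2 / (\<delta> * \<kappa>) * (\<delta> + Q)"
    have \<Lambda>4: "\<Lambda>4 \<ge> 0" using \<Lambda>3 \<Lambda>2 \<delta> \<kappa> Q by (auto simp: \<Lambda>4_def)
    have "norm (S x - S y) \<le> \<Lambda>4 * norm (x - y)" for x y
    proof (rule lipschitz_extend_tube [OF _ \<Lambda>4])
      show "S x = 0" if "x \<notin> V' \<delta>" for x using b0 [OF that] by (simp add: S_def)
      fix x y assume xy: "x \<in> V \<delta>" "y \<in> V \<delta>"
      define T where "T y = - N (tx y) (tz y) - pl y" for y
      have T1: "norm (T x - T y) \<le> (\<Lambda>3 + \<Lambda>2) * norm (x - y)"
      proof -
        have "T x - T y = - ((N (tx x) (tz x) - N (tx y) (tz y)) + (pl x - pl y))" by (simp add: T_def)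
        then have "norm (T x - T y) \<le> norm (N (tx x) (tz x) - N (tx y) (tz y)) + norm (pl x - pl y)"
          by (metis norm_minus_cancel norm_triangle_ineq)
        then show ?thesis
          using tz_lip(2) [OF xy] \<Lambda>2(2) [OF xy] by (simp add: \<Lambda>3_def algebra_simps)
      qed
      have T2: "norm (T y) \<le> \<delta> + Q"
        using norm_triangle_ineq4 [of "- N (tx y) (tz y)" "pl y"] Q(2) [OF xy(2)] txz(2) [OF xy(2)] norm_N
        by (simp add: T_def)
      have bl: "\<bar>b x - b y\<bar> \<le> 2 / (\<delta> * \<kappa>) * norm (x - y)"
      proof -
        have "\<bar>b x - b y\<bar> \<le> \<bar>(2 - 2 * cmod (tz x) / \<delta>) - (2 - 2 * cmod (tz y) / \<delta>)\<bar>"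
          using xy by (auto simp: b_def min_def)
        also have "\<dots> = 2 / \<delta> * \<bar>cmod (tz x) - cmod (tz y)\<bar>"
        proof -
          have "(2 - 2 * cmod (tz x) / \<delta>) - (2 - 2 * cmod (tz y) / \<delta>) = - (2 / \<delta> * (cmod (tz x) - cmod (tz y)))"
            by (simp add: right_diff_distrib diff_divide_distrib)
          then show ?thesis using \<delta> by (simp only: abs_minus_cancel abs_mult) simp
        qed
        also have "\<dots> \<le> 2 / \<delta> * (norm (x - y) / \<kappa>)"
          using tz_lip(1) [OF xy] \<delta> by (intro mult_left_mono) auto
        finally show ?thesis by simp
      qed
      have "S x - S y = b x *\<^sub>R (T x - T y) + (b x - b y) *\<^sub>R T y"
        by (simp add: S_def T_def algebra_simps)
      then have "norm (S x - S y) \<le> norm (b x *\<^sub>R (T x - T y)) + norm ((b x - b y) *\<^sub>R T y)"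
        by (metis norm_triangle_ineq)
      also have "\<dots> = b x * norm (T x - T y) + \<bar>b x - b y\<bar> * norm (T y)" using bb by simp
      also have "\<dots> \<le> 1 * ((\<Lambda>3 + \<Lambda>2) * norm (x - y)) + (2 / (\<delta> * \<kappa>) * norm (x - y)) * (\<delta> + Q)"
        by (intro add_mono mult_mono T1 T2 bl bb) (use \<Lambda>3 \<Lambda>2 \<delta> \<kappa> in auto)
      also have "\<dots> = \<Lambda>4 * norm (x - y)" by (simp add: \<Lambda>4_def algebra_simps)
      finally show "norm (S x - S y) \<le> \<Lambda>4 * norm (x - y)" .
    qed
    note Slip = this
    have "norm (X x - X y) \<le> (\<Lambda>1 + 1 + \<Lambda>4) * norm (x - y)" for x y
    proof -
      have "X x - X y = ((W x + x) - (W y + y)) - (x - y) + (S x - S y)" by (simp add: X_def)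
      then have "norm (X x - X y) \<le> norm ((W x + x) - (W y + y)) + norm (x - y) + norm (S x - S y)"
        using norm_triangle_ineq [of "((W x + x) - (W y + y)) - (x - y)" "S x - S y"]
          norm_triangle_ineq4 [of "(W x + x) - (W y + y)" "x - y"] by simp
      also have "\<dots> \<le> (\<Lambda>1 + 1 + \<Lambda>4) * norm (x - y)"
        using \<Lambda>1(2) [of x y] Slip [of x y] by (simp add: algebra_simps)
      finally show ?thesis .
    qed
    then show ?thesis using \<Lambda>1 \<Lambda>4 by (intro exI [of _ "\<Lambda>1 + 1 + \<Lambda>4"]) auto
  qed
  then obtain \<Lambda> where \<Lambda>: "\<Lambda> > 0" "\<forall>x y. norm (X x - X y) \<le> \<Lambda> * norm (x - y)" by blast
  have X2: "X (\<tau> x z) = - N x z" if "cmod z \<le> \<delta> / 2" for x z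
  proof -
    have z: "cmod z \<le> \<delta>" using that \<delta> by auto
    have "\<tau> x z \<in> V \<delta>" "\<tau> x z \<in> V (\<delta> / 2)" using z that by (auto simp: V_def)
    moreover have "N (tx (\<tau> x z)) z = N x z"
      using periodic_tx [of "\<lambda>x. N x z", OF N_per z] by simp
    ultimately show ?thesis using XV b1 tz_\<tau> [OF z] by simp
  qed
  have X3: "X y = B p *v (y - p)" if "p \<in> P" "dist p y \<le> \<rho>" for p y
    using Xp [OF that(1), of y] a1 [OF that(2)] that(2) \<rho> by simp
  have X5: "X y = - y" if "norm y \<ge> R0 + 1" for y
  proof -
    have "y \<notin> V \<delta>" "\<forall>p\<in>P. \<not> dist p y \<le> 2 * \<rho>" using R0(3,4) that by force+
    then show ?thesis using Xo e1 [OF that] by simp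
  qed
  show ?thesis
    by (rule exI [of _ X], rule exI [of _ \<Lambda>], rule exI [of _ \<rho>], rule exI [of _ "R0 + 1"])
       (use \<Lambda> \<rho>(1) R0(1) X2 X3 Xg X5 in \<open>auto simp: gradient_like_def\<close>)
qed

end

section \<open>The index count\<close>

context charged_tube
begin

text \<open>\<open>A\<close> is the Hessian of the potential, so its symmetry and trace can be read
  off the integral kernel.\<close>

lemma field_jacobian:
  fixes A :: "real^3^3"
  assumes p: "p \<notin> K" and A: "(g has_derivative (\<lambda>v. A *v v)) (at p)"
  shows "(A *v x) \<bullet> y = x \<bullet> (A *v y)" "0 \<le> trace A"
proof -
  have pc: "p \<notin> c ` {0..1}" using p by (simp add: K_image)
  have row: "(A *v v) \<bullet> e = integral {0..1} (hess_row s c e p) \<bullet> v" for v e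
  proof -
    have "((\<lambda>y. g y \<bullet> e) has_derivative (\<lambda>v. (A *v v) \<bullet> e)) (at p)"
      by (rule bounded_linear.has_derivative [OF bounded_linear_inner_left A])
    from has_derivative_unique [OF this field_deriv [OF continuous_c pc]]
    show ?thesis by metis
  qed
  show "(A *v x) \<bullet> y = x \<bullet> (A *v y)"
    using hess_row_symmetric [OF continuous_c pc, of s y x] row by (metis inner_commute)
  have "trace A = (\<Sum>i\<in>UNIV. (A *v axis i 1) \<bullet> axis i 1)"
    by (simp add: trace_def inner_axis matrix_vector_mult_basis column_def)
  also have "\<dots> = (\<Sum>b\<in>Basis. (A *v b) \<bullet> b)"
    by (rule sum.reindex_bij_betw [of "\<lambda>i. axis i 1"])
       (auto simp: bij_betw_def inj_on_def axis_eq_axis Basis_vec_def)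
  also have "\<dots> \<ge> 0"
    unfolding row by (rule hess_row_trace [OF continuous_c pc s]) simp
  finally show "0 \<le> trace A" .
qed

text \<open>The index sum is -1. An empty set gives 0 and two signs give an even number, so exactly
  one zero is left, and its determinant is negative.\<close>

lemma unique_saddle:
  assumes P: "finite P" "card P \<le> 2" "\<And>y. y \<in> P \<longleftrightarrow> y \<notin> K \<and> g y = 0"
    and nondeg: "\<And>p. p \<in> P \<Longrightarrow> \<exists>A. (g has_derivative (\<lambda>v. A *v v)) (at p) \<and> invertible A"
  shows "\<exists>p A a l. P = {p} \<and> (g has_derivative (\<lambda>v. A *v v)) (at p) \<and> norm a = 1 \<and> A *v a = l *\<^sub>R a \<and> l < 0 \<and>
     (\<forall>v. v \<bullet> a = 0 \<longrightarrow> v \<noteq> 0 \<longrightarrow> 0 < v \<bullet> (A *v v)) \<and> (\<forall>x y. (A *v x) \<bullet> y = x \<bullet> (A *v y))"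
proof -
  obtain A where A: "\<And>p. p \<in> P \<Longrightarrow> (g has_derivative (\<lambda>v. A p *v v)) (at p)" "\<And>p. p \<in> P \<Longrightarrow> invertible (A p)"
    using nondeg by metis
  have P': "P \<subseteq> - K" "\<And>y. y \<notin> K \<Longrightarrow> g y = 0 \<longleftrightarrow> y \<in> P" using P(3) by auto
  \<comment> \<open>Here each Hessian is its own linear model, since
    \<open>(A v) \<bullet> (A v)\<close> is positive for \<open>v \<noteq> 0\<close>.\<close>
  have "\<exists>A'. (g has_derivative A') (at p) \<and> (\<forall>v. v \<noteq> 0 \<longrightarrow> 0 < (A p *v v) \<bullet> A' v)" if "p \<in> P" for p
  proof (intro exI conjI allI impI)
    show "(g has_derivative (\<lambda>v. A p *v v)) (at p)" by (rule A(1) [OF that])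
    fix v :: "real^3" assume "v \<noteq> 0"
    moreover have "inj ((*v) (A p))"
      using A(2) [OF that] by (simp add: inj_matrix_vector_mult)
    ultimately have "A p *v v \<noteq> 0" by (metis injD matrix_vector_mult_0_right)
    then show "0 < (A p *v v) \<bullet> (A p *v v)" by simp
  qed
  then have "\<exists>X \<Lambda> \<rho> R. gradient_like P A X \<Lambda> \<rho> R"
    using P' by (intro gradient_like_field P(1)) auto
  then obtain X \<Lambda> \<rho> R where X: "0 < \<Lambda>" "0 < \<rho>" "0 < R" "\<And>x y. norm (X x - X y) \<le> \<Lambda> * norm (x - y)"
    "\<And>x z. cmod z \<le> \<delta> / 2 \<Longrightarrow> X (\<tau> x z) = - N x z"
    "\<And>p y. p \<in> P \<Longrightarrow> dist p y \<le> \<rho> \<Longrightarrow> X y = A p *v (y - p)"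
    "\<And>y. y \<notin> K \<Longrightarrow> y \<notin> P \<Longrightarrow> 0 < X y \<bullet> g y"
    "\<And>y. norm y \<ge> R \<Longrightarrow> X y = - y"
    unfolding gradient_like_def by blast
  have V2: "V (\<delta> / 2) \<subseteq> V \<delta>" using V_mono [of "\<delta> / 2" \<delta>] \<delta> by auto
  text \<open>Adding a tangential component removes the zeros of \<open>X\<close> on the curve.\<close>
  define t where "t y = (if y \<in> V (\<delta> / 2) then (1 - 2 * cmod (tz y) / \<delta>) *\<^sub>R c' (tx y) else 0)" for y
  define f where "f y = X y + t y" for y
  have "continuous_on (V (\<delta> / 2)) t"
  proof (rule continuous_on_V)
    have "continuous_on ({0..1} \<times> cball 0 (\<delta> / 2)) (\<lambda>(x, z). (1 - 2 * cmod z / \<delta>) *\<^sub>R c' x)"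
      unfolding case_prod_unfold
      by (intro continuous_intros continuous_on_compose2 [OF continuous_n(3)]) (use \<delta> in auto)
    then show "continuous_on ({0..1} \<times> cball 0 (\<delta> / 2)) (\<lambda>(x, z). t (\<tau> x z))"
    proof (rule continuous_on_eq, clarsimp)
      fix x z assume z: "cmod z * 2 \<le> \<delta>"
      then have z': "cmod z \<le> \<delta>" using norm_ge_zero [of z] by linarith
      have "\<tau> x z \<in> V (\<delta> / 2)" using z by (auto simp: V_def)
      moreover have "c' (tx (\<tau> x z)) = c' x" by (rule periodic_tx [of c', OF c'_per z'])
      ultimately show "(1 - 2 * cmod z / \<delta>) *\<^sub>R c' x = t (\<tau> x z)"
        by (simp add: t_def tz_\<tau> [OF z'])
    qed
  qed
  moreover have "continuous_on (- V' (\<delta> / 2)) t"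
  proof (rule continuous_on_eq [OF continuous_on_const])
    fix y assume y: "y \<in> - V' (\<delta> / 2)"
    show "0 = t y"
    proof (cases "y \<in> V (\<delta> / 2)")
      case True
      then have "cmod (tz y) = \<delta> / 2"
        using in_V_iff [of y "\<delta> / 2"] in_V'_iff [of y "\<delta> / 2"] V2 y \<delta> by force
      then show ?thesis using \<delta> by (simp add: t_def)
    qed (simp add: t_def)
  qed
  ultimately have "continuous_on (V (\<delta> / 2) \<union> - V' (\<delta> / 2)) t"
    by (intro continuous_on_closed_Un)
       (use compact_V [of "\<delta> / 2"] open_V' [of "\<delta> / 2"] \<delta> in \<open>auto simp: compact_imp_closed\<close>)
  moreover have "V (\<delta> / 2) \<union> - V' (\<delta> / 2) = UNIV" using V'_sub by auto
  ultimately have contt: "continuous_on UNIV t" by simp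
  have "\<Lambda>-lipschitz_on UNIV X"
    using X(1,4) by (intro lipschitz_onI) (auto simp: dist_norm)
  then have contf: "continuous_on UNIV f"
    unfolding f_def [abs_def] by (intro continuous_intros contt lipschitz_on_continuous_on)
  have PV: "p \<notin> V \<delta>" if "p \<in> P" for p using g_nz_V [of p] P(3) that by auto
  \<comment> \<open>In the inner tube the normal and the tangential part of \<open>f\<close> are
    orthogonal; the first vanishes only on the core, and there the second does not.\<close>
  have zeros: "f y = 0 \<longleftrightarrow> y \<in> P" for y
  proof (cases "y \<in> V (\<delta> / 2)")
    case True
    then have yV: "y \<in> V \<delta>" using V2 by blast
    have tz: "cmod (tz y) \<le> \<delta> / 2" using in_V_iff [OF yV, of "\<delta> / 2"] True \<delta> by auto
    have Xy: "X y = - N (tx y) (tz y)" using X(5) [OF tz, of "tx y"] txz(1) [OF yV] by simp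
    have "f y \<noteq> 0"
    proof
      assume "f y = 0"
      then have eq: "N (tx y) (tz y) = (1 - 2 * cmod (tz y) / \<delta>) *\<^sub>R c' (tx y)"
        using True by (simp add: f_def t_def Xy)
      then have "N (tx y) (tz y) \<bullet> N (tx y) (tz y) = 0"
        by (metis N_orth inner_scaleR_right mult_zero_right)
      then have "N (tx y) (tz y) = 0" by simp
      moreover from this have "tz y = 0" using norm_N [of "tx y" "tz y"] by simp
      ultimately have "c' (tx y) = 0" using eq by simp
      then show False using m(2) [of "tx y"] m(1) by simp
    qed
    then show ?thesis using PV yV by blast
  next
    case False
    then have fX: "f y = X y" by (simp add: f_def t_def)
    have "y \<notin> K" using False K_sub [of "\<delta> / 2"] V'_sub [of "\<delta> / 2"] \<delta> by auto
    show ?thesis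
    proof (cases "y \<in> P")
      case True
      then show ?thesis unfolding fX using X(6) [OF True, of y] X(2) by simp
    next
      case False
      then show ?thesis unfolding fX using X(7) [OF \<open>y \<notin> K\<close> False] by auto
    qed
  qed
  obtain R2 where R2: "R2 > 0" "\<And>y. y \<in> V (\<delta> / 2) \<Longrightarrow> norm y \<le> R2"
    using compact_imp_bounded [OF compact_V, of "\<delta> / 2"] unfolding bounded_pos by blast
  obtain d where d: "d > 0" "\<And>p. p \<in> P \<Longrightarrow> ball p d \<inter> V (\<delta> / 2) = {}"
  proof -
    have "\<exists>r>0. ball p r \<inter> V (\<delta> / 2) = {}" if pP: "p \<in> P" for p
    proof -
      have "open (- V (\<delta> / 2))" using compact_V [of "\<delta> / 2"] compact_imp_closed by blast
      moreover have "p \<in> - V (\<delta> / 2)" using PV [OF pP] V2 by blast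
      ultimately obtain r where "r > 0" "ball p r \<subseteq> - V (\<delta> / 2)" using openE by blast
      then show ?thesis by blast
    qed
    then obtain r where r: "\<And>p. p \<in> P \<Longrightarrow> r p > 0" "\<And>p. p \<in> P \<Longrightarrow> ball p (r p) \<inter> V (\<delta> / 2) = {}" by metis
    show thesis
    proof (rule that [of "Min (insert 1 (r ` P))"])
      show "0 < Min (insert 1 (r ` P))" using P(1) r(1) by auto
      fix p assume p: "p \<in> P"
      have "Min (insert 1 (r ` P)) \<le> r p" using P(1) p by auto
      then show "ball p (Min (insert 1 (r ` P))) \<inter> V (\<delta> / 2) = {}" using r(2) [OF p] by force
    qed
  qed
  \<comment> \<open>The radii \<open>R + R2\<close> and \<open>min \<rho> d\<close> are such that
    the tangential term is absent far out and near the zeros.\<close>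
  have sumP: "(\<Sum>p\<in>P. sgn (det (A p))) = -1"
  proof (rule zero_index_sum [OF contf P(1), where R = "R + R2" and ?r0.0 = "min \<rho> d"])
    show "0 < R + R2" using X(3) R2(1) by simp
    show "f y = - y" if "norm y \<ge> R + R2" for y
    proof -
      have "y \<notin> V (\<delta> / 2)" using R2(2) [of y] that X(3) by force
      then show ?thesis using X(8) [of y] that R2(1) by (simp add: f_def t_def)
    qed
    show "0 < min \<rho> d" using X(2) d(1) by simp
    show "f y = A p *v (y - p)" if "p \<in> P" "dist p y < min \<rho> d" for p y
    proof -
      have "y \<notin> V (\<delta> / 2)" using d(2) [OF that(1)] that(2) by auto
      then show ?thesis using X(6) [OF that(1), of y] that(2) by (simp add: f_def t_def)
    qed
    show "det (A p) \<noteq> 0" if "p \<in> P" for p using A(2) [OF that] by (simp add: invertible_det_nz)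
  qed (rule zeros)
  have "card P = 0 \<or> card P = 1 \<or> card P = 2" using P(2) by linarith
  then have "card P = 1"
  proof (elim disjE)
    assume "card P = 0"
    then show ?thesis using P(1) sumP by simp
  next
    assume "card P = 2"
    then obtain x y where "P = {x, y}" "x \<noteq> y" by (auto simp: card_2_iff)
    then have "sgn (det (A x)) + sgn (det (A y)) = -1" using sumP by simp
    moreover have "det (A x) \<noteq> 0" "det (A y) \<noteq> 0"
      using A(2) \<open>P = {x, y}\<close> by (auto simp: invertible_det_nz)
    ultimately show ?thesis by (auto simp: sgn_if split: if_splits)
  qed
  then obtain p where p: "P = {p}" by (auto simp: card_1_singleton_iff)
  then have dneg: "det (A p) < 0" using sumP by (auto simp: sgn_if split: if_splits)
  have pK: "p \<notin> K" and pP: "p \<in> P" using p P(3) by auto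
  note J = field_jacobian [OF pK A(1) [OF pP]]
  obtain a l where "norm a = 1" "A p *v a = l *\<^sub>R a" "l < 0" "\<And>v. v \<bullet> a = 0 \<Longrightarrow> v \<noteq> 0 \<Longrightarrow> 0 < v \<bullet> (A p *v v)"
    using saddle_direction [OF J(1) dneg J(2)] by metis
  then show ?thesis using p A(1) [OF pP] J(1) by blast
qed

end

section \<open>Coverings by roots\<close>

lemma finite_complex_roots_unity: "n > 0 \<Longrightarrow> finite {\<zeta>::complex. \<zeta> ^ n = 1}"
  using finite_roots_unity by auto

text \<open>The roots of unity act freely on nonzero pairs, and the fibres of \<open>E\<close> are
  orbits. A local continuous section \<open>s\<close> therefore trivialises \<open>E\<close>, with
  one sheet for each root of unity. Fibres consist of pairs because the covering below is glued from
  two charts.\<close>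

lemma covering_space_of_local_sections:
  fixes E :: "('a::euclidean_space \<times> complex \<times> complex) set"
  assumes n: "n > 0" and EW: "\<And>y v. (y, v) \<in> E \<Longrightarrow> y \<in> W"
    and loc: "\<And>y0. y0 \<in> W \<Longrightarrow> \<exists>T s. open T \<and> y0 \<in> T \<and> T \<subseteq> W \<and> continuous_on T s \<and>
      (\<forall>y\<in>T. s y \<noteq> 0 \<and> (\<forall>v. (y, v) \<in> E \<longleftrightarrow> (\<exists>\<zeta>. \<zeta> ^ n = 1 \<and> v = (\<zeta> * fst (s y), \<zeta> * snd (s y)))))"
  shows "covering_space E fst W"
  unfolding covering_space_def
proof (intro conjI ballI)
  show "continuous_on E fst" by (intro continuous_intros)
  show "fst ` E = W"
  proof (intro equalityI subsetI)
    fix y assume "y \<in> W"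
    then obtain T s where Ts: "open T \<and> y \<in> T \<and> T \<subseteq> W \<and> continuous_on T s \<and>
      (\<forall>y\<in>T. s y \<noteq> 0 \<and> (\<forall>v. (y, v) \<in> E \<longleftrightarrow> (\<exists>\<zeta>. \<zeta> ^ n = 1 \<and> v = (\<zeta> * fst (s y), \<zeta> * snd (s y)))))"
      using loc [OF \<open>y \<in> W\<close>] by (elim exE)
    then have "(y, v) \<in> E \<longleftrightarrow> (\<exists>\<zeta>. \<zeta> ^ n = 1 \<and> v = (\<zeta> * fst (s y), \<zeta> * snd (s y)))" for v by blast
    then have "(y, s y) \<in> E" by (auto intro!: exI [of _ 1])
    then show "y \<in> fst ` E" by force
  qed (use EW in auto)
  fix y0 assume "y0 \<in> W"
  then obtain T s where Ts: "open T \<and> y0 \<in> T \<and> T \<subseteq> W \<and> continuous_on T s \<and>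
      (\<forall>y\<in>T. s y \<noteq> 0 \<and> (\<forall>v. (y, v) \<in> E \<longleftrightarrow> (\<exists>\<zeta>. \<zeta> ^ n = 1 \<and> v = (\<zeta> * fst (s y), \<zeta> * snd (s y)))))"
    using loc [OF \<open>y0 \<in> W\<close>] by (elim exE)
  then have T: "open T" "y0 \<in> T" "T \<subseteq> W" and s: "continuous_on T s"
    and fib: "\<And>y. y \<in> T \<Longrightarrow> s y \<noteq> 0"
      "\<And>y v. y \<in> T \<Longrightarrow> (y, v) \<in> E \<longleftrightarrow> (\<exists>\<zeta>. \<zeta> ^ n = 1 \<and> v = (\<zeta> * fst (s y), \<zeta> * snd (s y)))"
    by blast+
  define act where "act \<zeta> y = (\<zeta> * fst (s y), \<zeta> * snd (s y))" for \<zeta> y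
  define S where "S \<zeta> = (\<lambda>y. (y, act \<zeta> y)) ` T" for \<zeta>
  have contact: "continuous_on T (act \<zeta>)" for \<zeta>
    unfolding act_def [abs_def] by (intro continuous_intros s)
  have act_inj: "\<zeta> = \<xi>" if "y \<in> T" "act \<zeta> y = act \<xi> y" for \<zeta> \<xi> y
  proof -
    have "fst (s y) \<noteq> 0 \<or> snd (s y) \<noteq> 0" using fib(1) [OF that(1)] by (auto simp: prod_eq_iff)
    then show ?thesis using that(2) by (auto simp: act_def)
  qed
  have SE: "S \<zeta> \<subseteq> E" if "\<zeta> ^ n = 1" for \<zeta>
    using that fib(2) by (auto simp: S_def act_def)
  \<comment> \<open>Over \<open>T\<close>, a sheet is what remains of \<open>E\<close> after the
    removal of finitely many other sheets, each of which is closed there.\<close>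
  have openS: "openin (top_of_set E) (S \<zeta>)" if \<zeta>: "\<zeta> ^ n = 1" for \<zeta>
  proof -
    define Z where "Z \<xi> = (T \<times> UNIV) \<inter> (\<lambda>z. snd z - act \<xi> (fst z)) -` (- {0})" for \<xi>
    define O' where "O' = (\<Inter>\<xi>\<in>{\<xi>. \<xi> ^ n = 1 \<and> \<xi> \<noteq> \<zeta>}. Z \<xi>) \<inter> T \<times> UNIV"
    have "open (Z \<xi>)" for \<xi>
      unfolding Z_def by (rule continuous_open_preimage)
         (auto intro!: continuous_intros continuous_on_compose2 [OF contact] open_Times T)
    moreover have "finite {\<xi>. \<xi> ^ n = 1 \<and> \<xi> \<noteq> \<zeta>}"
      by (rule finite_subset [OF _ finite_complex_roots_unity [OF n]]) auto
    ultimately have "open O'"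
      unfolding O'_def by (intro open_Int open_INT ballI open_Times T) auto
    moreover have "S \<zeta> = E \<inter> O'"
    proof (intro equalityI subsetI)
      fix z assume "z \<in> S \<zeta>"
      then obtain y where y: "y \<in> T" "z = (y, act \<zeta> y)" by (auto simp: S_def)
      have "act \<zeta> y \<noteq> act \<xi> y" if "\<xi> \<noteq> \<zeta>" for \<xi> using act_inj [OF y(1)] that by metis
      then show "z \<in> E \<inter> O'" using SE [OF \<zeta>] \<open>z \<in> S \<zeta>\<close> y by (auto simp: O'_def Z_def)
    next
      fix z assume z: "z \<in> E \<inter> O'"
      obtain y v where yv: "z = (y, v)" by (metis surj_pair)
      have "y \<in> T" using z by (auto simp: O'_def Z_def yv)
      then obtain \<xi> where \<xi>: "\<xi> ^ n = 1" "v = act \<xi> y" using z fib(2) by (auto simp: yv act_def)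
      have "\<xi> = \<zeta>"
      proof (rule ccontr)
        assume "\<xi> \<noteq> \<zeta>"
        then have "z \<in> Z \<xi>" using z \<xi>(1) unfolding O'_def by blast
        then have "v - act \<xi> y \<noteq> 0" by (auto simp: Z_def yv)
        then show False using \<xi>(2) by simp
      qed
      then show "z \<in> S \<zeta>" using \<xi> \<open>y \<in> T\<close> by (auto simp: S_def yv)
    qed
    ultimately show ?thesis by (auto simp: openin_open)
  qed
  show "\<exists>T. y0 \<in> T \<and> openin (top_of_set W) T \<and> (\<exists>v. \<Union> v = E \<inter> fst -` T \<and> (\<forall>u\<in>v. openin (top_of_set E) u) \<and>
      pairwise disjnt v \<and> (\<forall>u\<in>v. \<exists>q. homeomorphism u T fst q))"
  proof (rule exI [of _ T], intro conjI exI [of _ "S ` {\<zeta>. \<zeta> ^ n = 1}"])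
    show "openin (top_of_set W) T" using T by (auto simp: openin_open)
    show "\<Union> (S ` {\<zeta>. \<zeta> ^ n = 1}) = E \<inter> fst -` T"
    proof (intro equalityI subsetI)
      fix z assume "z \<in> \<Union> (S ` {\<zeta>. \<zeta> ^ n = 1})"
      then show "z \<in> E \<inter> fst -` T" using SE by (auto simp: S_def)
    next
      fix z assume z: "z \<in> E \<inter> fst -` T"
      obtain y v where yv: "z = (y, v)" by (metis surj_pair)
      then have "y \<in> T" using z by auto
      then obtain \<zeta> where "\<zeta> ^ n = 1" "v = act \<zeta> y" using z fib(2) by (auto simp: yv act_def)
      then show "z \<in> \<Union> (S ` {\<zeta>. \<zeta> ^ n = 1})" using \<open>y \<in> T\<close> by (auto simp: S_def yv)
    qed
    show "\<forall>u\<in>S ` {\<zeta>. \<zeta> ^ n = 1}. openin (top_of_set E) u" using openS by auto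
    show "pairwise disjnt (S ` {\<zeta>. \<zeta> ^ n = 1})"
    proof (rule pairwiseI)
      fix A B assume "A \<in> S ` {\<zeta>. \<zeta> ^ n = 1}" "B \<in> S ` {\<zeta>. \<zeta> ^ n = 1}" "A \<noteq> B"
      then obtain \<zeta> \<xi> where "A = S \<zeta>" "B = S \<xi>" "\<zeta> \<noteq> \<xi>" by auto
      then show "disjnt A B" using act_inj by (auto simp: disjnt_def S_def)
    qed
    show "\<forall>u\<in>S ` {\<zeta>. \<zeta> ^ n = 1}. \<exists>q. homeomorphism u T fst q"
    proof
      fix u assume "u \<in> S ` {\<zeta>. \<zeta> ^ n = 1}"
      then obtain \<zeta> where u: "u = S \<zeta>" by blast
      have "homeomorphism (S \<zeta>) T fst (\<lambda>y. (y, act \<zeta> y))"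
        by (rule homeomorphismI) (auto simp: S_def image_iff intro!: continuous_intros contact)
      then show "\<exists>q. homeomorphism u T fst q" unfolding u by blast
    qed
  qed (rule T)
qed

text \<open>A bounded factor is outweighed by one that tends to 0, which makes the extension by 0
  continuous.\<close>

lemma continuous_on_damped:
  fixes g :: "'a::metric_space \<Rightarrow> complex" and \<mu> :: "'a \<Rightarrow> real"
  assumes S: "open S" and T: "open T" and g: "continuous_on (S \<inter> T) g" and n: "\<And>y. y \<in> S \<inter> T \<Longrightarrow> norm (g y) = 1"
    and \<mu>: "continuous_on S \<mu>" and z: "\<And>y. y \<in> S - T \<Longrightarrow> \<mu> y = 0"
  shows "continuous_on S (\<lambda>y. if y \<in> T then of_real (\<mu> y) * g y else 0)"
proof -
  let ?f = "\<lambda>y. if y \<in> T then of_real (\<mu> y) * g y else 0"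
  have "isCont ?f y" if y: "y \<in> S" for y
  proof (cases "y \<in> T")
    case True
    have "continuous_on (S \<inter> T) (\<lambda>y. of_real (\<mu> y) * g y)"
      by (intro continuous_intros g continuous_on_subset [OF \<mu>]) auto
    then have "continuous_on (S \<inter> T) ?f" by (rule continuous_on_eq) auto
    then show ?thesis using S T True y continuous_on_eq_continuous_at [of "S \<inter> T" ?f] by blast
  next
    case False
    have "(?f \<longlongrightarrow> 0) (at y)"
    proof (rule Lim_null_comparison)
      have "isCont \<mu> y" using \<mu> S y continuous_on_eq_continuous_at by blast
      then have "(\<mu> \<longlongrightarrow> 0) (at y)" using z [of y] y False by (simp add: continuous_at)
      then show "((\<lambda>x. \<bar>\<mu> x\<bar>) \<longlongrightarrow> 0) (at y)" by (rule tendsto_rabs_zero)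
      have "\<forall>\<^sub>F x in at y. x \<in> S" using S y by (rule eventually_at_in_open')
      then show "\<forall>\<^sub>F x in at y. norm (?f x) \<le> \<bar>\<mu> x\<bar>"
        by eventually_elim (use n in \<open>auto simp: norm_mult\<close>)
    qed
    then show ?thesis using False by (simp add: continuous_at)
  qed
  then show ?thesis by (simp add: continuous_at_imp_continuous_on)
qed

text \<open>If \<open>e\<close> has an \<open>n\<close>-th root near the part of \<open>W\<close> where it is not defined, its \<open>n\<close>-th roots form a covering of \<open>W\<close>.\<close>

theorem winding_number_divisible:
  fixes N U :: "'a::euclidean_space set" and e g :: "'a \<Rightarrow> complex"
  assumes N: "open N" and U: "open U" and n: "n > 0"
    and e: "continuous_on U e" "\<And>y. y \<in> U \<Longrightarrow> norm (e y) = 1"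
    and g: "continuous_on (N \<inter> U) g" "\<And>y. y \<in> N \<inter> U \<Longrightarrow> g y ^ n = e y"
    and k: "path k" "path_image k \<subseteq> U" and \<omega>: "continuous_on {0..1} \<omega>" "\<And>t. t \<in> {0..1} \<Longrightarrow> e (k t) = cis (2 * pi * \<omega> t)"
    and hom: "homotopic_paths (N \<union> U) k (linepath x x)"
  shows "\<exists>j::int. \<omega> 1 - \<omega> 0 = of_nat n * of_int j"
proof -
  define W where "W = N \<union> U"
  have cl: "closedin (top_of_set W) (W - U)" "closedin (top_of_set W) (W - N)"
    using N U by (auto simp: W_def intro!: closedin_diff open_subset)
  have dj: "(W - U) \<inter> (W - N) = {}" by (auto simp: W_def)
  \<comment> \<open>\<open>m\<close> is 0 where only \<open>N\<close> is available and 1 where only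
    \<open>U\<close> is.\<close>
  obtain m :: "'a \<Rightarrow> real" where m0: "continuous_on W m" "\<And>x. x \<in> W \<Longrightarrow> m x \<in> closed_segment 0 1"
      "\<And>x. x \<in> W - U \<Longrightarrow> m x = 0" "\<And>x. x \<in> W - N \<Longrightarrow> m x = 1"
    by (rule Urysohn_local [OF cl dj, where a = "0::real" and b = 1]) blast
  have m: "continuous_on W m" "\<And>y. y \<in> N - U \<Longrightarrow> m y = 0" "\<And>y. y \<in> U - N \<Longrightarrow> m y = 1"
    using m0(1,3,4) by (auto simp: W_def)
  have gn: "norm (g y) = 1" if "y \<in> N \<inter> U" for y
  proof -
    have "norm (g y) ^ n = 1" using g(2) [OF that] e(2) [of y] that by (metis IntD2 norm_power)
    then show ?thesis using n by (intro power_eq_imp_eq_base [of _ n 1]) auto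
  qed
  have g0: "g y \<noteq> 0" if "y \<in> N \<inter> U" for y using gn [OF that] by auto
  define A where "A y = (if y \<in> U then of_real (m y) * g y else 0)" for y
  define B where "B y = (if y \<in> N then of_real (1 - m y) * (1 / g y) else 0)" for y
  have contA: "continuous_on N A"
    unfolding A_def [abs_def]
    by (rule continuous_on_damped [OF N U g(1) gn continuous_on_subset [OF m(1)] m(2)]) (auto simp: W_def)
  have contB: "continuous_on U B"
    unfolding B_def [abs_def]
  proof (rule continuous_on_damped [OF U N])
    show "continuous_on (U \<inter> N) (\<lambda>y. 1 / g y)"
      by (intro continuous_on_divide continuous_on_const) (use g(1) g0 in \<open>auto simp: Int_commute\<close>)
    show "norm (1 / g y) = 1" if "y \<in> U \<inter> N" for y using gn [of y] that by (simp add: norm_divide)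
    show "continuous_on U (\<lambda>y. 1 - m y)" by (intro continuous_intros continuous_on_subset [OF m(1)]) (auto simp: W_def)
  qed (use m(3) in auto)
  \<comment> \<open>Over \<open>U\<close> the fibre consists of the roots \<open>w\<close> of
    \<open>e\<close>, over \<open>N\<close> of the roots of unity \<open>\<zeta>\<close>, glued by
    \<open>w = \<zeta> g\<close>. Both are embedded by the pair
    \<open>(m w, (1 - m) \<zeta>)\<close>, each entry of which extends by 0 to where its factor is
    missing.\<close>
  define E1 where "E1 = {(y, of_real (m y) * w, B y * w) |y w. y \<in> U \<and> w ^ n = e y}"
  define E2 where "E2 = {(y, A y * \<zeta>, of_real (1 - m y) * \<zeta>) |y \<zeta>. y \<in> N \<and> \<zeta> ^ n = 1}"
  have E12: "(y, v) \<in> E1 \<longleftrightarrow> (y, v) \<in> E2" if y: "y \<in> N \<inter> U" for y v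
  proof
    assume "(y, v) \<in> E1"
    then obtain w where w: "w ^ n = e y" "v = (of_real (m y) * w, B y * w)" by (auto simp: E1_def)
    have "(w / g y) ^ n = 1" using w(1) g(2) [OF y] e(2) [of y] y by (auto simp: power_divide)
    moreover have "v = (A y * (w / g y), of_real (1 - m y) * (w / g y))"
      using y g0 [OF y] w(2) by (simp add: A_def B_def)
    moreover have "y \<in> N" using y by simp
    ultimately show "(y, v) \<in> E2" unfolding E2_def by blast
  next
    assume "(y, v) \<in> E2"
    then obtain \<zeta> where \<zeta>: "\<zeta> ^ n = 1" "v = (A y * \<zeta>, of_real (1 - m y) * \<zeta>)" by (auto simp: E2_def)
    have "(\<zeta> * g y) ^ n = e y" using \<zeta>(1) g(2) [OF y] by (simp add: power_mult_distrib)
    moreover have "v = (of_real (m y) * (\<zeta> * g y), B y * (\<zeta> * g y))"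
      using y g0 [OF y] \<zeta>(2) by (simp add: A_def B_def)
    moreover have "y \<in> U" using y by simp
    ultimately show "(y, v) \<in> E1" unfolding E1_def by blast
  qed
  have B0: "m y \<noteq> 0 \<or> B y \<noteq> 0" if "y \<in> U" for y
    using that m(3) [of y] g0 [of y] by (auto simp: B_def)
  have cov: "covering_space (E1 \<union> E2) fst W"
  proof (rule covering_space_of_local_sections [OF n])
    show "y \<in> W" if "(y, v) \<in> E1 \<union> E2" for y v using that by (auto simp: E1_def E2_def W_def)
    fix y0 assume "y0 \<in> W"
    then consider "y0 \<in> N" | "y0 \<in> U" by (auto simp: W_def)
    then show "\<exists>T s. open T \<and> y0 \<in> T \<and> T \<subseteq> W \<and> continuous_on T s \<and>
      (\<forall>y\<in>T. s y \<noteq> 0 \<and> (\<forall>v. (y, v) \<in> E1 \<union> E2 \<longleftrightarrow> (\<exists>\<zeta>. \<zeta> ^ n = 1 \<and> v = (\<zeta> * fst (s y), \<zeta> * snd (s y)))))"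
    proof cases
      case 1
      show ?thesis
      proof (rule exI [of _ N], rule exI [of _ "\<lambda>y. (A y, of_real (1 - m y))"], intro conjI ballI allI)
        show "continuous_on N (\<lambda>y. (A y, complex_of_real (1 - m y)))"
          by (intro continuous_intros contA continuous_on_subset [OF m(1)]) (auto simp: W_def)
        fix y assume y: "y \<in> N"
        show "(A y, complex_of_real (1 - m y)) \<noteq> 0"
          using m(2) [of y] g0 [of y] y by (auto simp: A_def zero_prod_def)
        show "(y, v) \<in> E1 \<union> E2 \<longleftrightarrow> (\<exists>\<zeta>. \<zeta> ^ n = 1 \<and> v = (\<zeta> * fst (A y, complex_of_real (1 - m y)), \<zeta> * snd (A y, complex_of_real (1 - m y))))" for v
        proof -
          have "(y, v) \<in> E1 \<union> E2 \<longleftrightarrow> (y, v) \<in> E2"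
          proof (cases "y \<in> U")
            case True then show ?thesis using E12 y by auto
          next
            case False then show ?thesis by (auto simp: E1_def)
          qed
          also have "\<dots> \<longleftrightarrow> (\<exists>\<zeta>. \<zeta> ^ n = 1 \<and> v = (A y * \<zeta>, of_real (1 - m y) * \<zeta>))"
            using y by (auto simp: E2_def)
          finally show ?thesis by (simp add: mult.commute)
        qed
      qed (use N 1 in \<open>auto simp: W_def\<close>)
    next
      case 2
      then obtain r where r: "r > 0" "ball y0 r \<subseteq> U" using U openE by blast
      have "continuous_on (ball y0 r) e" by (rule continuous_on_subset [OF e(1) r(2)])
      moreover have "e y \<noteq> 0" if "y \<in> ball y0 r" for y using e(2) [of y] r that by auto
      ultimately obtain h where h: "continuous_on (ball y0 r) h" "\<And>y. y \<in> ball y0 r \<Longrightarrow> e y = exp (h y)"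
        using continuous_logarithm_on_contractible [of "ball y0 r" e] convex_imp_contractible [OF convex_ball] by metis
      define \<rho> where "\<rho> y = exp (h y / of_nat n)" for y
      have \<rho>n: "\<rho> y ^ n = e y" if "y \<in> ball y0 r" for y
        using h(2) [OF that] n by (simp add: \<rho>_def flip: exp_of_nat_mult)
      have \<rho>0: "\<rho> y \<noteq> 0" for y by (simp add: \<rho>_def)
      show ?thesis
      proof (rule exI [of _ "ball y0 r"], rule exI [of _ "\<lambda>y. (of_real (m y) * \<rho> y, B y * \<rho> y)"], intro conjI ballI allI)
        show "continuous_on (ball y0 r) (\<lambda>y. (complex_of_real (m y) * \<rho> y, B y * \<rho> y))"
          unfolding \<rho>_def
          by (intro continuous_intros h(1) continuous_on_subset [OF m(1)] continuous_on_subset [OF contB])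
             (use r n in \<open>auto simp: W_def\<close>)
        fix y assume y: "y \<in> ball y0 r"
        then have yU: "y \<in> U" using r by auto
        show "(complex_of_real (m y) * \<rho> y, B y * \<rho> y) \<noteq> 0"
          using B0 [OF yU] \<rho>0 by (auto simp: zero_prod_def)
        show "(y, v) \<in> E1 \<union> E2 \<longleftrightarrow> (\<exists>\<zeta>. \<zeta> ^ n = 1 \<and> v = (\<zeta> * fst (complex_of_real (m y) * \<rho> y, B y * \<rho> y), \<zeta> * snd (complex_of_real (m y) * \<rho> y, B y * \<rho> y)))" for v
        proof -
          have "(y, v) \<in> E1 \<union> E2 \<longleftrightarrow> (y, v) \<in> E1"
          proof (cases "y \<in> N")
            case True then show ?thesis using E12 yU by auto
          next
            case False then show ?thesis by (auto simp: E2_def)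
          qed
          also have "\<dots> \<longleftrightarrow> (\<exists>w. w ^ n = e y \<and> v = (of_real (m y) * w, B y * w))"
            using yU by (auto simp: E1_def)
          also have "\<dots> \<longleftrightarrow> (\<exists>\<zeta>. \<zeta> ^ n = 1 \<and> v = (\<zeta> * (complex_of_real (m y) * \<rho> y), \<zeta> * (B y * \<rho> y)))"
          proof
            assume "\<exists>w. w ^ n = e y \<and> v = (of_real (m y) * w, B y * w)"
            then obtain w where w: "w ^ n = e y" "v = (of_real (m y) * w, B y * w)" by blast
            have "e y \<noteq> 0" using e(2) [OF yU] by auto
            then have "(w / \<rho> y) ^ n = 1" using w(1) \<rho>n [OF y] by (simp add: power_divide)
            then show "\<exists>\<zeta>. \<zeta> ^ n = 1 \<and> v = (\<zeta> * (complex_of_real (m y) * \<rho> y), \<zeta> * (B y * \<rho> y))"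
              using w(2) \<rho>0 [of y] by (intro exI [of _ "w / \<rho> y"]) simp
          next
            assume "\<exists>\<zeta>. \<zeta> ^ n = 1 \<and> v = (\<zeta> * (complex_of_real (m y) * \<rho> y), \<zeta> * (B y * \<rho> y))"
            then obtain \<zeta> where "\<zeta> ^ n = 1" "v = (\<zeta> * (complex_of_real (m y) * \<rho> y), \<zeta> * (B y * \<rho> y))" by blast
            then show "\<exists>w. w ^ n = e y \<and> v = (of_real (m y) * w, B y * w)"
              using \<rho>n [OF y] by (intro exI [of _ "\<zeta> * \<rho> y"]) (simp add: power_mult_distrib mult_ac)
          qed
          finally show ?thesis by simp
        qed
      qed (use r in \<open>auto simp: W_def\<close>)
    qed
  qed
  have kx: "k 0 = x" "k 1 = x"
    using homotopic_paths_imp_pathstart [OF hom] homotopic_paths_imp_pathfinish [OF hom]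
    by (auto simp: pathstart_def pathfinish_def linepath_def)
  have kU: "k t \<in> U" if "t \<in> {0..1}" for t using k(2) that by (auto simp: path_image_def)
  \<comment> \<open>\<open>w\<close> follows the roots of \<open>e\<close> along \<open>k\<close>
    and so gives an explicit lift of \<open>k\<close>.\<close>
  define w where "w t = cis (2 * pi * \<omega> t / of_nat n)" for t
  have wn: "w t ^ n = e (k t)" if "t \<in> {0..1}" for t
    using \<omega>(2) [OF that] n by (simp add: w_def Complex.DeMoivre)
  have contw: "continuous_on {0..1} w"
    unfolding w_def cis_conv_exp by (intro continuous_intros \<omega>(1)) (use n in auto)
  define h1 where "h1 t = (k t, of_real (m (k t)) * w t, B (k t) * w t)" for t
  have contk: "continuous_on {0..1} k" using k(1) by (simp add: path_def)
  have "path h1"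
    unfolding path_def h1_def [abs_def]
    by (intro continuous_intros contk contw continuous_on_compose2 [OF contB] continuous_on_compose2 [OF m(1)])
       (use kU in \<open>auto simp: W_def\<close>)
  have h1E: "h1 t \<in> E1 \<union> E2" if "t \<in> {0..1}" for t
    using kU [OF that] wn [OF that] by (auto simp: h1_def E1_def)
  \<comment> \<open>A loop homotopic to a constant lifts to a loop, so \<open>w\<close> returns to
    its initial value, and the total angle divided by \<open>n\<close> is an integer.\<close>
  have "pathfinish h1 = pathfinish (linepath (h1 0) (h1 0))"
  proof (rule covering_space_monodromy [OF cov k(1) _ _ _ hom [folded W_def] \<open>path h1\<close>])
    show "path_image k \<subseteq> W" using k(2) by (auto simp: W_def)
    show "path (linepath x x)" "path (linepath (h1 0) (h1 0))" by auto
    show "path_image (linepath x x) \<subseteq> W" using kx kU [of 0] by (auto simp: W_def)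
    show "path_image h1 \<subseteq> E1 \<union> E2" unfolding path_image_def by (rule image_subsetI) (rule h1E)
    show "path_image (linepath (h1 0) (h1 0)) \<subseteq> E1 \<union> E2" using h1E [of 0] by simp
    show "fst (h1 t) = k t" for t by (simp add: h1_def)
    show "fst (linepath (h1 0) (h1 0) t) = linepath x x t" for t
      using kx by (simp add: linepath_def h1_def algebra_simps flip: scaleR_left_distrib)
    show "pathstart h1 = pathstart (linepath (h1 0) (h1 0))" by (simp add: pathstart_def)
  qed
  then have "h1 1 = h1 0" by (simp add: pathfinish_def)
  then have "w 1 = w 0"
    using B0 [of x] kU [of 0] kx by (auto simp: h1_def)
  then have "cis (2 * pi * \<omega> 1 / of_nat n - 2 * pi * \<omega> 0 / of_nat n) = 1"
    by (simp add: w_def flip: cis_divide)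
  then have "cos (2 * pi * \<omega> 1 / of_nat n - 2 * pi * \<omega> 0 / of_nat n) = 1"
    by (metis cis.sel(1) one_complex.sel(1))
  then obtain j :: int where "2 * pi * \<omega> 1 / of_nat n - 2 * pi * \<omega> 0 / of_nat n = of_int j * 2 * pi"
    using cos_one_2pi_int by blast
  then have "2 * pi * ((\<omega> 1 - \<omega> 0) / of_nat n) = 2 * pi * of_int j"
    by (simp add: diff_divide_distrib right_diff_distrib)
  then have "(\<omega> 1 - \<omega> 0) / of_nat n = of_int j" by (rule mult_left_cancel [THEN iffD1, rotated]) simp
  then show ?thesis using n by (intro exI [of _ j]) (simp add: field_simps)
qed

section \<open>Unknotting inside a tube\<close>

context tube
begin

text \<open>A bijection of the cylinder that commutes with the period shift descends to the tube.
  Being the identity on the boundary, it extends to a homeomorphism of space with compact support,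
  to which Alexander's trick applies.\<close>

lemma tube_homeomorphism:
  fixes M :: "real \<times> complex \<Rightarrow> real \<times> complex"
  assumes r: "0 < r" "r \<le> \<delta>"
    and M: "continuous_on (UNIV \<times> cball 0 r) M" "bij_betw M (UNIV \<times> cball 0 r) (UNIV \<times> cball 0 r)"
      "\<And>x z. M (x + 1, z) = M (x, z) + (1, 0)" "\<And>x z. cmod z = r \<Longrightarrow> M (x, z) = (x, z)"
    and A: "A = {\<tau> (a \<theta>) (b \<theta>) |\<theta>. \<theta> \<in> I}" "\<And>\<theta>. \<theta> \<in> I \<Longrightarrow> cmod (b \<theta>) \<le> r"
  shows "ambient_isotopic A {\<tau> (fst (M (a \<theta>, b \<theta>))) (snd (M (a \<theta>, b \<theta>))) |\<theta>. \<theta> \<in> I}"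
proof -
  define m where "m p = \<tau> (fst (M p)) (snd (M p))" for p
  define F where "F y = (if y \<in> V r then m (tx y, tz y) else y)" for y
  have Mcb: "cmod (snd (M (x, z))) \<le> r" if "cmod z \<le> r" for x z
  proof -
    have "M (x, z) \<in> UNIV \<times> cball 0 r" using bij_betwE [OF M(2)] that by auto
    then show ?thesis by (auto simp: mem_Times_iff)
  qed
  have shift: "M (x + of_int k, z) = M (x, z) + (of_int k, 0)" for x z k
    using periodic_shift_int [of "\<lambda>x. M (x, z) - (x, 0)" x k] by (simp add: M(3) prod_eq_iff)
  have m_per: "m (x + 1, z) = m (x, z)" for x z
    using \<tau>_per [of _ 1] by (simp add: m_def M(3))
  have F\<tau>: "F (\<tau> x z) = m (x, z)" if z: "cmod z \<le> r" for x z
  proof -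
    have "\<tau> x z \<in> V r" using z by (auto simp: V_def)
    moreover have "tz (\<tau> x z) = z" using z r by (simp add: tz_\<tau>)
    moreover have "m (tx (\<tau> x z), z) = m (x, z)"
      by (rule periodic_tx [of "\<lambda>x. m (x, z)"]) (use m_per z r in auto)
    ultimately show ?thesis by (simp add: F_def)
  qed
  have FV: "F y \<in> V r" if "y \<in> V r" for y
    using that F\<tau> Mcb by (fastforce simp: V_def m_def)
  have "continuous_on (V r) F"
  proof (rule continuous_on_V)
    have "continuous_on ({0..1} \<times> cball 0 r) (\<lambda>p. (\<lambda>(x, z). \<tau> x z) (M p))"
      by (rule continuous_on_compose2 [OF continuous_\<tau> [of UNIV] continuous_on_subset [OF M(1)]]) auto
    then have "continuous_on ({0..1} \<times> cball 0 r) m"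
      by (simp add: m_def [abs_def] case_prod_unfold)
    then show "continuous_on ({0..1} \<times> cball 0 r) (\<lambda>(x, z). F (\<tau> x z))"
      by (rule continuous_on_eq) (auto simp: F\<tau>)
  qed
  moreover have "continuous_on (- V' r) F"
  proof (rule continuous_on_eq [OF continuous_on_id])
    fix y assume y: "y \<in> - V' r"
    show "y = F y"
    proof (cases "y \<in> V r")
      case True
      then obtain x z where xz: "y = \<tau> x z" "cmod z \<le> r" by (auto simp: V_def)
      then have "cmod z = r" using y by (force simp: V'_def)
      then show ?thesis using xz F\<tau> [of z x] M(4) [of z x] by (simp add: m_def)
    qed (simp add: F_def)
  qed
  ultimately have "continuous_on (V r \<union> - V' r) F"
    using compact_V open_V' [OF r(2)] by (intro continuous_on_closed_Un) (auto intro: compact_imp_closed)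
  moreover have "V r \<union> - V' r = UNIV" using V'_sub by auto
  ultimately have contF: "continuous_on UNIV F" by simp
  have injV: "y = w" if yw: "y \<in> V r" "w \<in> V r" "F y = F w" for y w
  proof -
    obtain x1 z1 x2 z2 where e: "y = \<tau> x1 z1" "cmod z1 \<le> r" "w = \<tau> x2 z2" "cmod z2 \<le> r"
      using yw by (auto simp: V_def)
    have eq: "\<tau> (fst (M (x1, z1))) (snd (M (x1, z1))) = \<tau> (fst (M (x2, z2))) (snd (M (x2, z2)))"
      using yw(3) e F\<tau> by (simp add: m_def)
    have s: "snd (M (x2, z2)) = snd (M (x1, z1))" and "fst (M (x2, z2)) - fst (M (x1, z1)) \<in> \<int>"
      using \<tau>_inj [OF eq] Mcb [OF e(2)] Mcb [OF e(4)] r by (auto intro: order_trans)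
    then obtain k :: int where "fst (M (x2, z2)) = fst (M (x1, z1)) + of_int k"
      by (metis Ints_cases diff_add_cancel add.commute)
    then have "M (x2, z2) = M (x1 + of_int k, z1)"
      using s by (simp add: shift prod_eq_iff)
    then have "(x2, z2) = (x1 + of_int k, z1)"
      using bij_betw_imp_inj_on [OF M(2)] e by (auto dest: inj_onD)
    then show ?thesis using e \<tau>_per by simp
  qed
  have "inj F"
  proof (rule injI)
    fix y w assume "F y = F w"
    then show "y = w" using injV [of y w] FV [of y] FV [of w] by (metis F_def)
  qed
  moreover have "surj F"
  proof -
    have "y \<in> range F" for y
    proof (cases "y \<in> V r")
      case True
      then obtain x z where xz: "y = \<tau> x z" "cmod z \<le> r" by (auto simp: V_def)
      then have "(x, z) \<in> M ` (UNIV \<times> cball 0 r)" using bij_betw_imp_surj_on [OF M(2)] by simp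
      then obtain x' z' where p: "cmod z' \<le> r" "M (x', z') = (x, z)" by auto
      then have "F (\<tau> x' z') = y" using xz by (simp add: F\<tau> m_def)
      then show ?thesis by blast
    next
      case False
      then have "F y = y" by (simp add: F_def)
      then show ?thesis by (metis rangeI)
    qed
    then show ?thesis by auto
  qed
  ultimately obtain G where hom: "homeomorphism UNIV UNIV F G"
    using invariance_of_domain_homeomorphism [OF open_UNIV contF] by auto
  obtain R where R: "\<And>y. y \<in> V r \<Longrightarrow> norm y \<le> R"
    using compact_imp_bounded [OF compact_V] unfolding bounded_iff by blast
  have "F x = x" if "norm x \<ge> max R 0 + 1" for x
    using R [of x] that by (auto simp: F_def)
  then have "ambient_isotopic A (F ` A)"
    by (intro ambient_isotopic_compact_support [OF hom, of "max R 0 + 1"]) auto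
  moreover have "F ` A = {m (a \<theta>, b \<theta>) |\<theta>. \<theta> \<in> I}"
  proof -
    have "A = (\<lambda>\<theta>. \<tau> (a \<theta>) (b \<theta>)) ` I" unfolding A(1) by blast
    then have "F ` A = (\<lambda>\<theta>. F (\<tau> (a \<theta>) (b \<theta>))) ` I" by (simp add: image_image)
    also have "\<dots> = (\<lambda>\<theta>. m (a \<theta>, b \<theta>)) ` I" by (rule image_cong) (auto simp: F\<tau> A(2))
    finally show ?thesis by blast
  qed
  ultimately show ?thesis by (simp add: m_def)
qed

text \<open>Each normal disc is deformed so that its centre goes to \<open>b x\<close> while its rim
  stays fixed. The added term has Lipschitz constant \<open>|b x| / r < 1\<close> in
  \<open>z\<close>, which gives injectivity.\<close>

lemma core_isotopic_graph:
  fixes b :: "real \<Rightarrow> complex"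
  assumes r: "0 < r" "r \<le> \<delta>"
    and b: "continuous_on UNIV b" "\<And>x. b (x + 1) = b x" "\<And>x. cmod (b x) < r"
  shows "ambient_isotopic K {\<tau> x (b x) |x. x \<in> UNIV}"
proof -
  define M where "M = (\<lambda>(x, z). (x, z + (1 - cmod z / r) *\<^sub>R b x))"
  have Mcb: "cmod (z + (1 - cmod z / r) *\<^sub>R b x) \<le> r" if "cmod z \<le> r" for x z
  proof -
    have "cmod (z + (1 - cmod z / r) *\<^sub>R b x) \<le> cmod z + (1 - cmod z / r) * cmod (b x)"
      using that r by (intro order_trans [OF norm_triangle_ineq]) simp
    also have "\<dots> \<le> cmod z + (1 - cmod z / r) * r"
      using that r b(3) [of x] by (intro add_left_mono mult_left_mono) auto
    also have "\<dots> = r" using r by (simp add: field_simps)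
    finally show ?thesis .
  qed
  have inj: "z = w" if eq: "z + (1 - cmod z / r) *\<^sub>R b x = w + (1 - cmod w / r) *\<^sub>R b x" for x z w
  proof (rule ccontr)
    assume ne: "z \<noteq> w"
    have "z - w = ((cmod z - cmod w) / r) *\<^sub>R b x"
      using eq by (simp add: diff_divide_distrib scaleR_left_diff_distrib) (simp add: algebra_simps)
    then have "cmod (z - w) = \<bar>cmod z - cmod w\<bar> / r * cmod (b x)" using r by simp
    also have "\<dots> \<le> cmod (z - w) / r * cmod (b x)"
      using r by (intro mult_right_mono divide_right_mono norm_triangle_ineq3) auto
    also have "\<dots> < cmod (z - w) / r * r"
      using r ne b(3) by (intro mult_strict_left_mono) auto
    finally show False using r by simp
  qed
  have surj: "\<exists>z. cmod z \<le> r \<and> z + (1 - cmod z / r) *\<^sub>R b x = w" if w: "cmod w \<le> r" for x w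
  proof -
    \<comment> \<open>The preimage is sought in the form \<open>w - s b x\<close> with
      \<open>s = 1 - |z| / r\<close>, so that the intermediate value theorem for \<open>s\<close>
      suffices.\<close>
    define f where "f s = cmod (w - s *\<^sub>R b x) - r * (1 - s)" for s
    have "\<exists>s\<ge>0. s \<le> 1 \<and> f s = 0"
      by (rule IVT') (use w in \<open>auto simp: f_def intro!: continuous_intros\<close>)
    then obtain s where s: "0 \<le> s" "s \<le> 1" "cmod (w - s *\<^sub>R b x) = r * (1 - s)" by (auto simp: f_def)
    have "1 - cmod (w - s *\<^sub>R b x) / r = s" using s(3) r by simp
    moreover have "cmod (w - s *\<^sub>R b x) \<le> r" using s r by (simp add: mult_left_le)
    ultimately show ?thesis by (intro exI [of _ "w - s *\<^sub>R b x"]) simp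
  qed
  have "ambient_isotopic K {\<tau> (fst (M (x, 0))) (snd (M (x, 0))) |x. x \<in> UNIV}"
  proof (rule tube_homeomorphism [OF r])
    have "continuous_on (UNIV \<times> cball 0 r) (\<lambda>p::real \<times> complex. b (fst p))"
      by (rule continuous_on_compose2 [OF b(1)]) (auto intro: continuous_intros)
    then show "continuous_on (UNIV \<times> cball 0 r) M"
      unfolding M_def case_prod_unfold using r by (intro continuous_intros) auto
    show "bij_betw M (UNIV \<times> cball 0 r) (UNIV \<times> cball 0 r)"
    proof (rule bij_betw_imageI)
      show "inj_on M (UNIV \<times> cball 0 r)"
        by (rule inj_onI) (auto simp: M_def dest: inj)
      show "M ` (UNIV \<times> cball 0 r) = UNIV \<times> cball 0 r"
      proof (intro equalityI subsetI)
        fix p assume "p \<in> M ` (UNIV \<times> cball 0 r)"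
        then show "p \<in> UNIV \<times> cball 0 r" using Mcb by (auto simp: M_def)
      next
        fix p :: "real \<times> complex" assume "p \<in> UNIV \<times> cball 0 r"
        then obtain x w where p: "p = (x, w)" "cmod w \<le> r" by auto
        obtain z where z: "cmod z \<le> r" "z + (1 - cmod z / r) *\<^sub>R b x = w" using surj [OF p(2)] by blast
        then have "p = M (x, z)" by (simp add: M_def p(1))
        then show "p \<in> M ` (UNIV \<times> cball 0 r)" using z(1) by auto
      qed
    qed
    show "M (x + 1, z) = M (x, z) + (1, 0)" for x z by (simp add: M_def b(2))
    show "cmod z = r \<Longrightarrow> M (x, z) = (x, z)" for x z using r by (simp add: M_def)
    show "K = {\<tau> x 0 |x. x \<in> UNIV}" by (auto simp: K_def \<tau>_def N_simps)
  qed (use r in auto)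
  then show ?thesis by (simp add: M_def)
qed

text \<open>The tube slides along the core by an amount that depends on the distance to the core and
  vanishes at the boundary.\<close>

lemma isotopic_shear:
  fixes \<sigma> :: "real \<Rightarrow> real" and b :: "real \<Rightarrow> complex"
  assumes r: "0 < r" "r \<le> \<delta>" and \<sigma>: "continuous_on {0..r} \<sigma>" "\<sigma> r = 0"
    and b: "\<And>\<theta>. \<theta> \<in> I \<Longrightarrow> cmod (b \<theta>) \<le> r"
  shows "ambient_isotopic {\<tau> (a \<theta>) (b \<theta>) |\<theta>. \<theta> \<in> I} {\<tau> (a \<theta> + \<sigma> (cmod (b \<theta>))) (b \<theta>) |\<theta>. \<theta> \<in> I}"
proof -
  define M where "M = (\<lambda>(x, z). (x + \<sigma> (cmod z), z))"
  have "ambient_isotopic {\<tau> (a \<theta>) (b \<theta>) |\<theta>. \<theta> \<in> I} {\<tau> (fst (M (a \<theta>, b \<theta>))) (snd (M (a \<theta>, b \<theta>))) |\<theta>. \<theta> \<in> I}"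
  proof (rule tube_homeomorphism [OF r])
    have "continuous_on (UNIV \<times> cball 0 r) (\<lambda>p::real \<times> complex. \<sigma> (cmod (snd p)))"
      by (rule continuous_on_compose2 [OF \<sigma>(1)]) (auto intro!: continuous_intros)
    then show "continuous_on (UNIV \<times> cball 0 r) M"
      unfolding M_def case_prod_unfold by (intro continuous_intros)
    show "bij_betw M (UNIV \<times> cball 0 r) (UNIV \<times> cball 0 r)"
      by (rule bij_betw_byWitness [of _ "\<lambda>(x, z). (x - \<sigma> (cmod z), z)"]) (auto simp: M_def)
    show "cmod z = r \<Longrightarrow> M (x, z) = (x, z)" for x z using \<sigma>(2) by (simp add: M_def)
  qed (use b in \<open>auto simp: M_def\<close>)
  then show ?thesis by (simp add: M_def)
qed

text \<open>The map multiplies the ratio \<open>t / (1 - t)\<close>, where \<open>t = \<bar>z\<bar> / r\<close>, by \<open>exp (- l)\<close>, so it is inverted by changing the sign of \<open>l\<close>.\<close>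

lemma isotopic_radial:
  fixes l :: "complex \<times> complex \<Rightarrow> real" and b :: "real \<Rightarrow> complex"
  assumes r: "0 < r" "r \<le> \<delta>" and l: "continuous_on UNIV l" "\<And>p. \<bar>l p\<bar> \<le> B"
    and b: "\<And>\<theta>. \<theta> \<in> I \<Longrightarrow> cmod (b \<theta>) \<le> r"
  shows "ambient_isotopic {\<tau> (a \<theta>) (b \<theta>) |\<theta>. \<theta> \<in> I}
    {\<tau> (a \<theta>) ((1 / (cmod (b \<theta>) / r + exp (l (cis (2 * pi * a \<theta>), sgn (b \<theta>))) * (1 - cmod (b \<theta>) / r))) *\<^sub>R b \<theta>) |\<theta>. \<theta> \<in> I}"
proof -
  define T where "T = (UNIV :: real set) \<times> cball (0::complex) r"
  define d where "d \<mu> z = cmod z / r + \<mu> * (1 - cmod z / r)" for \<mu> z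
  \<comment> \<open>The parameter \<open>s\<close> takes the values 1 and -1, so that the map and
    its inverse are treated together.\<close>
  define M where "M s = (\<lambda>(x, z). (x, (1 / d (exp (s * l (cis (2 * pi * x), sgn z))) z) *\<^sub>R z))" for s
  have dlow: "exp (- B) \<le> d (exp (s * l p)) z" if "cmod z \<le> r" "\<bar>s\<bar> = 1" for s p z
  proof -
    have "0 \<le> B" using l(2) [of p] abs_ge_zero [of "l p"] by linarith
    have "\<bar>s * l p\<bar> \<le> B" using l(2) [of p] that(2) by (simp add: abs_mult)
    then have "exp (- B) \<le> exp (s * l p)" "exp (-B) \<le> 1" using \<open>0 \<le> B\<close> by auto
    moreover have "0 \<le> cmod z / r" "0 \<le> 1 - cmod z / r" using that r by auto
    ultimately have "exp (-B) * (cmod z / r) + exp (-B) * (1 - cmod z / r) \<le> d (exp (s * l p)) z"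
      unfolding d_def by (intro add_mono mult_right_mono mult_left_le_one_le) auto
    then show ?thesis by (simp add: algebra_simps)
  qed
  have dpos: "0 < d (exp (s * l p)) z" if "cmod z \<le> r" "\<bar>s\<bar> = 1" for s p z
    using dlow [OF that] exp_gt_zero less_le_trans by blast
  have cb: "cmod ((1 / d (exp (s * l p)) z) *\<^sub>R z) \<le> r" if "cmod z \<le> r" "\<bar>s\<bar> = 1" for s p z
  proof -
    have "cmod z / r \<le> d (exp (s * l p)) z" using that r by (simp add: d_def)
    then show ?thesis using dpos [OF that, of p] r by (simp add: divide_simps mult.commute)
  qed
  have inv: "M (- s) (M s (x, z)) = (x, z)" if "cmod z \<le> r" "\<bar>s\<bar> = 1" for s x z
  proof (cases "z = 0")
    case False
    define p where "p = (cis (2 * pi * x), sgn z)"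
    define \<mu> where "\<mu> = exp (s * l p)"
    have e: "exp (- s * l p) = 1 / \<mu>" "\<mu> > 0" by (simp_all add: \<mu>_def exp_minus field_simps)
    have D: "d \<mu> z > 0" using dpos [OF that] by (simp add: \<mu>_def)
    define w where "w = (1 / d \<mu> z) *\<^sub>R z"
    have "sgn w = sgn z" using D by (simp add: w_def sgn_scaleR)
    have cw: "cmod w = cmod z / d \<mu> z" using D by (simp add: w_def)
    have rd: "r * d \<mu> z = cmod z + \<mu> * (r - cmod z)" using r by (simp add: d_def field_simps)
    have "d (1 / \<mu>) w * d \<mu> z = 1"
    proof -
      define q where "q = cmod z / d \<mu> z / r"
      have q: "q * d \<mu> z * r = cmod z" using D r by (simp add: q_def)
      have "d (1 / \<mu>) w * d \<mu> z * r = q * d \<mu> z * r + (1 / \<mu>) * (r * d \<mu> z - q * d \<mu> z * r)"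
      proof -
        have "(q + i * (1 - q)) * d \<mu> z * r = q * d \<mu> z * r + i * (r * d \<mu> z - q * d \<mu> z * r)" for i
          by (simp add: algebra_simps)
        then show ?thesis unfolding d_def [of "1 / \<mu>"] cw q_def [symmetric] .
      qed
      then have "d (1 / \<mu>) w * d \<mu> z * r = cmod z + (1 / \<mu>) * (r * d \<mu> z - cmod z)" by (simp only: q)
      also have "cmod z + (1 / \<mu>) * (r * d \<mu> z - cmod z) = r" unfolding rd using e by simp
      finally show ?thesis using r by simp
    qed
    then have "(1 / d (1 / \<mu>) w) *\<^sub>R w = z" using D by (simp add: w_def field_simps)
    moreover have "M s (x, z) = (x, w)" by (simp add: M_def w_def \<mu>_def p_def)
    moreover have "M (- s) (x, w) = (x, (1 / d (1 / \<mu>) w) *\<^sub>R w)"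
      unfolding M_def using e(1) \<open>sgn w = sgn z\<close> by (simp add: p_def)
    ultimately show ?thesis by simp
  qed (simp add: M_def)
  have MT: "M s p \<in> T" if "p \<in> T" "\<bar>s\<bar> = 1" for s p
    using that cb by (auto simp: M_def T_def)
  have bij: "bij_betw (M 1) T T"
  proof (rule bij_betw_byWitness [of _ "M (- 1)"])
    show "\<forall>p\<in>T. M (- 1) (M 1 p) = p" using inv [where s = 1] by (auto simp: T_def)
    show "\<forall>p\<in>T. M 1 (M (- 1) p) = p" using inv [where s = "-1"] by (auto simp: T_def)
  qed (use MT in auto)
  have cont: "continuous_on T (M 1)"
    unfolding continuous_on_eq_continuous_within
  proof
    fix p assume p: "p \<in> T"
    obtain x0 z0 where p0: "p = (x0, z0)" by fastforce
    let ?k = "\<lambda>p::real \<times> complex. 1 / d (exp (1 * l (cis (2 * pi * fst p), sgn (snd p)))) (snd p)"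
    have "((\<lambda>p. ?k p *\<^sub>R snd p) \<longlongrightarrow> ?k p *\<^sub>R snd p) (at p within T)"
    proof (cases "z0 = 0")
      \<comment> \<open>At the core the direction \<open>sgn z\<close> is discontinuous, but the
        factor stays below \<open>exp B\<close> while \<open>z\<close> tends to 0.\<close>
      case True
      have "((\<lambda>p. ?k p *\<^sub>R snd p) \<longlongrightarrow> 0) (at p within T)"
      proof (rule Lim_null_comparison)
        show "((\<lambda>p. exp B * cmod (snd p)) \<longlongrightarrow> 0) (at p within T)"
          by (rule tendsto_eq_intros | simp add: p0 True)+
        show "\<forall>\<^sub>F p in at p within T. norm (?k p *\<^sub>R snd p) \<le> exp B * cmod (snd p)"
        proof (rule eventually_at_topological [THEN iffD2], intro exI [of _ UNIV] conjI ballI impI)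
          fix p' assume "p' \<in> T"
          then have z: "cmod (snd p') \<le> r" by (auto simp: T_def)
          have "?k p' \<le> exp B"
            using dlow [OF z, of 1 "(cis (2 * pi * fst p'), sgn (snd p'))"] dpos [OF z, of 1 "(cis (2 * pi * fst p'), sgn (snd p'))"]
            by (simp add: exp_minus field_simps)
          then show "norm (?k p' *\<^sub>R snd p') \<le> exp B * cmod (snd p')"
            using dpos [OF z, of 1 "(cis (2 * pi * fst p'), sgn (snd p'))"] unfolding norm_scaleR by (intro mult_right_mono) auto
        qed auto
      qed
      then show ?thesis by (simp add: p0 True)
    next
      case False
      have "continuous (at p within T) (\<lambda>p. (cis (2 * pi * fst p), sgn (snd p)))"
        unfolding cis_conv_exp by (intro continuous_intros) (simp add: p0 False)
      then have "continuous (at p within T) (\<lambda>p. l (cis (2 * pi * fst p), sgn (snd p)))"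
        by (rule continuous_within_compose3 [rotated]) (use l(1) in \<open>simp add: continuous_on_eq_continuous_at\<close>)
      moreover have "d (exp (1 * l (cis (2 * pi * fst p), sgn (snd p)))) (snd p) \<noteq> 0"
        using dpos [of z0 1 "(cis (2 * pi * x0), sgn z0)"] p by (simp add: p0 T_def)
      ultimately have "continuous (at p within T) (\<lambda>p. ?k p *\<^sub>R snd p)"
        unfolding d_def using r by (intro continuous_intros) auto
      then show ?thesis by (simp add: continuous_within)
    qed
    then show "continuous (at p within T) (M 1)"
      unfolding M_def case_prod_unfold continuous_within
      by (rule tendsto_Pair [OF tendsto_fst [OF tendsto_ident_at]])
  qed
  have "ambient_isotopic {\<tau> (a \<theta>) (b \<theta>) |\<theta>. \<theta> \<in> I} {\<tau> (fst (M 1 (a \<theta>, b \<theta>))) (snd (M 1 (a \<theta>, b \<theta>))) |\<theta>. \<theta> \<in> I}"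
  proof (rule tube_homeomorphism [OF r cont [unfolded T_def] bij [unfolded T_def]])
    show "M 1 (x + 1, z) = M 1 (x, z) + (1, 0)" for x z
      by (simp add: M_def distrib_left flip: cis_mult)
    show "cmod z = r \<Longrightarrow> M 1 (x, z) = (x, z)" for x z
      using r by (simp add: M_def d_def)
  qed (use b in auto)
  then show ?thesis by (simp add: M_def d_def)
qed

text \<open>A radial rescaling first makes the distance to the core proportional to \<open>exp (a \<theta> - \<theta>)\<close>. A shear depending on this
  distance then turns \<open>a\<close> into a translation, and what remains is a graph over the core.\<close>

lemma core_isotopic_torus_curve:
  fixes a :: "real \<Rightarrow> real" and b :: "real \<Rightarrow> complex"
  assumes r: "0 < r" "r \<le> \<delta>"
    and a: "continuous_on UNIV a" "\<And>\<theta>. a (\<theta> + 1) = a \<theta> + 1"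
    and b: "continuous_on UNIV b" "\<And>\<theta>. b (\<theta> + 1) = b \<theta>" "\<And>\<theta>. b \<theta> \<noteq> 0" "\<And>\<theta>. cmod (b \<theta>) < r"
    and inj: "\<And>\<theta> \<eta>. a \<theta> - a \<eta> \<in> \<int> \<Longrightarrow> sgn (b \<theta>) = sgn (b \<eta>) \<Longrightarrow> \<theta> - \<eta> \<in> \<int>"
  shows "ambient_isotopic K {\<tau> (a \<theta>) (b \<theta>) |\<theta>. \<theta> \<in> UNIV}"
proof -
  have "bounded ((\<lambda>\<theta>. a \<theta> - \<theta>) ` {0..1})"
    by (intro compact_imp_bounded compact_continuous_image continuous_intros continuous_on_subset [OF a(1)]) auto
  then obtain D where D0: "\<forall>\<theta>\<in>{0..1}. \<bar>a \<theta> - \<theta>\<bar> \<le> D" unfolding bounded_iff by auto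
  have frac: "f \<theta> = f (frac \<theta>)" if "\<And>\<theta>. f (\<theta> + 1) = f \<theta>" for f :: "real \<Rightarrow> 'z" and \<theta>
    using periodic_shift_int [of f "frac \<theta>" "\<lfloor>\<theta>\<rfloor>"] that by (simp add: frac_def)
  have frac01: "frac \<theta> \<in> {0..1}" for \<theta> :: real
    using frac_ge_0 [of \<theta>] frac_lt_1 [of \<theta>] by simp
  have D: "\<bar>a \<theta> - \<theta>\<bar> \<le> D" for \<theta>
    using frac [of "\<lambda>\<theta>. a \<theta> - \<theta>" \<theta>] bspec [OF D0 frac01 [of \<theta>]] a(2) by simp
  \<comment> \<open>This choice puts \<open>s \<theta>\<close> between
    \<open>exp (- 2 * D - 1)\<close> and \<open>exp (- 1)\<close>, hence inside the open unit
    interval.\<close>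
  define S where "S = D + 1"
  define t where "t \<theta> = cmod (b \<theta>) / r" for \<theta>
  define s where "s \<theta> = exp (a \<theta> - \<theta> - S)" for \<theta>
  have t: "0 < t \<theta>" "t \<theta> < 1" for \<theta> using b(3,4) r by (auto simp: t_def)
  have s: "0 < s \<theta>" "s \<theta> < 1" "exp (- 2 * D - 1) \<le> s \<theta>" for \<theta>
    using D [of \<theta>] by (auto simp: s_def S_def abs_le_iff)
  \<comment> \<open>The logarithm of the quotient of \<open>t / (1 - t)\<close> by
    \<open>s / (1 - s)\<close>, so that the radial map turns the relative distance \<open>t\<close>
    into \<open>s\<close>.\<close>
  define lm where "lm \<theta> = ln (t \<theta> * (1 - s \<theta>) / (s \<theta> * (1 - t \<theta>)))" for \<theta>
  have expl: "exp (lm \<theta>) = t \<theta> * (1 - s \<theta>) / (s \<theta> * (1 - t \<theta>))" for \<theta>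
    using s [of \<theta>] t [of \<theta>] unfolding lm_def by (intro exp_ln divide_pos_pos mult_pos_pos) auto
  define p where "p \<theta> = (cis (2 * pi * a \<theta>), sgn (b \<theta>))" for \<theta>
  have lm_per: "lm (\<theta> + 1) = lm \<theta>" for \<theta> by (simp add: lm_def t_def s_def a b)
  have p_per: "p (\<theta> + 1) = p \<theta>" for \<theta>
    by (simp add: p_def a b distrib_left flip: cis_mult)
  have p_inj: "lm \<theta> = lm \<eta>" if "p \<theta> = p \<eta>" for \<theta> \<eta>
  proof -
    have "cis (2 * pi * a \<theta> - 2 * pi * a \<eta>) = 1" using that by (simp add: p_def flip: cis_divide)
    then have "cos (2 * pi * a \<theta> - 2 * pi * a \<eta>) = 1" by (metis cis.sel(1) one_complex.sel(1))
    then obtain k :: int where "2 * pi * a \<theta> - 2 * pi * a \<eta> = of_int k * 2 * pi" using cos_one_2pi_int by blast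
    then have "2 * pi * (a \<theta> - a \<eta>) = 2 * pi * of_int k" by (simp add: algebra_simps)
    then have "a \<theta> - a \<eta> \<in> \<int>" by simp
    then have "\<theta> - \<eta> \<in> \<int>" using inj that by (simp add: p_def)
    then obtain j :: int where "\<theta> = \<eta> + of_int j" by (metis Ints_cases diff_add_cancel add.commute)
    then show ?thesis using periodic_shift_int [of lm] lm_per by simp
  qed
  have contp: "continuous_on A p" for A
    unfolding p_def [abs_def] cis_conv_exp
    by (intro continuous_intros continuous_on_subset [OF a(1)] continuous_on_subset [OF b(1)]) (auto simp: b(3))
  have contlm: "continuous_on A lm" for A
    unfolding lm_def [abs_def] t_def s_def
    by (intro continuous_intros continuous_on_subset [OF a(1)] continuous_on_subset [OF b(1)])
       (use r t s in \<open>auto simp: t_def s_def less_imp_neq [symmetric] b(3)\<close>)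
  \<comment> \<open>By the injectivity assumption on the curve, \<open>lm\<close> depends only on
    the pair of angles \<open>p\<close>. As a function on pairs it is extended by Tietze's theorem,
    since the radial map acts on the whole tube.\<close>
  define f where "f y = lm (SOME \<theta>. p \<theta> = y)" for y
  have fp: "f (p \<theta>) = lm \<theta>" for \<theta>
    unfolding f_def by (rule p_inj) (rule someI [of _ \<theta>], rule refl)
  have "bounded (lm ` {0..1})" by (intro compact_imp_bounded compact_continuous_image contlm) auto
  then obtain B where B0: "\<forall>\<theta>\<in>{0..1}. \<bar>lm \<theta>\<bar> \<le> B" unfolding bounded_iff by auto
  have "0 \<le> B" using bspec [OF B0, of 0] by auto
  have "continuous_on (p ` {0..1}) f"
    by (rule continuous_on_compact_surjection [OF _ contp]) (auto simp: fp contlm)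
  moreover have "closedin (top_of_set UNIV) (p ` {0..1})"
    by (auto intro!: compact_imp_closed compact_continuous_image contp)
  ultimately obtain l where l: "continuous_on UNIV l" "\<And>y. y \<in> p ` {0..1} \<Longrightarrow> l y = f y" "\<And>y. norm (l y) \<le> B"
    by (rule Tietze [OF _ _ \<open>0 \<le> B\<close>]) (use B0 fp in auto)
  have lp: "l (p \<theta>) = lm \<theta>" for \<theta>
    using l(2) [of "p (frac \<theta>)"] frac01 [of \<theta>] frac [of p \<theta>, OF p_per] frac [of lm \<theta>, OF lm_per] fp by auto
  define b1 where "b1 \<theta> = (s \<theta> / t \<theta>) *\<^sub>R b \<theta>" for \<theta>
  have i1: "ambient_isotopic {\<tau> (a \<theta>) (b \<theta>) |\<theta>. \<theta> \<in> UNIV} {\<tau> (a \<theta>) (b1 \<theta>) |\<theta>. \<theta> \<in> UNIV}"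
  proof -
    have "1 / (cmod (b \<theta>) / r + exp (l (cis (2 * pi * a \<theta>), sgn (b \<theta>))) * (1 - cmod (b \<theta>) / r)) = s \<theta> / t \<theta>" for \<theta>
    proof -
      have "t \<theta> + exp (lm \<theta>) * (1 - t \<theta>) = t \<theta> / s \<theta>"
        using t [of \<theta>] s [of \<theta>] unfolding expl by (simp add: field_simps)
      then show ?thesis unfolding lp [unfolded p_def] t_def [symmetric] by simp
    qed
    then show ?thesis
      using isotopic_radial [OF r l(1) l(3) [unfolded real_norm_def], of UNIV b a] b(4)
      by (simp add: b1_def less_imp_le)
  qed
  have cb1: "cmod (b1 \<theta>) = r * s \<theta>" for \<theta>
    using t [of \<theta>] s [of \<theta>] r b(3) by (simp add: b1_def) (simp add: t_def)
  have cb1r: "cmod (b1 \<theta>) < r" for \<theta> using cb1 s(2) [of \<theta>] r by simp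
  \<comment> \<open>The truncation at a lower bound for the distances on the curve keeps the
    logarithm continuous at the core.\<close>
  define \<sigma> where "\<sigma> \<rho> = ln (r / max \<rho> (r * exp (- 2 * D - 1)))" for \<rho>
  have "D \<ge> 0" using D [of 0] by auto
  have i2: "ambient_isotopic {\<tau> (a \<theta>) (b1 \<theta>) |\<theta>. \<theta> \<in> UNIV} {\<tau> (a \<theta> + \<sigma> (cmod (b1 \<theta>))) (b1 \<theta>) |\<theta>. \<theta> \<in> UNIV}"
  proof (rule isotopic_shear [OF r])
    have m: "max \<rho> (r * exp (- 2 * D - 1)) > 0" for \<rho> using r by (simp add: less_max_iff_disj)
    then have "max \<rho> (r * exp (- 2 * D - 1)) \<noteq> 0" for \<rho> by (metis less_irrefl)
    then show "continuous_on {0..r} \<sigma>"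
      unfolding \<sigma>_def [abs_def] using r by (intro continuous_intros) auto
    show "\<sigma> r = 0" using r \<open>D \<ge> 0\<close> by (simp add: \<sigma>_def max_def mult_le_cancel_left1)
  qed (use cb1r in \<open>auto intro: less_imp_le\<close>)
  \<comment> \<open>The distance to the core is now
    \<open>r * exp (a \<theta> - \<theta> - S)\<close>, so the logarithm in the shear cancels
    \<open>a \<theta>\<close> and leaves \<open>\<theta> + S\<close>.\<close>
  have \<sigma>: "a \<theta> + \<sigma> (cmod (b1 \<theta>)) = \<theta> + S" for \<theta>
  proof -
    have "max (r * s \<theta>) (r * exp (- 2 * D - 1)) = r * s \<theta>"
      using s(3) [of \<theta>] r by (simp add: max_absorb1)
    then have "\<sigma> (cmod (b1 \<theta>)) = ln (1 / s \<theta>)" using r by (simp add: \<sigma>_def cb1)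
    also have "\<dots> = - (a \<theta> - \<theta> - S)" by (simp add: s_def ln_div)
    finally show ?thesis by simp
  qed
  have e: "{\<tau> (\<theta> + S) (b1 \<theta>) |\<theta>. \<theta> \<in> UNIV} = {\<tau> x (b1 (x - S)) |x. x \<in> UNIV}"
    by (auto intro: exI [of _ "_ + S"] exI [of _ "_ - S"])
  have i3: "ambient_isotopic K {\<tau> x (b1 (x - S)) |x. x \<in> UNIV}"
  proof (rule core_isotopic_graph [OF r])
    have "continuous_on UNIV b1"
      unfolding b1_def [abs_def] t_def s_def
      by (intro continuous_intros a b) (use r b(3) in auto)
    then show "continuous_on UNIV (\<lambda>x. b1 (x - S))"
      by (rule continuous_on_compose2) (auto intro!: continuous_intros)
    show "b1 (x + 1 - S) = b1 (x - S)" for x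
      using a(2) [of "x - S"] b(2) [of "x - S"] by (simp add: b1_def t_def s_def diff_add_eq)
    show "cmod (b1 (x - S)) < r" for x by (rule cb1r)
  qed
  show ?thesis
    using ambient_isotopic_trans [OF i3] ambient_isotopic_sym [OF ambient_isotopic_trans [OF i1 i2 [unfolded \<sigma> e]]]
    by blast
qed

end

section \<open>The flow near the saddle\<close>

text \<open>The images of the standard axes under an orthogonal map that carries the third axis to
  \<open>a\<close>.\<close>

lemma orthonormal_frame_exists:
  fixes a :: "real^3"
  assumes "norm a = 1"
  shows "\<exists>v1 v2. v1 \<bullet> v1 = 1 \<and> v2 \<bullet> v2 = 1 \<and> v1 \<bullet> v2 = 0 \<and> a \<bullet> v1 = 0 \<and> a \<bullet> v2 = 0 \<and>
    (\<forall>y. y = (y \<bullet> a) *\<^sub>R a + (y \<bullet> v1) *\<^sub>R v1 + (y \<bullet> v2) *\<^sub>R v2)"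
proof -
  have "norm (axis 3 1 :: real^3) = norm a" using assms by simp
  then obtain f where f: "orthogonal_transformation f" "f (axis 3 1 :: real^3) = a"
    by (rule orthogonal_transformation_exists)
  have ff: "f x \<bullet> f y = x \<bullet> y" for x y using f(1) by (simp add: orthogonal_transformation_def)
  define v1 where "v1 = f (axis 1 1)"
  define v2 where "v2 = f (axis 2 1)"
  have "y = (y \<bullet> a) *\<^sub>R a + (y \<bullet> v1) *\<^sub>R v1 + (y \<bullet> v2) *\<^sub>R v2" for y
  proof -
    obtain x where x: "y = f x" using orthogonal_transformation_surj [OF f(1)] by (metis surjD)
    have "x = x $ 3 *\<^sub>R axis 3 1 + x $ 1 *\<^sub>R axis 1 1 + x $ 2 *\<^sub>R axis 2 1"
      by (simp add: vec_eq_iff forall_3 axis_def)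
    then have "f x = f (x $ 3 *\<^sub>R axis 3 1 + x $ 1 *\<^sub>R axis 1 1 + x $ 2 *\<^sub>R axis 2 1)" by simp
    also have "\<dots> = x $ 3 *\<^sub>R a + x $ 1 *\<^sub>R v1 + x $ 2 *\<^sub>R v2"
      by (simp add: linear_add linear_scale orthogonal_transformation_linear [OF f(1)] f(2) v1_def v2_def)
    finally have "y = x $ 3 *\<^sub>R a + x $ 1 *\<^sub>R v1 + x $ 2 *\<^sub>R v2" by (simp add: x)
    moreover have "y \<bullet> a = x $ 3" "y \<bullet> v1 = x $ 1" "y \<bullet> v2 = x $ 2"
      unfolding x v1_def v2_def f(2) [symmetric] ff by (simp_all add: inner_axis)
    ultimately show ?thesis by simp
  qed
  moreover have "v1 \<bullet> v1 = 1" "v2 \<bullet> v2 = 1" "v1 \<bullet> v2 = 0" "a \<bullet> v1 = 0" "a \<bullet> v2 = 0"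
    unfolding v1_def v2_def f(2) [symmetric] ff by (simp_all add: inner_axis_axis)
  ultimately show ?thesis by blast
qed

text \<open>The linear model at the saddle is the reflection orthogonal to \<open>a\<close>, with
  eigenvalues -1, 1, 1. Its flow contracts the axis by \<open>exp (- t)\<close> and expands the
  orthogonal plane by \<open>exp t\<close>.\<close>

locale saddle_flow = charged_tube c c' n1 n2 L m \<delta> \<kappa> s + fl: flow X \<Lambda> \<phi>
  for c c' n1 n2 L m \<delta> \<kappa> s X \<Lambda> \<phi> +
  fixes p a v1 v2 :: "real^3" and B :: "real^3^3" and \<rho> R :: real
  assumes onb: "a \<bullet> a = 1" "v1 \<bullet> v1 = 1" "v2 \<bullet> v2 = 1" "a \<bullet> v1 = 0" "a \<bullet> v2 = 0" "v1 \<bullet> v2 = 0"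
    and expand: "\<And>y. y = (y \<bullet> a) *\<^sub>R a + (y \<bullet> v1) *\<^sub>R v1 + (y \<bullet> v2) *\<^sub>R v2"
    and pK: "p \<notin> K" and B: "\<And>y. B *v y = y - (2 * (a \<bullet> y)) *\<^sub>R a"
    and gl: "gradient_like {p} (\<lambda>_. B) X \<Lambda> \<rho> R"
begin

lemma \<rho>: "\<rho> > 0" and X_tube: "\<And>x z. cmod z \<le> \<delta> / 2 \<Longrightarrow> X (\<tau> x z) = - N x z"
  and X_saddle: "\<And>y. dist p y \<le> \<rho> \<Longrightarrow> X y = B *v (y - p)"
  and Xg: "\<And>y. y \<notin> K \<Longrightarrow> y \<noteq> p \<Longrightarrow> 0 < X y \<bullet> g y"
  using gl unfolding gradient_like_def by blast+

text \<open>Coordinates at the saddle: \<open>x\<close> along the stable axis, \<open>z\<close> in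
  the unstable plane.\<close>

definition Q :: "real \<Rightarrow> complex \<Rightarrow> real^3" where
  "Q x z = p + (x *\<^sub>R a + Re z *\<^sub>R v1 + Im z *\<^sub>R v2)"

lemma onb': "v1 \<bullet> a = 0" "v2 \<bullet> a = 0" "v2 \<bullet> v1 = 0"
  using onb by (simp_all add: inner_commute)

lemma Q_inner: "(Q x z - p) \<bullet> a = x" "(Q x z - p) \<bullet> v1 = Re z" "(Q x z - p) \<bullet> v2 = Im z"
  using onb onb' by (simp_all add: Q_def inner_add_left)

lemma Q_eqD: "Q x z = Q y w \<Longrightarrow> x = y \<and> z = w"
  using Q_inner [of x z] Q_inner [of y w] by (simp add: complex_eq_iff)

lemma Q_expand: "y = Q ((y - p) \<bullet> a) (Complex ((y - p) \<bullet> v1) ((y - p) \<bullet> v2))"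
  using expand [of "y - p"] by (simp add: Q_def algebra_simps)

lemma dist_Q: "(dist p (Q x z))\<^sup>2 = x\<^sup>2 + (cmod z)\<^sup>2"
proof -
  have "(dist p (Q x z))\<^sup>2 = (Q x z - p) \<bullet> (Q x z - p)"
    by (metis dist_norm dist_commute power2_norm_eq_inner)
  also have "\<dots> = x * ((Q x z - p) \<bullet> a) + Re z * ((Q x z - p) \<bullet> v1) + Im z * ((Q x z - p) \<bullet> v2)"
    by (subst (2) Q_def) (simp add: inner_add_right)
  also have "\<dots> = x\<^sup>2 + (cmod z)\<^sup>2" unfolding Q_inner cmod_power2 by (simp add: power2_eq_square)
  finally show ?thesis .
qed

lemma dist_Q_le: "\<bar>x\<bar> \<le> r / 2 \<Longrightarrow> cmod z \<le> r / 2 \<Longrightarrow> dist p (Q x z) \<le> r"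
proof -
  assume h: "\<bar>x\<bar> \<le> r / 2" "cmod z \<le> r / 2"
  then have r: "0 \<le> r" by linarith
  have "x\<^sup>2 \<le> (r / 2)\<^sup>2" using power_mono [OF h(1) abs_ge_zero, of 2] by simp
  moreover have "(cmod z)\<^sup>2 \<le> (r / 2)\<^sup>2" using h(2) by (intro power_mono) auto
  ultimately have "(dist p (Q x z))\<^sup>2 \<le> (r / 2)\<^sup>2 + (r / 2)\<^sup>2" unfolding dist_Q by linarith
  also have "\<dots> \<le> r\<^sup>2" by (simp add: power2_eq_square)
  finally show ?thesis using r by (rule power2_le_imp_le)
qed

lemma X_Q: "dist p (Q x z) \<le> \<rho> \<Longrightarrow> X (Q x z) = (- x) *\<^sub>R a + Re z *\<^sub>R v1 + Im z *\<^sub>R v2"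
proof -
  assume d: "dist p (Q x z) \<le> \<rho>"
  have "a \<bullet> (Q x z - p) = x" by (metis inner_commute Q_inner(1))
  then have "X (Q x z) = (Q x z - p) - (2 * x) *\<^sub>R a" using X_saddle [OF d] by (simp add: B)
  also have "(2 * x) *\<^sub>R a = x *\<^sub>R a + x *\<^sub>R a" by (simp flip: scaleR_left_distrib)
  also have "Q x z - p = x *\<^sub>R a + Re z *\<^sub>R v1 + Im z *\<^sub>R v2" by (simp add: Q_def)
  finally show ?thesis by simp
qed

text \<open>The explicit curve solves the equation as long as it stays in the ball where
  \<open>X\<close> is linear, and uniqueness identifies it with the orbit.\<close>

lemma flow_box:
  assumes t: "t \<ge> 0" and x: "\<bar>x\<bar> \<le> \<rho> / 2" and z: "exp t * cmod z \<le> \<rho> / 2"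
  shows "\<phi> t (Q x z) = Q (exp (- t) * x) (exp t *\<^sub>R z)"
proof -
  define u where "u t = Q (exp (- t) * x) (exp t *\<^sub>R z)" for t
  have "\<phi> t (u 0) = u t"
  proof (rule fl.flow_unique [OF _ t])
    fix s assume s: "s \<in> {0..t}"
    have "exp (- s) * \<bar>x\<bar> \<le> 1 * \<bar>x\<bar>" using s by (intro mult_right_mono) auto
    then have 1: "\<bar>exp (- s) * x\<bar> \<le> \<rho> / 2" using x by (simp add: abs_mult)
    have "exp s * cmod z \<le> exp t * cmod z" using s by (intro mult_right_mono) auto
    then have 2: "cmod (exp s *\<^sub>R z) \<le> \<rho> / 2" using z by simp
    have "X (u s) = (- (exp (- s) * x)) *\<^sub>R a + (exp s * Re z) *\<^sub>R v1 + (exp s * Im z) *\<^sub>R v2"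
      using X_Q [OF dist_Q_le [OF 1 2]] by (simp add: u_def)
    moreover have "(u has_vector_derivative (- (exp (- s) * x)) *\<^sub>R a + (exp s * Re z) *\<^sub>R v1 + (exp s * Im z) *\<^sub>R v2) (at s within {0..t})"
      unfolding u_def [abs_def] Q_def
      by (auto intro!: derivative_eq_intros simp: has_real_derivative_iff_has_vector_derivative [symmetric])
    ultimately show "(u has_vector_derivative X (u s)) (at s within {0..t})" by simp
  qed
  then show ?thesis by (simp add: u_def)
qed

text \<open>Since the coordinate along the knot is constant on the explicit solution, the end point
  of an orbit is known as soon as it has entered the tube.\<close>

lemma flow_tube:
  assumes t: "t \<ge> 0" and z: "cmod z \<le> \<delta> / 2"
  shows "\<phi> t (\<tau> x z) = \<tau> x (exp (- t) *\<^sub>R z)"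
proof -
  define u where "u t = \<tau> x (exp (- t) *\<^sub>R z)" for t
  have "\<phi> t (u 0) = u t"
  proof (rule fl.flow_unique [OF _ t])
    fix s assume s: "s \<in> {0..t}"
    have "exp (- s) * cmod z \<le> 1 * cmod z" using s by (intro mult_right_mono) auto
    then have "X (u s) = - (exp (- s) *\<^sub>R N x z)" using z X_tube [of "exp (- s) *\<^sub>R z" x] by (simp add: u_def N_simps)
    moreover have "(u has_vector_derivative - (exp (- s) *\<^sub>R N x z)) (at s within {0..t})"
      unfolding u_def [abs_def] \<tau>_def N_simps
      by (auto intro!: derivative_eq_intros simp: has_real_derivative_iff_has_vector_derivative [symmetric])
    ultimately show "(u has_vector_derivative X (u s)) (at s within {0..t})" by simp
  qed
  then show ?thesis by (simp add: u_def)
qed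

lemma flow_K: "t \<ge> 0 \<Longrightarrow> y \<in> K \<Longrightarrow> \<phi> t y = y"
  using flow_tube [of t 0] \<delta> by (auto simp: K_eq V_def)

lemma flow_notin_K: "t \<ge> 0 \<Longrightarrow> y \<notin> K \<Longrightarrow> \<phi> t y \<notin> K"
  using flow_K fl.flow_inj by metis

lemma p_notin_V: "p \<notin> V (\<delta> / 2)"
proof
  assume "p \<in> V (\<delta> / 2)"
  then obtain x z where xz: "p = \<tau> x z" "cmod z \<le> \<delta> / 2" by (auto simp: V_def)
  have "X p = 0" using X_saddle [of p] \<rho> by simp
  then have "N x z = 0" using X_tube [OF xz(2), of x] xz(1) by simp
  then have "z = 0" using norm_N [of x z] by simp
  then show False using pK xz(1) by (auto simp: K_eq V_def)
qed

lemma Xg_nonneg: "y \<notin> K \<Longrightarrow> 0 \<le> X y \<bullet> g y"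
  using Xg [of y] X_saddle [of p] \<rho> by (cases "y = p") auto

lemma closed_K: "closed K"
  unfolding K_eq by (rule compact_imp_closed [OF compact_V])

lemma G_deriv: "y \<notin> K \<Longrightarrow> (G has_derivative (\<lambda>v. g y \<bullet> v)) (at y)"
  by (rule coulomb_deriv [OF continuous_c]) (simp add: K_image)

lemma continuous_G: "continuous_on (- K) G"
proof (rule has_derivative_continuous_on)
  show "(G has_derivative (\<lambda>v. g y \<bullet> v)) (at y within - K)" if "y \<in> - K" for y
    by (rule has_derivative_at_withinI [OF G_deriv]) (use that in simp)
qed

lemma orbit_mean_value:
  assumes b: "b \<ge> 0" and y: "y \<notin> K"
  shows "\<exists>\<xi>\<in>{0..b}. G (\<phi> b y) - G y = (X (\<phi> \<xi> y) \<bullet> g (\<phi> \<xi> y)) * b"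
proof -
  have "\<exists>\<xi>\<in>{0..b}. G (\<phi> b y) - G (\<phi> 0 y) = g (\<phi> \<xi> y) \<bullet> ((b - 0) *\<^sub>R X (\<phi> \<xi> y))"
  proof (rule mvt_very_simple [OF b])
    fix x assume x: "0 \<le> x" "x \<le> b"
    have "((\<lambda>t. \<phi> t y) has_derivative (\<lambda>h. h *\<^sub>R X (\<phi> x y))) (at x within {0..b})"
      using has_vector_derivative_within_subset [OF fl.flow_deriv [OF x(1), of y], of "{0..b}"]
      by (auto simp: has_vector_derivative_def)
    moreover have "(G has_derivative (\<lambda>v. g (\<phi> x y) \<bullet> v)) (at (\<phi> x y))"
      using flow_notin_K [OF x(1) y] by (intro coulomb_deriv [OF continuous_c]) (simp add: K_image)
    ultimately show "((\<lambda>t. G (\<phi> t y)) has_derivative (\<lambda>h. g (\<phi> x y) \<bullet> (h *\<^sub>R X (\<phi> x y)))) (at x within {0..b})"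
      by (rule has_derivative_compose)
  qed
  then show ?thesis by (simp add: fl.flow_0 inner_commute mult.commute)
qed

lemma G_mono: assumes "b \<ge> 0" "y \<notin> K" shows "G y \<le> G (\<phi> b y)"
proof -
  obtain \<xi> where \<xi>: "\<xi> \<in> {0..b}" "G (\<phi> b y) - G y = (X (\<phi> \<xi> y) \<bullet> g (\<phi> \<xi> y)) * b"
    using orbit_mean_value [OF assms] by blast
  have "0 \<le> X (\<phi> \<xi> y) \<bullet> g (\<phi> \<xi> y)" using Xg_nonneg flow_notin_K [of \<xi> y] \<xi>(1) assms(2) by simp
  then have "0 \<le> (X (\<phi> \<xi> y) \<bullet> g (\<phi> \<xi> y)) * b" using assms(1) by simp
  then show ?thesis using \<xi>(2) by linarith
qed

text \<open>The basin of attraction of the knot. Entry into the tube amounts to convergence to the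
  knot because the flow contracts the tube, and in this form the set is visibly open.\<close>

definition U :: "(real^3) set" where "U = {y. \<exists>t\<ge>0. \<phi> t y \<in> V' (\<delta> / 2)}"

lemma flow_V': assumes "t \<ge> 0" "y \<in> V' (\<delta> / 2)" shows "\<phi> t y \<in> V' (\<delta> / 2)"
proof -
  obtain x z where xz: "y = \<tau> x z" "cmod z < \<delta> / 2" using assms(2) by (auto simp: V'_def)
  have "exp (- t) * cmod z \<le> 1 * cmod z" using assms(1) by (intro mult_right_mono) auto
  then show ?thesis using xz flow_tube [OF assms(1), of z x] by (force simp: V'_def)
qed

lemma U_flow: assumes "t \<ge> 0" shows "\<phi> t y \<in> U \<longleftrightarrow> y \<in> U"
proof
  assume "\<phi> t y \<in> U"
  then obtain s where "s \<ge> 0" "\<phi> s (\<phi> t y) \<in> V' (\<delta> / 2)" by (auto simp: U_def)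
  then show "y \<in> U" using assms fl.flow_add [of s t y] by (auto simp: U_def intro!: exI [of _ "s + t"])
next
  assume "y \<in> U"
  then obtain s where s: "s \<ge> 0" "\<phi> s y \<in> V' (\<delta> / 2)" by (auto simp: U_def)
  have "\<phi> s (\<phi> t y) = \<phi> t (\<phi> s y)" using fl.flow_add [of s t y] fl.flow_add [of t s y] s assms by (simp add: add.commute)
  then show "\<phi> t y \<in> U" using s flow_V' [OF assms s(2)] by (auto simp: U_def)
qed

lemma K_sub_U: "K \<subseteq> U"
  using K_sub [of "\<delta> / 2"] \<delta> flow_K [of 0] by (auto simp: U_def intro!: exI [of _ 0])

lemma open_flow_preimage: "t \<ge> 0 \<Longrightarrow> open S \<Longrightarrow> open {y. \<phi> t y \<in> S}"
  using open_vimage [OF _ fl.continuous_on_space [of t UNIV], of S] by (simp add: vimage_def)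

lemma open_U: "open U"
proof -
  have "U = (\<Union>t\<in>{0..}. {y. \<phi> t y \<in> V' (\<delta> / 2)})" by (auto simp: U_def)
  also have "open \<dots>" by (intro open_UN ballI open_flow_preimage open_V') (use \<delta> in auto)
  finally show ?thesis .
qed

text \<open>The point at which the orbit of \<open>y\<close> ends on the knot.\<close>

definition e :: "real^3 \<Rightarrow> complex" where
  "e y = cis (2 * pi * tx (\<phi> (SOME t. t \<ge> 0 \<and> \<phi> t y \<in> V' (\<delta> / 2)) y))"

lemma cis_tx: "cmod z \<le> \<delta> \<Longrightarrow> cis (2 * pi * tx (\<tau> x z)) = cis (2 * pi * x)"
  by (rule periodic_tx [of "\<lambda>x. cis (2 * pi * x)"]) (auto simp: distrib_left simp flip: cis_mult)

text \<open>After entry into the tube the angle along the knot no longer changes, so the value of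
  \<open>e\<close> is independent of the time picked in its definition.\<close>

lemma cis_tx_flow:
  assumes "0 \<le> r" "r \<le> t" "\<phi> r y \<in> V' (\<delta> / 2)"
  shows "cis (2 * pi * tx (\<phi> t y)) = cis (2 * pi * tx (\<phi> r y))"
proof -
  obtain x z where xz: "\<phi> r y = \<tau> x z" "cmod z < \<delta> / 2" using assms(3) by (auto simp: V'_def)
  have "\<phi> t y = \<tau> x (exp (- (t - r)) *\<^sub>R z)"
    using fl.flow_add [of "t - r" r y] flow_tube [of "t - r" z x] xz assms by simp
  moreover have "exp (- (t - r)) * cmod z \<le> 1 * cmod z" using assms by (intro mult_right_mono) auto
  then have "cmod (exp (- (t - r)) *\<^sub>R z) \<le> \<delta>" using xz(2) \<delta> by simp
  ultimately show ?thesis using cis_tx xz \<delta> by simp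
qed

lemma e_eq: assumes t: "t \<ge> 0" "\<phi> t y \<in> V' (\<delta> / 2)" shows "e y = cis (2 * pi * tx (\<phi> t y))"
proof -
  define s where "s = (SOME t. t \<ge> 0 \<and> \<phi> t y \<in> V' (\<delta> / 2))"
  have "s \<ge> 0 \<and> \<phi> s y \<in> V' (\<delta> / 2)" unfolding s_def by (rule someI [of _ t]) (use t in simp)
  then show ?thesis
    using cis_tx_flow [of s t y] cis_tx_flow [of t s y] t by (cases "s \<le> t") (auto simp: e_def s_def [symmetric])
qed

lemma e_K: "e (c x) = cis (2 * pi * x)"
proof -
  have 1: "c x = \<tau> x 0" by (simp add: \<tau>_def N_simps)
  moreover have "c x \<in> V' (\<delta> / 2)" using K_sub [of "\<delta> / 2"] \<delta> by (auto simp: K_def)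
  ultimately show ?thesis using e_eq [of 0 "c x"] cis_tx [of 0 x] \<delta> by (simp add: fl.flow_0)
qed

text \<open>One entry time serves for all orbits that start near a given point of the basin.\<close>

lemma continuous_e: "continuous_on U e"
  unfolding continuous_on_eq_continuous_at [OF open_U]
proof
  fix y assume "y \<in> U"
  then obtain t where t: "t \<ge> 0" "\<phi> t y \<in> V' (\<delta> / 2)" by (auto simp: U_def)
  let ?O = "{y. \<phi> t y \<in> V' (\<delta> / 2)}"
  have "continuous_on (V \<delta>) (\<lambda>w. cis (2 * pi * tx w))"
  proof (rule continuous_on_V)
    have "continuous_on ({0..1} \<times> cball 0 \<delta>) (\<lambda>w::real \<times> complex. cis (2 * pi * fst w))"
      unfolding cis_conv_exp by (intro continuous_intros)
    then show "continuous_on ({0..1} \<times> cball 0 \<delta>) (\<lambda>(x, z). cis (2 * pi * tx (\<tau> x z)))"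
      by (rule continuous_on_eq) (auto simp: cis_tx)
  qed
  then have "continuous_on ?O (\<lambda>y. cis (2 * pi * tx (\<phi> t y)))"
    by (rule continuous_on_compose2 [OF _ fl.continuous_on_space [OF t(1)]])
       (use V'_sub [of "\<delta> / 2"] V_mono [of "\<delta> / 2" \<delta>] \<delta> in auto)
  then have "continuous_on ?O e"
    by (rule continuous_on_eq) (use e_eq [OF t(1)] in auto)
  moreover have "open ?O" using t(1) \<delta> by (intro open_flow_preimage open_V') auto
  ultimately show "isCont e y" using t(2) continuous_on_eq_continuous_at by blast
qed

text \<open>An orbit that avoids the tube and a ball around the saddle stays in a compact set,
  because \<open>G\<close> never falls below its positive initial value. There
  \<open>X \<bullet> g\<close> has a positive minimum, so \<open>G\<close> would outgrow its maximum
  on that set.\<close>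

lemma orbit_visits_saddle:
  assumes y: "y \<notin> U" and \<eta>: "\<eta> > 0"
  shows "\<exists>t\<ge>0. dist p (\<phi> t y) < \<eta>"
proof (rule ccontr)
  assume "\<not> ?thesis"
  then have far: "\<And>t. t \<ge> 0 \<Longrightarrow> \<eta> \<le> dist p (\<phi> t y)" by force
  have yK: "y \<notin> K" using y K_sub_U by auto
  then have Gy: "G y > 0" by (intro coulomb_pos [OF continuous_c]) (simp add: K_image)
  obtain R1 where R1: "\<forall>t. norm (c t) \<le> R1" using c_bounded by blast
  obtain M where M: "\<forall>w. G y \<le> G w \<longrightarrow> norm w \<le> M"
    using coulomb_bounded_superlevel [OF continuous_c _ _ Gy, of R1 s] R1 s by auto
  define C where "C = cball 0 M - V' (\<delta> / 2) - ball p \<eta>"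
  have C: "compact C" unfolding C_def using open_V' [of "\<delta> / 2"] \<delta> by (intro compact_diff) auto
  have orb: "\<phi> t y \<in> C" if "t \<ge> 0" for t
    using far [OF that] y that M G_mono [OF that yK] by (auto simp: C_def U_def)
  have CK: "C \<inter> K = {}" using K_sub [of "\<delta> / 2"] \<delta> by (auto simp: C_def)
  have contX: "continuous_on C X"
    using fl.lip fl.L by (intro lipschitz_on_continuous_on [of \<Lambda>] lipschitz_onI) (auto simp: dist_norm)
  have "continuous_on C (\<lambda>w. X w \<bullet> g w)"
    by (intro continuous_on_inner contX continuous_on_subset [OF continuous_g]) (use CK in auto)
  moreover have "C \<noteq> {}" using orb [of 0] by auto
  ultimately obtain w where w: "w \<in> C" "\<And>v. v \<in> C \<Longrightarrow> X w \<bullet> g w \<le> X v \<bullet> g v"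
    using continuous_attains_inf [OF C] by blast
  define \<mu> where "\<mu> = X w \<bullet> g w"
  have "w \<notin> K" "w \<noteq> p" using w(1) CK \<eta> by (auto simp: C_def)
  then have \<mu>: "\<mu> > 0" unfolding \<mu>_def by (rule Xg)
  have "continuous_on C G" by (rule continuous_on_subset [OF continuous_G]) (use CK in auto)
  then obtain v where v: "v \<in> C" "\<And>u. u \<in> C \<Longrightarrow> G u \<le> G v"
    using continuous_attains_sup [OF C] \<open>C \<noteq> {}\<close> by blast
  \<comment> \<open>In this time, growth at the rate \<open>\<mu>\<close> exceeds the room left
    below the maximum by 1.\<close>
  define b where "b = (G v - G y + 1) / \<mu>"
  have "G y \<le> G v" using v(2) [OF orb [of 0]] by (simp add: fl.flow_0)
  then have b: "b \<ge> 0" using \<mu> by (simp add: b_def)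
  obtain \<xi> where \<xi>: "\<xi> \<in> {0..b}" "G (\<phi> b y) - G y = (X (\<phi> \<xi> y) \<bullet> g (\<phi> \<xi> y)) * b"
    using orbit_mean_value [OF b yK] by blast
  have "\<mu> * b \<le> (X (\<phi> \<xi> y) \<bullet> g (\<phi> \<xi> y)) * b"
    using w(2) [OF orb [of \<xi>]] \<xi>(1) b by (intro mult_right_mono) (auto simp: \<mu>_def)
  also have "\<dots> \<le> G v - G y" using \<xi>(2) v(2) [OF orb [OF b]] by linarith
  also have "\<mu> * b = G v - G y + 1" using \<mu> by (simp add: b_def)
  finally show False by simp
qed

text \<open>\<open>G\<close> does not decrease along the orbit, which comes arbitrarily close to the
  saddle.\<close>

lemma G_le_saddle:
  assumes y: "y \<notin> U" shows "G y \<le> G p"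
proof (rule ccontr)
  assume n: "\<not> G y \<le> G p"
  have "isCont G p" using continuous_G closed_K pK by (simp add: continuous_on_eq_continuous_at open_Compl)
  then have "(G \<longlongrightarrow> G p) (nhds p)"
    by (simp only: continuous_at tendsto_at_iff_tendsto_nhds)
  then have "\<forall>\<^sub>F w in nhds p. G w < G y"
    by (rule order_tendstoD(2)) (use n in simp)
  then obtain \<eta> where \<eta>: "\<eta> > 0" "\<forall>w. dist w p < \<eta> \<longrightarrow> G w < G y" unfolding eventually_nhds_metric by blast
  obtain t where "t \<ge> 0" "dist p (\<phi> t y) < \<eta>" using orbit_visits_saddle [OF y \<eta>(1)] by blast
  moreover have "y \<notin> K" using y K_sub_U by auto
  ultimately show False using \<eta>(2) G_mono [of t y] by (force simp: dist_commute)
qed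

text \<open>On the unstable plane \<open>X\<close> is the radial field, so
  \<open>X \<bullet> g > 0\<close> says that \<open>G\<close> increases along rays from the
  saddle.\<close>

lemma G_disc: "z \<noteq> 0 \<Longrightarrow> cmod z \<le> \<rho> \<Longrightarrow> G p < G (Q 0 z)"
proof -
  assume z: "z \<noteq> 0" "cmod z \<le> \<rho>"
  \<comment> \<open>The knot misses the ball of linearity: \<open>X\<close> vanishes on the knot,
    but in the ball only at \<open>p\<close>.\<close>
  have ball: "w \<notin> K" if w: "dist p w \<le> \<rho>" for w
  proof
    assume "w \<in> K"
    then have "X w = 0" using X_tube [of 0] \<delta> by (auto simp: K_eq V_def N_simps)
    moreover obtain x z where w': "w = Q x z" using Q_expand by blast
    moreover have "X (Q x z) = Q (- x) z - p" using X_Q w w' by (simp add: Q_def)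
    ultimately have "Q (- x) z - p = 0" by simp
    then have "x = 0" "z = 0" using Q_inner [of "- x" z] by (simp_all add: complex_eq_iff)
    then have "w = p" using w' by (simp add: Q_def)
    then show False using pK \<open>w \<in> K\<close> by simp
  qed
  define v where "v = Re z *\<^sub>R v1 + Im z *\<^sub>R v2"
  have Qv: "Q 0 (t *\<^sub>R z) = p + t *\<^sub>R v" for t by (simp add: Q_def v_def algebra_simps)
  have dQ: "dist p (p + t *\<^sub>R v) = \<bar>t\<bar> * cmod z" for t
  proof -
    have "(dist p (Q 0 (t *\<^sub>R z)))\<^sup>2 = (\<bar>t\<bar> * cmod z)\<^sup>2" by (simp add: dist_Q)
    then show ?thesis unfolding Qv by (simp only: power2_eq_iff_nonneg zero_le_dist mult_nonneg_nonneg abs_ge_zero norm_ge_zero)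
  qed
  have dQ1: "dist p (p + t *\<^sub>R v) \<le> \<rho>" if "0 \<le> t" "t \<le> 1" for t
    using dQ [of t] z(2) that mult_left_le_one_le [of "cmod z" t] by simp
  have "\<exists>t\<in>{0<..<1}. G (p + 1 *\<^sub>R v) - G (p + 0 *\<^sub>R v) = g (p + t *\<^sub>R v) \<bullet> ((1 - 0) *\<^sub>R v)"
  proof (rule mvt_simple)
    fix t :: real assume t: "0 \<le> t" "t \<le> 1"
    have "((\<lambda>t. p + t *\<^sub>R v) has_derivative (\<lambda>h. h *\<^sub>R v)) (at t within {0..1})"
      by (auto intro!: derivative_eq_intros)
    moreover have "(G has_derivative (\<lambda>w. g (p + t *\<^sub>R v) \<bullet> w)) (at (p + t *\<^sub>R v))"
      using ball [OF dQ1 [OF t]] by (intro coulomb_deriv [OF continuous_c]) (simp add: K_image)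
    ultimately show "((\<lambda>t. G (p + t *\<^sub>R v)) has_derivative (\<lambda>h. g (p + t *\<^sub>R v) \<bullet> (h *\<^sub>R v))) (at t within {0..1})"
      by (rule has_derivative_compose)
  qed simp
  then obtain t where t: "0 < t" "t < 1" "G (p + v) - G p = g (p + t *\<^sub>R v) \<bullet> v" by auto
  have d: "dist p (p + t *\<^sub>R v) \<le> \<rho>" using dQ1 t by simp
  have "p + t *\<^sub>R v \<noteq> p" using dQ [of t] t z by auto
  then have "0 < X (p + t *\<^sub>R v) \<bullet> g (p + t *\<^sub>R v)" using Xg ball [OF d] by blast
  moreover have "X (p + t *\<^sub>R v) = t *\<^sub>R v"
    using X_Q [of 0 "t *\<^sub>R z"] d unfolding Qv by (simp add: v_def algebra_simps)
  ultimately have "0 < t * (v \<bullet> g (p + t *\<^sub>R v))" by simp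
  then have "0 < g (p + t *\<^sub>R v) \<bullet> v" using t(1) by (simp add: inner_commute zero_less_mult_iff)
  then show ?thesis using t(3) Qv [of 1] by simp
qed

end

section \<open>The linking number of the unstable circle\<close>

text \<open>Two branches of the logarithm are needed because \<open>Ln\<close> jumps on the negative axis.\<close>

lemma continuous_on_periodic_Ln:
  fixes f :: "'b::topological_space \<times> complex \<Rightarrow> 'c::topological_space" and \<zeta> :: "'a::t2_space \<Rightarrow> complex"
  assumes f: "continuous_on D f" and \<xi>: "continuous_on S \<xi>" and \<zeta>: "continuous_on S \<zeta>"
    and nz: "\<And>y. y \<in> S \<Longrightarrow> \<zeta> y \<noteq> 0" and D: "\<And>y w. y \<in> S \<Longrightarrow> exp w = \<zeta> y \<Longrightarrow> (\<xi> y, w) \<in> D"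
    and per: "\<And>x w w'. (x, w) \<in> D \<Longrightarrow> (x, w') \<in> D \<Longrightarrow> exp w = exp w' \<Longrightarrow> f (x, w) = f (x, w')"
  shows "continuous_on S (\<lambda>y. f (\<xi> y, Ln (\<zeta> y)))"
  unfolding continuous_on_def
proof
  fix y0 assume y0: "y0 \<in> S"
  have t\<xi>: "(\<xi> \<longlongrightarrow> \<xi> y0) (at y0 within S)" and t\<zeta>: "(\<zeta> \<longlongrightarrow> \<zeta> y0) (at y0 within S)"
    using \<xi> \<zeta> y0 by (auto simp: continuous_on_def)
  have ev: "\<forall>\<^sub>F y in at y0 within S. y \<in> S" by (simp add: eventually_at_filter)
  have main: "((\<lambda>y. f (\<xi> y, Ln (\<zeta> y))) \<longlongrightarrow> f (\<xi> y0, Ln (\<zeta> y0))) (at y0 within S)"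
    if w: "(w \<longlongrightarrow> w y0) (at y0 within S)" "\<And>y. y \<in> S \<Longrightarrow> exp (w y) = \<zeta> y" for w
  proof -
    have eq: "f (\<xi> y, w y) = f (\<xi> y, Ln (\<zeta> y))" if "y \<in> S" for y
      using that nz [OF that] w(2) [OF that] by (intro per D) auto
    have "((\<lambda>y. f (\<xi> y, w y)) \<longlongrightarrow> f (\<xi> y0, w y0)) (at y0 within S)"
    proof (rule continuous_on_tendsto_compose [OF f])
      show "((\<lambda>y. (\<xi> y, w y)) \<longlongrightarrow> (\<xi> y0, w y0)) (at y0 within S)" by (rule tendsto_Pair [OF t\<xi> w(1)])
      show "(\<xi> y0, w y0) \<in> D" using D w(2) y0 by blast
      show "\<forall>\<^sub>F y in at y0 within S. (\<xi> y, w y) \<in> D" by (rule eventually_mono [OF ev]) (rule D, assumption, rule w(2))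
    qed
    moreover have "\<forall>\<^sub>F y in at y0 within S. f (\<xi> y, w y) = f (\<xi> y, Ln (\<zeta> y))"
      by (rule eventually_mono [OF ev]) (rule eq)
    ultimately have "((\<lambda>y. f (\<xi> y, Ln (\<zeta> y))) \<longlongrightarrow> f (\<xi> y0, w y0)) (at y0 within S)"
      by (rule Lim_transform_eventually)
    then show ?thesis unfolding eq [OF y0] .
  qed
  show "((\<lambda>y. f (\<xi> y, Ln (\<zeta> y))) \<longlongrightarrow> f (\<xi> y0, Ln (\<zeta> y0))) (at y0 within S)"
  proof (cases "\<zeta> y0 \<in> \<real>\<^sub>\<le>\<^sub>0")
    case False
    show ?thesis
      by (rule main [of "\<lambda>y. Ln (\<zeta> y)"]) (use t\<zeta> False nz in \<open>auto intro: tendsto_Ln\<close>)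
  next
    case True
    then have "- \<zeta> y0 \<notin> \<real>\<^sub>\<le>\<^sub>0" using nz [OF y0] by (auto simp: complex_nonpos_Reals_iff complex_eq_iff)
    then have "((\<lambda>y. Ln (- \<zeta> y) + \<i> * pi) \<longlongrightarrow> Ln (- \<zeta> y0) + \<i> * pi) (at y0 within S)"
      by (intro tendsto_intros t\<zeta>)
    then show ?thesis
      by (rule main [of "\<lambda>y. Ln (- \<zeta> y) + \<i> * pi"]) (use nz in \<open>auto simp: exp_add\<close>)
  qed
qed

text \<open>The box is so flat that its rim \<open>|z| = \<delta>2\<close> lies above the level of
  the saddle. Orbits that leave through the rim therefore belong to the basin of the knot.\<close>

locale saddle_box = saddle_flow +
  fixes \<delta>1 \<delta>2 :: real
  assumes \<delta>12: "0 < \<delta>1" "0 < \<delta>2" "\<delta>1 \<le> \<rho> / 2" "\<delta>2 \<le> \<rho> / 2"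
    and box_V: "\<And>x z. \<bar>x\<bar> < \<delta>1 \<Longrightarrow> cmod z < \<delta>2 \<Longrightarrow> Q x z \<notin> V (\<delta> / 2)"
    and exit: "\<And>x z. \<bar>x\<bar> < \<delta>1 \<Longrightarrow> cmod z = \<delta>2 \<Longrightarrow> G p < G (Q x z)"

context saddle_flow
begin

lemma saddle_box_exists:
  "\<exists>\<delta>1 \<delta>2. saddle_box c c' n1 n2 L m \<delta> \<kappa> s X \<Lambda> \<phi> p a v1 v2 B \<rho> R \<delta>1 \<delta>2"
proof -
  have "open (- V (\<delta> / 2))" using compact_imp_closed [OF compact_V] by (simp add: open_Compl)
  then obtain \<eta> where \<eta>: "\<eta> > 0" "cball p \<eta> \<subseteq> - V (\<delta> / 2)"
    using p_notin_V open_contains_cball by blast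
  define \<delta>2 where "\<delta>2 = min \<rho> \<eta> / 2"
  have d2: "0 < \<delta>2" "\<delta>2 \<le> \<rho> / 2" "\<delta>2 \<le> \<eta> / 2" using \<rho> \<eta>(1) by (auto simp: \<delta>2_def)
  define S where "S = Q 0 ` sphere 0 \<delta>2"
  have contQ: "continuous_on A (\<lambda>z. Q x z)" for A x
    unfolding Q_def by (intro continuous_intros)
  have "compact S" unfolding S_def by (intro compact_continuous_image contQ) auto
  moreover have "open (- K \<inter> G -` {G p<..})"
    by (rule continuous_open_preimage [OF continuous_G]) (auto intro: closed_K)
  moreover have "S \<subseteq> - K \<inter> G -` {G p<..}"
  proof
    fix y assume "y \<in> S"
    then obtain z where z: "y = Q 0 z" "cmod z = \<delta>2" by (auto simp: S_def)
    have "z \<noteq> 0" "cmod z \<le> \<rho>" using z(2) d2 \<rho> by auto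
    then have "G p < G y" using G_disc z(1) by simp
    moreover have "dist p y \<le> \<eta>" unfolding z(1) by (rule dist_Q_le) (use z d2 in auto)
    then have "y \<notin> V (\<delta> / 2)" using \<eta>(2) by auto
    then have "y \<notin> K" using V_mono [of 0 "\<delta> / 2"] \<delta> by (auto simp: K_eq)
    ultimately show "y \<in> - K \<inter> G -` {G p<..}" by simp
  qed
  ultimately obtain \<epsilon> where \<epsilon>: "\<epsilon> > 0" "(\<Union>x\<in>S. ball x \<epsilon>) \<subseteq> - K \<inter> G -` {G p<..}"
    by (rule compact_subset_open_imp_ball_epsilon_subset)
  \<comment> \<open>\<open>\<epsilon>\<close> comes from a neighbourhood of the compact rim circle
    on which \<open>G\<close> still exceeds \<open>G p\<close>.\<close>
  define \<delta>1 where "\<delta>1 = min \<delta>2 \<epsilon>"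
  have "saddle_box c c' n1 n2 L m \<delta> \<kappa> s X \<Lambda> \<phi> p a v1 v2 B \<rho> R \<delta>1 \<delta>2"
  proof (unfold_locales)
    show "0 < \<delta>1" "0 < \<delta>2" "\<delta>1 \<le> \<rho> / 2" "\<delta>2 \<le> \<rho> / 2" using d2 \<epsilon> by (auto simp: \<delta>1_def)
    show "Q x z \<notin> V (\<delta> / 2)" if "\<bar>x\<bar> < \<delta>1" "cmod z < \<delta>2" for x z
    proof -
      have "dist p (Q x z) \<le> \<eta>" by (rule dist_Q_le) (use that d2 in \<open>auto simp: \<delta>1_def\<close>)
      then show ?thesis using \<eta>(2) by auto
    qed
    show "G p < G (Q x z)" if "\<bar>x\<bar> < \<delta>1" "cmod z = \<delta>2" for x z
    proof -
      have "Q x z - Q 0 z = x *\<^sub>R a" by (simp add: Q_def)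
      moreover have "norm a = 1" using onb(1) by (simp add: norm_eq_1)
      ultimately have "dist (Q x z) (Q 0 z) = \<bar>x\<bar>" by (simp add: dist_norm)
      then have "Q x z \<in> ball (Q 0 z) \<epsilon>" using that(1) by (simp add: \<delta>1_def dist_commute)
      moreover have "Q 0 z \<in> S" using that(2) by (simp add: S_def)
      ultimately show ?thesis using \<epsilon>(2) by blast
    qed
  qed
  then show ?thesis by blast
qed

end

section \<open>The basin near the saddle\<close>

context saddle_box
begin

definition NB :: "(real^3) set" where "NB = {Q x z |x z. \<bar>x\<bar> < \<delta>1 \<and> cmod z < \<delta>2}"

definition zc :: "real^3 \<Rightarrow> complex" where "zc y = Complex ((y - p) \<bullet> v1) ((y - p) \<bullet> v2)"

lemma zc_Q: "zc (Q x z) = z" and Q_zc: "Q ((y - p) \<bullet> a) (zc y) = y"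
  using Q_inner [of x z] Q_expand [of y] by (simp_all add: zc_def)

lemma continuous_zc: "continuous_on A zc"
  unfolding zc_def [abs_def] Complex_eq by (intro continuous_intros)

lemma NB_iff: "y \<in> NB \<longleftrightarrow> \<bar>(y - p) \<bullet> a\<bar> < \<delta>1 \<and> cmod (zc y) < \<delta>2"
proof
  assume "y \<in> NB"
  then show "\<bar>(y - p) \<bullet> a\<bar> < \<delta>1 \<and> cmod (zc y) < \<delta>2" by (auto simp: NB_def zc_Q Q_inner)
next
  assume "\<bar>(y - p) \<bullet> a\<bar> < \<delta>1 \<and> cmod (zc y) < \<delta>2"
  then show "y \<in> NB" using Q_zc [of y] unfolding NB_def by (metis (mono_tags, lifting) mem_Collect_eq)
qed

lemma open_NB: "open NB"
proof -
  have "NB = {y. \<bar>(y - p) \<bullet> a\<bar> < \<delta>1} \<inter> {y. cmod (zc y) < \<delta>2}" using NB_iff by auto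
  moreover have "open {y. \<bar>(y - p) \<bullet> a\<bar> < \<delta>1}" "open {y. cmod (zc y) < \<delta>2}"
    by (intro open_Collect_less continuous_intros continuous_zc)+
  ultimately show ?thesis by (simp only: open_Int)
qed

text \<open>After the time \<open>ln (\<delta>2 / |z|)\<close> the flow has carried the point to the
  rim, and a point above the level of the saddle lies in the basin.\<close>

lemma box_U:
  assumes "\<bar>x\<bar> < \<delta>1" "z \<noteq> 0" "cmod z < \<delta>2" shows "Q x z \<in> U"
proof -
  define t where "t = ln (\<delta>2 / cmod z)"
  have t: "t \<ge> 0" "exp t = \<delta>2 / cmod z" using assms \<delta>12 by (auto simp: t_def)
  have "\<phi> t (Q x z) = Q (exp (- t) * x) (exp t *\<^sub>R z)"
    by (rule flow_box) (use assms t \<delta>12 in auto)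
  moreover have "\<bar>exp (- t) * x\<bar> \<le> 1 * \<bar>x\<bar>" unfolding abs_mult using t by (intro mult_right_mono) auto
  then have "G p < G (Q (exp (- t) * x) (exp t *\<^sub>R z))" using assms t \<delta>12 by (intro exit) auto
  ultimately have "\<phi> t (Q x z) \<in> U" using G_le_saddle by force
  then show ?thesis using U_flow [OF t(1)] by simp
qed

lemma axis_flow: assumes "\<bar>x\<bar> < \<delta>1" "t \<ge> 0" shows "\<bar>exp (- t) * x\<bar> < \<delta>1" "\<phi> t (Q x 0) = Q (exp (- t) * x) 0"
proof -
  have "\<bar>exp (- t) * x\<bar> \<le> 1 * \<bar>x\<bar>" unfolding abs_mult using assms by (intro mult_right_mono) auto
  then show "\<bar>exp (- t) * x\<bar> < \<delta>1" using assms by simp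
  show "\<phi> t (Q x 0) = Q (exp (- t) * x) 0" using flow_box [of t x 0] assms \<delta>12 \<rho> by simp
qed

text \<open>Points of the axis run towards the saddle without leaving the box, which misses the
  tube.\<close>

lemma axis_notin_U: "\<bar>x\<bar> < \<delta>1 \<Longrightarrow> Q x 0 \<notin> U"
  using axis_flow [of x] box_V [of _ 0] \<delta>12 V'_sub [of "\<delta> / 2"] by (force simp: U_def)

lemma flow_NB_U: assumes "t \<ge> 0" "y \<in> NB \<union> U" shows "\<phi> t y \<in> NB \<union> U"
proof (cases "y \<in> U")
  case True then show ?thesis using U_flow assms by simp
next
  case False
  then obtain x z where xz: "y = Q x z" "\<bar>x\<bar> < \<delta>1" "cmod z < \<delta>2" using assms by (auto simp: NB_def)
  then have "z = 0" using False box_U by blast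
  then show ?thesis using xz axis_flow [OF xz(2) assms(1)] \<delta>12 by (force simp: NB_def)
qed

lemma flow_enters: "\<exists>t\<ge>0. \<phi> t y \<in> NB \<union> U"
proof (cases "y \<in> U")
  case True then show ?thesis using fl.flow_0 [of y] by (intro exI [of _ 0]) simp
next
  case False
  have "p = Q 0 0" by (simp add: Q_def)
  then have "p \<in> NB" using \<delta>12 unfolding NB_def by (intro CollectI exI [of _ 0]) auto
  then obtain \<eta> where \<eta>: "\<eta> > 0" "ball p \<eta> \<subseteq> NB" using open_NB openE by blast
  obtain t where "t \<ge> 0" "dist p (\<phi> t y) < \<eta>" using orbit_visits_saddle [OF False \<eta>(1)] by blast
  then show ?thesis using \<eta>(2) by auto
qed

text \<open>Forward invariance turns the entry times of a finite subcover into a single time for the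
  whole compact set.\<close>

lemma compact_flow_into:
  assumes C: "compact C" and S: "open S" and fwd: "\<And>t y. t \<ge> 0 \<Longrightarrow> y \<in> S \<Longrightarrow> \<phi> t y \<in> S"
    and ent: "\<And>y. y \<in> C \<Longrightarrow> \<exists>t\<ge>0. \<phi> t y \<in> S"
  shows "\<exists>T\<ge>0. \<forall>y\<in>C. \<phi> T y \<in> S"
proof -
  define O' where "O' t = {y. \<phi> t y \<in> S}" for t
  have "C \<subseteq> (\<Union>t\<in>{0..}. O' t)" using ent by (force simp: O'_def)
  moreover have "open (O' t)" if "t \<in> {0..}" for t using that S open_flow_preimage by (auto simp: O'_def)
  ultimately obtain D where D: "D \<subseteq> {0..}" "finite D" "C \<subseteq> (\<Union>t\<in>D. O' t)"
    using compactE_image [OF C, of "{0..}" O'] by blast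
  define T where "T = Max (insert 0 D)"
  have "\<phi> T y \<in> S" if "y \<in> C" for y
  proof -
    have "\<exists>t\<in>D. \<phi> t y \<in> S" using subsetD [OF D(3) that] by (simp add: O'_def)
    then obtain t where t: "t \<in> D" "\<phi> t y \<in> S" by blast
    have "t \<le> T" "t \<ge> 0" using t(1) D(1,2) by (auto simp: T_def)
    then show ?thesis using fl.flow_add [of "T - t" t y] fwd [of "T - t" "\<phi> t y"] t(2) by simp
  qed
  moreover have "T \<ge> 0" using D(2) by (simp add: T_def)
  ultimately show ?thesis by blast
qed

text \<open>Through \<open>z = exp w\<close> this is the universal cover of the box without its
  axis. It is convex, so \<open>e\<close> has a logarithm on it.\<close>

definition D :: "(real \<times> complex) set" where "D = {-\<delta>1<..<\<delta>1} \<times> {w. Re w < ln \<delta>2}"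

lemma convex_D: "convex D"
proof -
  have "convex {w. Re w < ln \<delta>2}" using convex_halfspace_lt [of "1::complex" "ln \<delta>2"] by simp
  then show ?thesis unfolding D_def by (intro convex_Times) (auto simp: convex_real_interval)
qed

lemma D_exp: "(x, w) \<in> D \<longleftrightarrow> \<bar>x\<bar> < \<delta>1 \<and> cmod (exp w) < \<delta>2"
proof -
  have "Re w < ln \<delta>2 \<longleftrightarrow> exp (Re w) < \<delta>2" using \<delta>12 by (metis exp_less_cancel_iff exp_ln)
  then show ?thesis by (auto simp: D_def)
qed

text \<open>The integer \<open>d\<close> counts how often a small circle around the stable axis winds along the knot.\<close>

lemma linking_lift:
  "\<exists>h d. continuous_on D h \<and> (\<forall>x w. (x, w) \<in> D \<longrightarrow> e (Q x (exp w)) = exp (h (x, w))) \<and>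
     (\<forall>x w t. (x, w) \<in> D \<longrightarrow> h (x, w + 2 * pi * \<i> * of_int t) = h (x, w) + 2 * pi * \<i> * of_int d * of_int t)"
proof -
  have QU: "Q x (exp w) \<in> U" if "(x, w) \<in> D" for x w
    using box_U that by (simp add: D_exp)
  have "continuous_on D (\<lambda>q. Q (fst q) (exp (snd q)))"
    unfolding Q_def by (intro continuous_intros)
  then have "continuous_on D (\<lambda>q. e (Q (fst q) (exp (snd q))))"
    by (rule continuous_on_compose2 [OF continuous_e]) (use QU in auto)
  moreover have "contractible D" by (rule convex_imp_contractible [OF convex_D])
  moreover have "e (Q (fst q) (exp (snd q))) \<noteq> 0" for q by (simp add: e_def)
  ultimately obtain h where h: "continuous_on D h" "\<And>q. q \<in> D \<Longrightarrow> e (Q (fst q) (exp (snd q))) = exp (h q)"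
    by (rule continuous_logarithm_on_contractible) auto
  \<comment> \<open>The change of \<open>h\<close> under one turn of \<open>w\<close>, measured in
    units of \<open>2 * pi * \<i>\<close>: it is integral and continuous, hence constant on the
    connected set \<open>D\<close>.\<close>
  define f where "f q = (h (fst q, snd q + 2 * pi * \<i>) - h q) / (2 * pi * \<i>)" for q
  have shift: "(x, w + 2 * pi * \<i> * of_int t) \<in> D" if "(x, w) \<in> D" for x w t
    using that by (simp add: D_def)
  have fZ: "f q \<in> \<int>" if q: "q \<in> D" for q
  proof -
    have "exp (h (fst q, snd q + 2 * pi * \<i>)) = exp (h q)"
      using h(2) [OF q] h(2) [of "(fst q, snd q + 2 * pi * \<i>)"] shift [of "fst q" "snd q" 1] q
      by (simp add: exp_add)
    then obtain k :: int where "h (fst q, snd q + 2 * pi * \<i>) = h q + (of_int (2 * k) * pi) * \<i>"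
      unfolding exp_eq by (elim exE)
    then have "f q = of_int k" by (simp add: f_def field_simps)
    then show ?thesis by simp
  qed
  have "f constant_on D"
  proof (rule continuous_discrete_range_constant)
    show "connected D" by (rule convex_connected [OF convex_D])
    have "continuous_on D (\<lambda>q. h (fst q, snd q + 2 * pi * \<i>))"
      by (rule continuous_on_compose2 [OF h(1)]) (use shift [of _ _ 1] in \<open>auto intro!: continuous_intros\<close>)
    then show "continuous_on D f" unfolding f_def [abs_def] by (intro continuous_intros h(1)) auto
    show "\<exists>e>0. \<forall>y. y \<in> D \<and> f y \<noteq> f x \<longrightarrow> e \<le> norm (f y - f x)" if "x \<in> D" for x
    proof (intro exI [of _ 1] conjI allI impI)
      fix y assume "y \<in> D \<and> f y \<noteq> f x"
      then have "f y - f x \<in> \<int>" "f y - f x \<noteq> 0" using fZ that by auto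
      then obtain k :: int where k: "f y - f x = of_int k" by (elim Ints_cases)
      then have "k \<noteq> 0" using \<open>f y - f x \<noteq> 0\<close> by auto
      then show "1 \<le> norm (f y - f x)" unfolding k by simp
    qed simp
  qed
  moreover have "(0, of_real (ln \<delta>2 - 1)) \<in> D" using \<delta>12 by (simp add: D_def)
  ultimately obtain d :: int where d: "\<And>q. q \<in> D \<Longrightarrow> f q = of_int d"
    using fZ unfolding constant_on_def by (metis Ints_cases)
  have one: "h (x, w + 2 * pi * \<i>) = h (x, w) + 2 * pi * \<i> * of_int d" if "(x, w) \<in> D" for x w
    using d [OF that] by (simp add: f_def field_simps)
  have "h (x, w + 2 * pi * \<i> * of_int t) = h (x, w) + 2 * pi * \<i> * of_int d * of_int t" if xw: "(x, w) \<in> D" for x w t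
  proof -
    \<comment> \<open>Subtracting the expected increment leaves a function of period 1, so the
      formula for one turn extends to all integers.\<close>
    define F where "F t = h (x, w + 2 * pi * \<i> * of_real t) - 2 * pi * \<i> * of_int d * of_real t" for t
    have "F (t + 1) = F t" for t
    proof -
      have "(x, w + 2 * pi * \<i> * of_real t) \<in> D" using xw by (simp add: D_def)
      from one [OF this] show ?thesis by (simp add: F_def algebra_simps)
    qed
    then have "F (0 + of_int t) = F 0" by (rule periodic_shift_int)
    then show ?thesis by (simp add: F_def diff_eq_eq)
  qed
  moreover have "\<forall>x w. (x, w) \<in> D \<longrightarrow> e (Q x (exp w)) = exp (h (x, w))" using h(2) by force
  ultimately show ?thesis using h(1) by blast
qed

text \<open>Otherwise the \<open>n\<close>-th roots of \<open>e\<close> with \<open>n \<ge> 2\<close> dividing \<open>d\<close> extend across the axis, while the flow contracts the knot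
  inside \<open>NB \<union> U\<close>.\<close>

lemma linking_number_unit:
  assumes h: "continuous_on D h" "\<And>x w. (x, w) \<in> D \<Longrightarrow> e (Q x (exp w)) = exp (h (x, w))"
    "\<And>x w t. (x, w) \<in> D \<Longrightarrow> h (x, w + 2 * pi * \<i> * of_int t) = h (x, w) + 2 * pi * \<i> * of_int d * of_int t"
  shows "\<bar>d\<bar> = 1"
proof (rule ccontr)
  assume d1: "\<bar>d\<bar> \<noteq> 1"
  \<comment> \<open>For \<open>d = 0\<close> every number divides \<open>d\<close>, and 2 is
    taken.\<close>
  define n where "n = (if d = 0 then 2 else nat \<bar>d\<bar>)"
  have n: "n \<ge> 2" "int n dvd d" using d1 by (auto simp: n_def)
  then obtain j where j: "d = int n * j" by blast
  \<comment> \<open>As \<open>n\<close> divides \<open>d\<close>, one turn around the axis changes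
    \<open>h / n\<close> by a multiple of \<open>2 * pi * \<i>\<close>, so this root of
    \<open>e\<close> does not depend on the branch of \<open>Ln\<close>.\<close>
  define gr where "gr y = exp (h ((y - p) \<bullet> a, Ln (zc y)) / of_nat n)" for y
  have S: "\<bar>(y - p) \<bullet> a\<bar> < \<delta>1" "cmod (zc y) < \<delta>2" "zc y \<noteq> 0" if "y \<in> NB \<inter> U" for y
  proof -
    show "\<bar>(y - p) \<bullet> a\<bar> < \<delta>1" "cmod (zc y) < \<delta>2" using that by (auto simp: NB_iff)
    then show "zc y \<noteq> 0" using that axis_notin_U Q_zc [of y] by force
  qed
  have contg: "continuous_on (NB \<inter> U) gr"
    unfolding gr_def
  proof (rule continuous_on_periodic_Ln [of D "\<lambda>q. exp (h q / of_nat n)"])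
    show "continuous_on D (\<lambda>q. exp (h q / of_nat n))" by (intro continuous_intros h(1)) (use n in auto)
    show "continuous_on (NB \<inter> U) (\<lambda>y. (y - p) \<bullet> a)" by (intro continuous_intros)
    show "exp (h (x, w) / of_nat n) = exp (h (x, w') / of_nat n)"
      if xw: "(x, w) \<in> D" "(x, w') \<in> D" "exp w = exp w'" for x w w'
    proof -
      obtain k :: int where "w = w' + (of_int (2 * k) * pi) * \<i>"
        using xw(3) unfolding exp_eq by (elim exE)
      then have "w = w' + 2 * pi * \<i> * of_int k" by (simp add: algebra_simps)
      then have "h (x, w) / of_nat n = h (x, w') / of_nat n + 2 * of_int (j * k) * pi * \<i>"
        using h(3) [OF xw(2), of k] n by (simp add: j field_simps)
      then show ?thesis using exp_integer_2pi [of "of_int (j * k)"] by (simp add: exp_add)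
    qed
  qed (use S continuous_zc in \<open>auto simp: D_exp\<close>)
  have gre: "gr y ^ n = e y" if "y \<in> NB \<inter> U" for y
  proof -
    have "gr y ^ n = exp (h ((y - p) \<bullet> a, Ln (zc y)))"
      using n by (simp add: gr_def flip: exp_of_nat_mult)
    also have "\<dots> = e (Q ((y - p) \<bullet> a) (exp (Ln (zc y))))"
      using S [OF that] by (intro h(2) [symmetric]) (simp add: D_exp)
    finally show ?thesis using S [OF that] by (simp add: Q_zc)
  qed
  obtain R1 where R1: "\<forall>t. norm (c t) \<le> R1" using c_bounded by blast
  \<comment> \<open>The knot is contracted linearly inside a ball; at time \<open>T\<close> the flow
    has pushed this contraction into \<open>NB \<union> U\<close> while leaving the knot
    fixed.\<close>
  obtain T where T: "T \<ge> 0" "\<forall>y\<in>cball 0 R1. \<phi> T y \<in> NB \<union> U"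
    using compact_flow_into [of "cball 0 R1" "NB \<union> U"] open_NB open_U flow_NB_U flow_enters by auto
  have "path c" unfolding path_def by (rule continuous_c)
  have cK: "c t \<in> K" for t by (simp add: K_def)
  have "homotopic_paths (cball 0 R1) c (linepath (c 0) (c 0))"
  proof (rule homotopic_paths_linear [OF \<open>path c\<close>])
    show "pathfinish (linepath (c 0) (c 0)) = pathfinish c" using c_per [of 0] by (simp add: pathfinish_def)
    show "closed_segment (c t) (linepath (c 0) (c 0) t) \<subseteq> cball 0 R1" for t
      using R1 by (intro closed_segment_subset) (auto simp: linepath_def simp flip: scaleR_left_distrib)
  qed (auto simp: pathstart_def)
  then have "homotopic_paths (NB \<union> U) (\<phi> T \<circ> c) (\<phi> T \<circ> linepath (c 0) (c 0))"
    by (rule homotopic_paths_continuous_image) (use T fl.continuous_on_space in auto)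
  moreover have "\<phi> T \<circ> c = c" using flow_K [OF T(1) cK] by auto
  moreover have "\<phi> T \<circ> linepath (c 0) (c 0) = linepath (c 0) (c 0)"
    using flow_K [OF T(1) cK [of 0]] by (auto simp: linepath_def simp flip: scaleR_left_distrib)
  ultimately have hom: "homotopic_paths (NB \<union> U) c (linepath (c 0) (c 0))" by simp
  have ne: "norm (e y) = 1" for y by (simp add: e_def)
  \<comment> \<open>Along the knot itself \<open>e\<close> winds exactly once, and 1 is not
    divisible by \<open>n\<close>.\<close>
  have "\<exists>i::int. 1 - 0 = real n * of_int i"
  proof (rule winding_number_divisible [where \<omega> = "\<lambda>t. t", OF open_NB open_U _ continuous_e _ contg gre \<open>path c\<close> _ _ _ hom])
    show "path_image c \<subseteq> U" using cK K_sub_U by (auto simp: path_image_def)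
  qed (use n ne in \<open>auto simp: e_K\<close>)
  then obtain i :: int where "1 = real n * of_int i" by auto
  then have "of_int 1 = (of_int (int n * i) :: real)" by simp
  then have "1 = int n * i" by (simp only: of_int_eq_iff)
  then have "int n dvd 1" by (metis dvd_triv_left)
  then show False using n by simp
qed

text \<open>The flow is an ambient isotopy from the round circle in the unstable plane to a curve in
  the tube, and with \<open>\<bar>d\<bar> = 1\<close> this curve satisfies the hypotheses for torus
  curves isotopic to the core.\<close>

lemma core_isotopic_round_circle: "ambient_isotopic K round_circle"
proof -
  obtain h d where h: "continuous_on D h" "\<And>x w. (x, w) \<in> D \<Longrightarrow> e (Q x (exp w)) = exp (h (x, w))"
    "\<And>x w t. (x, w) \<in> D \<Longrightarrow> h (x, w + 2 * pi * \<i> * of_int t) = h (x, w) + 2 * pi * \<i> * of_int d * of_int t"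
    using linking_lift by (elim exE conjE) (rule that, blast+)
  have d: "\<bar>d\<bar> = 1" by (rule linking_number_unit [OF h])
  define r where "r = \<delta>2 / 2"
  have r: "0 < r" "r < \<delta>2" using \<delta>12 by (auto simp: r_def)
  define w where "w \<theta> = of_real (ln r) + 2 * pi * \<i> * of_real \<theta>" for \<theta> :: real
  have expw: "exp (w \<theta>) = r *\<^sub>R cis (2 * pi * \<theta>)" for \<theta>
    using r by (simp add: w_def exp_add cis_conv_exp scaleR_conv_of_real mult_ac exp_of_real)
  have wD: "(0, w \<theta>) \<in> D" for \<theta> using r \<delta>12 by (simp add: D_exp expw)
  define c0 where "c0 \<theta> = Q 0 (r *\<^sub>R cis (2 * pi * \<theta>))" for \<theta>
  have c0U: "c0 \<theta> \<in> U" for \<theta> using r \<delta>12 by (auto simp: c0_def intro!: box_U)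
  have c0per: "c0 (\<theta> + 1) = c0 \<theta>" for \<theta>
    by (simp add: c0_def distrib_left flip: cis_mult)
  have contc0: "continuous_on A c0" for A
    unfolding c0_def [abs_def] Q_def cis_conv_exp by (intro continuous_intros)
  have c0e: "e (c0 \<theta>) = exp (h (0, w \<theta>))" for \<theta>
    using h(2) [OF wD [of \<theta>]] by (simp add: expw c0_def)
  have imc0: "range c0 = c0 ` {0..1}"
  proof -
    have "c0 \<theta> \<in> c0 ` {0..1}" for \<theta>
    proof (rule image_eqI)
      show "c0 \<theta> = c0 (frac \<theta>)" using periodic_shift_int [of c0 "frac \<theta>" "\<lfloor>\<theta>\<rfloor>"] c0per by (simp add: frac_def)
      show "frac \<theta> \<in> {0..1}" using frac_ge_0 [of \<theta>] frac_lt_1 [of \<theta>] by simp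
    qed
    then show ?thesis by blast
  qed
  have "compact (c0 ` {0..1})" by (intro compact_continuous_image contc0) auto
  then have "\<exists>T\<ge>0. \<forall>y\<in>range c0. \<phi> T y \<in> V' (\<delta> / 2)"
    unfolding imc0
  proof (rule compact_flow_into)
    show "open (V' (\<delta> / 2))" by (rule open_V') (use \<delta> in simp)
    show "\<exists>t\<ge>0. \<phi> t y \<in> V' (\<delta> / 2)" if "y \<in> c0 ` {0..1}" for y using that c0U by (auto simp: U_def)
  qed (rule flow_V')
  then obtain T where T: "T \<ge> 0" "\<forall>y\<in>range c0. \<phi> T y \<in> V' (\<delta> / 2)" by blast
  define b where "b \<theta> = tz (\<phi> T (c0 \<theta>))" for \<theta>
  \<comment> \<open>A continuous lift of the coordinate along the knot; \<open>tx\<close> is fixed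
    only modulo 1 and need not be continuous.\<close>
  define a0 where "a0 \<theta> = Im (h (0, w \<theta>)) / (2 * pi)" for \<theta>
  have Tc: "\<phi> T (c0 \<theta>) \<in> V' (\<delta> / 2)" for \<theta> using T(2) by simp
  have in_V: "\<phi> T (c0 \<theta>) \<in> V \<delta>" for \<theta>
    using Tc [of \<theta>] V'_sub [of "\<delta> / 2"] V_mono [of "\<delta> / 2" \<delta>] \<delta> by auto
  have eT: "cis (2 * pi * tx (\<phi> T (c0 \<theta>))) = cis (2 * pi * a0 \<theta>)" for \<theta>
  proof -
    have e: "cis (2 * pi * tx (\<phi> T (c0 \<theta>))) = exp (h (0, w \<theta>))"
      using e_eq [OF T(1) Tc [of \<theta>]] c0e [of \<theta>] by simp
    then have "cmod (exp (h (0, w \<theta>))) = 1" by (metis norm_cis)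
    then have "Re (h (0, w \<theta>)) = 0" by simp
    then have "exp (h (0, w \<theta>)) = cis (Im (h (0, w \<theta>)))" by (simp add: exp_eq_polar)
    then show ?thesis using e by (simp add: a0_def)
  qed
  have cis_int: "\<exists>k::int. x = y + of_int k" if "cis (2 * pi * x) = cis (2 * pi * y)" for x y
  proof -
    have "cis (2 * pi * x - 2 * pi * y) = 1" using that by (simp flip: cis_divide)
    then have "cos (2 * pi * x - 2 * pi * y) = 1" by (metis cis.sel(1) one_complex.sel(1))
    then obtain k :: int where "2 * pi * x - 2 * pi * y = of_int k * 2 * pi" using cos_one_2pi_int by blast
    then have "2 * pi * (x - y) = 2 * pi * of_int k" by (simp add: algebra_simps)
    then have "x = y + of_int k" by simp
    then show ?thesis by blast
  qed
  have repr: "\<phi> T (c0 \<theta>) = \<tau> (a0 \<theta>) (b \<theta>)" for \<theta>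
  proof -
    obtain k :: int where k: "tx (\<phi> T (c0 \<theta>)) = a0 \<theta> + of_int k" using cis_int [OF eT] by blast
    show ?thesis using txz(1) [OF in_V [of \<theta>]] \<tau>_per [of "a0 \<theta>" k] by (simp add: b_def k)
  qed
  have contw: "continuous_on UNIV (\<lambda>\<theta>. (0::real, w \<theta>))"
    unfolding w_def by (intro continuous_intros)
  have conta: "continuous_on UNIV a0"
    unfolding a0_def [abs_def] by (intro continuous_intros continuous_on_compose2 [OF h(1) contw]) (use wD in auto)
  have contb: "continuous_on UNIV b"
  proof -
    have "continuous_on (V \<delta>) tz"
    proof (rule continuous_on_V)
      have "continuous_on ({0..1} \<times> cball 0 \<delta>) (\<lambda>q::real \<times> complex. snd q)" by (intro continuous_intros)
      then show "continuous_on ({0..1} \<times> cball 0 \<delta>) (\<lambda>(x, z). tz (\<tau> x z))"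
        by (rule continuous_on_eq) (auto simp: tz_\<tau>)
    qed
    moreover have "continuous_on UNIV (\<lambda>\<theta>. \<phi> T (c0 \<theta>))"
      by (rule continuous_on_compose2 [OF fl.continuous_on_space [OF T(1), of UNIV] contc0]) auto
    ultimately show ?thesis unfolding b_def [abs_def] by (rule continuous_on_compose2) (use in_V in auto)
  qed
  have a_per: "a0 (\<theta> + of_int k) = a0 \<theta> + of_int (d * k)" for \<theta> k
  proof -
    have "w (\<theta> + of_int k) = w \<theta> + 2 * pi * \<i> * of_int k" by (simp add: w_def algebra_simps)
    then show ?thesis using h(3) [OF wD [of \<theta>], of k] by (simp add: a0_def field_simps)
  qed
  have b_per: "b (\<theta> + of_int k) = b \<theta>" for \<theta> k
    using periodic_shift_int [of c0 \<theta> k] c0per by (simp add: b_def)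
  have c0K: "c0 \<theta> \<notin> K" for \<theta>
  proof -
    have "G p < G (c0 \<theta>) \<and> c0 \<theta> \<notin> V (\<delta> / 2)"
      unfolding c0_def using r \<delta>12 \<rho> by (intro conjI G_disc box_V) auto
    then show ?thesis using V_mono [of 0 "\<delta> / 2"] \<delta> by (auto simp: K_eq)
  qed
  have b_nz: "b \<theta> \<noteq> 0" for \<theta>
  proof
    assume "b \<theta> = 0"
    then have "\<phi> T (c0 \<theta>) \<in> K" using repr [of \<theta>] by (auto simp: K_eq V_def)
    then show False using flow_notin_K [OF T(1) c0K] by blast
  qed
  have b_lt: "cmod (b \<theta>) < \<delta> / 2" for \<theta>
    using in_V'_iff [OF in_V, of "\<delta> / 2"] Tc \<delta> by (auto simp: b_def)
  \<comment> \<open>Two points of the curve on one ray from the core lie on one orbit. By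
    injectivity of the flow the same holds for their preimages on the circle, and since the flow
    expands the unstable plane, an orbit meets the circle only once.\<close>
  have inj1: "\<theta> - \<eta> \<in> \<int>"
    if *: "a0 \<theta> - a0 \<eta> \<in> \<int>" "sgn (b \<theta>) = sgn (b \<eta>)" "cmod (b \<theta>) \<le> cmod (b \<eta>)" for \<theta> \<eta>
  proof -
    define t where "t = ln (cmod (b \<eta>) / cmod (b \<theta>))"
    have t: "t \<ge> 0" "exp (- t) = cmod (b \<theta>) / cmod (b \<eta>)"
      using *(3) b_nz by (auto simp: t_def exp_minus)
    have "b \<theta> = exp (- t) *\<^sub>R b \<eta>"
    proof -
      have "b \<theta> = cmod (b \<theta>) *\<^sub>R sgn (b \<theta>)" using b_nz by (simp add: sgn_div_norm)
      also have "\<dots> = exp (- t) *\<^sub>R b \<eta>" unfolding *(2) t(2) by (simp add: sgn_div_norm divide_inverse)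
      finally show ?thesis .
    qed
    moreover obtain k :: int where "a0 \<theta> = a0 \<eta> + of_int k" using *(1) by (metis Ints_cases diff_add_cancel add.commute)
    ultimately have "\<phi> T (c0 \<theta>) = \<phi> t (\<phi> T (c0 \<eta>))"
      unfolding repr using flow_tube [OF t(1), of "b \<eta>" "a0 \<eta>"] b_lt [of \<eta>] \<tau>_per by simp
    also have "\<dots> = \<phi> T (\<phi> t (c0 \<eta>))"
      using fl.flow_add [OF t(1) T(1)] fl.flow_add [OF T(1) t(1)] by (metis add.commute)
    finally have 1: "c0 \<theta> = \<phi> t (c0 \<eta>)" by (rule fl.flow_inj [OF T(1)])
    have "\<phi> t (Q 0 ((exp (- t) * r) *\<^sub>R cis (2 * pi * \<theta>))) = c0 \<theta>"
    proof -
      define q where "q = exp (- t) * r"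
      have q: "exp t * q = r" "q > 0" using r by (simp_all add: q_def exp_minus)
      then have "\<phi> t (Q 0 (q *\<^sub>R cis (2 * pi * \<theta>))) = c0 \<theta>"
        using flow_box [OF t(1), of 0 "q *\<^sub>R cis (2 * pi * \<theta>)"] r \<delta>12 \<rho> by (simp add: c0_def)
      then show ?thesis unfolding q_def .
    qed
    then have "Q 0 ((exp (- t) * r) *\<^sub>R cis (2 * pi * \<theta>)) = c0 \<eta>"
      using 1 fl.flow_inj [OF t(1)] by metis
    then have 2: "(exp (- t) * r) *\<^sub>R cis (2 * pi * \<theta>) = r *\<^sub>R cis (2 * pi * \<eta>)"
      unfolding c0_def using Q_eqD by blast
    then have "cmod ((exp (- t) * r) *\<^sub>R cis (2 * pi * \<theta>)) = cmod (r *\<^sub>R cis (2 * pi * \<eta>))" by simp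
    then have "exp (- t) * r = r" using r by (simp add: abs_mult)
    then have "cis (2 * pi * \<theta>) = cis (2 * pi * \<eta>)" using 2 r by simp
    then show ?thesis using cis_int by force
  qed
  have inj: "\<theta> - \<eta> \<in> \<int>" if "a0 \<theta> - a0 \<eta> \<in> \<int>" "sgn (b \<theta>) = sgn (b \<eta>)" for \<theta> \<eta>
  proof (cases "cmod (b \<theta>) \<le> cmod (b \<eta>)")
    case True then show ?thesis using inj1 that by blast
  next
    case False
    have "a0 \<eta> - a0 \<theta> \<in> \<int>" using Ints_minus [OF that(1)] by simp
    then have "\<eta> - \<theta> \<in> \<int>" by (rule inj1) (use that(2) False in auto)
    then show ?thesis using Ints_minus [of "\<eta> - \<theta>"] by simp
  qed
  \<comment> \<open>If \<open>d\<close> is -1, the circle is traversed in the opposite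
    direction.\<close>
  define \<epsilon> where "\<epsilon> = real_of_int d"
  have \<epsilon>: "\<epsilon> = 1 \<or> \<epsilon> = -1" using d by (auto simp: \<epsilon>_def)
  have dd: "d * d = 1" using d by (metis abs_mult_self_eq mult_1)
  have "ambient_isotopic K {\<tau> (a0 (\<epsilon> * \<theta>)) (b (\<epsilon> * \<theta>)) |\<theta>. \<theta> \<in> UNIV}"
  proof (rule core_isotopic_torus_curve [of "\<delta> / 2"])
    show "continuous_on UNIV (\<lambda>\<theta>. a0 (\<epsilon> * \<theta>))" "continuous_on UNIV (\<lambda>\<theta>. b (\<epsilon> * \<theta>))"
      by (intro continuous_on_compose2 [OF conta] continuous_on_compose2 [OF contb] continuous_intros; simp)+
    show "a0 (\<epsilon> * (\<theta> + 1)) = a0 (\<epsilon> * \<theta>) + 1" for \<theta>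
      using a_per [of "\<epsilon> * \<theta>" d] dd by (simp add: \<epsilon>_def distrib_left)
    show "b (\<epsilon> * (\<theta> + 1)) = b (\<epsilon> * \<theta>)" for \<theta>
      using b_per [of "\<epsilon> * \<theta>" d] by (simp add: \<epsilon>_def distrib_left)
    show "\<theta> - \<eta> \<in> \<int>" if "a0 (\<epsilon> * \<theta>) - a0 (\<epsilon> * \<eta>) \<in> \<int>" "sgn (b (\<epsilon> * \<theta>)) = sgn (b (\<epsilon> * \<eta>))" for \<theta> \<eta>
    proof -
      have "\<epsilon> * \<theta> - \<epsilon> * \<eta> \<in> \<int>" by (rule inj [OF that])
      then show ?thesis using \<epsilon> by (auto dest: Ints_minus)
    qed
  qed (use \<delta> b_nz b_lt in auto)
  moreover have "{\<tau> (a0 (\<epsilon> * \<theta>)) (b (\<epsilon> * \<theta>)) |\<theta>. \<theta> \<in> UNIV} = \<phi> T ` range c0"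
  proof -
    have "surj (\<lambda>\<theta>. \<epsilon> * \<theta>)" using \<epsilon> by (intro surjI [of _ "\<lambda>\<theta>. \<epsilon> * \<theta>"]) auto
    have "\<phi> T ` range c0 = (\<lambda>\<theta>. \<phi> T (c0 \<theta>)) ` range (\<lambda>\<theta>. \<epsilon> * \<theta>)"
      unfolding \<open>surj (\<lambda>\<theta>. \<epsilon> * \<theta>)\<close> by (rule image_image)
    also have "\<dots> = range (\<lambda>\<theta>. \<phi> T (c0 (\<epsilon> * \<theta>)))" by (rule image_image)
    also have "\<dots> = {\<tau> (a0 (\<epsilon> * \<theta>)) (b (\<epsilon> * \<theta>)) |\<theta>. \<theta> \<in> UNIV}"
      unfolding repr by blast
    finally show ?thesis by (rule sym)
  qed
  ultimately have i1: "ambient_isotopic K (\<phi> T ` range c0)" by simp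
  have i2: "ambient_isotopic (range c0) (\<phi> T ` range c0)"
  proof (rule ambient_isotopicI [of "\<lambda>t. \<phi> (t * T)"])
    have "continuous_on ({0..1} \<times> UNIV) (\<lambda>q. (\<lambda>(t, x). \<phi> t x) (fst q * T, snd q))"
      by (rule continuous_on_compose2 [OF fl.continuous_on_flow]) (use T in \<open>auto intro!: continuous_intros\<close>)
    then show "continuous_on ({0..1} \<times> UNIV) (\<lambda>(t, x). \<phi> (t * T) x)" by (simp add: case_prod_unfold)
    show "\<exists>g. homeomorphism UNIV UNIV (\<phi> (t * T)) g" if "t \<in> {0..1}" for t
      using that T by (intro fl.homeomorphism_flow) simp
  qed (auto simp: fl.flow_0)
  have "range c0 = {p + v |v. v \<bullet> a = 0 \<and> norm v = r}"
  proof (intro equalityI subsetI)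
    fix y assume "y \<in> range c0"
    then obtain \<theta> where y: "y = Q 0 (r *\<^sub>R cis (2 * pi * \<theta>))" by (auto simp: c0_def)
    have "(dist p y)\<^sup>2 = r\<^sup>2" unfolding y dist_Q by simp
    then have "norm (y - p) = r" using r by (simp add: dist_commute [of p] dist_norm [of y])
    moreover have "(y - p) \<bullet> a = 0" by (simp add: y Q_inner)
    ultimately show "y \<in> {p + v |v. v \<bullet> a = 0 \<and> norm v = r}" by (intro CollectI exI [of _ "y - p"]) simp
  next
    fix y assume "y \<in> {p + v |v. v \<bullet> a = 0 \<and> norm v = r}"
    then have y: "(y - p) \<bullet> a = 0" "dist y p = r" by (auto simp: dist_norm)
    have "(dist p (Q ((y - p) \<bullet> a) (zc y)))\<^sup>2 = r\<^sup>2" using y(2) by (simp add: Q_zc dist_commute)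
    then have "cmod (zc y) = r" unfolding dist_Q y(1) using r by simp
    then have "zc y = r *\<^sub>R cis (2 * pi * (Arg (zc y) / (2 * pi)))"
      using rcis_cmod_Arg [of "zc y"] by (simp add: rcis_def scaleR_conv_of_real)
    then have "Q ((y - p) \<bullet> a) (zc y) = c0 (Arg (zc y) / (2 * pi))" unfolding c0_def y(1) by simp
    then show "y \<in> range c0" unfolding Q_zc by blast
  qed
  then have "ambient_isotopic round_circle (range c0)"
    using ambient_isotopic_circle [of a r p] onb(1) r by (simp add: norm_eq_1)
  then show ?thesis
    using ambient_isotopic_trans [OF i1 ambient_isotopic_sym [OF i2]] ambient_isotopic_sym ambient_isotopic_trans by blast
qed

end

section \<open>Assembling the contradiction\<close>

lemma (in charged_tube) few_critical_points_imp_unknot: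
  assumes P: "finite P" "card P \<le> 2" "\<And>y. y \<in> P \<longleftrightarrow> y \<notin> K \<and> g y = 0"
    and nondeg: "\<And>p. p \<in> P \<Longrightarrow> \<exists>A. (g has_derivative (\<lambda>v. A *v v)) (at p) \<and> invertible A"
  shows "ambient_isotopic K round_circle"
proof -
  have "\<exists>p A a l. P = {p} \<and> (g has_derivative (\<lambda>v. A *v v)) (at p) \<and> norm a = 1 \<and> A *v a = l *\<^sub>R a \<and> l < 0 \<and>
     (\<forall>v. v \<bullet> a = 0 \<longrightarrow> v \<noteq> 0 \<longrightarrow> 0 < v \<bullet> (A *v v)) \<and> (\<forall>x y. (A *v x) \<bullet> y = x \<bullet> (A *v y))"
    by (rule unique_saddle [OF P]) (rule nondeg)
  then obtain p A a l where p: "P = {p}" and A: "(g has_derivative (\<lambda>v. A *v v)) (at p)" and a: "norm a = 1"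
    and l: "A *v a = l *\<^sub>R a" "l < 0" and pos: "\<forall>v. v \<bullet> a = 0 \<longrightarrow> v \<noteq> 0 \<longrightarrow> 0 < v \<bullet> (A *v v)"
    and sym: "\<forall>x y. (A *v x) \<bullet> y = x \<bullet> (A *v y)"
    by (elim exE conjE) (rule that)
  \<comment> \<open>The reflection orthogonal to \<open>a\<close> replaces the Hessian as linear
    model. Splitting \<open>v = u + x a\<close> turns the pairing with the Hessian into
    \<open>u \<bullet> A u - l x^2\<close>, which is positive because \<open>l < 0\<close>.\<close>
  define B where "B = matrix (\<lambda>v. v - (2 * (a \<bullet> v)) *\<^sub>R a)"
  have "linear (\<lambda>v. v - (2 * (a \<bullet> v)) *\<^sub>R a)"
    by (rule linearI) (simp_all add: inner_add_right algebra_simps)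
  then have B: "B *v v = v - (2 * (a \<bullet> v)) *\<^sub>R a" for v by (simp add: B_def matrix_works)
  have aa: "a \<bullet> a = 1" using a by (simp add: norm_eq_1)
  have BA: "0 < (B *v v) \<bullet> (A *v v)" if "v \<noteq> 0" for v
  proof -
    define x where "x = v \<bullet> a"
    define u where "u = v - x *\<^sub>R a"
    have v: "v = u + x *\<^sub>R a" by (simp add: u_def)
    have ua: "u \<bullet> a = 0" by (simp add: u_def x_def inner_diff_left aa)
    then have au: "a \<bullet> u = 0" by (simp add: inner_commute)
    have "a \<bullet> (A *v u) = (A *v a) \<bullet> u" using sym by simp
    then have aAu: "a \<bullet> (A *v u) = 0" by (simp add: l au)
    have "B *v v = u - x *\<^sub>R a"
    proof -
      have "a \<bullet> v = x" by (simp add: x_def inner_commute)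
      moreover have "(2 * x) *\<^sub>R a = x *\<^sub>R a + x *\<^sub>R a" by (simp flip: scaleR_left_distrib)
      ultimately show ?thesis unfolding B by (simp add: u_def)
    qed
    moreover have "A *v v = A *v u + (x * l) *\<^sub>R a"
      by (simp add: v matrix_vector_right_distrib matrix_vector_mult_scaleR l)
    ultimately have eq: "(B *v v) \<bullet> (A *v v) = u \<bullet> (A *v u) + x\<^sup>2 * (- l)"
      by (simp add: inner_add_right inner_diff_left aAu ua aa power2_eq_square)
    show ?thesis
    proof (cases "u = 0")
      case True
      then have "x \<noteq> 0" using v that by auto
      then show ?thesis unfolding eq using l(2) by (simp add: True mult_pos_neg)
    next
      case False
      then have "0 < u \<bullet> (A *v u)" using pos ua by blast
      moreover have "0 \<le> x\<^sup>2 * (- l)" using l(2) by (intro mult_nonneg_nonneg) auto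
      ultimately show ?thesis unfolding eq by linarith
    qed
  qed
  have "\<exists>X \<Lambda> \<rho> R. gradient_like {p} (\<lambda>_. B) X \<Lambda> \<rho> R"
  proof (rule gradient_like_field)
    show "{p} \<subseteq> - K" "\<And>y. y \<notin> K \<Longrightarrow> g y = 0 \<longleftrightarrow> y \<in> {p}" using P(3) p by auto
    show "\<exists>A. (g has_derivative A) (at p') \<and> (\<forall>v. v \<noteq> 0 \<longrightarrow> 0 < (B *v v) \<bullet> A v)" if "p' \<in> {p}" for p'
      using that by (intro exI [of _ "\<lambda>v. A *v v"]) (simp add: A BA)
  qed simp
  then obtain X \<Lambda> \<rho> R where X: "gradient_like {p} (\<lambda>_. B) X \<Lambda> \<rho> R" by (elim exE)
  have "\<exists>\<phi>. flow X \<Lambda> \<phi>"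
    by (rule flow_exists) (use X in \<open>auto simp: gradient_like_def\<close>)
  then obtain \<phi> where \<phi>: "flow X \<Lambda> \<phi>" by (elim exE)
  obtain v1 v2 where v: "v1 \<bullet> v1 = 1" "v2 \<bullet> v2 = 1" "v1 \<bullet> v2 = 0" "a \<bullet> v1 = 0" "a \<bullet> v2 = 0"
    "\<forall>y. y = (y \<bullet> a) *\<^sub>R a + (y \<bullet> v1) *\<^sub>R v1 + (y \<bullet> v2) *\<^sub>R v2"
    using orthonormal_frame_exists [OF a] by (elim exE conjE)
  interpret fl: flow X \<Lambda> \<phi> by (rule \<phi>)
  interpret saddle_flow c c' n1 n2 L m \<delta> \<kappa> s X \<Lambda> \<phi> p a v1 v2 B \<rho> R
  proof
    show "y = (y \<bullet> a) *\<^sub>R a + (y \<bullet> v1) *\<^sub>R v1 + (y \<bullet> v2) *\<^sub>R v2" for y using v(6) by (rule spec)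
    show "p \<notin> K" using P(3) p by auto
  qed (use v aa B X in auto)
  obtain \<delta>1 \<delta>2 where "saddle_box c c' n1 n2 L m \<delta> \<kappa> s X \<Lambda> \<phi> p a v1 v2 B \<rho> R \<delta>1 \<delta>2"
    using saddle_box_exists by (elim exE)
  then show ?thesis by (rule saddle_box.core_isotopic_round_circle)
qed

lemma GDERIV_unique: "GDERIV f x :> D \<Longrightarrow> GDERIV f x :> E \<Longrightarrow> D = E"
proof -
  assume "GDERIV f x :> D" "GDERIV f x :> E"
  then have "(\<lambda>h. h \<bullet> D) = (\<lambda>h. h \<bullet> E)"
    unfolding gderiv_def by (rule has_derivative_unique)
  then have "(D - E) \<bullet> D = (D - E) \<bullet> E" by (rule fun_cong)
  then have "(D - E) \<bullet> (D - E) = 0" by (simp only: inner_diff_right [of "D - E"] diff_self)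
  then show "D = E" by simp
qed

theorem theorem6p2:
  fixes q :: real and H :: "real \<Rightarrow> real ^ 3"
  assumes "q \<ge> 2"
    and "periodic_C2_curve H"
    and "circle_embedding H"
    and "nontrivial_knot (H ` {0..1})"
    and "morse_on (- H ` {0..1}) (potential q H)"
  shows "\<exists>S. S \<subseteq> {x \<in> - H ` {0..1}. critical_point (potential q H) x} \<and> card S = 3"
proof (rule ccontr)
  assume few: "\<not> ?thesis"
  obtain c c' n1 n2 L m where fc: "framed_curve c c' n1 n2 L m" and cH: "\<forall>t\<in>{0..1}. c t = H t"
    using framed_curve_exists [OF assms(2,3)] by (elim exE conjE)
  interpret framed_curve c c' n1 n2 L m by (rule fc)
  obtain \<delta>0 \<kappa> where "\<delta>0 > 0" "\<kappa> > 0" and bl: "\<forall>x u z w. \<bar>u\<bar> \<le> 1/2 \<longrightarrow> cmod z \<le> \<delta>0 \<longrightarrow> cmod w \<le> \<delta>0 \<longrightarrow>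
       \<kappa> * (\<bar>u\<bar> + cmod (w - z)) \<le> norm (\<tau> (x + u) w - \<tau> x z)"
    using tube_bilipschitz by blast
  interpret t0: tube c c' n1 n2 L m \<delta>0 \<kappa>
    by unfold_locales (use \<open>\<delta>0 > 0\<close> \<open>\<kappa> > 0\<close> bl in auto)
  define s where "s = q - 1"
  have s: "s \<ge> 1" using assms(1) by (simp add: s_def)
  \<comment> \<open>The tube is shrunk until the gradient points towards the core; the bilipschitz
    bound passes to the smaller radius.\<close>
  obtain \<delta> where \<delta>: "\<delta> > 0" "\<delta> \<le> \<delta>0" "\<forall>x z. z \<noteq> 0 \<longrightarrow> cmod z \<le> \<delta> \<longrightarrow> field s c (\<tau> x z) \<bullet> N x z < 0"
    using t0.field_towards_core [OF s] by blast
  interpret charged_tube c c' n1 n2 L m \<delta> \<kappa> s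
    by unfold_locales (use \<delta> t0.\<kappa> bl s in auto)
  have "H ` {0..1} = c ` {0..1}" by (rule image_cong) (use cH in auto)
  then have HK: "H ` {0..1} = K" by (simp add: K_image)
  define f where "f = potential q H"
  have open_K: "open (- K)" unfolding K_eq by (intro open_Compl compact_imp_closed compact_V)
  have fG: "f y = G y" if "y \<in> - K" for y
    unfolding f_def s_def
  proof (rule potential_eq_coulomb)
    show "y \<notin> c ` {0..1}" using that unfolding K_image by simp
    show "H t = c t" if "t \<in> {0..1}" for t using cH that by simp
  qed
  have grad: "GDERIV f y :> g y" if y: "y \<in> - K" for y
    unfolding gderiv_def
  proof (rule has_derivative_transform_within_open [OF _ open_K y])
    have "(G has_derivative (\<lambda>h. g y \<bullet> h)) (at y)"
      by (rule coulomb_deriv [OF continuous_c]) (use y in \<open>simp add: K_image\<close>)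
    then show "(G has_derivative (\<lambda>h. h \<bullet> g y)) (at y)" by (simp only: inner_commute)
  qed (simp add: fG)
  define P where "P = {y \<in> - K. critical_point f y}"
  have P_iff: "y \<in> P \<longleftrightarrow> y \<notin> K \<and> g y = 0" for y
  proof
    assume "y \<in> P"
    then have y: "y \<in> - K" and "GDERIV f y :> 0" unfolding P_def critical_point_def by blast+
    then show "y \<notin> K \<and> g y = 0" using GDERIV_unique [OF grad [OF y]] by simp
  next
    assume y: "y \<notin> K \<and> g y = 0"
    then show "y \<in> P" using grad [of y] unfolding P_def critical_point_def by simp
  qed
  have no3: "\<nexists>S. S \<subseteq> P \<and> card S = 3" using few unfolding P_def f_def HK .
  \<comment> \<open>An infinite critical set would contain three points too, so the negated claim
    yields finiteness before any bound on the cardinality.\<close>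
  have "finite P" using infinite_arbitrarily_large [of P 3] no3 by blast
  moreover have "card P \<le> 2"
  proof (rule ccontr)
    assume "\<not> card P \<le> 2"
    then have "3 \<le> card P" by simp
    then show False by (rule obtain_subset_with_card_n) (use no3 in blast)
  qed
  \<comment> \<open>Nondegeneracy speaks of some gradient field near \<open>p\<close>; by uniqueness
    of gradients it agrees with \<open>g\<close> there, which transfers its derivative.\<close>
  moreover have "\<exists>A. (g has_derivative (\<lambda>v. A *v v)) (at p) \<and> invertible A" if "p \<in> P" for p
  proof -
    have pK: "p \<in> - K" and "nondegenerate_at f p"
      using that assms(5) by (auto simp: P_def morse_on_def HK f_def)
    then obtain A g' where A: "invertible A" and ev: "\<forall>\<^sub>F y in nhds p. GDERIV f y :> g' y"
      and d: "(g' has_derivative (\<lambda>v. A *v v)) (at p)"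
      unfolding nondegenerate_at_def has_hessian_def by (elim exE conjE)
    have "\<forall>\<^sub>F y in nhds p. y \<in> - K" using open_K pK by (rule eventually_nhds_in_open)
    with ev have "\<forall>\<^sub>F y in nhds p. g' y = g y"
      by eventually_elim (rule GDERIV_unique [OF _ grad])
    then have "\<forall>\<^sub>F y in at p. g' y = g y" "g' p = g p"
      using eventually_nhds_x_imp_x by (auto simp: eventually_at_filter elim: eventually_mono)
    then have "(g has_derivative (\<lambda>v. A *v v)) (at p)"
      using has_derivative_transform_eventually [OF d] by simp
    then show ?thesis using A by blast
  qed
  ultimately have "ambient_isotopic K round_circle"
    using few_critical_points_imp_unknot [of P] P_iff by blast
  then show False using assms(4) by (simp add: nontrivial_knot_def HK)
qed

end
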